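(* Let $n\ge 1$. The generalized BEER complex $\Omega(\Gamma)$ for $\Gamma=A_{n-1}$ coincides, as a CW-complex, with the Bartholdi–Enriquez–Etingof–Rains complex $\Omega_n$ (i.e. the two are isomorphic CW-complexes).
   Context: Generalized BEER complex. A Coxeter graph $\Gamma$ on a countable set $S$ encodes a symmetric matrix $(m_{s,t})_{s,t\in S}$ with $m_{s,s}=1$ and $m_{s,t}\in\{2,3,\dots\}\cup\{\infty\}$ for $s\neq t$; its Coxeter group is $W=\langle S\mid s^2=1,\ (st)^{m_{s,t}}=1\ (m_{s,t}\neq\infty)\rangle$. Let $V=\bigoplus_{s\in S}\mathbb{R}\alpha_s$ with the form $\langle\alpha_s,\alpha_t\rangle=-\cos(\pi/m_{s,t})$ ($-1$ if $m_{s,t}=\infty$); $W$ acts on $V$ by $s(v)=v-2\langle\alpha_s,v\rangle\alpha_s$. Roots: $\Phi[\Gamma]=\{w(\alpha_s)\}$; for $\beta=w(\alpha_s)$ put $r_\beta=wsw^{-1}$. A subset $\mathcal{X}\subset\Phi[\Gamma]$ is almost parabolic (AP) if its vectors are linearly independent and for all $\beta,\gamma\in\mathcal{X}$ there exist $w\in W$, $s,t\in S$ with $\beta=w(\alpha_s)$, $\gamma=w(\alpha_t)$. Put $R_{\mathcal{X}}=\{r_\beta:\beta\in\mathcal{X}\}$, $W_{\mathcal{X}}=\langle R_{\mathcal{X}}\rangle$; $\mathcal{X}$ is of spherical type if $W_{\mathcal{X}}$ is finite. For $\mathcal{X}$ AP, $(W_{\mathcal{X}},R_{\mathcal{X}})$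 is a Coxeter system. Let $\mathcal{R}^f$ be the set of AP subsets of spherical type (including $\emptyset$). For $\mathcal{Y}\subset\mathcal{X}\in\mathcal{R}^f$, $u\in W_{\mathcal{X}}$ is $(\emptyset,R_{\mathcal{Y}})$-minimal if it has minimal length with respect to $R_{\mathcal{X}}$ in $uW_{\mathcal{Y}}$. For $\mathcal{X}\in\mathcal{R}^f$ let $V_{\mathcal{X}}=\mathrm{span}(\mathcal{X})$ (the form is positive definite on it), $\{\beta^*_{\mathcal{X}}\}$ the basis of $V_{\mathcal{X}}$ dual to $\mathcal{X}$, $o_{\mathcal{X}}=\sum_{\beta\in\mathcal{X}}\beta^*_{\mathcal{X}}$, $C[\mathcal{X}]=\mathrm{conv}\{z(o_{\mathcal{X}}): z\in W_{\mathcal{X}}\}$ (with $C[\emptyset]=\{0\}$), with faces $F(u,\mathcal{Y},\mathcal{X})=\mathrm{conv}\{uz(o_{\mathcal{X}}): z\in W_{\mathcal{Y}}\}$, $\mathcal{Y}\subset\mathcal{X}$, $u\in W_{\mathcal{X}}$ $(\emptyset,R_{\mathcal{Y}})$-minimal. $\Omega(\Gamma)$ is the CW-complex with exactly one $k$-cell for each $\mathcal{X}\in\mathcal{R}^f$ with $|\mathcal{X}|=k$, modelled on a separate copy of $C[\mathcal{X}]$ (distinct $\mathcal{X}$ give distinct cells), with characteristic maps $\Lambda_{\mathcal{X}}:C[\mathcal{X}]\to\Omega(\Gamma)$ satisfying $\Lambda_{\mathcal{X}}(x)=\Lambda_{u(\mathcal{Y})}(x+u(o_{\mathcal{Y}}-o_{\mathcal{X}}))$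 for $x$ in a proper face $F(u,\mathcal{Y},\mathcal{X})$ (here $u(\mathcal{Y})\in\mathcal{R}^f$ and the translation maps this face onto $C[u(\mathcal{Y})]$). For $\Gamma=A_{n-1}$ ($A_0$ being the empty graph), $W=\mathfrak{S}_n$, $S=\{s_1,\dots,s_{n-1}\}$ with $s_i=(i\;i+1)$, $\alpha_{s_i}=(e_i-e_{i+1})/\sqrt2\in V=\{x\in\mathbb{R}^n:\sum x_i=0\}$, and $w(e_i)=e_{w(i)}$. The complex $\Omega_n$. Let $o=\sum_{j=1}^n\frac{n+1-2j}{\sqrt 2}e_j\in V$ and $C[S]=\mathrm{conv}\{w(o): w\in\mathfrak{S}_n\}$. For $X\subset S$ let $W_X=\langle X\rangle$; $u\in\mathfrak{S}_n$ is $(\emptyset,X)$-minimal if it has minimal length in $uW_X$. The faces of $C[S]$ (including $C[S]$ itself) are $F(u,X,S)=\mathrm{conv}\{uw(o): w\in W_X\}$ with $X\subset S$, $u$ $(\emptyset,X)$-minimal. Associate to it the ordered partition $P(u,X)=(P_1,\dots,P_p)$ of $\{1,\dots,n\}$, where $p=n-|X|$, $S\setminus X=\{s_{i_1},\dots,s_{i_{p-1}}\}$ with $i_1<\cdots<i_{p-1}$, $i_0=0$, $i_p=n$, $P_k=u(\{i_{k-1}+1,\dots,i_k\})$. Faces $(F(u,X,S),w)$ and $(F(v,Y,S),w')$ of $C[S]\times\mathfrak{S}_n$ are equivalent if $P(u,X)$ and $P(v,Y)$ are equal up to permuting the blocks and, for every block $P_k$ and all $i,j\in P_k$, $w(i)<w(j)\Leftrightarrow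 w'(i)<w'(j)$; then translation by $v(o)-u(o)$ maps $F(u,X,S)$ onto $F(v,Y,S)$. $\Omega_n$ is the quotient of $C[S]\times\mathfrak{S}_n$ identifying $(x,w)$ with $(x+v(o)-u(o),w')$ for every $x\in F(u,X,S)$ and all such equivalent pairs; its cells are the images of the faces of $C[S]\times\mathfrak{S}_n$. *)

theory Defs
  imports
    "HOL-Analysis.Analysis"
    "HOL-Analysis.Finite_Function_Topology"
    "HOL-Library.Extended_Nat"
    "HOL-Algebra.Generated_Groups"
    "HOL-Algebra.Sym_Groups"
begin

section \<open>Quotient spaces and CW-complexes\<close>

definition qclass :: "('a \<Rightarrow> 'a \<Rightarrow> bool) \<Rightarrow> 'a \<Rightarrow> 'a set" where
  "qclass r x = {y. equivclp r x y}"

text \<open>The quotient of a space by the equivalence relation generated by \<open>r\<close>.\<close>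

definition quotient_space :: "'a topology \<Rightarrow> ('a \<Rightarrow> 'a \<Rightarrow> bool) \<Rightarrow> 'a set topology" where
  "quotient_space X r = topology (\<lambda>U. U \<subseteq> qclass r ` topspace X \<and>
     openin X {x \<in> topspace X. qclass r x \<in> U})"

lemma openin_quotient_space:
  "openin (quotient_space X r) U \<longleftrightarrow>
     U \<subseteq> qclass r ` topspace X \<and> openin X {x \<in> topspace X. qclass r x \<in> U}"
proof -
  have "istopology (\<lambda>U. U \<subseteq> qclass r ` topspace X \<and> openin X {x \<in> topspace X. qclass r x \<in> U})"
    unfolding istopology_def
  proof (intro conjI allI impI)
    fix S T
    assume S: "S \<subseteq> qclass r ` topspace X \<and> openin X {x \<in> topspace X. qclass r x \<in> S}"
      and T: "T \<subseteq> qclass r ` topspace X \<and> openin X {x \<in> topspace X. qclass r x \<in> T}"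
    show "S \<inter> T \<subseteq> qclass r ` topspace X" using S by blast
    have "{x \<in> topspace X. qclass r x \<in> S \<inter> T} =
      {x \<in> topspace X. qclass r x \<in> S} \<inter> {x \<in> topspace X. qclass r x \<in> T}" by blast
    then show "openin X {x \<in> topspace X. qclass r x \<in> S \<inter> T}" using S T by auto
  next
    fix K
    assume K: "\<forall>S\<in>K. S \<subseteq> qclass r ` topspace X \<and> openin X {x \<in> topspace X. qclass r x \<in> S}"
    then show "\<Union>K \<subseteq> qclass r ` topspace X" by blast
    have "{x \<in> topspace X. qclass r x \<in> \<Union>K} = (\<Union>S\<in>K. {x \<in> topspace X. qclass r x \<in> S})" by blast
    then show "openin X {x \<in> topspace X. qclass r x \<in> \<Union>K}" using K by auto
  qed
  then show ?thesis by (simp add: quotient_space_def)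
qed

lemma topspace_quotient_space: "topspace (quotient_space X r) = qclass r ` topspace X"
proof
  show "topspace (quotient_space X r) \<subseteq> qclass r ` topspace X"
    using openin_quotient_space[of X r "topspace (quotient_space X r)"] by simp
  have "{x \<in> topspace X. qclass r x \<in> qclass r ` topspace X} = topspace X" by blast
  then have "openin (quotient_space X r) (qclass r ` topspace X)"
    by (simp add: openin_quotient_space)
  then show "qclass r ` topspace X \<subseteq> topspace (quotient_space X r)"
    by (rule openin_subset)
qed

lemma quotient_map_quotient_space: "quotient_map X (quotient_space X r) (qclass r)"
  by (auto simp: quotient_map_def topspace_quotient_space openin_quotient_space)

text \<open>A space together with, for each \<open>k\<close>, a set of subsets that are to be its \<^emph>\<open>open\<close> \<open>k\<close>-cells.\<close>

record 'a cell_structure =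
  space_of :: "'a topology"
  cells_of :: "nat \<Rightarrow> 'a set set"

definition closed_disc :: "nat \<Rightarrow> (nat \<Rightarrow> real) topology" where
  "closed_disc k = subtopology (Euclidean_space k) {x. (\<Sum>i<k. x i ^ 2) \<le> 1}"

definition open_disc :: "nat \<Rightarrow> (nat \<Rightarrow> real) topology" where
  "open_disc k = subtopology (Euclidean_space k) {x. (\<Sum>i<k. x i ^ 2) < 1}"

text \<open>CW-complexes in the sense of Whitehead: a Hausdorff space partitioned into open cells, each of
  them having a characteristic map whose boundary values lie in finitely many cells of smaller
  dimension, and carrying the weak topology with respect to the closures of the cells.\<close>

definition cw_complex :: "'a cell_structure \<Rightarrow> bool" where
  "cw_complex K \<longleftrightarrow>
     Hausdorff_space (space_of K) \<and>
     (\<Union>k. \<Union> (cells_of K k)) = topspace (space_of K) \<and>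
     (\<forall>k l. \<forall>e\<in>cells_of K k. \<forall>f\<in>cells_of K l. e \<inter> f \<noteq> {} \<longrightarrow> k = l \<and> e = f) \<and>
     (\<forall>k. \<forall>e\<in>cells_of K k. \<exists>\<phi>.
        continuous_map (closed_disc k) (space_of K) \<phi> \<and>
        homeomorphic_map (open_disc k) (subtopology (space_of K) e) \<phi> \<and>
        (\<exists>F. finite F \<and> F \<subseteq> (\<Union>j<k. cells_of K j) \<and>
             \<phi> ` (topspace (closed_disc k) - topspace (open_disc k)) \<subseteq> \<Union>F)) \<and>
     (\<forall>A \<subseteq> topspace (space_of K).
        (\<forall>k. \<forall>e\<in>cells_of K k. closedin (space_of K) (A \<inter> (space_of K closure_of e))) \<longrightarrow>
        closedin (space_of K) A)"

definition cw_isomorphic :: "'a cell_structure \<Rightarrow> 'b cell_structure \<Rightarrow> bool" where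
  "cw_isomorphic K L \<longleftrightarrow> cw_complex K \<and> cw_complex L \<and>
     (\<exists>h. homeomorphic_map (space_of K) (space_of L) h \<and>
          (\<forall>k. (\<lambda>e. h ` e) ` cells_of K k = cells_of L k))"


section \<open>Length and minimal coset representatives\<close>

text \<open>Word length with respect to \<open>R\<close>; it is used for sets \<open>R\<close> of involutions only, so
  that words in the inverses of the generators need not be considered.\<close>

definition word_length :: "('g, 'm) monoid_scheme \<Rightarrow> 'g set \<Rightarrow> 'g \<Rightarrow> nat" where
  "word_length G R g =
     (LEAST k. \<exists>xs. set xs \<subseteq> R \<and> length xs = k \<and> foldr (mult G) xs \<one>\<^bsub>G\<^esub> = g)"

definition coset_minimal :: "('g, 'm) monoid_scheme \<Rightarrow> 'g set \<Rightarrow> 'g set \<Rightarrow> 'g \<Rightarrow> bool" where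
  "coset_minimal G R T u \<longleftrightarrow> u \<in> generate G R \<and>
     (\<forall>z \<in> generate G T. word_length G R u \<le> word_length G R (u \<otimes>\<^bsub>G\<^esub> z))"


section \<open>Coxeter groups and their geometric representation\<close>

record 's coxeter_graph =
  nodes :: "'s set"
  label :: "'s \<Rightarrow> 's \<Rightarrow> enat"

definition coxeter_graph :: "'s coxeter_graph \<Rightarrow> bool" where
  "coxeter_graph \<Gamma> \<longleftrightarrow> countable (nodes \<Gamma>) \<and>
     (\<forall>s\<in>nodes \<Gamma>. label \<Gamma> s s = 1) \<and>
     (\<forall>s\<in>nodes \<Gamma>. \<forall>t\<in>nodes \<Gamma>. label \<Gamma> s t = label \<Gamma> t s \<and> (s \<noteq> t \<longrightarrow> 2 \<le> label \<Gamma> s t))"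

text \<open>The Coxeter group consists of the classes of words over the nodes modulo the congruence
  generated by \<open>(st)\<^sup>m = 1\<close>, \<open>m\<close> being the (finite) label of \<open>s\<close>, \<open>t\<close>. The case
  \<open>s = t\<close> is the relation \<open>s\<^sup>2 = 1\<close>.\<close>

inductive cox_step :: "'s coxeter_graph \<Rightarrow> 's list \<Rightarrow> 's list \<Rightarrow> bool" for \<Gamma> where
  "\<lbrakk>s \<in> nodes \<Gamma>; t \<in> nodes \<Gamma>; label \<Gamma> s t = enat m\<rbrakk> \<Longrightarrow>
     cox_step \<Gamma> (u @ concat (replicate m [s, t]) @ v) (u @ v)"

definition cox_class :: "'s coxeter_graph \<Rightarrow> 's list \<Rightarrow> 's list set" where
  "cox_class \<Gamma> = qclass (cox_step \<Gamma>)"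

definition coxeter_group :: "'s coxeter_graph \<Rightarrow> 's list set monoid" where
  "coxeter_group \<Gamma> =
     \<lparr> carrier = cox_class \<Gamma> ` lists (nodes \<Gamma>),
       mult = (\<lambda>A B. \<Union>a\<in>A. \<Union>b\<in>B. cox_class \<Gamma> (a @ b)),
       one = cox_class \<Gamma> [] \<rparr>"

lemma cox_class_eq_iff: "cox_class \<Gamma> u = cox_class \<Gamma> v \<longleftrightarrow> equivclp (cox_step \<Gamma>) u v"
  unfolding cox_class_def qclass_def set_eq_iff mem_Collect_eq
  by (meson equivclp_refl equivclp_sym equivclp_trans)

lemma cox_step_ctx: "cox_step \<Gamma> u v \<Longrightarrow> cox_step \<Gamma> (a @ u @ b) (a @ v @ b)"
proof (induction rule: cox_step.induct)
  case (1 s t m u v)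
  then show ?case using cox_step.intros[OF 1, of "a @ u" "v @ b"] by simp
qed

lemma cox_equiv_ctx:
  assumes "equivclp (cox_step \<Gamma>) u v" shows "equivclp (cox_step \<Gamma>) (a @ u @ b) (a @ v @ b)"
  using assms
proof (induction rule: equivclp_induct)
  case base then show ?case by simp
next
  case (step y z)
  then have "cox_step \<Gamma> (a @ y @ b) (a @ z @ b) \<or> cox_step \<Gamma> (a @ z @ b) (a @ y @ b)"
    using cox_step_ctx by blast
  then show ?case using step.IH by (rule equivclp_into_equivclp[rotated])
qed

lemma cox_class_self: "u \<in> cox_class \<Gamma> u"
  by (simp add: cox_class_def qclass_def)

lemma mult_cox_class:
  "cox_class \<Gamma> u \<otimes>\<^bsub>coxeter_group \<Gamma>\<^esub> cox_class \<Gamma> v = cox_class \<Gamma> (u @ v)"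
proof -
  have "cox_class \<Gamma> (a @ b) = cox_class \<Gamma> (u @ v)"
    if "a \<in> cox_class \<Gamma> u" "b \<in> cox_class \<Gamma> v" for a b
  proof -
    have "equivclp (cox_step \<Gamma>) (u @ v) (a @ v)" "equivclp (cox_step \<Gamma>) (a @ v) (a @ b)"
      using that cox_equiv_ctx[of \<Gamma> u a "[]" v] cox_equiv_ctx[of \<Gamma> v b a "[]"]
      by (auto simp: cox_class_def qclass_def)
    then show ?thesis unfolding cox_class_eq_iff by (meson equivclp_sym equivclp_trans)
  qed
  then have "(\<Union>a\<in>cox_class \<Gamma> u. \<Union>b\<in>cox_class \<Gamma> v. cox_class \<Gamma> (a @ b)) = cox_class \<Gamma> (u @ v)"
    using cox_class_self[of u \<Gamma>] cox_class_self[of v \<Gamma>] by blast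
  then show ?thesis by (simp add: coxeter_group_def)
qed

lemma group_coxeter_group:
  assumes "coxeter_graph \<Gamma>" shows "group (coxeter_group \<Gamma>)"
proof (rule groupI)
  have car: "carrier (coxeter_group \<Gamma>) = cox_class \<Gamma> ` lists (nodes \<Gamma>)"
    and one: "\<one>\<^bsub>coxeter_group \<Gamma>\<^esub> = cox_class \<Gamma> []" by (simp_all add: coxeter_group_def)
  show "x \<otimes>\<^bsub>coxeter_group \<Gamma>\<^esub> y \<in> carrier (coxeter_group \<Gamma>)"
    if "x \<in> carrier (coxeter_group \<Gamma>)" "y \<in> carrier (coxeter_group \<Gamma>)" for x y
    using that by (auto simp: car mult_cox_class intro!: imageI)
  show "\<one>\<^bsub>coxeter_group \<Gamma>\<^esub> \<in> carrier (coxeter_group \<Gamma>)" by (auto simp: car one)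
  show "x \<otimes>\<^bsub>coxeter_group \<Gamma>\<^esub> y \<otimes>\<^bsub>coxeter_group \<Gamma>\<^esub> z =
      x \<otimes>\<^bsub>coxeter_group \<Gamma>\<^esub> (y \<otimes>\<^bsub>coxeter_group \<Gamma>\<^esub> z)"
    if "x \<in> carrier (coxeter_group \<Gamma>)" "y \<in> carrier (coxeter_group \<Gamma>)"
      "z \<in> carrier (coxeter_group \<Gamma>)" for x y z
    using that by (auto simp: car mult_cox_class intro!: imageI)
  show "\<one>\<^bsub>coxeter_group \<Gamma>\<^esub> \<otimes>\<^bsub>coxeter_group \<Gamma>\<^esub> x = x"
    if "x \<in> carrier (coxeter_group \<Gamma>)" for x
    using that by (auto simp: car one mult_cox_class)
  have rev: "cox_class \<Gamma> (rev u @ u) = cox_class \<Gamma> []" if "u \<in> lists (nodes \<Gamma>)" for u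
    using that
  proof (induction u)
    case (Cons s u)
    have "label \<Gamma> s s = enat 1"
      using Cons assms by (auto simp: coxeter_graph_def one_enat_def)
    then have "cox_step \<Gamma> (rev u @ [s, s] @ u) (rev u @ u)"
      using cox_step.intros[of s \<Gamma> s 1 "rev u" u] Cons by auto
    then have "cox_class \<Gamma> (rev u @ [s, s] @ u) = cox_class \<Gamma> (rev u @ u)"
      unfolding cox_class_eq_iff by (rule r_into_equivclp)
    then show ?case using Cons by simp
  qed simp
  show "\<exists>y\<in>carrier (coxeter_group \<Gamma>). y \<otimes>\<^bsub>coxeter_group \<Gamma>\<^esub> x = \<one>\<^bsub>coxeter_group \<Gamma>\<^esub>"
    if "x \<in> carrier (coxeter_group \<Gamma>)" for x
  proof -
    obtain u where u: "u \<in> lists (nodes \<Gamma>)" "x = cox_class \<Gamma> u" using \<open>x \<in> _\<close> by (auto simp: car)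
    have "cox_class \<Gamma> (rev u) \<in> carrier (coxeter_group \<Gamma>)" using u by (auto simp: car intro!: imageI)
    moreover have "cox_class \<Gamma> (rev u) \<otimes>\<^bsub>coxeter_group \<Gamma>\<^esub> x = \<one>\<^bsub>coxeter_group \<Gamma>\<^esub>"
      using rev[OF u(1)] by (simp only: u(2) mult_cox_class one)
    ultimately show ?thesis by blast
  qed
qed

type_synonym 's geom = "'s \<Rightarrow>\<^sub>0 real"

definition sroot :: "'s \<Rightarrow> 's geom" where
  "sroot s = Poly_Mapping.single s 1"

definition form :: "'s coxeter_graph \<Rightarrow> 's geom \<Rightarrow> 's geom \<Rightarrow> real" where
  "form \<Gamma> x y = (\<Sum>s\<in>Poly_Mapping.keys x. \<Sum>t\<in>Poly_Mapping.keys y.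
     Poly_Mapping.lookup x s * Poly_Mapping.lookup y t *
     (case label \<Gamma> s t of enat m \<Rightarrow> - cos (pi / real m) | \<infinity> \<Rightarrow> - 1))"

definition simple_refl :: "'s coxeter_graph \<Rightarrow> 's \<Rightarrow> 's geom \<Rightarrow> 's geom" where
  "simple_refl \<Gamma> s v = v - (2 * form \<Gamma> (sroot s) v) *\<^sub>R sroot s"

text \<open>The action of a group element is that of any word representing it.\<close>

definition act :: "'s coxeter_graph \<Rightarrow> 's list set \<Rightarrow> 's geom \<Rightarrow> 's geom" where
  "act \<Gamma> g v = foldr (simple_refl \<Gamma>) (SOME w. w \<in> g) v"

definition roots :: "'s coxeter_graph \<Rightarrow> 's geom set" where
  "roots \<Gamma> = {act \<Gamma> w (sroot s) | w s. w \<in> carrier (coxeter_group \<Gamma>) \<and> s \<in> nodes \<Gamma>}"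

definition root_refl :: "'s coxeter_graph \<Rightarrow> 's geom \<Rightarrow> 's list set" where
  "root_refl \<Gamma> \<beta> = (THE r. \<exists>w\<in>carrier (coxeter_group \<Gamma>). \<exists>s\<in>nodes \<Gamma>.
     \<beta> = act \<Gamma> w (sroot s) \<and>
     r = w \<otimes>\<^bsub>coxeter_group \<Gamma>\<^esub> cox_class \<Gamma> [s] \<otimes>\<^bsub>coxeter_group \<Gamma>\<^esub> inv\<^bsub>coxeter_group \<Gamma>\<^esub> w)"


section \<open>The generalized BEER complex of a Coxeter graph\<close>

definition almost_parabolic :: "'s coxeter_graph \<Rightarrow> 's geom set \<Rightarrow> bool" where
  "almost_parabolic \<Gamma> X \<longleftrightarrow> X \<subseteq> roots \<Gamma> \<and> independent X \<and>
     (\<forall>\<beta>\<in>X. \<forall>\<gamma>\<in>X. \<exists>w\<in>carrier (coxeter_group \<Gamma>). \<exists>s\<in>nodes \<Gamma>. \<exists>t\<in>nodes \<Gamma>.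
        \<beta> = act \<Gamma> w (sroot s) \<and> \<gamma> = act \<Gamma> w (sroot t))"

definition ap_refls :: "'s coxeter_graph \<Rightarrow> 's geom set \<Rightarrow> 's list set set" where
  "ap_refls \<Gamma> X = root_refl \<Gamma> ` X"

definition ap_group :: "'s coxeter_graph \<Rightarrow> 's geom set \<Rightarrow> 's list set set" where
  "ap_group \<Gamma> X = generate (coxeter_group \<Gamma>) (ap_refls \<Gamma> X)"

definition spherical_ap :: "'s coxeter_graph \<Rightarrow> 's geom set set" where
  "spherical_ap \<Gamma> = {X. almost_parabolic \<Gamma> X \<and> finite (ap_group \<Gamma> X)}"

definition dual_vec :: "'s coxeter_graph \<Rightarrow> 's geom set \<Rightarrow> 's geom \<Rightarrow> 's geom" where
  "dual_vec \<Gamma> X \<beta> = (THE v. v \<in> span X \<and> (\<forall>\<gamma>\<in>X. form \<Gamma> v \<gamma> = (if \<gamma> = \<beta> then 1 else 0)))"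

definition base_pt :: "'s coxeter_graph \<Rightarrow> 's geom set \<Rightarrow> 's geom" where
  "base_pt \<Gamma> X = (\<Sum>\<beta>\<in>X. dual_vec \<Gamma> X \<beta>)"

definition coxeter_cell :: "'s coxeter_graph \<Rightarrow> 's geom set \<Rightarrow> 's geom set" where
  "coxeter_cell \<Gamma> X = convex hull ((\<lambda>z. act \<Gamma> z (base_pt \<Gamma> X)) ` ap_group \<Gamma> X)"

definition coxeter_face ::
    "'s coxeter_graph \<Rightarrow> 's list set \<Rightarrow> 's geom set \<Rightarrow> 's geom set \<Rightarrow> 's geom set" where
  "coxeter_face \<Gamma> u Y X =
     convex hull ((\<lambda>z. act \<Gamma> (u \<otimes>\<^bsub>coxeter_group \<Gamma>\<^esub> z) (base_pt \<Gamma> X)) ` ap_group \<Gamma> Y)"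

text \<open>The pair \<open>(X, x)\<close> is the point \<open>x\<close> of the copy of the polytope \<open>C[X]\<close> belonging to \<open>X\<close>.\<close>

inductive beer_glue ::
    "'s coxeter_graph \<Rightarrow> 's geom set \<times> 's geom \<Rightarrow> 's geom set \<times> 's geom \<Rightarrow> bool" for \<Gamma> where
  "\<lbrakk>X \<in> spherical_ap \<Gamma>; Y \<subset> X;
    coset_minimal (coxeter_group \<Gamma>) (ap_refls \<Gamma> X) (ap_refls \<Gamma> Y) u;
    x \<in> coxeter_face \<Gamma> u Y X\<rbrakk> \<Longrightarrow>
     beer_glue \<Gamma> (X, x) (act \<Gamma> u ` Y, x + act \<Gamma> u (base_pt \<Gamma> Y - base_pt \<Gamma> X))"

text \<open>The characteristic map of the cell of \<open>X\<close> sends \<open>x\<close> to \<open>qclass (beer_glue \<Gamma>) (X, x)\<close>.\<close>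

definition beer_complex :: "'s coxeter_graph \<Rightarrow> ('s geom set \<times> 's geom) set cell_structure" where
  "beer_complex \<Gamma> =
     \<lparr> space_of = quotient_space
         (sum_topology (\<lambda>X. top_of_set (coxeter_cell \<Gamma> X)) (spherical_ap \<Gamma>)) (beer_glue \<Gamma>),
       cells_of = (\<lambda>k. {qclass (beer_glue \<Gamma>) ` ({X} \<times> rel_interior (coxeter_cell \<Gamma> X)) | X.
         X \<in> spherical_ap \<Gamma> \<and> card X = k}) \<rparr>"

definition type_A :: "nat \<Rightarrow> nat coxeter_graph" where
  "type_A k = \<lparr> nodes = {1..k},
     label = (\<lambda>i j. if i = j then 1 else if i = Suc j \<or> j = Suc i then 3 else 2) \<rparr>"

lemma coxeter_graph_type_A: "coxeter_graph (type_A k)"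
  by (auto simp: coxeter_graph_def type_A_def)


section \<open>The complex \<open>\<Omega>\<^sub>n\<close> of Bartholdi, Enriquez, Etingof and Rains\<close>

text \<open>Vectors of \<open>\<real>\<^sup>n\<close> are finitely supported functions whose support lies in \<open>{1..n}\<close>;
  a set of simple transpositions \<open>s\<^sub>i = (i i+1)\<close> is given by the set of its indices \<open>i\<close>.\<close>

definition perm_act :: "(nat \<Rightarrow> nat) \<Rightarrow> nat geom \<Rightarrow> nat geom" where
  "perm_act w x = (\<Sum>i\<in>Poly_Mapping.keys x. Poly_Mapping.single (w i) (Poly_Mapping.lookup x i))"

definition perm_base :: "nat \<Rightarrow> nat geom" where
  "perm_base n = (\<Sum>j=1..n. Poly_Mapping.single j ((real n + 1 - 2 * real j) / sqrt 2))"

definition simple_transps :: "nat set \<Rightarrow> (nat \<Rightarrow> nat) set" where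
  "simple_transps X = (\<lambda>i. Transposition.transpose i (Suc i)) ` X"

definition young_subgroup :: "nat \<Rightarrow> nat set \<Rightarrow> (nat \<Rightarrow> nat) set" where
  "young_subgroup n X = generate (sym_group n) (simple_transps X)"

definition permutohedron :: "nat \<Rightarrow> nat geom set" where
  "permutohedron n = convex hull ((\<lambda>w. perm_act w (perm_base n)) ` {w. w permutes {1..n}})"

definition perm_face :: "nat \<Rightarrow> (nat \<Rightarrow> nat) \<Rightarrow> nat set \<Rightarrow> nat geom set" where
  "perm_face n u X = convex hull ((\<lambda>w. perm_act (u \<circ> w) (perm_base n)) ` young_subgroup n X)"

definition perm_minimal :: "nat \<Rightarrow> nat set \<Rightarrow> (nat \<Rightarrow> nat) \<Rightarrow> bool" where
  "perm_minimal n X u \<longleftrightarrow>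
     coset_minimal (sym_group n) (simple_transps {1..<n}) (simple_transps X) u"

text \<open>The ordered partition \<open>P(u, X)\<close>; its blocks are the images under \<open>u\<close> of the intervals between
  consecutive entries of \<open>0 = i\<^sub>0 < i\<^sub>1 < \<dots> < i\<^sub>p = n\<close>.\<close>

definition face_partition :: "nat \<Rightarrow> (nat \<Rightarrow> nat) \<Rightarrow> nat set \<Rightarrow> nat set list" where
  "face_partition n u X =
     (let is = 0 # sorted_list_of_set ({1..<n} - X) @ [n]
      in map (\<lambda>(a, b). u ` {a<..b}) (zip is (tl is)))"

definition faces_equiv :: "nat \<Rightarrow> (nat \<Rightarrow> nat) \<Rightarrow> nat set \<Rightarrow> (nat \<Rightarrow> nat) \<Rightarrow>
    (nat \<Rightarrow> nat) \<Rightarrow> nat set \<Rightarrow> (nat \<Rightarrow> nat) \<Rightarrow> bool" where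
  "faces_equiv n u X w v Y w' \<longleftrightarrow>
     mset (face_partition n u X) = mset (face_partition n v Y) \<and>
     (\<forall>B\<in>set (face_partition n u X). \<forall>i\<in>B. \<forall>j\<in>B. w i < w j \<longleftrightarrow> w' i < w' j)"

inductive omega_glue ::
    "nat \<Rightarrow> nat geom \<times> (nat \<Rightarrow> nat) \<Rightarrow> nat geom \<times> (nat \<Rightarrow> nat) \<Rightarrow> bool" for n where
  "\<lbrakk>X \<subseteq> {1..<n}; Y \<subseteq> {1..<n}; perm_minimal n X u; perm_minimal n Y v;
    w permutes {1..n}; w' permutes {1..n}; faces_equiv n u X w v Y w'; x \<in> perm_face n u X\<rbrakk> \<Longrightarrow>
     omega_glue n (x, w) (x + perm_act v (perm_base n) - perm_act u (perm_base n), w')"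

definition omega_complex :: "nat \<Rightarrow> (nat geom \<times> (nat \<Rightarrow> nat)) set cell_structure" where
  "omega_complex n =
     \<lparr> space_of = quotient_space
         (prod_topology (top_of_set (permutohedron n)) (discrete_topology {w. w permutes {1..n}}))
         (omega_glue n),
       cells_of = (\<lambda>k. {qclass (omega_glue n) ` (rel_interior (perm_face n u X) \<times> {w}) | u X w.
         X \<subseteq> {1..<n} \<and> card X = k \<and> perm_minimal n X u \<and> w permutes {1..n}}) \<rparr>"

end

theory Submission imports Defs begin

text \<open>Both complexes are glued from products of permutohedra. A cell of either is described by a block
  order, that is a partition of \<open>{1..n}\<close> with a linear order on each block: for the BEER complex it
  is read off from the roots \<open>e\<^sub>a - e\<^sub>b\<close> of the almost parabolic set, for \<open>\<Omega>\<^sub>n\<close> one restricts the order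
  \<open>w(i) < w(j)\<close> to the blocks of the face. The permutohedron of a block order is cut out by the
  inequalities \<open>mass x A \<le> crossings Z A\<close>, its faces belong to refinements of the blocks, and in both
  complexes two points are identified exactly if they lie on faces with the same refined block order
  and correspond to each other under translation. The slack of the inequalities separating \<open>i\<close> from \<open>j\<close>
  yields a continuous invariant \<open>psi\<close> of the identified points that is also complete. By compactness
  both complexes are therefore homeomorphic, cell by cell, to the image of \<open>psi\<close>.\<close>

section \<open>Block orders and their inversions\<close>

text \<open>The gluing relations are given by generators, so neither their classes nor the Hausdorff
  property can be read off from them. Since \<open>face_step\<close> is transitive, every point
  descends in one step to the interior of a smallest face, and uniqueness of that descent decides
  which points are identified. Coordinate differences alone would determine a point inside its cell,
  but they are not invariant for pairs that a face separates; this is why \<open>psi\<close>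
  multiplies them by a quantity that vanishes there. The CW axioms are then checked once, on the
  image of \<open>psi\<close>, and never on a quotient space.

  All vectors are scaled by the square root of 2. Simple roots become e_i - e_(i+1), and every base
  point becomes the sum of the positive roots, an integral vector, so that the bounds in the
  inequalities count pairs.

  Reflections and lengths belong to the group given by generators and relations. That this group
  acts faithfully by permutations is proved through normal forms, and only then can minimality of
  coset representatives be expressed by inversions.\<close>

definition comparability :: "('a \<times> 'a) set \<Rightarrow> ('a \<times> 'a) set" where
  "comparability Z = Z \<union> Z\<inverse>"

definition cover :: "('a \<times> 'a) set \<Rightarrow> ('a \<times> 'a) set" where
  "cover Z = Z - Z O Z"

text \<open>A block order is a partition of \<open>{1..n}\<close> together with a strict linear order on each of its
  blocks. These data are equivalent to an almost parabolic subset in type \<open>A\<close>: the roots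
  \<open>e\<^sub>a - e\<^sub>b\<close> with \<open>(a, b)\<close> in the covering relation.\<close>

definition block_order :: "nat \<Rightarrow> (nat \<times> nat) set \<Rightarrow> bool" where
  "block_order n Z \<longleftrightarrow> Z \<subseteq> {1..n} \<times> {1..n} \<and> irrefl Z \<and> trans Z \<and>
     (\<forall>a b c. (a, b) \<in> comparability Z \<longrightarrow> (b, c) \<in> comparability Z \<longrightarrow>
        a = c \<or> (a, c) \<in> comparability Z)"

text \<open>With \<open>E\<close> the comparability relation of a block order this is the Young
  subgroup of its blocks, that is, the reflection group of the corresponding almost parabolic
  set.\<close>

definition block_perms :: "nat \<Rightarrow> (nat \<times> nat) set \<Rightarrow> (nat \<Rightarrow> nat) set" where
  "block_perms n E = {p. p permutes {1..n} \<and> (\<forall>a. p a = a \<or> (a, p a) \<in> E)}"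

definition transps :: "(nat \<times> nat) set \<Rightarrow> (nat \<Rightarrow> nat) set" where
  "transps Z = (\<lambda>(i, j). Transposition.transpose i j) ` Z"

text \<open>The target order \<open>T\<close> is kept apart from \<open>Z\<close>, because sorting
  carries \<open>Z\<close> to an arbitrary order on the same blocks. For \<open>T = Z\<close> these
  are the inversions that compute the Coxeter length.\<close>

definition inversions ::
    "(nat \<times> nat) set \<Rightarrow> (nat \<times> nat) set \<Rightarrow> (nat \<Rightarrow> nat) \<Rightarrow> (nat \<times> nat) set" where
  "inversions Z T u = {(a, b) \<in> Z. (u b, u a) \<in> T}"

lemma comparability_iff: "(a, b) \<in> comparability Z \<longleftrightarrow> (a, b) \<in> Z \<or> (b, a) \<in> Z"
  by (auto simp: comparability_def)

lemma comparability_sym: "(a, b) \<in> comparability Z \<Longrightarrow> (b, a) \<in> comparability Z"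
  by (auto simp: comparability_def)

lemma comparability_Un: "comparability (Y \<union> Z) = comparability Y \<union> comparability Z"
  by (auto simp: comparability_def)

lemma block_orderD:
  assumes "block_order n Z"
  shows "Z \<subseteq> {1..n} \<times> {1..n}" "finite Z" "(a, a) \<notin> Z" "trans Z"
    "(a, b) \<in> Z \<Longrightarrow> (b, c) \<in> Z \<Longrightarrow> (a, c) \<in> Z"
    "(a, b) \<in> Z \<Longrightarrow> (b, a) \<notin> Z"
    "(a, b) \<in> comparability Z \<Longrightarrow> (b, c) \<in> comparability Z \<Longrightarrow>
      a = c \<or> (a, c) \<in> comparability Z"
    "(a, a) \<notin> comparability Z"
    "(a, b) \<in> comparability Z \<Longrightarrow> a \<in> {1..n}"
    "(a, b) \<in> comparability Z \<Longrightarrow> b \<in> {1..n}"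
proof -
  show sub: "Z \<subseteq> {1..n} \<times> {1..n}" and tr: "trans Z" and irr: "(a, a) \<notin> Z"
    using assms by (auto simp: block_order_def irrefl_def)
  show "finite Z" using sub by (rule finite_subset) simp
  show "(a, b) \<in> Z \<Longrightarrow> (b, c) \<in> Z \<Longrightarrow> (a, c) \<in> Z" using tr by (rule transD)
  show "(a, b) \<in> Z \<Longrightarrow> (b, a) \<notin> Z"
    using assms by (auto simp: block_order_def irrefl_def dest: transD)
  show "(a, b) \<in> comparability Z \<Longrightarrow> (b, c) \<in> comparability Z \<Longrightarrow>
      a = c \<or> (a, c) \<in> comparability Z"
    using assms by (auto simp only: block_order_def)
  show "(a, a) \<notin> comparability Z" using irr by (simp add: comparability_iff)
  show "(a, b) \<in> comparability Z \<Longrightarrow> a \<in> {1..n}" "(a, b) \<in> comparability Z \<Longrightarrow> b \<in> {1..n}"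
    using sub by (auto simp: comparability_iff)
qed

lemma cover_subset: "cover Z \<subseteq> Z"
  by (auto simp: cover_def)

text \<open>A pair that is not a covering pair splits at an intermediate element, and both halves
  have strictly fewer elements in between.\<close>

lemma trancl_cover:
  assumes "finite Z" "trans Z" "irrefl Z"
  shows "(cover Z)\<^sup>+ = Z"
proof
  show "(cover Z)\<^sup>+ \<subseteq> Z"
    using trancl_mono_subset[OF cover_subset, of Z] trancl_id[OF assms(2)] by simp
  have "(a, b) \<in> (cover Z)\<^sup>+" if "(a, b) \<in> Z" for a b
    using that
  proof (induction "card {c. (a, c) \<in> Z \<and> (c, b) \<in> Z}" arbitrary: a b rule: less_induct)
    case less
    have fin: "finite {c. (a, c) \<in> Z \<and> (c, b) \<in> Z}"
      by (rule finite_subset[of _ "Range Z"]) (use assms(1) in \<open>auto simp: finite_Range\<close>)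
    show ?case
    proof (cases "(a, b) \<in> cover Z")
      case False
      then obtain c where c: "(a, c) \<in> Z" "(c, b) \<in> Z" using less.prems by (auto simp: cover_def)
      have "{d. (a, d) \<in> Z \<and> (d, c) \<in> Z} \<subset> {d. (a, d) \<in> Z \<and> (d, b) \<in> Z}"
        "{d. (c, d) \<in> Z \<and> (d, b) \<in> Z} \<subset> {d. (a, d) \<in> Z \<and> (d, b) \<in> Z}"
        using c assms(2,3) by (auto simp: irrefl_def dest: transD)
      then have "(a, c) \<in> (cover Z)\<^sup>+" "(c, b) \<in> (cover Z)\<^sup>+"
        using less.hyps c psubset_card_mono[OF fin] by blast+
      then show ?thesis by (rule trancl_trans)
    qed auto
  qed
  then show "Z \<subseteq> (cover Z)\<^sup>+" by auto
qed

lemma block_order_trancl_cover: "block_order n Z \<Longrightarrow> (cover Z)\<^sup>+ = Z"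
  using trancl_cover[of Z] block_orderD(2,4)[of n Z] unfolding block_order_def by blast

text \<open>Consecutive elements of a block stand in the same relation to every other element, so
  exchanging them disturbs no other pair. In root systems: a simple reflection permutes the positive
  roots other than its own.\<close>

lemma cover_transpose:
  assumes Z: "block_order n Z" and ij: "(i, j) \<in> cover Z" and ab: "(a, b) \<in> Z" "(a, b) \<noteq> (i, j)"
  shows "(Transposition.transpose i j a, Transposition.transpose i j b) \<in> Z"
proof -
  note D = block_orderD[OF Z]
  have ijZ: "(i, j) \<in> Z" and no: "\<And>c. (i, c) \<in> Z \<Longrightarrow> (c, j) \<notin> Z"
    using ij by (auto simp: cover_def)
  have 1: "(j, b) \<in> Z" if "(i, b) \<in> Z" "b \<noteq> j" for b
    using D(7)[of j i b] that ijZ no[of b] by (auto simp: comparability_iff)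
  have 2: "(a, i) \<in> Z" if "(a, j) \<in> Z" "a \<noteq> i" for a
    using D(7)[of a j i] that ijZ no[of a] by (auto simp: comparability_iff)
  have 3: "(a, j) \<in> Z" if "(a, i) \<in> Z" for a using D(5) that ijZ by blast
  have 4: "(i, b) \<in> Z" if "(j, b) \<in> Z" for b using D(5) that ijZ by blast
  have "a \<noteq> b" using ab D(3) by auto
  moreover have "(a, b) \<noteq> (j, i)" using ab ijZ D(6) by blast
  ultimately consider "a = i" "b \<noteq> i" "b \<noteq> j" | "b = j" "a \<noteq> i" "a \<noteq> j" | "b = i" "a \<noteq> i" "a \<noteq> j"
    | "a = j" "b \<noteq> i" "b \<noteq> j" | "a \<noteq> i" "a \<noteq> j" "b \<noteq> i" "b \<noteq> j"
    using ab(2) by blast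
  then show ?thesis
  proof cases
    case 1 then show ?thesis using \<open>\<And>b. (i, b) \<in> Z \<Longrightarrow> b \<noteq> j \<Longrightarrow> (j, b) \<in> Z\<close> ab(1) by simp
  next
    case 2 then show ?thesis using \<open>\<And>a. (a, j) \<in> Z \<Longrightarrow> a \<noteq> i \<Longrightarrow> (a, i) \<in> Z\<close> ab(1) by simp
  next
    case 3 then show ?thesis using \<open>\<And>a. (a, i) \<in> Z \<Longrightarrow> (a, j) \<in> Z\<close> ab(1) by simp
  next
    case 4 then show ?thesis using \<open>\<And>b. (j, b) \<in> Z \<Longrightarrow> (i, b) \<in> Z\<close> ab(1) by simp
  next
    case 5 then show ?thesis using ab(1) by simp
  qed
qed

section \<open>Permutations that preserve the blocks\<close>

lemma block_permsD: "p \<in> block_perms n E \<Longrightarrow> p a = a \<or> (a, p a) \<in> E"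
  by (simp add: block_perms_def)

lemma block_perms_permutes: "p \<in> block_perms n E \<Longrightarrow> p permutes {1..n}"
  by (simp add: block_perms_def)

lemma block_perms_id: "id \<in> block_perms n E"
  by (simp add: block_perms_def permutes_id)

lemma block_perms_comp:
  assumes Z: "block_order n Z"
    and p: "p \<in> block_perms n (comparability Z)" and q: "q \<in> block_perms n (comparability Z)"
  shows "p \<circ> q \<in> block_perms n (comparability Z)"
proof -
  have "p (q a) = a \<or> (a, p (q a)) \<in> comparability Z" for a
    using block_permsD[OF q, of a] block_permsD[OF p, of "q a"]
      block_orderD(7)[OF Z, of a "q a" "p (q a)"] by auto
  then show ?thesis using p q by (auto simp: block_perms_def permutes_compose)
qed

lemma block_perms_inv:
  assumes "p \<in> block_perms n (comparability Z)"
  shows "inv' p \<in> block_perms n (comparability Z)"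
proof -
  have p: "p permutes {1..n}" using assms by (simp add: block_perms_def)
  have "inv' p a = a \<or> (a, inv' p a) \<in> comparability Z" for a
    using block_permsD[OF assms, of "inv' p a"] comparability_sym[of "inv' p a" a Z]
      permutes_inverses(1)[OF p, of a] by auto
  then show ?thesis using p by (simp add: block_perms_def permutes_inv)
qed

lemma block_perms_comparability:
  assumes Z: "block_order n Z" and p: "p \<in> block_perms n (comparability Z)"
    and ab: "(a, b) \<in> comparability Z"
  shows "(p a, p b) \<in> comparability Z"
proof -
  have pp: "inj p" using permutes_inj[OF block_perms_permutes[OF p]] .
  have "a \<noteq> b" using ab block_orderD(8)[OF Z] by auto
  then have ne: "p a \<noteq> p b" using pp by (simp add: inj_eq)
  have "p a = a \<or> (p a, a) \<in> comparability Z" "p b = b \<or> (b, p b) \<in> comparability Z"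
    using block_permsD[OF p, of a] block_permsD[OF p, of b] comparability_sym[of a "p a" Z] by auto
  then show ?thesis
    using ab ne block_orderD(7)[OF Z, of "p a" a b] block_orderD(7)[OF Z, of "p a" b "p b"]
      block_orderD(7)[OF Z, of a b "p b"] by auto
qed

lemma transpose_block_perms:
  assumes "block_order n Z" "(i, j) \<in> Z"
  shows "Transposition.transpose i j \<in> block_perms n (comparability Z)"
  using assms block_orderD(1)[OF assms(1)]
  by (auto simp: block_perms_def comparability_iff Transposition.transpose_def
      intro!: permutes_swap_id)

lemma comparability_map_prod: "comparability (map_prod p p ` Z) = map_prod p p ` comparability Z"
  by (auto simp: comparability_def)

lemma cover_map_prod:
  assumes "inj p" shows "cover (map_prod p p ` Z) = map_prod p p ` cover Z"
proof -
  have "map_prod p p ` Z O map_prod p p ` Z = map_prod p p ` (Z O Z)"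
    using assms by (force simp: inj_eq relcomp_unfold)
  moreover have "inj (map_prod p p)" using assms by (simp add: prod.inj_map)
  ultimately show ?thesis unfolding cover_def by (simp add: image_set_diff)
qed

lemma trans_map_prod: "inj p \<Longrightarrow> trans Z \<Longrightarrow> trans (map_prod p p ` Z)"
  unfolding trans_def by (auto simp: inj_eq)

lemma block_order_map_prod:
  assumes Z: "block_order n Z" and p: "p permutes {1..n}"
  shows "block_order n (map_prod p p ` Z)"
proof -
  have inj: "inj p" using p by (rule permutes_inj)
  have "map_prod p p ` Z \<subseteq> {1..n} \<times> {1..n}"
    using block_orderD(1)[OF Z] permutes_in_image[OF p] by auto
  moreover have "irrefl (map_prod p p ` Z)"
    using block_orderD(3)[OF Z] inj by (auto simp: irrefl_def inj_eq)
  moreover have "a = c \<or> (a, c) \<in> comparability (map_prod p p ` Z)"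
    if ab: "(a, b) \<in> comparability (map_prod p p ` Z)"
    and bc: "(b, c) \<in> comparability (map_prod p p ` Z)" for a b c
  proof -
    obtain a' b' where a: "a = p a'" "b = p b'" "(a', b') \<in> comparability Z"
      using ab by (auto simp: comparability_map_prod)
    obtain b'' c' where c: "b = p b''" "c = p c'" "(b'', c') \<in> comparability Z"
      using bc by (auto simp: comparability_map_prod)
    have "b' = b''" using a(2) c(1) inj by (simp add: inj_eq)
    then have "a' = c' \<or> (a', c') \<in> comparability Z" using block_orderD(7)[OF Z] a c by blast
    then show ?thesis using a c by (auto simp: comparability_map_prod)
  qed
  ultimately show ?thesis
    using trans_map_prod[OF inj block_orderD(4)[OF Z]] unfolding block_order_def by blast
qed

lemma block_perms_map_prod:
  assumes Z: "block_order n Z" and p: "p \<in> block_perms n (comparability Z)"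
  shows "block_order n (map_prod p p ` Z)" "comparability (map_prod p p ` Z) = comparability Z"
proof -
  show "block_order n (map_prod p p ` Z)"
    using Z p by (intro block_order_map_prod) (auto simp: block_perms_def)
  have bij: "bij p" using p permutes_bij by (auto simp: block_perms_def)
  have "(a, b) \<in> map_prod p p ` comparability Z" if "(a, b) \<in> comparability Z" for a b
  proof -
    have "(inv' p a, inv' p b) \<in> comparability Z"
      by (rule block_perms_comparability[OF Z block_perms_inv[OF p] that])
    then have "map_prod p p (inv' p a, inv' p b) \<in> map_prod p p ` comparability Z" by (rule imageI)
    then show ?thesis using bij by (simp add: bij_is_surj surj_f_inv_f)
  qed
  then show "comparability (map_prod p p ` Z) = comparability Z"
    using block_perms_comparability[OF Z p] by (auto simp: comparability_map_prod)
qed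

text \<open>By \<open>cover_transpose\<close>, composing with an adjacent transposition only
  relabels the pairs other than \<open>(i, j)\<close>. A single pair therefore decides how the
  number of inversions changes.\<close>

lemma inversions_transpose:
  assumes Z: "block_order n Z" and ij: "(i, j) \<in> cover Z"
  defines "t \<equiv> Transposition.transpose i j"
  shows "card (inversions Z T (u \<circ> t) - {(i, j)}) = card (inversions Z T u - {(i, j)})"
proof -
  have t: "t (t a) = a" for a by (simp add: t_def)
  have tij: "t i = j" "t j = i" by (simp_all add: t_def)
  have ji: "(j, i) \<notin> Z" using ij block_orderD(6)[OF Z] cover_subset by blast
  have mv: "(t a, t b) \<in> Z \<and> (t a, t b) \<noteq> (i, j)" if "(a, b) \<in> Z" "(a, b) \<noteq> (i, j)" for a b
    using cover_transpose[OF Z ij that] that ji t tij by (metis Pair_inject t_def)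
  have "bij_betw (map_prod t t) (inversions Z T (u \<circ> t) - {(i, j)}) (inversions Z T u - {(i, j)})"
  proof (rule bij_betw_byWitness[where f' = "map_prod t t"])
    show "map_prod t t ` (inversions Z T (u \<circ> t) - {(i, j)}) \<subseteq> inversions Z T u - {(i, j)}"
      using mv by (auto simp: inversions_def)
    show "map_prod t t ` (inversions Z T u - {(i, j)}) \<subseteq> inversions Z T (u \<circ> t) - {(i, j)}"
      using mv by (auto simp: inversions_def t)
  qed (auto simp: t)
  then show ?thesis by (rule bij_betw_same_card)
qed

lemma finite_inversions: "finite Z \<Longrightarrow> finite (inversions Z T u)"
  by (rule finite_subset[of _ Z]) (auto simp: inversions_def)

lemma card_inversions_transpose:
  assumes Z: "block_order n Z" and ij: "(i, j) \<in> cover Z" and T: "(u j, u i) \<in> T" "(u i, u j) \<notin> T"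
  shows "card (inversions Z T u) = Suc (card (inversions Z T (u \<circ> Transposition.transpose i j)))"
proof -
  have "(i, j) \<in> inversions Z T u" "(i, j) \<notin> inversions Z T (u \<circ> Transposition.transpose i j)"
    using T ij cover_subset by (auto simp: inversions_def)
  then show ?thesis
    using inversions_transpose[OF Z ij, of T u] finite_inversions[OF block_orderD(2)[OF Z]]
    by (metis Diff_empty Diff_insert0 card_Suc_Diff1)
qed

section \<open>Words in adjacent transpositions and Coxeter length\<close>

definition prod_perms :: "(nat \<Rightarrow> nat) list \<Rightarrow> nat \<Rightarrow> nat" where
  "prod_perms ts = foldr (\<circ>) ts id"

lemma prod_perms_simps [simp]: "prod_perms [] = id" "prod_perms (t # ts) = t \<circ> prod_perms ts"
  by (simp_all add: prod_perms_def)

lemma prod_perms_append: "prod_perms (xs @ ys) = prod_perms xs \<circ> prod_perms ys"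
  by (induction xs) (simp_all add: o_assoc)

text \<open>Bubble sort, with one adjacent transposition for each inversion.\<close>

lemma bubble_sort:
  assumes Z: "block_order n Z" and T: "block_order n T" and ZT: "comparability T = comparability Z"
    and u: "u \<in> block_perms n (comparability Z)"
  shows "\<exists>ts. set ts \<subseteq> transps (cover Z) \<and> length ts = card (inversions Z T u) \<and>
    map_prod (u \<circ> prod_perms ts) (u \<circ> prod_perms ts) ` Z = T"
  using u
proof (induction "card (inversions Z T u)" arbitrary: u)
  case 0
  have inj: "inj u" using permutes_inj[OF block_perms_permutes[OF 0(2)]] .
  have none: "(u b, u a) \<notin> T" if "(a, b) \<in> Z" for a b
    using 0 that finite_inversions[OF block_orderD(2)[OF Z], of T u] by (auto simp: inversions_def)
  have sub: "(u a, u b) \<in> T" if "(a, b) \<in> Z" for a b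
  proof -
    have "(a, b) \<in> comparability Z" using that by (simp add: comparability_iff)
    then have "(u a, u b) \<in> comparability T" using block_perms_comparability[OF Z 0(2)] ZT by simp
    then show ?thesis using none[OF that] by (simp add: comparability_iff)
  qed
  \<comment> \<open>\<open>T\<close> and the image of \<open>Z\<close> have the same comparable
    pairs, so an inclusion between these two asymmetric relations is an equality.\<close>
  have "(c, d) \<in> map_prod u u ` Z" if "(c, d) \<in> T" for c d
  proof -
    have "(c, d) \<in> comparability T" using that by (simp add: comparability_iff)
    then have "(c, d) \<in> map_prod u u ` comparability Z"
      using ZT block_perms_map_prod(2)[OF Z 0(2)] by (simp add: comparability_map_prod)
    then obtain a b where ab: "c = u a" "d = u b" "(a, b) \<in> Z \<or> (b, a) \<in> Z"
      by (auto simp: comparability_iff)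
    then show ?thesis using none[of b a] that by auto
  qed
  then have "map_prod u u ` Z = T" using sub by auto
  then show ?case using 0 by (intro exI[of _ "[]"]) simp
next
  case (Suc m)
  \<comment> \<open>If no covering pair were inverted, \<open>u\<close> would be increasing along
    covers and hence, by transitivity of \<open>T\<close>, along all of \<open>Z\<close>.\<close>
  have "\<exists>(i, j) \<in> cover Z. (u j, u i) \<in> T"
  proof (rule ccontr)
    assume *: "\<not> (\<exists>(i, j) \<in> cover Z. (u j, u i) \<in> T)"
    have cov: "(u a, u b) \<in> T" if "(a, b) \<in> cover Z" for a b
    proof -
      have "(a, b) \<in> comparability Z" using that cover_subset by (auto simp: comparability_iff)
      then have "(u a, u b) \<in> comparability T"
        using block_perms_comparability[OF Z Suc.prems] ZT by simp
      then show ?thesis using * that by (auto simp: comparability_iff)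
    qed
    have "(u a, u b) \<in> T" if "(a, b) \<in> (cover Z)\<^sup>+" for a b
      using that by (induction rule: trancl_induct) (auto intro: cov block_orderD(5)[OF T])
    then have "inversions Z T u = {}"
      using block_orderD(6)[OF T] block_order_trancl_cover[OF Z] by (auto simp: inversions_def)
    then show False using Suc.hyps(2) by simp
  qed
  then obtain i j where ij: "(i, j) \<in> cover Z" "(u j, u i) \<in> T" by auto
  define t where "t = Transposition.transpose i j"
  have t: "t \<in> block_perms n (comparability Z)"
    unfolding t_def using transpose_block_perms[OF Z] ij cover_subset by blast
  have "m = card (inversions Z T (u \<circ> t))"
    using card_inversions_transpose[OF Z ij] ij(2) block_orderD(6)[OF T] Suc.hyps(2)
    by (simp add: t_def)
  from Suc.hyps(1)[OF this block_perms_comp[OF Z Suc.prems t]]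
  obtain ts where ts: "set ts \<subseteq> transps (cover Z)" "length ts = card (inversions Z T (u \<circ> t))"
    "map_prod (u \<circ> t \<circ> prod_perms ts) (u \<circ> t \<circ> prod_perms ts) ` Z = T" by blast
  have "t \<in> transps (cover Z)" using ij by (force simp: t_def transps_def)
  then show ?case
    using ts Suc.hyps(2) \<open>m = _\<close> by (intro exI[of _ "t # ts"]) (simp add: o_assoc)
qed

lemma prod_perms_block_perms:
  assumes Z: "block_order n Z" and ts: "set ts \<subseteq> transps (cover Z)"
  shows "prod_perms ts \<in> block_perms n (comparability Z)"
  using ts
proof (induction ts)
  case (Cons t ts)
  then obtain i j where "t = Transposition.transpose i j" "(i, j) \<in> Z"
    using cover_subset by (auto simp: transps_def)
  then have "t \<in> block_perms n (comparability Z)" using transpose_block_perms[OF Z] by simp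
  then show ?case unfolding prod_perms_simps
    using Cons by (intro block_perms_comp[OF Z]) simp_all
qed (simp only: prod_perms_simps block_perms_id)

lemma prod_perms_rev:
  "set ts \<subseteq> transps Z \<Longrightarrow> prod_perms (rev ts) \<circ> prod_perms ts = id"
proof (induction ts)
  case (Cons t ts)
  have "t \<circ> t = id" using Cons.prems by (auto simp: transps_def fun_eq_iff)
  have "prod_perms (rev (t # ts)) \<circ> prod_perms (t # ts) =
      prod_perms (rev ts) \<circ> (t \<circ> t) \<circ> prod_perms ts"
    unfolding rev.simps prod_perms_append prod_perms_simps comp_id comp_assoc ..
  also have "\<dots> = prod_perms (rev ts) \<circ> prod_perms ts" unfolding \<open>t \<circ> t = id\<close> by simp
  also have "\<dots> = id" using Cons by (intro Cons.IH) simp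
  finally show ?case .
qed simp

text \<open>Existence half of the simple transitivity of block permutations on the orders of the
  blocks: sort, starting from the identity.\<close>

lemma ex_block_perm:
  assumes "block_order n Z" "block_order n T" "comparability T = comparability Z"
  obtains u where "u \<in> block_perms n (comparability Z)" "map_prod u u ` Z = T"
proof -
  obtain ts where "set ts \<subseteq> transps (cover Z)" "map_prod (prod_perms ts) (prod_perms ts) ` Z = T"
    using bubble_sort[OF assms block_perms_id] unfolding id_comp by blast
  then show ?thesis using that prod_perms_block_perms[OF assms(1)] by blast
qed

text \<open>Uniqueness half. The number of predecessors increases strictly along \<open>Z\<close>
  and is preserved by \<open>u\<close>, which pins every element to its place in its block.\<close>

lemma block_perm_rigid:
  assumes Z: "block_order n Z" and u: "u \<in> block_perms n (comparability Z)"
    and eq: "map_prod u u ` Z = Z"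
  shows "u = id"
proof (rule ccontr)
  have inj: "inj u" using permutes_inj[OF block_perms_permutes[OF u]] .
  have fin: "finite {c. (c, a) \<in> Z}" for a
    by (rule finite_subset[of _ "Domain Z"]) (use block_orderD(2)[OF Z] in \<open>auto intro: finite_Domain\<close>)
  have img: "u ` {c. (c, a) \<in> Z} = {c. (c, u a) \<in> Z}" for a
  proof (intro equalityI subsetI)
    fix c assume "c \<in> {c. (c, u a) \<in> Z}"
    then have "(c, u a) \<in> map_prod u u ` Z" using eq by simp
    then show "c \<in> u ` {c. (c, a) \<in> Z}" using inj by (auto simp: inj_eq)
  next
    fix c assume "c \<in> u ` {c. (c, a) \<in> Z}"
    then obtain b where "c = u b" "(b, a) \<in> Z" by auto
    then have "(c, u a) \<in> map_prod u u ` Z" by (metis image_eqI map_prod_simp)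
    then show "c \<in> {c. (c, u a) \<in> Z}" using eq by simp
  qed
  have card: "card {c. (c, u a) \<in> Z} = card {c. (c, a) \<in> Z}" for a
    using img[of a] card_image[OF inj_on_subset[OF inj subset_UNIV], of "{c. (c, a) \<in> Z}"] by simp
  have less: "card {c. (c, a) \<in> Z} < card {c. (c, b) \<in> Z}" if "(a, b) \<in> Z" for a b
    by (rule psubset_card_mono[OF fin])
      (use that block_orderD(3)[OF Z] block_orderD(5)[OF Z] in blast)
  assume "u \<noteq> id"
  then obtain a where "u a \<noteq> a" by (auto simp: fun_eq_iff)
  then have "(a, u a) \<in> Z \<or> (u a, a) \<in> Z" using u by (auto simp: block_perms_def comparability_iff)
  then show False using less[of a "u a"] less[of "u a" a] card[of a] by (metis less_irrefl)
qed

text \<open>Sorting \<open>u\<close> by adjacent transpositions ends at the identity, by rigidity;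
  the reversed word is then a word for \<open>u\<close> itself.\<close>

lemma block_perm_word:
  assumes Z: "block_order n Z" and u: "u \<in> block_perms n (comparability Z)"
  obtains ts where "set ts \<subseteq> transps (cover Z)" "length ts = card (inversions Z Z u)"
    "prod_perms ts = u"
proof -
  obtain ts where ts: "set ts \<subseteq> transps (cover Z)" "length ts = card (inversions Z Z u)"
    "map_prod (u \<circ> prod_perms ts) (u \<circ> prod_perms ts) ` Z = Z"
    using bubble_sort[OF Z Z refl u] by blast
  have "u \<circ> prod_perms ts \<in> block_perms n (comparability Z)"
    using block_perms_comp[OF Z u prod_perms_block_perms[OF Z ts(1)]] .
  then have "u \<circ> prod_perms ts = id" using block_perm_rigid[OF Z] ts(3) by blast
  moreover have "prod_perms ts \<circ> prod_perms (rev ts) = id"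
    using prod_perms_rev[of "rev ts" "cover Z"] ts(1) by simp
  ultimately have "prod_perms (rev ts) = u"
    using comp_assoc[of u "prod_perms ts" "prod_perms (rev ts)"] by simp
  then show ?thesis using that[of "rev ts"] ts by simp
qed

lemma sym_group_simps:
  "carrier (sym_group n) = {p. p permutes {1..n}}" "mult (sym_group n) = (\<circ>)"
  "\<one>\<^bsub>sym_group n\<^esub> = id"
  by (simp_all add: sym_group_def)

lemma sym_group_inv:
  assumes "p permutes {1..n}" shows "inv\<^bsub>sym_group n\<^esub> p = inv' p"
  using group.inv_equality[OF sym_group_is_group, of n "inv' p" p] assms
  by (simp add: sym_group_simps permutes_inv permutes_inv_o)

lemma generate_transps:
  assumes Z: "block_order n Z"
  shows "generate (sym_group n) (transps (cover Z)) = block_perms n (comparability Z)"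
proof
  show "generate (sym_group n) (transps (cover Z)) \<subseteq> block_perms n (comparability Z)"
  proof
    have block: "t \<in> block_perms n (comparability Z)" if "t \<in> transps (cover Z)" for t
      using prod_perms_block_perms[OF Z, of "[t]"] that by simp
    fix p assume "p \<in> generate (sym_group n) (transps (cover Z))"
    then show "p \<in> block_perms n (comparability Z)"
    proof induction
      case one then show ?case unfolding sym_group_simps by (rule block_perms_id)
    next
      case (incl t)
      then show ?case using block by simp
    next
      case (inv t)
      then have "t \<in> block_perms n (comparability Z)"
        using block by simp
      then have "inv\<^bsub>sym_group n\<^esub> t = inv' t" by (intro sym_group_inv block_perms_permutes)
      then show ?case using block_perms_inv[OF \<open>t \<in> block_perms _ _\<close>] by simp
    next
      case (eng p q) then show ?case unfolding sym_group_simps by (intro block_perms_comp[OF Z])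
    qed
  qed
  have "prod_perms ts \<in> generate (sym_group n) (transps (cover Z))"
    if "set ts \<subseteq> transps (cover Z)" for ts
    using that
  proof (induction ts)
    case Nil
    show ?case
      using generate.one[of "sym_group n" "transps (cover Z)"] unfolding sym_group_simps prod_perms_simps .
  next
    case (Cons t ts)
    then have "t \<in> generate (sym_group n) (transps (cover Z))"
      "prod_perms ts \<in> generate (sym_group n) (transps (cover Z))"
      by (auto intro: generate.incl)
    from generate.eng[OF this] show ?case unfolding sym_group_simps prod_perms_simps .
  qed
  then show "block_perms n (comparability Z) \<subseteq> generate (sym_group n) (transps (cover Z))"
    using block_perm_word[OF Z] by blast
qed

text \<open>The bubble sort word attains the number of inversions, and no word is shorter, because
  one adjacent transposition creates at most one inversion.\<close>

lemma word_length_inversions: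
  assumes Z: "block_order n Z" and u: "u \<in> block_perms n (comparability Z)"
  shows "word_length (sym_group n) (transps (cover Z)) u = card (inversions Z Z u)"
  unfolding word_length_def sym_group_simps prod_perms_def[symmetric]
proof (rule Least_equality)
  show "\<exists>xs. set xs \<subseteq> transps (cover Z) \<and> length xs = card (inversions Z Z u) \<and>
      prod_perms xs = u"
    using block_perm_word[OF Z u] by blast
next
  have *: "card (inversions Z Z (prod_perms xs)) \<le> length xs" if "set xs \<subseteq> transps (cover Z)" for xs
    using that
  proof (induction xs rule: rev_induct)
    case Nil
    have "inversions Z Z (prod_perms []) = {}"
      using block_orderD(6)[OF Z] by (auto simp: inversions_def)
    then show ?case by (simp only: card.empty)
  next
    case (snoc t xs)
    define v where "v = prod_perms xs"
    obtain i j where ij: "(i, j) \<in> cover Z" "t = Transposition.transpose i j"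
      using snoc.prems by (auto simp: transps_def)
    have fin: "finite (inversions Z Z w)" for w
      using finite_inversions[OF block_orderD(2)[OF Z]] .
    have "card (inversions Z Z (v \<circ> t)) \<le> Suc (card (inversions Z Z (v \<circ> t) - {(i, j)}))"
      by (metis Diff_empty card_Suc_Diff1 card_Diff_insert fin le_SucI order_refl Diff_insert0)
    also have "\<dots> = Suc (card (inversions Z Z v - {(i, j)}))"
      using inversions_transpose[OF Z ij(1), of Z v] ij(2) by simp
    also have "\<dots> \<le> Suc (card (inversions Z Z v))" by (simp add: card_mono fin)
    also have "\<dots> \<le> Suc (length xs)" using snoc by (simp add: v_def)
    finally show ?case
      unfolding prod_perms_append prod_perms_simps comp_id v_def by (metis length_append_singleton)
  qed
  then show "card (inversions Z Z u) \<le> k"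
    if "\<exists>xs. set xs \<subseteq> transps (cover Z) \<and> length xs = k \<and> prod_perms xs = u" for k
    using that by blast
qed

text \<open>The condition on the difference says that \<open>Y\<close> cuts every block of
  \<open>Z\<close> into consecutive intervals, so that \<open>Y\<close> corresponds to a standard
  parabolic subsystem. It is equivalent to \<open>cover Y \<subseteq> cover Z\<close>, by
  \<open>suborder_cover\<close> and \<open>suborderI_cover\<close>, but suits arguments that compose
  pairs across the cuts.\<close>

definition suborder :: "nat \<Rightarrow> (nat \<times> nat) set \<Rightarrow> (nat \<times> nat) set \<Rightarrow> bool" where
  "suborder n Y Z \<longleftrightarrow> block_order n Y \<and> block_order n Z \<and> Y \<subseteq> Z \<and> trans (Z - Y)"

lemma suborderD:
  assumes "suborder n Y Z"
  shows "block_order n Y" "block_order n Z" "Y \<subseteq> Z" "trans (Z - Y)"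
    "comparability Y \<subseteq> comparability Z"
  using assms by (auto simp: suborder_def comparability_def)

lemma suborder_refl: "block_order n Z \<Longrightarrow> suborder n Z Z"
  by (simp add: suborder_def)

text \<open>The blocks of \<open>Y\<close> are intervals of the blocks of \<open>Z\<close>, so any
  other element of the surrounding block lies before or after all of such an interval.\<close>

lemma suborder_mix:
  assumes Y: "suborder n Y Z"
  shows "(a, b) \<in> comparability Y \<Longrightarrow> (b, c) \<in> Z - Y \<Longrightarrow> (a, c) \<in> Z - Y"
    "(a, b) \<in> Z - Y \<Longrightarrow> (b, c) \<in> comparability Y \<Longrightarrow> (a, c) \<in> Z - Y"
proof -
  note S = suborderD[OF Y] and D = block_orderD[OF suborderD(2)[OF Y]]
    and DY = block_orderD[OF suborderD(1)[OF Y]]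
  have nc: "(b, c) \<notin> comparability Y" if "(b, c) \<in> Z - Y" for b c
    using that D(6) S(3) by (auto simp: comparability_iff)
  show "(a, c) \<in> Z - Y" if ab: "(a, b) \<in> comparability Y" and bc: "(b, c) \<in> Z - Y"
  proof -
    have "a \<noteq> c" using comparability_sym[OF ab] nc[OF bc] by auto
    have ac: "(a, c) \<notin> comparability Y"
      using DY(7)[OF comparability_sym[OF ab], of c] nc[OF bc] bc D(3) by auto
    have "(a, b) \<in> comparability Z" "(b, c) \<in> comparability Z"
      using S(5) ab bc by (auto simp: comparability_def)
    then have "(a, c) \<in> comparability Z" using D(7) \<open>a \<noteq> c\<close> by blast
    moreover have False if ca: "(c, a) \<in> Z"
    proof -
      have "(c, a) \<in> Z - Y" using ca ac by (auto simp: comparability_iff)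
      then have "(b, a) \<in> Z - Y" using bc S(4) by (auto dest: transD)
      then show False using nc comparability_sym[OF ab] by blast
    qed
    ultimately show ?thesis using ac by (auto simp: comparability_iff)
  qed
  show "(a, c) \<in> Z - Y" if ab: "(a, b) \<in> Z - Y" and bc: "(b, c) \<in> comparability Y"
  proof -
    have "a \<noteq> c" using comparability_sym[OF bc] nc[OF ab] by auto
    have ac: "(a, c) \<notin> comparability Y"
      using DY(7)[OF _ comparability_sym[OF bc], of a] nc[OF ab] ab D(3) by auto
    have "(a, b) \<in> comparability Z" "(b, c) \<in> comparability Z"
      using S(5) ab bc by (auto simp: comparability_def)
    then have "(a, c) \<in> comparability Z" using D(7) \<open>a \<noteq> c\<close> by blast
    moreover have False if ca: "(c, a) \<in> Z"
    proof -
      have "(c, a) \<in> Z - Y" using ca ac by (auto simp: comparability_iff)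
      then have "(c, b) \<in> Z - Y" using ab S(4) by (auto dest: transD)
      then show False using nc comparability_sym[OF bc] by blast
    qed
    ultimately show ?thesis using ac by (auto simp: comparability_iff)
  qed
qed

lemma suborder_cover:
  assumes Y: "suborder n Y Z" shows "cover Y \<subseteq> cover Z"
proof
  fix x assume x: "x \<in> cover Y"
  obtain a b where ab: "x = (a, b)" by fastforce
  have aY: "(a, b) \<in> Y" and no: "\<And>c. (a, c) \<in> Y \<Longrightarrow> (c, b) \<notin> Y" using x ab by (auto simp: cover_def)
  have "False" if "(a, c) \<in> Z" "(c, b) \<in> Z" for c
  proof (cases "(a, c) \<in> Y")
    case True
    then have "(c, b) \<in> Z - Y" using no that by blast
    then have "(a, b) \<in> Z - Y" using suborder_mix(1)[OF Y, of a c b] True by (auto simp: comparability_iff)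
    then show False using aY by simp
  next
    case False
    then have ac: "(a, c) \<in> Z - Y" using that by simp
    have "(a, b) \<in> Z - Y"
    proof (cases "(c, b) \<in> Y")
      case True
      then show ?thesis using suborder_mix(2)[OF Y ac] by (auto simp: comparability_iff)
    next
      case False
      then show ?thesis using ac that suborderD(4)[OF Y] by (auto dest: transD)
    qed
    then show False using aY by simp
  qed
  then show "x \<in> cover Z" using aY ab suborderD(3)[OF Y] by (auto simp: cover_def)
qed

text \<open>The criterion in terms of simple roots. An element lying in \<open>Z\<close> between the
  ends of a chain of covers of \<open>Z\<close> has to be a member of the chain, so a composite of
  two pairs of \<open>Z\<close> that lands in \<open>Y\<close> has its first factor in
  \<open>Y\<close> already.\<close>

lemma suborderI_cover:
  assumes Y: "block_order n Y" and Z: "block_order n Z" and cov: "cover Y \<subseteq> cover Z"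
  shows "suborder n Y Z"
proof -
  have YZ: "Y \<subseteq> Z"
    using trancl_mono_subset[OF cov] block_order_trancl_cover[OF Y] block_order_trancl_cover[OF Z]
    by simp
  have split: "(a, b) \<in> Y" if "(a, c) \<in> Y" "(a, b) \<in> Z" "(b, c) \<in> Z" for a b c
  proof -
    have "(a, c) \<in> (cover Y)\<^sup>+" using that(1) block_order_trancl_cover[OF Y] by simp
    then show ?thesis using that(2,3)
    proof (induction arbitrary: b rule: trancl_induct)
      case (base y)
      then show ?case using cov by (auto simp: cover_def)
    next
      case (step y z)
      have yzc: "(y, z) \<in> cover Z" using step.hyps cov by blast
      have "(a, y) \<in> Y" using step.hyps(1) block_order_trancl_cover[OF Y] by simp
      have "b = y \<or> (b, y) \<in> Z \<or> (y, b) \<in> Z"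
        using block_orderD(7)[OF Z, of b z y] step.prems yzc cover_subset
        by (auto simp: comparability_iff)
      moreover have "(y, b) \<notin> Z" using yzc step.prems by (auto simp: cover_def)
      ultimately show ?case using step \<open>(a, y) \<in> Y\<close> by blast
    qed
  qed
  have "trans (Z - Y)"
    using split block_orderD(5)[OF Z] by (intro transI) blast
  then show ?thesis using Y Z YZ by (simp add: suborder_def)
qed

lemma suborder_map_prod:
  assumes "suborder n Y Z" "p permutes {1..n}"
  shows "suborder n (map_prod p p ` Y) (map_prod p p ` Z)"
proof -
  have inj: "inj p" using assms(2) by (rule permutes_inj)
  then have "map_prod p p ` (Z - Y) = map_prod p p ` Z - map_prod p p ` Y"
    by (intro image_set_diff) (simp add: prod.inj_map)
  then show ?thesis
    using assms trans_map_prod[OF inj suborderD(4)[OF assms(1)]]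
    by (auto simp: suborder_def intro: block_order_map_prod)
qed

text \<open>The root system fact that a parabolic subgroup permutes the positive roots outside its
  own subsystem; here because the elements of an interval are interchangeable when compared with
  elements outside it.\<close>

lemma suborder_perm_diff:
  assumes Y: "suborder n Y Z" and z: "z \<in> block_perms n (comparability Y)"
  shows "map_prod z z ` (Z - Y) = Z - Y"
proof -
  have *: "(p a, p b) \<in> Z - Y" if "(a, b) \<in> Z - Y" "p \<in> block_perms n (comparability Y)" for p a b
  proof -
    have "p a = a \<or> (p a, a) \<in> comparability Y" "p b = b \<or> (b, p b) \<in> comparability Y"
      using block_permsD[OF that(2), of a] block_permsD[OF that(2), of b] comparability_sym[of a "p a" Y]
      by auto
    then have "(p a, b) \<in> Z - Y" "p b = b \<or> (b, p b) \<in> comparability Y"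
      using that(1) suborder_mix(1)[OF Y, of "p a" a b] by auto
    then show ?thesis using suborder_mix(2)[OF Y, of "p a" b "p b"] by auto
  qed
  have zp: "z permutes {1..n}" using z by (simp add: block_perms_def)
  have "(a, b) \<in> map_prod z z ` (Z - Y)" if "(a, b) \<in> Z - Y" for a b
  proof -
    have "map_prod z z (inv' z a, inv' z b) \<in> map_prod z z ` (Z - Y)"
      using *[OF that block_perms_inv[OF z]] by (rule imageI)
    then show ?thesis using permutes_inverses(1)[OF zp] by simp
  qed
  then show ?thesis using *[OF _ z] by auto
qed

text \<open>If \<open>u\<close> reverses a covering pair of \<open>Y\<close>, composing with the
  transposition of this pair shortens it. If \<open>u\<close> is increasing on the blocks of
  \<open>Y\<close>, all its inversions lie in \<open>Z - Y\<close>; this set is permuted by the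
  subgroup of \<open>Y\<close>, so no inversion is lost in \<open>u \<circ> z\<close>.\<close>

lemma coset_minimal_transps:
  assumes Y: "suborder n Y Z"
  shows "coset_minimal (sym_group n) (transps (cover Z)) (transps (cover Y)) u \<longleftrightarrow>
    u \<in> block_perms n (comparability Z) \<and> map_prod u u ` Y \<subseteq> Z"
proof -
  note oY = suborderD(1)[OF Y] and oZ = suborderD(2)[OF Y]
  have sub: "block_perms n (comparability Y) \<subseteq> block_perms n (comparability Z)"
    using suborderD(5)[OF Y] by (auto simp: block_perms_def)
  have min: "coset_minimal (sym_group n) (transps (cover Z)) (transps (cover Y)) u \<longleftrightarrow>
      u \<in> block_perms n (comparability Z) \<and> (\<forall>z\<in>block_perms n (comparability Y).
        card (inversions Z Z u) \<le> card (inversions Z Z (u \<circ> z)))"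
    unfolding coset_minimal_def generate_transps[OF oY] generate_transps[OF oZ]
    using sub block_perms_comp[OF oZ] word_length_inversions[OF oZ]
    by (auto simp: sym_group_simps subset_iff)
  show ?thesis unfolding min
  proof (intro iffI conjI; (elim conjE)?)
    assume u: "u \<in> block_perms n (comparability Z)"
      and le: "\<forall>z\<in>block_perms n (comparability Y). card (inversions Z Z u) \<le> card (inversions Z Z (u \<circ> z))"
    have cov: "(u a, u b) \<in> Z" if ab: "(a, b) \<in> cover Y" for a b
    proof (rule ccontr)
      assume n: "(u a, u b) \<notin> Z"
      have abZ: "(a, b) \<in> cover Z" using ab suborder_cover[OF Y] by blast
      have "(u a, u b) \<in> comparability Z"
        using block_perms_comparability[OF oZ u] abZ cover_subset by (fastforce simp: comparability_iff)
      then have "(u b, u a) \<in> Z" using n by (simp add: comparability_iff)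
      then have "card (inversions Z Z (u \<circ> Transposition.transpose a b)) < card (inversions Z Z u)"
        using card_inversions_transpose[OF oZ abZ _ n] by simp
      moreover have "Transposition.transpose a b \<in> block_perms n (comparability Y)"
        using transpose_block_perms[OF oY] ab cover_subset by blast
      ultimately show False using le by (meson leD)
    qed
    have "(u a, u b) \<in> Z" if "(a, b) \<in> (cover Y)\<^sup>+" for a b
      using that by (induction rule: trancl_induct) (auto intro: cov block_orderD(5)[OF oZ])
    then show "map_prod u u ` Y \<subseteq> Z" using block_order_trancl_cover[OF oY] by auto
  next
    assume u: "u \<in> block_perms n (comparability Z)" and uY: "map_prod u u ` Y \<subseteq> Z"
    show "\<forall>z\<in>block_perms n (comparability Y). card (inversions Z Z u) \<le> card (inversions Z Z (u \<circ> z))"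
    proof
      fix z assume z: "z \<in> block_perms n (comparability Y)"
      have zp: "z permutes {1..n}" using z by (simp add: block_perms_def)
      have "map_prod (inv' z) (inv' z) ` inversions Z Z u \<subseteq> inversions Z Z (u \<circ> z)"
      proof clarsimp
        fix a b assume ab: "(a, b) \<in> inversions Z Z u"
        then have "(a, b) \<in> Z - Y" using uY block_orderD(6)[OF oZ] by (force simp: inversions_def)
        then have "(inv' z a, inv' z b) \<in> Z - Y"
          using suborder_perm_diff[OF Y block_perms_inv[OF z]] by (metis image_eqI map_prod_simp)
        then show "(inv' z a, inv' z b) \<in> inversions Z Z (u \<circ> z)"
          using ab permutes_inverses(1)[OF zp] by (simp add: inversions_def)
      qed
      moreover have "inj (map_prod (inv' z) (inv' z))"
        using permutes_inj[OF permutes_inv[OF zp]] by (simp add: prod.inj_map)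
      ultimately show "card (inversions Z Z u) \<le> card (inversions Z Z (u \<circ> z))"
        using card_inj_on_le finite_inversions[OF block_orderD(2)[OF oZ]] inj_on_subset
        by (metis subset_UNIV)
    qed
  qed
qed

section \<open>The standard order and linear extensions\<close>

definition natural_order :: "nat \<Rightarrow> (nat \<times> nat) set" where
  "natural_order n = {(a, b). a \<in> {1..n} \<and> b \<in> {1..n} \<and> a < b}"

lemma block_order_natural: "block_order n (natural_order n)"
  by (auto simp: block_order_def natural_order_def irrefl_def trans_def comparability_def)

lemma comparability_natural:
  "comparability (natural_order n) = {(a, b). a \<in> {1..n} \<and> b \<in> {1..n} \<and> a \<noteq> b}"
  by (auto simp: comparability_def natural_order_def)

lemma cover_natural: "cover (natural_order n) = (\<lambda>i. (i, Suc i)) ` {1..<n}"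
proof -
  have "(a, b) \<in> (\<lambda>i. (i, Suc i)) ` {1..<n}" if "(a, b) \<in> cover (natural_order n)" for a b
  proof -
    have "a < b" "1 \<le> a" "b \<le> n" using that by (auto simp: cover_def natural_order_def)
    have "\<not> Suc a < b" 
    proof
      assume "Suc a < b"
      then have "(a, Suc a) \<in> natural_order n" "(Suc a, b) \<in> natural_order n"
        using \<open>1 \<le> a\<close> \<open>b \<le> n\<close> by (auto simp: natural_order_def)
      then show False using that by (auto simp: cover_def)
    qed
    then show ?thesis using \<open>a < b\<close> \<open>1 \<le> a\<close> \<open>b \<le> n\<close> by (intro image_eqI[of _ _ a]) auto
  qed
  then show ?thesis by (auto simp: cover_def natural_order_def)
qed

lemma block_perms_natural: "block_perms n (comparability (natural_order n)) = {p. p permutes {1..n}}"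
proof -
  have "p a = a \<or> (a, p a) \<in> comparability (natural_order n)" if "p permutes {1..n}" for p a
    using permutes_in_image[OF that, of a] permutes_not_in[OF that, of a]
    unfolding comparability_natural by (cases "a \<in> {1..n}") auto
  then show ?thesis by (auto simp: block_perms_def)
qed

text \<open>The blocks are laid out one after another in the order of their least elements, which
  makes each block an interval of a total order. One permutation thus brings a whole block order
  into standard position.\<close>

lemma linear_extension:
  assumes Z: "block_order n Z"
  obtains p where "p permutes {1..n}" "suborder n Z (map_prod p p ` natural_order n)"
proof -
  define r where "r a = Min {b. b = a \<or> (a, b) \<in> comparability Z}" for a
  have r: "r a = r b" if "(a, b) \<in> comparability Z" for a b
  proof -
    have "{c. c = a \<or> (a, c) \<in> comparability Z} = {c. c = b \<or> (b, c) \<in> comparability Z}"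
      using that comparability_sym[OF that] block_orderD(7)[OF Z that]
        block_orderD(7)[OF Z comparability_sym[OF that]] by auto
    then show ?thesis by (simp add: r_def)
  qed
  have r': "a = b \<or> (a, b) \<in> comparability Z" if "r a = r b" for a b
  proof -
    have fin: "finite {b. b = a \<or> (a, b) \<in> comparability Z}" for a
      by (rule finite_subset[of _ "insert a {1..n}"]) (use block_orderD(10)[OF Z] in auto)
    have "r a \<in> {b. b = a \<or> (a, b) \<in> comparability Z}" for a
      unfolding r_def by (rule Min_in[OF fin]) blast
    then have "r a = a \<or> (a, r a) \<in> comparability Z" "r a = b \<or> (b, r a) \<in> comparability Z"
      using that by (metis (mono_tags, lifting) mem_Collect_eq)+
    then show ?thesis
      using block_orderD(7)[OF Z, of a "r a" b] comparability_sym[of b "r a" Z] by auto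
  qed
  define T where "T = Z \<union> {(a, b). a \<in> {1..n} \<and> b \<in> {1..n} \<and> r a < r b}"
  have T_Z: "T - Z = {(a, b). a \<in> {1..n} \<and> b \<in> {1..n} \<and> r a < r b}"
  proof -
    have "\<not> r a < r b" if "(a, b) \<in> Z" for a b using r[of a b] that by (simp add: comparability_iff)
    then show ?thesis by (auto simp: T_def)
  qed
  have T: "block_order n T"
    unfolding block_order_def
  proof (intro conjI allI impI)
    show "T \<subseteq> {1..n} \<times> {1..n}" using block_orderD(1)[OF Z] by (auto simp: T_def)
    show "irrefl T" using block_orderD(3)[OF Z] by (auto simp: T_def irrefl_def)
    have "(a, c) \<in> T" if "(a, b) \<in> T" "(b, c) \<in> T" for a b c
      using that r[of a b] r[of b c] block_orderD(5)[OF Z, of a b c] block_orderD(1)[OF Z]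
      by (auto simp: T_def comparability_iff)
    then show "trans T" by (rule transI)
    fix a b c assume "(a, b) \<in> comparability T" "(b, c) \<in> comparability T"
    then have "a \<in> {1..n}" "c \<in> {1..n}" using block_orderD(1)[OF Z]
      by (auto simp: T_def comparability_iff)
    then show "a = c \<or> (a, c) \<in> comparability T"
      using r'[of a c] by (cases "r a = r c") (auto simp: T_def comparability_iff neq_iff)
  qed
  have "comparability T = comparability (natural_order n)"
  proof -
    have "(a, b) \<in> comparability T" if "a \<in> {1..n}" "b \<in> {1..n}" "a \<noteq> b" for a b
      using that r'[of a b] by (cases "r a = r b") (auto simp: T_def comparability_iff neq_iff)
    then have "comparability (natural_order n) \<subseteq> comparability T"
      unfolding comparability_natural by auto
    moreover have "comparability T \<subseteq> comparability (natural_order n)"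
    proof (rule subrelI)
      fix a b assume ab: "(a, b) \<in> comparability T"
      then have "a \<noteq> b" using block_orderD(8)[OF T] by auto
      then show "(a, b) \<in> comparability (natural_order n)"
        using block_orderD(9,10)[OF T ab] by (simp add: comparability_natural)
    qed
    ultimately show ?thesis by blast
  qed
  then obtain p where p: "p \<in> block_perms n (comparability (natural_order n))"
    "map_prod p p ` natural_order n = T"
    using ex_block_perm[OF block_order_natural T] by blast
  have "trans (T - Z)" unfolding T_Z by (auto intro: transI)
  then have "suborder n Z T" using Z T by (auto simp: suborder_def T_def)
  then show ?thesis using that p by (simp add: block_perms_natural)
qed

section \<open>Permutohedra of block orders\<close>

lemma lookup_scaleR [simp]: "Poly_Mapping.lookup (r *\<^sub>R x) i = r *\<^sub>R Poly_Mapping.lookup x i"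
proof -
  have "finite {i. r *\<^sub>R Poly_Mapping.lookup x i \<noteq> 0}"
    by (rule finite_subset[OF _ finite_keys[of x]]) (auto simp: in_keys_iff)
  then show ?thesis by (simp add: scaleR_poly_mapping_def)
qed

lemma norm_lookup_le:
  fixes x :: "'a \<Rightarrow>\<^sub>0 'b::real_normed_vector"
  shows "norm (Poly_Mapping.lookup x i) \<le> norm x"
proof (cases "i \<in> Poly_Mapping.keys x")
  case True
  have "norm x = (\<Sum>j\<in>Poly_Mapping.keys x. norm (Poly_Mapping.lookup x j))"
    by (simp add: norm_poly_mapping_def dist_poly_mapping_def)
  moreover have "norm (Poly_Mapping.lookup x i) \<le> (\<Sum>j\<in>Poly_Mapping.keys x. norm (Poly_Mapping.lookup x j))"
    using True by (intro member_le_sum) auto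
  ultimately show ?thesis by simp
qed (simp add: in_keys_iff)

text \<open>The norm is the sum of the norms of the coordinates, so a coordinate is continuous
  although the space is infinite-dimensional.\<close>

lemma bounded_linear_lookup:
  "bounded_linear (\<lambda>x :: 'a \<Rightarrow>\<^sub>0 'b::real_normed_vector. Poly_Mapping.lookup x i)"
  by (rule bounded_linear_intro[of _ 1]) (simp_all add: lookup_add norm_lookup_le)

lemmas continuous_on_lookup [continuous_intros] =
  bounded_linear.continuous_on[OF bounded_linear_lookup]

section \<open>Roots, masses and cut functions\<close>

definition dvec :: "nat \<Rightarrow> nat \<Rightarrow> nat geom" where
  "dvec i j = Poly_Mapping.single i 1 - Poly_Mapping.single j 1"

text \<open>For a block order this is the sum of its positive roots, twice the Weyl vector. It is
  the base point of the polytope in scaled coordinates, see \<open>cvec_base_pt\<close> and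
  \<open>scaled_perm_base\<close>.\<close>

definition osum :: "(nat \<times> nat) set \<Rightarrow> nat geom" where
  "osum D = (\<Sum>(i, j)\<in>D. dvec i j)"

definition mass :: "nat geom \<Rightarrow> nat set \<Rightarrow> real" where
  "mass x A = (\<Sum>a\<in>A. Poly_Mapping.lookup x a)"

text \<open>The permutohedron is the Minkowski sum of the segments from \<open>- dvec i j\<close> to
  \<open>dvec i j\<close> over the pairs of \<open>Z\<close>. This cut function is its support
  function, evaluated at the indicator of \<open>A\<close>.\<close>

definition crossings :: "(nat \<times> nat) set \<Rightarrow> nat set \<Rightarrow> real" where
  "crossings Z A = (\<Sum>(i, j)\<in>Z. of_bool ((i \<in> A) \<noteq> (j \<in> A)))"

text \<open>The convex hull of the vectors \<open>osum T\<close>, where \<open>T\<close> runs through the block orders with the same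
  blocks as \<open>Z\<close>, in its description by inequalities; \<open>zono_int\<close> is its relative interior.\<close>

definition zono :: "nat \<Rightarrow> (nat \<times> nat) set \<Rightarrow> nat geom set" where
  "zono n Z = {x. Poly_Mapping.keys x \<subseteq> {1..n} \<and> mass x {1..n} = 0 \<and>
     (\<forall>A\<subseteq>{1..n}. mass x A \<le> crossings Z A)}"

definition zono_int :: "nat \<Rightarrow> (nat \<times> nat) set \<Rightarrow> nat geom set" where
  "zono_int n Z = {x \<in> zono n Z. \<forall>A\<subseteq>{1..n}. 0 < crossings Z A \<longrightarrow> mass x A < crossings Z A}"

lemma lookup_dvec: "Poly_Mapping.lookup (dvec i j) c = of_bool (i = c) - of_bool (j = c)"
  by (simp add: dvec_def lookup_minus lookup_single when_def)

lemma keys_dvec: "Poly_Mapping.keys (dvec i j) \<subseteq> {i, j}"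
  by (auto simp: in_keys_iff lookup_dvec of_bool_def split: if_splits)

lemma mass_add: "mass (x + y) A = mass x A + mass y A"
  and mass_diff: "mass (x - y) A = mass x A - mass y A"
  and mass_scaleR: "mass (r *\<^sub>R x) A = r * mass x A"
  and mass_zero [simp]: "mass 0 A = 0"
  by (simp_all add: mass_def lookup_add lookup_minus sum.distrib sum_subtractf sum_distrib_left)

lemma mass_Un_Int:
  assumes "finite A" "finite B" shows "mass x (A \<union> B) + mass x (A \<inter> B) = mass x A + mass x B"
  unfolding mass_def by (rule sum.union_inter[OF assms])

lemma mass_dvec: "finite A \<Longrightarrow> mass (dvec i j) A = of_bool (i \<in> A) - of_bool (j \<in> A)"
proof -
  assume "finite A"
  then have "(\<Sum>a\<in>A. of_bool (i = a)) = (of_bool (i \<in> A) :: real)" for i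
    using sum.delta'[of A i "\<lambda>_. 1::real"] by (simp add: of_bool_def)
  then show ?thesis by (simp add: mass_def lookup_dvec sum_subtractf)
qed

lemma mass_sum: "mass (sum f I) A = (\<Sum>i\<in>I. mass (f i) A)"
  unfolding mass_def lookup_sum by (rule sum.swap)

lemma mass_osum:
  "finite A \<Longrightarrow> mass (osum D) A = (\<Sum>(i, j)\<in>D. of_bool (i \<in> A) - of_bool (j \<in> A))"
  unfolding osum_def mass_sum by (rule sum.cong) (auto simp: mass_dvec)

lemma mass_osum_le_crossings: "finite A \<Longrightarrow> mass (osum D) A \<le> crossings D A"
  unfolding mass_osum crossings_def by (rule sum_mono) auto

lemma crossings_nonneg: "0 \<le> crossings Z A"
  unfolding crossings_def by (rule sum_nonneg) auto

lemma crossings_pos_iff: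
  assumes "finite Z" shows "0 < crossings Z A \<longleftrightarrow> (\<exists>(i, j)\<in>Z. (i \<in> A) \<noteq> (j \<in> A))"
proof -
  have "crossings Z A = 0 \<longleftrightarrow> (\<forall>p\<in>Z. (case p of (i, j) \<Rightarrow> of_bool ((i \<in> A) \<noteq> (j \<in> A))) = (0::real))"
    unfolding crossings_def using assms by (intro sum_nonneg_eq_0_iff) auto
  then show ?thesis using crossings_nonneg[of Z A] by fastforce
qed

lemma crossings_zero: "(\<And>i j. (i, j) \<in> Z \<Longrightarrow> i \<in> A \<longleftrightarrow> j \<in> A) \<Longrightarrow> crossings Z A = 0"
  unfolding crossings_def by (rule sum.neutral) auto

lemma crossings_zeroD: "finite Z \<Longrightarrow> crossings Z A = 0 \<Longrightarrow> (i, j) \<in> Z \<Longrightarrow> i \<in> A \<longleftrightarrow> j \<in> A"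
  using crossings_pos_iff[of Z A] by fastforce

lemma crossings_Un: "finite Y \<Longrightarrow> finite D \<Longrightarrow> Y \<inter> D = {} \<Longrightarrow> crossings (Y \<union> D) A = crossings Y A + crossings D A"
  unfolding crossings_def by (rule sum.union_disjoint)

lemma osum_Un: "finite Y \<Longrightarrow> finite D \<Longrightarrow> Y \<inter> D = {} \<Longrightarrow> osum (Y \<union> D) = osum Y + osum D"
  unfolding osum_def by (rule sum.union_disjoint)

text \<open>Each separated pair can be counted once, in the orientation that leaves
  \<open>A\<close>; such a count does not see the order within the blocks.\<close>

lemma crossings_comparability:
  assumes "block_order n Z" "block_order n T" "comparability T = comparability Z"
  shows "crossings T A = crossings Z A"
proof -
  have "crossings Z A = (\<Sum>(i, j)\<in>comparability Z. of_bool (i \<in> A \<and> j \<notin> A))" if "block_order n Z" for Z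
  proof -
    have fin: "finite Z" using that by (rule block_orderD)
    have disj: "Z \<inter> Z\<inverse> = {}" using block_orderD(6)[OF that] by auto
    have "(\<Sum>(i, j)\<in>Z\<inverse>. of_bool (i \<in> A \<and> j \<notin> A)) = (\<Sum>(i, j)\<in>Z. of_bool (j \<in> A \<and> i \<notin> A) :: real)"
      by (rule sum.reindex_bij_witness[of _ prod.swap prod.swap]) auto
    then have "(\<Sum>(i, j)\<in>comparability Z. of_bool (i \<in> A \<and> j \<notin> A)) =
        (\<Sum>(i, j)\<in>Z. of_bool (i \<in> A \<and> j \<notin> A)) + (\<Sum>(i, j)\<in>Z. of_bool (j \<in> A \<and> i \<notin> A) :: real)"
      unfolding comparability_def using fin disj by (subst sum.union_disjoint) auto
    also have "\<dots> = crossings Z A"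
      unfolding crossings_def sum.distrib[symmetric] by (rule sum.cong) auto
    finally show ?thesis by simp
  qed
  from this[OF assms(1)] this[OF assms(2)] show ?thesis using assms(3) by simp
qed

lemma keys_osum:
  assumes "D \<subseteq> {1..n} \<times> {1..n}" shows "Poly_Mapping.keys (osum D) \<subseteq> {1..n}"
proof
  fix c assume c: "c \<in> Poly_Mapping.keys (osum D)"
  show "c \<in> {1..n}"
  proof (rule ccontr)
    assume "c \<notin> {1..n}"
    then have "Poly_Mapping.lookup (osum D) c = 0"
      unfolding osum_def lookup_sum using assms by (intro sum.neutral) (auto simp: lookup_dvec)
    then show False using c by (simp add: in_keys_iff)
  qed
qed

lemma mass_osum_total:
  assumes "D \<subseteq> {1..n} \<times> {1..n}" shows "mass (osum D) {1..n} = 0"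
proof -
  have "mass (osum D) {1..n} = (\<Sum>(i, j)\<in>D. 0)"
    unfolding mass_osum[OF finite_atLeastAtMost] using assms by (intro sum.cong) auto
  then show ?thesis by (simp add: case_prod_unfold)
qed

lemma keys_add_subset: "Poly_Mapping.keys x \<subseteq> B \<Longrightarrow> Poly_Mapping.keys y \<subseteq> B \<Longrightarrow> Poly_Mapping.keys (x + y) \<subseteq> B"
  and keys_diff_subset: "Poly_Mapping.keys x \<subseteq> B \<Longrightarrow> Poly_Mapping.keys y \<subseteq> B \<Longrightarrow> Poly_Mapping.keys (x - y) \<subseteq> B"
  and keys_scaleR_subset: "Poly_Mapping.keys x \<subseteq> B \<Longrightarrow> Poly_Mapping.keys (r *\<^sub>R x) \<subseteq> B"
  for x y :: "nat geom"
  unfolding subset_iff in_keys_iff lookup_add lookup_minus lookup_scaleR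
  by (metis add_0, metis diff_self, simp)

lemma convex_zono: "convex (zono n Z)"
proof (rule convexI)
  fix x y and u v :: real
  assume xy: "x \<in> zono n Z" "y \<in> zono n Z" and uv: "0 \<le> u" "0 \<le> v" "u + v = 1"
  have "mass (u *\<^sub>R x + v *\<^sub>R y) A \<le> crossings Z A" if A: "A \<subseteq> {1..n}" for A
  proof -
    have "u * mass x A + v * mass y A \<le> u * crossings Z A + v * crossings Z A"
      using xy uv A by (intro add_mono mult_left_mono) (auto simp: zono_def)
    also have "\<dots> = crossings Z A" using uv by (metis distrib_right mult_1)
    finally show ?thesis by (simp add: mass_add mass_scaleR)
  qed
  then show "u *\<^sub>R x + v *\<^sub>R y \<in> zono n Z"
    using xy by (auto simp: zono_def mass_add mass_scaleR intro!: keys_add_subset keys_scaleR_subset del: subsetI)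
qed

text \<open>By \<open>ex_block_perm\<close> and \<open>block_perm_rigid\<close> these correspond to
  the elements of the Young subgroup of the blocks.\<close>

definition orders :: "nat \<Rightarrow> (nat \<times> nat) set \<Rightarrow> (nat \<times> nat) set set" where
  "orders n Z = {T. block_order n T \<and> comparability T = comparability Z}"

lemma osum_zono: "block_order n Z \<Longrightarrow> T \<in> orders n Z \<Longrightarrow> osum T \<in> zono n Z"
proof -
  assume Z: "block_order n Z" and "T \<in> orders n Z"
  then have T: "block_order n T" "comparability T = comparability Z" by (simp_all add: orders_def)
  have "mass (osum T) A \<le> crossings Z A" if "A \<subseteq> {1..n}" for A
    using mass_osum_le_crossings[of A T] crossings_comparability[OF Z T] finite_subset[OF that] by simp
  then show ?thesis
    using keys_osum[OF block_orderD(1)[OF T(1)]] mass_osum_total[OF block_orderD(1)[OF T(1)]]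
    by (simp add: zono_def)
qed

text \<open>A block permutation of \<open>Y\<close> realizes the new order on the blocks of
  \<open>Y\<close> and preserves \<open>T - Y\<close>, so it transports the whole
  configuration.\<close>

lemma suborder_replace:
  assumes Y: "suborder n Y T" and Y': "Y' \<in> orders n Y"
  shows "suborder n Y' ((T - Y) \<union> Y')" "(T - Y) \<union> Y' \<in> orders n T" "(T - Y) \<inter> Y' = {}"
proof -
  obtain u where u: "u \<in> block_perms n (comparability Y)" "map_prod u u ` Y = Y'"
    using ex_block_perm[OF suborderD(1)[OF Y], of Y'] Y' by (auto simp: orders_def)
  have uT: "u \<in> block_perms n (comparability T)"
    using u(1) suborderD(5)[OF Y] by (auto simp: block_perms_def)
  have "T = (T - Y) \<union> Y" using suborderD(3)[OF Y] by blast
  then have img: "map_prod u u ` T = (T - Y) \<union> Y'"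
    using suborder_perm_diff[OF Y u(1)] u(2) by (metis image_Un)
  show "suborder n Y' ((T - Y) \<union> Y')"
    using suborder_map_prod[OF Y block_perms_permutes[OF u(1)]] by (simp add: img u(2))
  show "(T - Y) \<union> Y' \<in> orders n T"
    using block_perms_map_prod[OF suborderD(2)[OF Y] uT] by (simp add: img orders_def)
  show "(T - Y) \<inter> Y' = {}"
  proof -
    have "(a, b) \<notin> comparability Y" if "(a, b) \<in> T - Y" for a b
      using that suborderD(3)[OF Y] block_orderD(6)[OF suborderD(2)[OF Y]]
      by (auto simp: comparability_iff)
    then show ?thesis using Y' by (auto simp: orders_def comparability_def)
  qed
qed

text \<open>A pair of \<open>T - Y\<close> adds 1 to the cut if \<open>A\<close> separates it, but
  contributes to the mass of \<open>osum (T - Y)\<close> with the sign of its direction. The two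
  differ, by 2, only for pairs that lead from outside into \<open>A\<close>. Passing to a face
  therefore never increases a slack, and keeps it for sets closed under predecessors.\<close>

lemma slack_diff:
  assumes Y: "suborder n Y T" and A: "finite A"
  shows "crossings T A - mass x A = crossings Y A - mass (x - osum (T - Y)) A +
    2 * (\<Sum>(a, b)\<in>T - Y. of_bool (a \<notin> A \<and> b \<in> A))"
proof -
  have fin: "finite T" "finite Y" using block_orderD(2) suborderD(1,2)[OF Y] by blast+
  have "crossings T A = crossings (Y \<union> (T - Y)) A" using suborderD(3)[OF Y] by (simp add: Un_absorb1)
  also have "\<dots> = crossings Y A + crossings (T - Y) A" using fin by (intro crossings_Un) auto
  finally have "crossings T A = crossings Y A + crossings (T - Y) A" .
  moreover have "crossings (T - Y) A = mass (osum (T - Y)) A +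
      2 * (\<Sum>(a, b)\<in>T - Y. of_bool (a \<notin> A \<and> b \<in> A))"
    unfolding crossings_def mass_osum[OF A] sum_distrib_left sum.distrib[symmetric]
    by (rule sum.cong) auto
  ultimately show ?thesis by (simp add: mass_diff)
qed

lemma slack_le:
  assumes Y: "suborder n Y T" and A: "finite A"
  shows "crossings Y A - mass (x - osum (T - Y)) A \<le> crossings T A - mass x A"
proof -
  have "0 \<le> (\<Sum>(a, b)\<in>T - Y. of_bool (a \<notin> A \<and> b \<in> A) :: real)" by (rule sum_nonneg) auto
  then show ?thesis using slack_diff[OF Y A, of x] by simp
qed

lemma slack_eq:
  assumes Y: "suborder n Y T" and A: "finite A"
    and up: "\<And>a b. (a, b) \<in> T - Y \<Longrightarrow> b \<in> A \<Longrightarrow> a \<in> A"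
  shows "crossings T A - mass x A = crossings Y A - mass (x - osum (T - Y)) A"
proof -
  have "(\<Sum>(a, b)\<in>T - Y. of_bool (a \<notin> A \<and> b \<in> A) :: real) = 0" using up by (intro sum.neutral) auto
  then show ?thesis using slack_diff[OF Y A, of x] by simp
qed

lemma zono_face:
  assumes Y: "suborder n Y T" and x: "x - osum (T - Y) \<in> zono n Y"
  shows "x \<in> zono n T"
proof -
  have D: "T - Y \<subseteq> {1..n} \<times> {1..n}" using block_orderD(1)[OF suborderD(2)[OF Y]] by auto
  have "mass x A \<le> crossings T A" if A: "A \<subseteq> {1..n}" for A
  proof -
    have "mass (x - osum (T - Y)) A \<le> crossings Y A" using x A unfolding zono_def by blast
    then show ?thesis using slack_le[OF Y finite_subset[OF A], of x] by simp
  qed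
  moreover have "mass x {1..n} = 0"
    using x mass_osum_total[OF D] by (simp add: zono_def mass_diff)
  moreover have "Poly_Mapping.keys ((x - osum (T - Y)) + osum (T - Y)) \<subseteq> {1..n}"
    using x keys_osum[OF D] by (intro keys_add_subset) (simp_all add: zono_def)
  ultimately show ?thesis by (simp add: zono_def)
qed

text \<open>A set \<open>A\<close> at which \<open>x\<close> is tight splits every block \<open>B\<close> into \<open>B \<inter> A\<close> followed by \<open>B - A\<close>, and
  thereby exhibits a proper face containing \<open>x\<close>.\<close>

definition low_part :: "(nat \<times> nat) set \<Rightarrow> nat set \<Rightarrow> (nat \<times> nat) set" where
  "low_part Z A = {(i, j) \<in> Z. i \<in> A \<longleftrightarrow> j \<in> A}"

definition cross_part :: "(nat \<times> nat) set \<Rightarrow> nat set \<Rightarrow> (nat \<times> nat) set" where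
  "cross_part Z A = {(i, j) \<in> comparability Z. i \<in> A \<and> j \<notin> A}"

lemma suborder_split:
  assumes Z: "block_order n Z"
  shows "suborder n (low_part Z A) (low_part Z A \<union> cross_part Z A)"
    "comparability (low_part Z A \<union> cross_part Z A) = comparability Z"
    "(low_part Z A \<union> cross_part Z A) - low_part Z A = cross_part Z A"
proof -
  let ?Y = "low_part Z A" and ?D = "cross_part Z A"
  have cY: "(a, b) \<in> comparability ?Y \<longleftrightarrow> (a, b) \<in> comparability Z \<and> (a \<in> A \<longleftrightarrow> b \<in> A)" for a b
    by (auto simp: comparability_iff low_part_def)
  have D: "(a, b) \<in> ?D \<longleftrightarrow> (a, b) \<in> comparability Z \<and> a \<in> A \<and> b \<notin> A" for a b
    by (auto simp: cross_part_def)
  show comp: "comparability (?Y \<union> ?D) = comparability Z"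
  proof (intro equalityI subrelI)
    fix a b show "(a, b) \<in> comparability Z" if "(a, b) \<in> comparability (?Y \<union> ?D)"
      using that comparability_sym[of b a Z] cY D by (auto simp: comparability_iff low_part_def cross_part_def)
    show "(a, b) \<in> comparability (?Y \<union> ?D)" if "(a, b) \<in> comparability Z"
      using that comparability_sym[OF that] cY[of a b] D[of a b] D[of b a]
      by (cases "a \<in> A \<longleftrightarrow> b \<in> A") (auto simp: comparability_Un comparability_iff[of _ _ ?D])
  qed
  show diff: "(?Y \<union> ?D) - ?Y = ?D" by (auto simp: low_part_def cross_part_def)
  have Y: "block_order n ?Y"
    unfolding block_order_def
  proof (intro conjI allI impI)
    show "?Y \<subseteq> {1..n} \<times> {1..n}" using block_orderD(1)[OF Z] by (auto simp: low_part_def)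
    show "irrefl ?Y" using block_orderD(3)[OF Z] by (auto simp: low_part_def irrefl_def)
    show "trans ?Y"
    proof (rule transI)
      fix a b c assume "(a, b) \<in> ?Y" "(b, c) \<in> ?Y"
      then show "(a, c) \<in> ?Y" using block_orderD(5)[OF Z, of a b c] by (auto simp: low_part_def)
    qed
    fix a b c assume "(a, b) \<in> comparability ?Y" "(b, c) \<in> comparability ?Y"
    then show "a = c \<or> (a, c) \<in> comparability ?Y" using block_orderD(7)[OF Z, of a b c] cY by auto
  qed
  have T: "block_order n (?Y \<union> ?D)"
    unfolding block_order_def comp
  proof (intro conjI allI impI)
    show "?Y \<union> ?D \<subseteq> {1..n} \<times> {1..n}"
    proof (rule subrelI)
      fix a b assume "(a, b) \<in> ?Y \<union> ?D"
      then have "(a, b) \<in> comparability Z" by (auto simp: low_part_def cross_part_def comparability_iff)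
      then show "(a, b) \<in> {1..n} \<times> {1..n}" using block_orderD(9,10)[OF Z] by blast
    qed
    show "irrefl (?Y \<union> ?D)"
      using block_orderD(3)[OF Z] by (auto simp: low_part_def cross_part_def irrefl_def)
    show "trans (?Y \<union> ?D)"
    proof (rule transI)
      fix a b c assume ab: "(a, b) \<in> ?Y \<union> ?D" and bc: "(b, c) \<in> ?Y \<union> ?D"
      have "(a, b) \<in> comparability Z" "(b, c) \<in> comparability Z"
        using ab bc by (auto simp: low_part_def cross_part_def comparability_iff)
      then have "a = c \<or> (a, c) \<in> comparability Z" by (rule block_orderD(7)[OF Z])
      then show "(a, c) \<in> ?Y \<union> ?D"
        using ab bc block_orderD(5)[OF Z, of a b c] block_orderD(6)[OF Z, of a b]
        by (auto simp: low_part_def cross_part_def)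
    qed
    fix a b c assume "(a, b) \<in> comparability Z" "(b, c) \<in> comparability Z"
    then show "a = c \<or> (a, c) \<in> comparability Z" by (rule block_orderD(7)[OF Z])
  qed
  have "trans ?D" by (auto simp: cross_part_def intro: transI)
  then show "suborder n ?Y (?Y \<union> ?D)" using Y T diff by (auto simp: suborder_def)
qed

text \<open>Uncrossing: tightness at \<open>A\<close> turns the bounds at
  \<open>C \<union> A\<close> and \<open>C \<inter> A\<close> into one bound at \<open>C\<close>,
  which is then evaluated pair by pair.\<close>

lemma zono_tight:
  assumes Z: "block_order n Z" and A: "A \<subseteq> {1..n}" and x: "x \<in> zono n Z" and tight: "mass x A = crossings Z A"
  shows "x - osum (cross_part Z A) \<in> zono n (low_part Z A)"
proof -
  let ?Y = "low_part Z A" and ?D = "cross_part Z A"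
  note S = suborder_split[OF Z, of A]
  have T: "block_order n (?Y \<union> ?D)" using S(1) by (rule suborderD)
  have D: "?D \<subseteq> {1..n} \<times> {1..n}" using block_orderD(1)[OF T] by auto
  have fin: "finite ?Y" "finite ?D" "?Y \<inter> ?D = {}"
    using block_orderD(2)[OF T] S(3) by auto
  have cutZ: "crossings Z C = crossings ?Y C + crossings ?D C" for C
    using crossings_comparability[OF Z T S(2)] crossings_Un[OF fin] by simp
  have "mass (x - osum ?D) C \<le> crossings ?Y C" if C: "C \<subseteq> {1..n}" for C
  proof -
    have fC: "finite C" and fA: "finite A" using C A finite_subset by auto
    have "mass x C + crossings Z A = mass x (C \<union> A) + mass x (C \<inter> A)"
      using mass_Un_Int[OF fC fA] tight by simp
    also have "\<dots> \<le> crossings Z (C \<union> A) + crossings Z (C \<inter> A)"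
    proof (rule add_mono)
      have "C \<union> A \<subseteq> {1..n}" "C \<inter> A \<subseteq> {1..n}" using A C by auto
      then show "mass x (C \<union> A) \<le> crossings Z (C \<union> A)" "mass x (C \<inter> A) \<le> crossings Z (C \<inter> A)"
        using x unfolding zono_def by blast+
    qed
    finally have "mass x C \<le> crossings Z (C \<union> A) + crossings Z (C \<inter> A) - crossings Z A" by simp
    moreover have "crossings ?Y (C \<union> A) + crossings ?Y (C \<inter> A) - crossings ?Y A \<le> crossings ?Y C"
      unfolding crossings_def sum.distrib[symmetric] sum_subtractf[symmetric]
      by (rule sum_mono) (auto simp: low_part_def)
    \<comment> \<open>For \<open>i\<close> in \<open>A\<close> and \<open>j\<close> outside,
      separation by \<open>C \<union> A\<close> means \<open>j \<notin> C\<close> and separation by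
      \<open>C \<inter> A\<close> means \<open>i \<in> C\<close>. Subtracting the 1 that comes from
      \<open>A\<close> leaves the mass of \<open>dvec i j\<close> on \<open>C\<close>.\<close>
    moreover have "crossings ?D (C \<union> A) + crossings ?D (C \<inter> A) - crossings ?D A \<le> mass (osum ?D) C"
      unfolding crossings_def mass_osum[OF fC] sum.distrib[symmetric] sum_subtractf[symmetric]
      by (rule sum_mono) (auto simp: cross_part_def)
    ultimately show ?thesis unfolding cutZ by (simp add: mass_diff)
  qed
  then show ?thesis
    using x keys_osum[OF D] mass_osum_total[OF D]
    by (auto simp: zono_def mass_diff intro!: keys_diff_subset del: subsetI)
qed

text \<open>Only the sets that contain \<open>i\<close> but not \<open>j\<close> lose slack in this
  direction. The smallest slack among them is the distance \<open>t\<close> to the boundary, and a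
  set attaining it is tight at the exit point.\<close>

lemma zono_line:
  assumes Z: "block_order n Z" and x: "x \<in> zono n Z" and ij: "(i, j) \<in> comparability Z"
  obtains t A where "0 \<le> t" "x + t *\<^sub>R dvec i j \<in> zono n Z" "A \<subseteq> {1..n}" "i \<in> A" "j \<notin> A"
    "mass (x + t *\<^sub>R dvec i j) A = crossings Z A"
proof -
  define S where "S = {A. A \<subseteq> {1..n} \<and> i \<in> A \<and> j \<notin> A}"
  have iN: "i \<in> {1..n}" "j \<in> {1..n}" "i \<noteq> j" using block_orderD(8,9,10)[OF Z] ij by auto
  have "finite S" by (rule finite_subset[of _ "Pow {1..n}"]) (auto simp: S_def)
  moreover have "{i} \<in> S" using iN by (auto simp: S_def)
  ultimately have "arg_min_on (\<lambda>A. crossings Z A - mass x A) S \<in> S"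
    "\<not> (\<exists>B\<in>S. crossings Z B - mass x B < crossings Z (arg_min_on (\<lambda>A. crossings Z A - mass x A) S) -
      mass x (arg_min_on (\<lambda>A. crossings Z A - mass x A) S))"
    using arg_min_if_finite[of S "\<lambda>A. crossings Z A - mass x A"] by blast+
  then obtain A where A: "A \<in> S" "\<And>B. B \<in> S \<Longrightarrow> crossings Z A - mass x A \<le> crossings Z B - mass x B"
    by (meson not_less)
  define t where "t = crossings Z A - mass x A"
  have AN: "A \<subseteq> {1..n}" "i \<in> A" "j \<notin> A" using A(1) by (auto simp: S_def)
  have t: "0 \<le> t" using x AN(1) by (auto simp: t_def zono_def)
  have m: "mass (x + t *\<^sub>R dvec i j) B = mass x B + t * (of_bool (i \<in> B) - of_bool (j \<in> B))"
    if "B \<subseteq> {1..n}" for B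
    using finite_subset[OF that] by (simp add: mass_add mass_scaleR mass_dvec)
  have "mass (x + t *\<^sub>R dvec i j) B \<le> crossings Z B" if B: "B \<subseteq> {1..n}" for B
  proof (cases "i \<in> B \<and> j \<notin> B")
    case True
    then show ?thesis using A(2)[of B] B m[OF B] by (simp add: S_def t_def)
  next
    case False
    then have "t * (of_bool (i \<in> B) - of_bool (j \<in> B)) \<le> 0" using t by auto
    moreover have "mass x B \<le> crossings Z B" using x B by (simp add: zono_def)
    ultimately show ?thesis using m[OF B] by simp
  qed
  moreover have "Poly_Mapping.keys (dvec i j) \<subseteq> {1..n}"
    using keys_dvec[of i j] iN by auto
  ultimately have "x + t *\<^sub>R dvec i j \<in> zono n Z"
    using x m[of "{1..n}"] iN
    by (auto simp: zono_def intro!: keys_add_subset keys_scaleR_subset del: subsetI)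
  then show ?thesis using that[of t A] t AN m[of A] by (simp add: t_def)
qed

text \<open>Induction on the number of pairs. The line through \<open>x\<close> in the direction of
  a root meets the boundary on both sides of \<open>x\<close>; either end lies on a face, which is a
  translate of the polytope of a smaller block order, and \<open>x\<close> is a convex combination
  of the two ends.\<close>

lemma zono_hull:
  assumes "block_order n Z"
  shows "convex hull (osum ` orders n Z) = zono n Z"
proof
  show "convex hull (osum ` orders n Z) \<subseteq> zono n Z"
    using osum_zono[OF assms] by (intro hull_minimal convex_zono) auto
  have "x \<in> convex hull (osum ` orders n Z)" if "x \<in> zono n Z" "block_order n Z" for x Z
    using that
  proof (induction "card Z" arbitrary: x Z rule: less_induct)
    case less
    note Z = less.prems(2)
    show ?case
    proof (cases "Z = {}")
      case True
      have "Poly_Mapping.lookup x i = 0" if i: "i \<in> {1..n}" for i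
      proof -
        have neg: "Poly_Mapping.lookup x i \<le> 0" if "i \<in> {1..n}" for i
        proof -
          have "mass x {i} \<le> crossings Z {i}" using less.prems(1) that unfolding zono_def by blast
          then show ?thesis using True by (simp add: mass_def crossings_def)
        qed
        have "mass x {1..n} = 0" using less.prems(1) by (simp add: zono_def)
        then show ?thesis
          using sum_nonneg_eq_0_iff[of "{1..n}" "\<lambda>i. - Poly_Mapping.lookup x i"] neg i
          by (simp add: mass_def sum_negf)
      qed
      then have "Poly_Mapping.lookup x i = 0" for i
        using less.prems(1) by (cases "i \<in> {1..n}") (auto simp: zono_def in_keys_iff)
      then have "x = 0" by (intro poly_mapping_eqI) simp
      then have "x = osum {}" by (simp add: osum_def)
      moreover have "{} \<in> orders n Z" using True Z by (simp add: orders_def)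
      ultimately show ?thesis by (auto intro: hull_inc)
    next
      case False
      have face: "y \<in> convex hull (osum ` orders n Z)"
        if y: "y \<in> zono n Z" and A: "A \<subseteq> {1..n}" "mass y A = crossings Z A"
          and ij: "(i, j) \<in> comparability Z" "i \<in> A" "j \<notin> A" for y A i j
      proof -
        let ?Y = "low_part Z A" and ?D = "cross_part Z A"
        note S = suborder_split[OF Z, of A]
        have Y: "block_order n ?Y" using S(1) by (rule suborderD)
        have "?Y \<subset> Z" using ij by (auto simp: low_part_def comparability_iff)
        then have "card ?Y < card Z" using block_orderD(2)[OF Z] by (rule psubset_card_mono[rotated])
        then have "y - osum ?D \<in> convex hull (osum ` orders n ?Y)"
          using less.hyps Y zono_tight[OF Z A(1) y A(2)] by blast
        then have "osum ?D + (y - osum ?D) \<in> (+) (osum ?D) ` (convex hull (osum ` orders n ?Y))"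
          by (rule imageI)
        then have "y \<in> convex hull ((+) (osum ?D) ` osum ` orders n ?Y)"
          by (simp add: convex_hull_translation)
        moreover have "(+) (osum ?D) ` osum ` orders n ?Y \<subseteq> osum ` orders n Z"
        proof clarify
          fix Y' assume Y': "Y' \<in> orders n ?Y"
          note R = suborder_replace[OF S(1) Y', unfolded S(3)]
          have "finite (?D \<union> Y')" using R(2) block_orderD(2) by (auto simp: orders_def)
          then have "osum ?D + osum Y' = osum (?D \<union> Y')" using R(3) by (intro osum_Un[symmetric]) auto
          moreover have "?D \<union> Y' \<in> orders n Z" using R(2) S(2) by (simp add: orders_def)
          ultimately show "osum ?D + osum Y' \<in> osum ` orders n Z" by (metis imageI)
        qed
        ultimately show ?thesis using hull_mono by blast
      qed
      obtain i j where ij: "(i, j) \<in> Z" using False by auto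
      then have c: "(i, j) \<in> comparability Z" "(j, i) \<in> comparability Z"
        by (auto simp: comparability_iff)
      obtain s A where s: "0 \<le> s" "x + s *\<^sub>R dvec i j \<in> zono n Z" "A \<subseteq> {1..n}" "i \<in> A" "j \<notin> A"
        "mass (x + s *\<^sub>R dvec i j) A = crossings Z A" using zono_line[OF Z less.prems(1) c(1)] .
      obtain t B where t: "0 \<le> t" "x + t *\<^sub>R dvec j i \<in> zono n Z" "B \<subseteq> {1..n}" "j \<in> B" "i \<notin> B"
        "mass (x + t *\<^sub>R dvec j i) B = crossings Z B" using zono_line[OF Z less.prems(1) c(2)] .
      let ?y = "x + s *\<^sub>R dvec i j" and ?z = "x + t *\<^sub>R dvec j i"
      have y: "?y \<in> convex hull (osum ` orders n Z)" using face[OF s(2,3,6) c(1) s(4,5)] .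
      have z: "?z \<in> convex hull (osum ` orders n Z)" using face[OF t(2,3,6) c(2) t(4,5)] .
      show ?thesis
      proof (cases "s + t = 0")
        case True
        then have "s = 0" using s(1) t(1) by simp
        then show ?thesis using y by simp
      next
        case False
        have ji: "dvec j i = - dvec i j" by (simp add: dvec_def)
        \<comment> \<open>The weights are crossed, so that the opposite displacements
          \<open>s\<close> and \<open>t\<close> cancel.\<close>
        have one: "t / (s + t) + s / (s + t) = 1" using False by (simp add: add_divide_distrib[symmetric])
        have "(t / (s + t)) *\<^sub>R ?y + (s / (s + t)) *\<^sub>R ?z =
            (t / (s + t) + s / (s + t)) *\<^sub>R x + (t / (s + t) * s - s / (s + t) * t) *\<^sub>R dvec i j"
          unfolding ji by (simp add: algebra_simps)
        also have "\<dots> = x" using one by simp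
        finally have "(t / (s + t)) *\<^sub>R ?y + (s / (s + t)) *\<^sub>R ?z = x" .
        moreover have "(t / (s + t)) *\<^sub>R ?y + (s / (s + t)) *\<^sub>R ?z \<in> convex hull (osum ` orders n Z)"
          using s(1) t(1) one by (intro convexD[OF convex_convex_hull y z]) auto
        ultimately show ?thesis by simp
      qed
    qed
  qed
  then show "zono n Z \<subseteq> convex hull (osum ` orders n Z)" using assms by blast
qed

lemma osum_map_prod:
  "inj p \<Longrightarrow> osum (map_prod p p ` D) = (\<Sum>(i, j)\<in>D. dvec (p i) (p j))"
  unfolding osum_def
  by (subst sum.reindex) (auto simp: case_prod_unfold intro: inj_on_subset[OF prod.inj_map])

lemma lookup_osum_map_prod:
  assumes "inj p"
  shows "Poly_Mapping.lookup (osum (map_prod p p ` D)) (p c) = Poly_Mapping.lookup (osum D) c"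
  unfolding osum_map_prod[OF assms] unfolding osum_def lookup_sum
  by (rule sum.cong) (auto simp: lookup_dvec inj_eq[OF assms])

text \<open>The common form of the faces in both complexes. The permutations \<open>z\<close> act
  within the blocks of \<open>Y\<close>, so all vertices share the summand coming from the pairs
  across the cuts, and the remaining summand runs through all orders on the blocks of the image of
  \<open>Y\<close>.\<close>

lemma face_hull:
  assumes Y: "suborder n Y Z" and p: "p permutes {1..n}"
  shows "convex hull ((\<lambda>z. osum (map_prod (p \<circ> z) (p \<circ> z) ` Z)) ` block_perms n (comparability Y)) =
    (+) (osum (map_prod p p ` Z - map_prod p p ` Y)) ` zono n (map_prod p p ` Y)"
proof -
  let ?D = "map_prod p p ` Z - map_prod p p ` Y"
  have inj: "inj p" using p by (rule permutes_inj)
  have D: "map_prod p p ` (Z - Y) = ?D"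
    using inj by (intro image_set_diff) (simp add: prod.inj_map)
  have PY: "suborder n (map_prod p p ` Y) (map_prod p p ` Z)" by (rule suborder_map_prod[OF Y p])
  have fin: "finite Z" using block_orderD(2)[OF suborderD(2)[OF Y]] .
  have osm: "osum (map_prod (p \<circ> z) (p \<circ> z) ` Z) = osum ?D + osum (map_prod p p ` map_prod z z ` Y)"
    "map_prod p p ` map_prod z z ` Y \<in> orders n (map_prod p p ` Y)"
    if z: "z \<in> block_perms n (comparability Y)" for z
  proof -
    note m = block_perms_map_prod[OF suborderD(1)[OF Y] z]
    then show o: "map_prod p p ` map_prod z z ` Y \<in> orders n (map_prod p p ` Y)"
      using block_order_map_prod[OF m(1) p] by (simp add: orders_def comparability_map_prod)
    have "Z = (Z - Y) \<union> Y" using suborderD(3)[OF Y] by blast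
    then have "map_prod z z ` Z = (Z - Y) \<union> map_prod z z ` Y"
      using suborder_perm_diff[OF Y z] by (metis image_Un)
    then have "map_prod (p \<circ> z) (p \<circ> z) ` Z = ?D \<union> map_prod p p ` map_prod z z ` Y"
      unfolding map_prod.comp[symmetric] image_comp[symmetric] D[symmetric] image_Un[symmetric] by simp
    then show "osum (map_prod (p \<circ> z) (p \<circ> z) ` Z) = osum ?D + osum (map_prod p p ` map_prod z z ` Y)"
      using suborder_replace(3)[OF PY o] fin finite_subset[OF suborderD(3)[OF Y] fin]
      by (simp add: osum_Un)
  qed
  have "(\<lambda>z. osum (map_prod (p \<circ> z) (p \<circ> z) ` Z)) ` block_perms n (comparability Y) =
      (+) (osum ?D) ` osum ` orders n (map_prod p p ` Y)"
  proof
    show "(\<lambda>z. osum (map_prod (p \<circ> z) (p \<circ> z) ` Z)) ` block_perms n (comparability Y) \<subseteq>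
        (+) (osum ?D) ` osum ` orders n (map_prod p p ` Y)"
      using osm by auto
    show "(+) (osum ?D) ` osum ` orders n (map_prod p p ` Y) \<subseteq>
        (\<lambda>z. osum (map_prod (p \<circ> z) (p \<circ> z) ` Z)) ` block_perms n (comparability Y)"
    proof clarify
      fix Y' assume Y': "Y' \<in> orders n (map_prod p p ` Y)"
      let ?q = "inv' p"
      have q: "?q permutes {1..n}" using p by (rule permutes_inv)
      have pq: "p \<circ> ?q = id" "?q \<circ> p = id" using permutes_inv_o[OF p] by auto
      have qp: "map_prod ?q ?q ` map_prod p p ` X = X" "map_prod p p ` map_prod ?q ?q ` X = X" for X
        using pq by (simp_all add: image_comp map_prod.comp map_prod.id)
      have "block_order n (map_prod ?q ?q ` Y')"
        using Y' by (intro block_order_map_prod[OF _ q]) (simp add: orders_def)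
      moreover have "comparability (map_prod ?q ?q ` Y') = comparability Y"
        using Y' qp by (simp add: orders_def comparability_map_prod)
      ultimately obtain z where z: "z \<in> block_perms n (comparability Y)"
        "map_prod z z ` Y = map_prod ?q ?q ` Y'" using ex_block_perm[OF suborderD(1)[OF Y]] by blast
      have "osum ?D + osum Y' = osum (map_prod (p \<circ> z) (p \<circ> z) ` Z)"
        using osm(1)[OF z(1)] z(2) qp by simp
      then show "osum ?D + osum Y' \<in>
          (\<lambda>z. osum (map_prod (p \<circ> z) (p \<circ> z) ` Z)) ` block_perms n (comparability Y)"
        using z(1) by (rule image_eqI)
    qed
  qed
  then show ?thesis
    using zono_hull[OF suborderD(1)[OF PY]] by (simp add: convex_hull_translation)
qed

section \<open>Gluing of permutohedra and its invariants\<close>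

text \<open>The point \<open>y\<close> of the cell of \<open>Y\<close> is identified with the point \<open>x\<close> of the cell of \<open>Z\<close> because
  \<open>x\<close> lies on the face of \<open>zono n Z\<close> that belongs to the blocks of \<open>Y\<close>, arranged as in \<open>T\<close>.\<close>

definition face_step ::
    "nat \<Rightarrow> (nat \<times> nat) set \<Rightarrow> nat geom \<Rightarrow> (nat \<times> nat) set \<Rightarrow> nat geom \<Rightarrow> bool" where
  "face_step n Z x Y y \<longleftrightarrow> block_order n Z \<and> (\<exists>T. suborder n Y T \<and>
     comparability T = comparability Z \<and> Y \<subseteq> Z \<and> y = x - osum (T - Y) \<and> y \<in> zono n Y)"

lemma face_step_zono:
  assumes "face_step n Z x Y y"
  shows "block_order n Z" "block_order n Y" "x \<in> zono n Z" "y \<in> zono n Y"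
proof -
  obtain T where T: "block_order n Z" "suborder n Y T" "comparability T = comparability Z"
    "y = x - osum (T - Y)" "y \<in> zono n Y" using assms by (auto simp: face_step_def)
  show "block_order n Z" "block_order n Y" "y \<in> zono n Y" using T suborderD by auto
  have "x \<in> zono n T" using zono_face[OF T(2)] T(4,5) by simp
  moreover have "crossings T A = crossings Z A" for A
    using crossings_comparability[OF T(1) suborderD(2)[OF T(2)] T(3)] .
  ultimately show "x \<in> zono n Z" by (simp add: zono_def)
qed

lemma face_step_refl: "block_order n Z \<Longrightarrow> x \<in> zono n Z \<Longrightarrow> face_step n Z x Z x"
  unfolding face_step_def by (auto simp: osum_def intro!: exI[of _ Z] suborder_refl)

text \<open>Reordering the blocks of \<open>Y\<close> inside \<open>T\<close> as prescribed by
  \<open>U\<close> yields one arrangement for the composite step. That \<open>X\<close> consists of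
  intervals of it is seen on covers, where it follows by composing inclusions.\<close>

lemma face_step_trans:
  assumes "face_step n Z x Y y" "face_step n Y y X w"
  shows "face_step n Z x X w"
proof -
  obtain T where T: "block_order n Z" "suborder n Y T" "comparability T = comparability Z" "Y \<subseteq> Z"
    "y = x - osum (T - Y)" using assms(1) by (auto simp: face_step_def)
  obtain U where U: "suborder n X U" "comparability U = comparability Y" "X \<subseteq> Y"
    "w = y - osum (U - X)" "w \<in> zono n X" using assms(2) by (auto simp: face_step_def)
  have UY: "U \<in> orders n Y" using U suborderD(2) by (auto simp: orders_def)
  note R = suborder_replace[OF T(2) UY]
  have "cover X \<subseteq> cover ((T - Y) \<union> U)"
    using suborder_cover[OF U(1)] suborder_cover[OF R(1)] by blast
  then have X: "suborder n X ((T - Y) \<union> U)"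
    using suborderD[OF U(1)] suborderD[OF R(1)] by (intro suborderI_cover) auto
  have XU: "X \<subseteq> U" using suborderD(3)[OF U(1)] .
  have fin: "finite (T - Y)" "finite U"
    using block_orderD(2)[OF suborderD(2)[OF T(2)]] block_orderD(2)[OF suborderD(2)[OF U(1)]] by auto
  have "((T - Y) \<union> U) - X = (T - Y) \<union> (U - X)" using R(3) XU by blast
  then have "osum (((T - Y) \<union> U) - X) = osum (T - Y) + osum (U - X)"
    using R(3) fin by (simp add: osum_Un Diff_Int_distrib Int_Diff)
  moreover have "comparability ((T - Y) \<union> U) = comparability Z"
    using R(2) T(3) by (simp add: orders_def)
  ultimately show ?thesis
    unfolding face_step_def using X T U
    by (intro conjI exI[of _ "(T - Y) \<union> U"]) (auto simp: algebra_simps)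
qed

text \<open>As long as some inequality with a positive bound is tight, it exhibits a face whose
  block order has fewer pairs.\<close>

lemma ex_face_step_int:
  assumes "block_order n Z" "x \<in> zono n Z"
  obtains Y y where "face_step n Z x Y y" "y \<in> zono_int n Y"
  using assms
proof (induction "card Z" arbitrary: Z x thesis rule: less_induct)
  case less
  note Z = less.prems(2)
  show ?case
  proof (cases "x \<in> zono_int n Z")
    case True
    then show ?thesis using less.prems(1) face_step_refl[OF less.prems(2,3)] by blast
  next
    case False
    then obtain A where A: "A \<subseteq> {1..n}" "0 < crossings Z A" "\<not> mass x A < crossings Z A"
      using less.prems(3) by (auto simp: zono_int_def)
    have "mass x A \<le> crossings Z A" using A(1) less.prems(3) unfolding zono_def by blast
    then have tight: "mass x A = crossings Z A" using A(3) by simp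
    let ?Y = "low_part Z A"
    note S = suborder_split[OF Z, of A]
    have step: "face_step n Z x ?Y (x - osum (cross_part Z A))"
      unfolding face_step_def using Z S zono_tight[OF Z A(1) less.prems(3) tight]
      by (intro conjI exI[of _ "?Y \<union> cross_part Z A"]) (auto simp: low_part_def)
    obtain i j where "(i, j) \<in> Z" "(i \<in> A) \<noteq> (j \<in> A)"
      using A(2) crossings_pos_iff[OF block_orderD(2)[OF Z]] by auto
    then have "?Y \<subset> Z" by (auto simp: low_part_def)
    then have "card ?Y < card Z" using block_orderD(2)[OF Z] by (rule psubset_card_mono[rotated])
    then obtain X w where "face_step n ?Y (x - osum (cross_part Z A)) X w" "w \<in> zono_int n X"
      using less.hyps face_step_zono(2,4)[OF step] by blast
    then show ?thesis using less.prems(1) face_step_trans[OF step] by blast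
  qed
qed

text \<open>The set and its complement both have cut zero, hence nonpositive mass, and the two
  masses add up to zero.\<close>

lemma mass_closed:
  assumes Y: "block_order n Y" and y: "y \<in> zono n Y" and A: "A \<subseteq> {1..n}" and c: "crossings Y A = 0"
  shows "mass y A = 0"
proof -
  have "crossings Y ({1..n} - A) = 0"
    using crossings_zeroD[OF block_orderD(2)[OF Y] c] block_orderD(1)[OF Y] by (intro crossings_zero) blast
  moreover have "mass y ({1..n} - A) \<le> crossings Y ({1..n} - A)" "mass y A \<le> crossings Y A"
    using y A unfolding zono_def by blast+
  moreover have "mass y ({1..n} - A) + mass y A = mass y {1..n}"
    unfolding mass_def using A by (simp add: sum.subset_diff)
  ultimately show ?thesis using y c by (simp add: zono_def)
qed

text \<open>The gap vanishes exactly if the face containing \<open>x\<close> in its interior has \<open>i\<close> and \<open>j\<close> in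
  different blocks; otherwise it can be divided out of the second component of \<open>psi\<close>.\<close>

definition separators :: "nat \<Rightarrow> nat \<Rightarrow> nat \<Rightarrow> nat set set" where
  "separators n i j = {A. A \<subseteq> {1..n} \<and> (i \<in> A) \<noteq> (j \<in> A)}"

definition gap :: "nat \<Rightarrow> (nat \<times> nat) set \<Rightarrow> nat geom \<Rightarrow> nat \<Rightarrow> nat \<Rightarrow> real" where
  "gap n Z x i j = Min ((\<lambda>A. crossings Z A - mass x A) ` separators n i j)"

definition psi :: "nat \<Rightarrow> (nat \<times> nat) set \<Rightarrow> nat geom \<Rightarrow> nat \<times> nat \<Rightarrow> real \<times> real" where
  "psi n Z x = (\<lambda>(i, j). if (i, j) \<in> Z
     then (gap n Z x i j, gap n Z x i j * (Poly_Mapping.lookup x i - Poly_Mapping.lookup x j))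
     else (0, 0))"

lemma finite_separators: "finite (separators n i j)"
  by (rule finite_subset[of _ "Pow {1..n}"]) (auto simp: separators_def)

lemma separators_nonempty: "i \<in> {1..n} \<Longrightarrow> i \<noteq> j \<Longrightarrow> separators n i j \<noteq> {}"
  by (auto simp: separators_def intro!: exI[of _ "{i}"])

lemma gap_le: "A \<in> separators n i j \<Longrightarrow> gap n Z x i j \<le> crossings Z A - mass x A"
  unfolding gap_def by (rule Min_le) (use finite_separators in auto)

lemma gap_attained:
  assumes "i \<in> {1..n}" "i \<noteq> j"
  obtains A where "A \<in> separators n i j" "gap n Z x i j = crossings Z A - mass x A"
proof -
  have "gap n Z x i j \<in> (\<lambda>A. crossings Z A - mass x A) ` separators n i j"
    unfolding gap_def using finite_separators separators_nonempty[OF assms] by (intro Min_in) auto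
  then show ?thesis using that by blast
qed

definition block_of :: "(nat \<times> nat) set \<Rightarrow> nat \<Rightarrow> nat set" where
  "block_of Y i = {a. a = i \<or> (a, i) \<in> comparability Y}"

lemma block_of_subset: "block_order n Y \<Longrightarrow> i \<in> {1..n} \<Longrightarrow> block_of Y i \<subseteq> {1..n}"
  using block_orderD(9) by (auto simp: block_of_def simp del: One_nat_def)

lemma block_of_closed:
  assumes Y: "block_order n Y" and ab: "(a, b) \<in> Y"
  shows "a \<in> block_of Y i \<longleftrightarrow> b \<in> block_of Y i"
proof -
  have c: "(a, b) \<in> comparability Y" "(b, a) \<in> comparability Y" using ab by (auto simp: comparability_iff)
  show ?thesis
    using block_orderD(7)[OF Y c(1), of i] block_orderD(7)[OF Y c(2), of i] c by (auto simp: block_of_def)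
qed

lemma crossings_block_of: "block_order n Y \<Longrightarrow> crossings Y (block_of Y i) = 0"
  using block_of_closed by (intro crossings_zero)

text \<open>Applied with \<open>P\<close> a union of blocks: no pair is cut by \<open>P\<close>, so
  the slack can be localized to one block.\<close>

lemma slack_split:
  assumes P: "\<And>a b. (a, b) \<in> Y \<Longrightarrow> a \<in> P \<longleftrightarrow> b \<in> P" and A: "finite A"
  shows "crossings Y A - mass y A = (crossings Y (A \<inter> P) - mass y (A \<inter> P)) +
    (crossings Y (A - P) - mass y (A - P))"
proof -
  have "crossings Y A = crossings Y (A \<inter> P) + crossings Y (A - P)"
    unfolding crossings_def sum.distrib[symmetric] using P by (intro sum.cong) auto
  moreover have "mass y A = mass y (A \<inter> P) + mass y (A - P)"
    unfolding mass_def using A by (rule sum.Int_Diff)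
  ultimately show ?thesis by simp
qed

text \<open>A pair of \<open>Z\<close> outside \<open>Y\<close> is separated by a tight set, so its
  gap is zero. For a pair of \<open>Y\<close> the gap is attained on sets closed under predecessors,
  which have the same slack in both cells, and the coordinate difference survives the translation
  because \<open>osum D\<close> is constant on the blocks of \<open>Y\<close>.\<close>

lemma psi_face_step:
  assumes "face_step n Z x Y y"
  shows "psi n Z x = psi n Y y"
proof -
  obtain T where Z: "block_order n Z" and T: "suborder n Y T" "comparability T = comparability Z"
    "Y \<subseteq> Z" "y = x - osum (T - Y)" "y \<in> zono n Y"
    using assms by (auto simp: face_step_def)
  have x: "x \<in> zono n Z" using face_step_zono[OF assms] by simp
  note oY = suborderD(1)[OF T(1)] and oT = suborderD(2)[OF T(1)]
  define D where "D = T - Y"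
  have cutT: "crossings Z A = crossings T A" for A
    using crossings_comparability[OF Z oT T(2)] by simp
  have slack_ge: "crossings Y A - mass y A \<le> crossings Z A - mass x A" if "A \<subseteq> {1..n}" for A
    using slack_le[OF T(1) finite_subset[OF that], of x] by (simp add: cutT T(4))
  have slack_up: "crossings Z A - mass x A = crossings Y A - mass y A"
    if "A \<subseteq> {1..n}" "\<And>a b. (a, b) \<in> D \<Longrightarrow> b \<in> A \<Longrightarrow> a \<in> A" for A
    using slack_eq[OF T(1) finite_subset[OF that(1)], of x] that(2) by (simp add: cutT T(4) D_def)
  have Dtrans: "(a, c) \<in> D" if "(a, b) \<in> D" "(b, c) \<in> D" for a b c
    using suborderD(4)[OF T(1)] that unfolding D_def by (rule transD)
  have DN: "a \<in> {1..n}" "b \<in> {1..n}" "a \<noteq> b" if "(a, b) \<in> D" for a b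
    using that block_orderD(1,3)[OF oT] by (auto simp: D_def)
  \<comment> \<open>The elements that precede the block of \<open>b\<close> in the arrangement
    \<open>T\<close>. This set is a union of blocks of \<open>Y\<close> and closed under
    predecessors in \<open>D\<close>, hence tight.\<close>
  define pred where "pred b = {a. (a, b) \<in> D}" for b
  have predN: "pred b \<subseteq> {1..n}" for b using DN by (auto simp: pred_def simp del: One_nat_def)
  have pred_up: "a \<in> pred c" if "(a, b) \<in> D" "b \<in> pred c" for a b c
    using that Dtrans by (auto simp: pred_def)
  have pred_closed: "a \<in> pred c \<longleftrightarrow> b \<in> pred c" if "(a, b) \<in> Y" for a b c
  proof -
    have "(a, b) \<in> comparability Y" "(b, a) \<in> comparability Y" using that by (auto simp: comparability_iff)
    then have "(a, c) \<in> D \<longleftrightarrow> (b, c) \<in> D" unfolding D_def using suborder_mix(1)[OF T(1)] by blast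
    then show ?thesis by (simp add: pred_def)
  qed
  have pred_slack: "crossings Y (pred b) - mass y (pred b) = 0" for b
  proof -
    have "crossings Y (pred b) = 0" using pred_closed by (rule crossings_zero)
    then show ?thesis using mass_closed[OF oY T(5) predN] by simp
  qed
  have nonneg: "0 \<le> crossings Y A - mass y A" if "A \<subseteq> {1..n}" for A
    using T(5) that by (simp add: zono_def)
  have in_Y: "gap n Z x i j = gap n Y y i j \<and> Poly_Mapping.lookup x i - Poly_Mapping.lookup x j =
      Poly_Mapping.lookup y i - Poly_Mapping.lookup y j" if ij: "(i, j) \<in> Y" for i j
  proof
    have ijN: "i \<in> {1..n}" "j \<in> {1..n}" "i \<noteq> j" using ij block_orderD(1,3)[OF oY] by auto
    have "gap n Y y i j \<le> gap n Z x i j"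
    proof -
      obtain A where A: "A \<in> separators n i j" "gap n Z x i j = crossings Z A - mass x A"
        using gap_attained[OF ijN(1,3)] .
      then show ?thesis using gap_le[OF A(1), of Y y] slack_ge[of A] by (simp add: separators_def)
    qed
    moreover have "gap n Z x i j \<le> gap n Y y i j"
    proof -
      obtain A where A: "A \<in> separators n i j" "gap n Y y i j = crossings Y A - mass y A"
        using gap_attained[OF ijN(1,3)] .
      have AN: "A \<subseteq> {1..n}" and sep: "(i \<in> A) \<noteq> (j \<in> A)" using A(1) by (auto simp: separators_def)
      \<comment> \<open>The optimal set \<open>A\<close> is cut down to the block of
        \<open>i\<close> and then filled up by everything that precedes this block. The result still
        separates \<open>i\<close> from \<open>j\<close>, has the same slack in both cells, and no
        more slack than \<open>A\<close>.\<close>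
      define P where "P = block_of Y i"
      define C where "C = pred i \<union> (A \<inter> P)"
      have P_closed: "a \<in> P \<longleftrightarrow> b \<in> P" if "(a, b) \<in> Y" for a b
        unfolding P_def using block_of_closed[OF oY that] .
      have jP: "i \<in> P" "j \<in> P" using ij by (auto simp: P_def block_of_def comparability_iff)
      have disj: "a \<notin> pred i" if "a \<in> P" for a
      proof
        assume "a \<in> pred i"
        then have "(a, i) \<in> T" "(a, i) \<notin> Y" "a \<noteq> i" using DN(3) by (auto simp: pred_def D_def)
        then have "(i, a) \<in> Y" using that by (auto simp: P_def block_of_def comparability_iff)
        then show False using suborderD(3)[OF T(1)] block_orderD(6)[OF oT] \<open>(a, i) \<in> T\<close> by blast
      qed
      have CN: "C \<subseteq> {1..n}" using predN AN by (auto simp: C_def simp del: One_nat_def)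
      have "i \<in> C \<longleftrightarrow> i \<in> A" "j \<in> C \<longleftrightarrow> j \<in> A" using jP disj by (auto simp: C_def)
      then have C: "C \<in> separators n i j" using sep CN by (simp add: separators_def)
      have "a \<in> C" if "(a, b) \<in> D" "b \<in> C" for a b
      proof (cases "b \<in> pred i")
        case True
        then show ?thesis using pred_up[OF that(1)] by (simp add: C_def)
      next
        case False
        then have "b = i \<or> (b, i) \<in> comparability Y" using that(2) by (auto simp: C_def P_def block_of_def)
        then have "(a, i) \<in> D" using suborder_mix(2)[OF T(1), of a b i] that(1) by (auto simp: D_def)
        then show ?thesis by (simp add: C_def pred_def)
      qed
      then have "crossings Z C - mass x C = crossings Y C - mass y C" using slack_up[OF CN] by blast
      also have "\<dots> = (crossings Y (C \<inter> pred i) - mass y (C \<inter> pred i)) +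
          (crossings Y (C - pred i) - mass y (C - pred i))"
        using pred_closed finite_subset[OF CN] by (intro slack_split) auto
      also have "C \<inter> pred i = pred i" by (auto simp: C_def)
      also have "C - pred i = A \<inter> P" using disj by (auto simp: C_def)
      also have "crossings Y (pred i) - mass y (pred i) + (crossings Y (A \<inter> P) - mass y (A \<inter> P)) =
          crossings Y (A \<inter> P) - mass y (A \<inter> P)" using pred_slack by simp
      also have "\<dots> \<le> crossings Y A - mass y A"
      proof -
        have "crossings Y A - mass y A = (crossings Y (A \<inter> P) - mass y (A \<inter> P)) +
            (crossings Y (A - P) - mass y (A - P))"
          using P_closed finite_subset[OF AN] by (intro slack_split) auto
        moreover have "0 \<le> crossings Y (A - P) - mass y (A - P)" using AN by (intro nonneg) auto
        ultimately show ?thesis by simp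
      qed
      finally show ?thesis using gap_le[OF C, of Z x] A(2) by simp
    qed
    ultimately show "gap n Z x i j = gap n Y y i j" by simp
    \<comment> \<open>A transposition inside a block of \<open>Y\<close> permutes \<open>D\<close>,
      so \<open>osum D\<close> has equal coordinates at \<open>i\<close> and
      \<open>j\<close>.\<close>
    let ?t = "Transposition.transpose i j"
    have "map_prod ?t ?t ` D = D"
      unfolding D_def by (rule suborder_perm_diff[OF T(1) transpose_block_perms[OF oY ij]])
    moreover have "inj ?t" by simp
    ultimately have "Poly_Mapping.lookup (osum D) j = Poly_Mapping.lookup (osum D) i"
      using lookup_osum_map_prod[of ?t D i] by simp
    then show "Poly_Mapping.lookup x i - Poly_Mapping.lookup x j =
        Poly_Mapping.lookup y i - Poly_Mapping.lookup y j"
      by (simp add: T(4) D_def lookup_minus)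
  qed
  have not_Y: "gap n Z x i j = 0" if ij: "(i, j) \<in> Z" "(i, j) \<notin> Y" for i j
  proof -
    have ijN: "i \<in> {1..n}" "j \<in> {1..n}" "i \<noteq> j" using ij block_orderD(1,3)[OF Z] by auto
    have "(j, i) \<notin> Y" using ij T(3) block_orderD(6)[OF Z] by blast
    moreover have "(i, j) \<in> comparability T" using ij(1) T(2) by (simp add: comparability_iff)
    ultimately have "(i, j) \<in> D \<or> (j, i) \<in> D" using ij by (auto simp: D_def comparability_iff)
    \<comment> \<open>Whichever of \<open>i\<close> and \<open>j\<close> comes later in
      \<open>T\<close>, its set of predecessors contains the other one but not itself.\<close>
    then obtain b where b: "pred b \<in> separators n i j"
      using DN(3) predN by (auto simp: separators_def pred_def simp del: One_nat_def)
    have "crossings Z (pred b) - mass x (pred b) = 0"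
      using slack_up[OF predN[of b]] pred_up pred_slack by simp
    then have "gap n Z x i j \<le> 0" using gap_le[OF b, of Z x] by simp
    moreover have "0 \<le> gap n Z x i j"
    proof -
      obtain A where "A \<in> separators n i j" "gap n Z x i j = crossings Z A - mass x A"
        using gap_attained[OF ijN(1,3)] .
      then show ?thesis using x by (simp add: separators_def zono_def)
    qed
    ultimately show ?thesis by simp
  qed
  show ?thesis
  proof (rule ext, clarify)
    fix i j show "psi n Z x (i, j) = psi n Y y (i, j)"
      using in_Y[of i j] not_Y[of i j] T(3) by (cases "(i, j) \<in> Y") (auto simp: psi_def)
  qed
qed

text \<open>In the interior the gap of every pair of \<open>Z\<close> is positive. Hence the support
  of the first component is \<open>Z\<close>, and the gap can be cancelled from the second. This
  determines the point up to a constant on each block, and the constant is fixed by the vanishing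
  mass of the block.\<close>

lemma psi_int_inj:
  assumes Z: "block_order n Z" "x \<in> zono_int n Z" and Y: "block_order n Y" "y \<in> zono_int n Y"
    and eq: "psi n Z x = psi n Y y"
  shows "Z = Y" "x = y"
proof -
  have pos: "0 < gap n Z x i j" if Z: "block_order n Z" "x \<in> zono_int n Z" and ij: "(i, j) \<in> Z"
    for Z x i j
  proof -
    have ijN: "i \<in> {1..n}" "i \<noteq> j" using ij block_orderD(1,3)[OF Z(1)] by auto
    obtain A where A: "A \<in> separators n i j" "gap n Z x i j = crossings Z A - mass x A"
      using gap_attained[OF ijN] .
    then have "0 < crossings Z A"
      using crossings_pos_iff[OF block_orderD(2)[OF Z(1)]] ij by (auto simp: separators_def)
    then show ?thesis using Z(2) A by (auto simp: zono_int_def separators_def)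
  qed
  have mem: "(i, j) \<in> Z \<longleftrightarrow> fst (psi n Z x (i, j)) \<noteq> 0"
    if "block_order n Z" "x \<in> zono_int n Z" for Z x i j
    using pos[OF that, of i j] by (auto simp: psi_def)
  show ZY: "Z = Y"
  proof (intro equalityI subrelI)
    fix i j
    have "(i, j) \<in> Z \<longleftrightarrow> (i, j) \<in> Y" using mem[OF Z, of i j] mem[OF Y, of i j] eq by simp
    then show "(i, j) \<in> Z \<Longrightarrow> (i, j) \<in> Y" "(i, j) \<in> Y \<Longrightarrow> (i, j) \<in> Z" by simp_all
  qed
  define d where "d a = Poly_Mapping.lookup x a - Poly_Mapping.lookup y a" for a
  have d: "d i = d j" if "(i, j) \<in> Z" for i j
  proof -
    have "psi n Z x (i, j) = psi n Z y (i, j)" using eq ZY by simp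
    then show ?thesis using that pos[OF Z that] by (auto simp: psi_def d_def)
  qed
  have "d i = 0" for i
  proof (cases "i \<in> {1..n}")
    case True
    note P = block_of_subset[OF Z(1) True]
    have "(\<Sum>a\<in>block_of Z i. d a) = mass x (block_of Z i) - mass y (block_of Z i)"
      by (simp add: d_def mass_def sum_subtractf)
    also have "\<dots> = 0"
      using mass_closed[OF Z(1) _ P crossings_block_of[OF Z(1)]] Z(2) Y(2) ZY by (simp add: zono_int_def)
    finally have "(\<Sum>a\<in>block_of Z i. d a) = 0" .
    moreover have "(\<Sum>a\<in>block_of Z i. d a) = (\<Sum>a\<in>block_of Z i. d i)"
    proof (rule sum.cong)
      fix a assume "a \<in> block_of Z i"
      then show "d a = d i" using d[of a i] d[of i a] by (auto simp: block_of_def comparability_iff)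
    qed simp
    ultimately have "real (card (block_of Z i)) * d i = 0" by simp
    moreover have "i \<in> block_of Z i" by (simp add: block_of_def)
    then have "card (block_of Z i) \<noteq> 0" using finite_subset[OF P] by auto
    ultimately show ?thesis by simp
  next
    case False
    moreover have "Poly_Mapping.keys x \<subseteq> {1..n}" "Poly_Mapping.keys y \<subseteq> {1..n}"
      using Z(2) Y(2) by (simp_all add: zono_int_def zono_def)
    ultimately have "i \<notin> Poly_Mapping.keys x" "i \<notin> Poly_Mapping.keys y" by blast+
    then show ?thesis by (simp add: d_def in_keys_iff)
  qed
  then show "x = y" by (intro poly_mapping_eqI) (simp add: d_def)
qed

text \<open>Both points descend to the interior of a face, where \<open>psi\<close> is injective.
  Any chain of identifications is thereby replaced by two descents to a common point.\<close>

lemma psi_eq_iff: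
  assumes Z: "block_order n Z" "x \<in> zono n Z" and Y: "block_order n Y" "y \<in> zono n Y"
  shows "psi n Z x = psi n Y y \<longleftrightarrow> (\<exists>X w. face_step n Z x X w \<and> face_step n Y y X w \<and> w \<in> zono_int n X)"
proof
  obtain X w where X: "face_step n Z x X w" "w \<in> zono_int n X" using ex_face_step_int[OF Z] .
  obtain X' w' where X': "face_step n Y y X' w'" "w' \<in> zono_int n X'" using ex_face_step_int[OF Y] .
  assume "psi n Z x = psi n Y y"
  then have "psi n X w = psi n X' w'" using psi_face_step[OF X(1)] psi_face_step[OF X'(1)] by simp
  then have "X = X'" "w = w'"
    using psi_int_inj[OF face_step_zono(2)[OF X(1)] X(2) face_step_zono(2)[OF X'(1)] X'(2)] by blast+
  then show "\<exists>X w. face_step n Z x X w \<and> face_step n Y y X w \<and> w \<in> zono_int n X"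
    using X X' by blast
next
  show "\<exists>X w. face_step n Z x X w \<and> face_step n Y y X w \<and> w \<in> zono_int n X \<Longrightarrow> psi n Z x = psi n Y y"
    using psi_face_step by metis
qed

lemma continuous_on_Min_finite:
  fixes f :: "'i \<Rightarrow> 'a::topological_space \<Rightarrow> real"
  assumes "finite I" "I \<noteq> {}" "\<And>i. i \<in> I \<Longrightarrow> continuous_on S (f i)"
  shows "continuous_on S (\<lambda>x. Min ((\<lambda>i. f i x) ` I))"
  using assms
proof (induction I rule: finite_ne_induct)
  case (insert i I)
  have "continuous_on S (\<lambda>x. min (f i x) (Min ((\<lambda>i. f i x) ` I)))"
    using insert by (intro continuous_on_min) auto
  then show ?case using insert.hyps by simp
qed simp

lemma continuous_on_mass [continuous_intros]: "continuous_on S (\<lambda>x. mass x A)"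
  unfolding mass_def by (intro continuous_intros)

lemma continuous_on_psi:
  assumes "block_order n Z" shows "continuous_on S (\<lambda>x. psi n Z x p)"
proof -
  obtain i j where p: "p = (i, j)" by fastforce
  show ?thesis
  proof (cases "(i, j) \<in> Z")
    case True
    then have "i \<in> {1..n}" "i \<noteq> j" using block_orderD(1,3)[OF assms] by auto
    then have "continuous_on S (\<lambda>x. gap n Z x i j)"
      unfolding gap_def using finite_separators separators_nonempty
      by (intro continuous_on_Min_finite continuous_intros)
    then show ?thesis using True by (simp add: p psi_def) (intro continuous_intros)
  qed (simp add: p psi_def)
qed

section \<open>Linear hulls and relative interiors\<close>

text \<open>The linear hull of the polytope. The sets of cut zero are the unions of blocks, so these
  equations say that every block has mass zero.\<close>

definition flat :: "nat \<Rightarrow> (nat \<times> nat) set \<Rightarrow> nat geom set" where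
  "flat n Z = {x. Poly_Mapping.keys x \<subseteq> {1..n} \<and> (\<forall>A\<subseteq>{1..n}. crossings Z A = 0 \<longrightarrow> mass x A = 0)}"

text \<open>Inequalities with bound zero are equations on the polytope and move into
  \<open>flat\<close>. The remaining ones hold strictly at the origin, which provides the strict
  solution for \<open>rel_interior_inequalities\<close>.\<close>

lemma zono_flat:
  assumes Z: "block_order n Z"
  shows "zono n Z = {x \<in> flat n Z. \<forall>A\<in>{A. A \<subseteq> {1..n} \<and> 0 < crossings Z A}. 0 \<le> crossings Z A - mass x A}"
    "zono_int n Z = {x \<in> flat n Z. \<forall>A\<in>{A. A \<subseteq> {1..n} \<and> 0 < crossings Z A}. 0 < crossings Z A - mass x A}"
proof -
  show "zono n Z = {x \<in> flat n Z. \<forall>A\<in>{A. A \<subseteq> {1..n} \<and> 0 < crossings Z A}. 0 \<le> crossings Z A - mass x A}"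
  proof (intro equalityI subsetI)
    fix x assume x: "x \<in> zono n Z"
    then show "x \<in> {x \<in> flat n Z. \<forall>A\<in>{A. A \<subseteq> {1..n} \<and> 0 < crossings Z A}. 0 \<le> crossings Z A - mass x A}"
      using mass_closed[OF Z x] by (simp add: flat_def zono_def)
  next
    fix x assume x: "x \<in> {x \<in> flat n Z. \<forall>A\<in>{A. A \<subseteq> {1..n} \<and> 0 < crossings Z A}. 0 \<le> crossings Z A - mass x A}"
    have "mass x A \<le> crossings Z A" if A: "A \<subseteq> {1..n}" for A
    proof (cases "crossings Z A = 0")
      case True
      then show ?thesis using x A by (simp add: flat_def)
    next
      case False
      then have "0 < crossings Z A" using crossings_nonneg[of Z A] by simp
      then show ?thesis using x A by simp
    qed
    moreover have "crossings Z {1..n} = 0"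
      using block_orderD(1)[OF Z] by (intro crossings_zero) auto
    ultimately show "x \<in> zono n Z" using x by (auto simp: flat_def zono_def)
  qed
  then show "zono_int n Z = {x \<in> flat n Z. \<forall>A\<in>{A. A \<subseteq> {1..n} \<and> 0 < crossings Z A}. 0 < crossings Z A - mass x A}"
    by (auto simp: zono_int_def intro: less_imp_le)
qed

lemma subspace_flat: "subspace (flat n Z)"
  by (rule subspaceI)
    (auto simp: flat_def mass_add mass_scaleR intro!: keys_add_subset keys_scaleR_subset del: subsetI)

lemma zero_zono_int: "block_order n Z \<Longrightarrow> 0 \<in> zono_int n Z"
  unfolding zono_flat(2) using subspace_0[OF subspace_flat] by auto

text \<open>Strict inequalities are relatively open. Conversely, if one of them is an equality at
  \<open>v\<close>, the segment from the strict solution \<open>p\<close> to \<open>v\<close> leaves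
  \<open>S\<close> as soon as it is prolonged beyond \<open>v\<close>. The setting is that of normed
  spaces, since the vectors to which it is applied form an infinite-dimensional space.\<close>

lemma rel_interior_inequalities:
  fixes g :: "'i \<Rightarrow> 'a::real_normed_vector \<Rightarrow> real"
  assumes S: "S = {v \<in> L. \<forall>i\<in>I. 0 \<le> g i v}" and L: "affine L" and I: "finite I"
    and cont: "\<And>i. i \<in> I \<Longrightarrow> continuous_on UNIV (g i)"
    and aff: "\<And>i u v t. i \<in> I \<Longrightarrow> g i ((1 - t) *\<^sub>R u + t *\<^sub>R v) = (1 - t) * g i u + t * g i v"
    and p: "p \<in> L" "\<And>i. i \<in> I \<Longrightarrow> 0 < g i p"
  shows "rel_interior S = {v \<in> L. \<forall>i\<in>I. 0 < g i v}"
proof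
  have SL: "affine hull S \<subseteq> L" using L S by (intro hull_minimal) auto
  have pS: "p \<in> S" using p S by (auto intro: less_imp_le)
  show "{v \<in> L. \<forall>i\<in>I. 0 < g i v} \<subseteq> rel_interior S"
  proof
    fix v assume v: "v \<in> {v \<in> L. \<forall>i\<in>I. 0 < g i v}"
    have "open (\<Inter>i\<in>I. {w. 0 < g i w})"
      using I cont by (intro open_INT ballI open_Collect_less continuous_intros) auto
    then have "openin (top_of_set (affine hull S)) (affine hull S \<inter> (\<Inter>i\<in>I. {w. 0 < g i w}))"
      by (rule openin_open_Int)
    moreover have "affine hull S \<inter> (\<Inter>i\<in>I. {w. 0 < g i w}) \<subseteq> S"
      using SL by (auto simp: S less_imp_le subset_iff)
    moreover have "v \<in> affine hull S" using v S by (intro hull_inc) (auto intro: less_imp_le)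
    ultimately show "v \<in> rel_interior S" using v unfolding rel_interior_def by blast
  qed
  show "rel_interior S \<subseteq> {v \<in> L. \<forall>i\<in>I. 0 < g i v}"
  proof
    fix v assume "v \<in> rel_interior S"
    then obtain U where U: "open U" "v \<in> U" "affine hull S \<inter> U \<subseteq> S" "v \<in> affine hull S"
      unfolding rel_interior_def by (auto simp: openin_open)
    then have vS: "v \<in> S" by blast
    have "0 < g i v" if i: "i \<in> I" for i
    proof (rule ccontr)
      assume "\<not> 0 < g i v"
      then have gv: "g i v = 0" using vS i by (force simp: S)
      \<comment> \<open>Negative \<open>t\<close> continues the segment from \<open>p\<close> beyond
        \<open>v\<close>.\<close>
      define h where "h t = (1 - t) *\<^sub>R v + t *\<^sub>R p" for t
      have "continuous_on UNIV h" unfolding h_def by (intro continuous_intros)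
      then have "open (h -` U)" using U(1) by (simp add: continuous_on_open_vimage)
      moreover have "0 \<in> h -` U" using U(2) by (simp add: h_def)
      ultimately obtain e where e: "0 < e" "ball 0 e \<subseteq> h -` U" by (meson open_contains_ball)
      then have "- e / 2 \<in> h -` U" by (auto simp: subset_iff dist_norm)
      then have "h (- e / 2) \<in> U" by simp
      moreover have "h (- e / 2) \<in> affine hull S"
        unfolding h_def using U(4) hull_inc[OF pS, of affine]
        by (intro mem_affine[OF affine_affine_hull]) auto
      ultimately have "0 \<le> g i (h (- e / 2))" using U(3) i by (auto simp: S)
      also have "g i (h (- e / 2)) = (- e / 2) * g i p"
        unfolding h_def aff[OF i] using gv by simp
      also have "\<dots> < 0" using e(1) p(2)[OF i] by (simp add: mult_neg_pos)
      finally show False by simp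
    qed
    then show "v \<in> {v \<in> L. \<forall>i\<in>I. 0 < g i v}" using vS by (simp add: S)
  qed
qed

text \<open>Meant for the two coordinate changes that lead from the given cells to
  \<open>zono\<close>: the linear map \<open>cvec\<close>, and scaling followed by a translation.
  The point \<open>p\<close> lies over the centre.\<close>

lemma rel_interior_zono_vimage:
  fixes F :: "'a::real_normed_vector \<Rightarrow> nat geom"
  assumes Z: "block_order n Z" and cont: "\<And>c. continuous_on UNIV (\<lambda>v. Poly_Mapping.lookup (F v) c)"
    and aff: "\<And>u v t. F ((1 - t) *\<^sub>R u + t *\<^sub>R v) = (1 - t) *\<^sub>R F u + t *\<^sub>R F v" and p: "F p = 0"
  shows "rel_interior (F -` zono n Z) = F -` zono_int n Z"
proof -
  let ?I = "{A. A \<subseteq> {1..n} \<and> 0 < crossings Z A}"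
  have "rel_interior (F -` zono n Z) = {v \<in> F -` flat n Z. \<forall>A\<in>?I. 0 < crossings Z A - mass (F v) A}"
  proof (rule rel_interior_inequalities[where p = p])
    show "F -` zono n Z = {v \<in> F -` flat n Z. \<forall>A\<in>?I. 0 \<le> crossings Z A - mass (F v) A}"
      unfolding zono_flat(1)[OF Z] by auto
    have "affine (flat n Z)" by (rule subspace_imp_affine[OF subspace_flat])
    then show "affine (F -` flat n Z)"
      using aff unfolding affine_alt by simp
    show "finite ?I" by (rule finite_subset[of _ "Pow {1..n}"]) auto
    show "continuous_on UNIV (\<lambda>v. crossings Z A - mass (F v) A)" for A
      unfolding mass_def by (intro continuous_intros cont)
    show "crossings Z A - mass (F ((1 - t) *\<^sub>R u + t *\<^sub>R v)) A =
        (1 - t) * (crossings Z A - mass (F u) A) + t * (crossings Z A - mass (F v) A)" for A t u v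
      unfolding aff mass_add mass_scaleR by (simp add: algebra_simps)
    show "p \<in> F -` flat n Z" using subspace_0[OF subspace_flat] p by simp
    show "0 < crossings Z A - mass (F p) A" if "A \<in> ?I" for A using that p by simp
  qed
  also have "\<dots> = F -` zono_int n Z" unfolding zono_flat(2)[OF Z] by auto
  finally show ?thesis .
qed

section \<open>Covering differences as a basis of the linear hull\<close>

lemma dvec_add: "dvec a b + dvec b c = dvec a c"
  by (simp add: dvec_def)

lemma flat_subset_span:
  assumes Z: "block_order n Z" and x: "x \<in> flat n Z"
  shows "x \<in> span ((\<lambda>(a, b). dvec a b) ` cover Z)"
proof -
  let ?V = "span ((\<lambda>(a, b). dvec a b) ` cover Z)"
  have V: "dvec a b \<in> ?V" if "(a, b) \<in> (cover Z)\<^sup>+" for a b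
    using that
  proof (induction rule: trancl_induct)
    case (base b) then show ?case by (intro span_base) force
  next
    case (step b c)
    then have "dvec b c \<in> ?V" by (intro span_base) force
    from span_add[OF step.IH this] show ?case by (simp add: dvec_add)
  qed
  have V': "dvec a b \<in> ?V" if ab: "a = b \<or> (a, b) \<in> comparability Z" for a b
  proof -
    consider "a = b" | "(a, b) \<in> Z" | "(b, a) \<in> Z" using ab by (auto simp: comparability_iff)
    then show ?thesis
    proof cases
      case 1
      then have "dvec a b = 0" by (simp add: dvec_def)
      then show ?thesis by (simp only: span_zero)
    next
      case 2
      then show ?thesis using V[of a b] block_order_trancl_cover[OF Z] by simp
    next
      case 3
      then have "- dvec b a \<in> ?V" using V[of b a] block_order_trancl_cover[OF Z] by (intro span_neg) simp
      then show ?thesis by (simp add: dvec_def)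
    qed
  qed
  \<comment> \<open>One representative for each block. The vector is expanded in the differences
    between an element and its representative; the representatives drop out, because every block has
    mass zero.\<close>
  define r where "r i = Min (block_of Z i)" for i
  have r: "i = r i \<or> (i, r i) \<in> comparability Z" if "i \<in> {1..n}" for i
  proof -
    have "r i \<in> block_of Z i"
      unfolding r_def using finite_subset[OF block_of_subset[OF Z that]]
      by (intro Min_in) (auto simp: block_of_def)
    then show ?thesis using comparability_sym[of "r i" i Z] by (auto simp: block_of_def)
  qed
  have r_eq: "r a = r b" if "(a, b) \<in> Z" for a b
  proof -
    have c: "(a, b) \<in> comparability Z" "(b, a) \<in> comparability Z" using that by (auto simp: comparability_iff)
    have "block_of Z a = block_of Z b"
    proof (intro equalityI subsetI)
      show "d \<in> block_of Z b" if "d \<in> block_of Z a" for d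
        using that c block_orderD(7)[OF Z _ c(1), of d] by (auto simp: block_of_def)
      show "d \<in> block_of Z a" if "d \<in> block_of Z b" for d
        using that c block_orderD(7)[OF Z _ c(2), of d] by (auto simp: block_of_def)
    qed
    then show ?thesis by (simp add: r_def)
  qed
  have zero: "(\<Sum>i\<in>{1..n}. Poly_Mapping.lookup x i * of_bool (r i = c)) = 0" for c
  proof -
    have "crossings Z {i \<in> {1..n}. r i = c} = 0"
    proof (rule crossings_zero)
      fix i j assume ij: "(i, j) \<in> Z"
      then have "i \<in> {1..n}" "j \<in> {1..n}" using block_orderD(1)[OF Z] by auto
      then show "i \<in> {i \<in> {1..n}. r i = c} \<longleftrightarrow> j \<in> {i \<in> {1..n}. r i = c}" using r_eq[OF ij] by simp
    qed
    moreover have "{i \<in> {1..n}. r i = c} \<subseteq> {1..n}" by blast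
    ultimately have "mass x {i \<in> {1..n}. r i = c} = 0" using x by (simp only: flat_def mem_Collect_eq)
    moreover have "mass x {i \<in> {1..n}. r i = c} = (\<Sum>i\<in>{1..n}. Poly_Mapping.lookup x i * of_bool (r i = c))"
      unfolding mass_def by (rule sum.mono_neutral_cong_left) auto
    ultimately show ?thesis by simp
  qed
  have "x = (\<Sum>i\<in>{1..n}. Poly_Mapping.lookup x i *\<^sub>R dvec i (r i))"
  proof (rule poly_mapping_eqI)
    fix c
    have "Poly_Mapping.lookup (\<Sum>i\<in>{1..n}. Poly_Mapping.lookup x i *\<^sub>R dvec i (r i)) c =
        (\<Sum>i\<in>{1..n}. Poly_Mapping.lookup x i * of_bool (i = c)) -
        (\<Sum>i\<in>{1..n}. Poly_Mapping.lookup x i * of_bool (r i = c))"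
      by (simp add: lookup_sum lookup_dvec right_diff_distrib sum_subtractf)
    also have "\<dots> = (\<Sum>i\<in>{1..n}. Poly_Mapping.lookup x i * of_bool (i = c))" using zero by simp
    also have "\<dots> = Poly_Mapping.lookup x c"
    proof (cases "c \<in> {1..n}")
      case True
      then have "(\<Sum>i\<in>{1..n}. Poly_Mapping.lookup x i * of_bool (i = c)) =
          (\<Sum>i\<in>{c}. Poly_Mapping.lookup x i * of_bool (i = c))"
        by (intro sum.mono_neutral_right) auto
      then show ?thesis by simp
    next
      case False
      then have "Poly_Mapping.lookup x c = 0" using x by (auto simp: flat_def in_keys_iff)
      moreover have "(\<Sum>i\<in>{1..n}. Poly_Mapping.lookup x i * of_bool (i = c)) = 0"
        using False by (intro sum.neutral) auto
      ultimately show ?thesis by simp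
    qed
    finally show "Poly_Mapping.lookup x c =
      Poly_Mapping.lookup (\<Sum>i\<in>{1..n}. Poly_Mapping.lookup x i *\<^sub>R dvec i (r i)) c" by simp
  qed
  also have "\<dots> \<in> ?V" using r V' by (intro span_sum span_scale) blast
  finally show ?thesis .
qed

lemma dvec_flat:
  assumes Z: "block_order n Z" and ab: "(a, b) \<in> Z" shows "dvec a b \<in> flat n Z"
proof -
  have "mass (dvec a b) A = 0" if "A \<subseteq> {1..n}" "crossings Z A = 0" for A
    using crossings_zeroD[OF block_orderD(2)[OF Z] that(2) ab] finite_subset[OF that(1)]
    by (simp add: mass_dvec)
  then show ?thesis using keys_dvec[of a b] ab block_orderD(1)[OF Z] unfolding flat_def by blast
qed

lemma span_dvec_cover:
  assumes Z: "block_order n Z"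
  shows "span ((\<lambda>(a, b). dvec a b) ` cover Z) = flat n Z"
proof
  show "span ((\<lambda>(a, b). dvec a b) ` cover Z) \<subseteq> flat n Z"
    using dvec_flat[OF Z] cover_subset[of Z] by (intro span_minimal subspace_flat) auto
qed (use flat_subset_span[OF Z] in blast)

text \<open>The partial sums along the blocks are coordinates with respect to the covering differences.\<close>

lemma mass_down_cover:
  assumes Z: "block_order n Z" and ab: "(a, b) \<in> cover Z" and cd: "(c, d) \<in> cover Z"
  shows "mass (dvec c d) {e. e = a \<or> (e, a) \<in> Z} = of_bool ((c, d) = (a, b))"
proof -
  have fin: "finite {e. e = a \<or> (e, a) \<in> Z}"
    by (rule finite_subset[of _ "insert a {1..n}"]) (use block_orderD(1)[OF Z] in auto)
  have Z': "(a, b) \<in> Z" "(c, d) \<in> Z" using ab cd cover_subset by blast+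
  have "(c, d) = (a, b)" if "c = a \<or> (c, a) \<in> Z" "\<not> (d = a \<or> (d, a) \<in> Z)"
  proof -
    have "c = a"
    proof (rule ccontr)
      assume "c \<noteq> a"
      then have ca: "(c, a) \<in> Z" using that by simp
      then have "a = d \<or> (a, d) \<in> comparability Z"
        using block_orderD(7)[OF Z, of a c d] Z' by (simp add: comparability_iff)
      then have "(a, d) \<in> Z" using that(2) by (auto simp: comparability_iff)
      then show False using ca cd by (auto simp: cover_def)
    qed
    then have "b = d \<or> (b, d) \<in> comparability Z"
      using block_orderD(7)[OF Z, of b a d] Z' by (simp add: comparability_iff)
    then show ?thesis using ab cd \<open>c = a\<close> Z' by (auto simp: cover_def comparability_iff)
  qed
  moreover have "(d, a) \<in> Z \<Longrightarrow> (c, a) \<in> Z" "d = a \<Longrightarrow> (c, a) \<in> Z"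
    using Z' block_orderD(5)[OF Z] by blast+
  moreover have "b \<noteq> a" "(b, a) \<notin> Z" using Z'(1) block_orderD(3,6)[OF Z] by blast+
  ultimately have "(c \<in> {e. e = a \<or> (e, a) \<in> Z}) = (d \<in> {e. e = a \<or> (e, a) \<in> Z}) \<or> (c, d) = (a, b)"
    "b \<notin> {e. e = a \<or> (e, a) \<in> Z}" by blast+
  then show ?thesis unfolding mass_dvec[OF fin] by (cases "(c, d) = (a, b)") auto
qed

lemma dvec_cover_coordinates:
  assumes Z: "block_order n Z" and ab: "(a, b) \<in> cover Z"
  shows "mass (\<Sum>(c, d)\<in>cover Z. t (c, d) *\<^sub>R dvec c d) {e. e = a \<or> (e, a) \<in> Z} = t (a, b)"
proof -
  have fin: "finite (cover Z)" using finite_subset[OF cover_subset block_orderD(2)[OF Z]] .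
  have "mass (\<Sum>(c, d)\<in>cover Z. t (c, d) *\<^sub>R dvec c d) {e. e = a \<or> (e, a) \<in> Z} =
      (\<Sum>q\<in>cover Z. if q = (a, b) then t q else 0)"
    unfolding mass_sum using mass_down_cover[OF Z ab]
    by (intro sum.cong) (auto simp: mass_scaleR case_prod_unfold)
  then show ?thesis using fin ab by simp
qed

section \<open>CW-complexes as quotients of compact spaces\<close>

lemma cw_complexI:
  assumes "Hausdorff_space (space_of K)" "(\<Union>k. \<Union> (cells_of K k)) = topspace (space_of K)"
    and disj: "\<And>k l e f. e \<in> cells_of K k \<Longrightarrow> f \<in> cells_of K l \<Longrightarrow> e \<inter> f \<noteq> {} \<Longrightarrow> k = l \<and> e = f"
    and "\<And>k e. e \<in> cells_of K k \<Longrightarrow> \<exists>\<phi>. continuous_map (closed_disc k) (space_of K) \<phi> \<and>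
        homeomorphic_map (open_disc k) (subtopology (space_of K) e) \<phi> \<and>
        (\<exists>F. finite F \<and> F \<subseteq> (\<Union>j<k. cells_of K j) \<and>
          \<phi> ` (topspace (closed_disc k) - topspace (open_disc k)) \<subseteq> \<Union>F)"
    and "\<And>A. A \<subseteq> topspace (space_of K) \<Longrightarrow>
        (\<forall>k. \<forall>e\<in>cells_of K k. closedin (space_of K) (A \<inter> (space_of K closure_of e))) \<Longrightarrow>
        closedin (space_of K) A"
  shows "cw_complex K"
  unfolding cw_complex_def
proof (intro conjI)
  show "\<forall>k l. \<forall>e\<in>cells_of K k. \<forall>f\<in>cells_of K l. e \<inter> f \<noteq> {} \<longrightarrow> k = l \<and> e = f"
    by (intro allI ballI impI disj)
qed (use assms in simp_all)

lemma cw_complex_transfer: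
  assumes M: "cw_complex M" and h: "homeomorphic_map (space_of M) (space_of K) h"
    and cells: "\<And>k. cells_of K k = (`) h ` cells_of M k"
  shows "cw_complex K"
proof -
  let ?M = "space_of M" and ?K = "space_of K"
  note M' = M[unfolded cw_complex_def]
  note haus = M'[THEN conjunct1] and un = M'[THEN conjunct2, THEN conjunct1]
    and disj = M'[THEN conjunct2, THEN conjunct2, THEN conjunct1, rule_format]
    and char = M'[THEN conjunct2, THEN conjunct2, THEN conjunct2, THEN conjunct1, rule_format]
    and weak = M'[THEN conjunct2, THEN conjunct2, THEN conjunct2, THEN conjunct2, rule_format]
  have inj: "inj_on h (topspace ?M)" by (rule homeomorphic_imp_injective_map[OF h])
  have surj: "h ` topspace ?M = topspace ?K" by (rule homeomorphic_imp_surjective_map[OF h])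
  have sub: "e \<subseteq> topspace ?M" if "e \<in> cells_of M k" for e k using that un by blast
  have "?M homeomorphic_space ?K" using h homeomorphic_map_maps homeomorphic_space_def by metis
  then have 1: "Hausdorff_space ?K" using haus homeomorphic_Hausdorff_space by blast
  have 2: "(\<Union>k. \<Union> (cells_of K k)) = topspace ?K"
    unfolding cells surj[symmetric] un[symmetric] by blast
  have 3: "k = l \<and> e = f" if "e \<in> cells_of K k" "f \<in> cells_of K l" "e \<inter> f \<noteq> {}" for k l e f
  proof -
    obtain e' where e: "e = h ` e'" "e' \<in> cells_of M k"
      using \<open>e \<in> _\<close>[unfolded cells] by (rule imageE)
    obtain f' where f: "f = h ` f'" "f' \<in> cells_of M l"
      using \<open>f \<in> _\<close>[unfolded cells] by (rule imageE)
    have "h ` (e' \<inter> f') = h ` e' \<inter> h ` f'"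
      using inj sub[OF e(2)] sub[OF f(2)] by (rule inj_on_image_Int)
    then have "e' \<inter> f' \<noteq> {}" using that(3) e(1) f(1) by auto
    then show ?thesis using disj[OF e(2) f(2)] e(1) f(1) by blast
  qed
  have 4: "\<exists>\<phi>. continuous_map (closed_disc k) ?K \<phi> \<and>
      homeomorphic_map (open_disc k) (subtopology ?K e) \<phi> \<and>
      (\<exists>F. finite F \<and> F \<subseteq> (\<Union>j<k. cells_of K j) \<and>
        \<phi> ` (topspace (closed_disc k) - topspace (open_disc k)) \<subseteq> \<Union>F)"
    if eK: "e \<in> cells_of K k" for k e
  proof -
    obtain e' where e: "e = h ` e'" "e' \<in> cells_of M k" using eK[unfolded cells] by (rule imageE)
    obtain \<phi> F where \<phi>: "continuous_map (closed_disc k) ?M \<phi>"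
      "homeomorphic_map (open_disc k) (subtopology ?M e') \<phi>"
      and F: "finite F" "F \<subseteq> (\<Union>j<k. cells_of M j)"
        "\<phi> ` (topspace (closed_disc k) - topspace (open_disc k)) \<subseteq> \<Union>F"
      using char[OF e(2)] by (elim exE conjE)
    have "continuous_map (closed_disc k) ?K (h \<circ> \<phi>)"
      using continuous_map_compose[OF \<phi>(1) homeomorphic_imp_continuous_map[OF h]] .
    moreover have "homeomorphic_map (subtopology ?M e') (subtopology ?K e) h"
      using sub[OF e(2)] surj e(1)
      by (intro homeomorphic_map_subtopologies[OF h]) (metis Int_absorb1 image_mono)
    then have "homeomorphic_map (open_disc k) (subtopology ?K e) (h \<circ> \<phi>)"
      by (rule homeomorphic_map_compose[OF \<phi>(2)])
    moreover have "finite ((`) h ` F)" using F(1) by (rule finite_imageI)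
    moreover have "(`) h ` F \<subseteq> (\<Union>j<k. cells_of K j)"
      using image_mono[OF F(2), of "(`) h"] by (simp only: cells image_UN)
    moreover have "(h \<circ> \<phi>) ` (topspace (closed_disc k) - topspace (open_disc k)) \<subseteq> \<Union>((`) h ` F)"
      using image_mono[OF F(3), of h] unfolding image_comp[symmetric] image_Union by simp
    ultimately show ?thesis by (intro exI[of _ "h \<circ> \<phi>"] exI[of _ "(`) h ` F"] conjI)
  qed
  have 5: "closedin ?K A" if A: "A \<subseteq> topspace ?K"
    and cl: "\<forall>k. \<forall>e\<in>cells_of K k. closedin ?K (A \<inter> (?K closure_of e))" for A
  proof -
    define B where "B = {x \<in> topspace ?M. h x \<in> A}"
    have AB: "A = h ` B" using A surj by (auto simp: B_def)
    have BM: "B \<subseteq> topspace ?M" by (auto simp: B_def)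
    have "closedin ?M (B \<inter> (?M closure_of e))" if e: "e \<in> cells_of M k" for k e
    proof -
      have c: "?M closure_of e \<subseteq> topspace ?M" by (rule closure_of_subset_topspace)
      have "h ` (B \<inter> (?M closure_of e)) = A \<inter> (?K closure_of (h ` e))"
        unfolding homeomorphic_map_closure_of[OF h sub[OF e]] AB
        using inj BM c by (rule inj_on_image_Int)
      moreover have "h ` e \<in> cells_of K k" unfolding cells using e by (rule imageI)
      then have "closedin ?K (A \<inter> (?K closure_of (h ` e)))" using cl[rule_format] by blast
      ultimately show ?thesis
        unfolding homeomorphic_map_closedness_eq[OF h] using BM by auto
    qed
    then have "closedin ?M B" by (rule weak[OF BM])
    then show ?thesis using homeomorphic_map_closedness_eq[OF h] AB by blast
  qed
  show ?thesis using 1 2 3 4 5 by (rule cw_complexI)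
qed

lemma qclass_eq_iff: "qclass r x = qclass r y \<longleftrightarrow> equivclp r x y"
  unfolding qclass_def set_eq_iff mem_Collect_eq
  by (meson equivclp_refl equivclp_sym equivclp_trans)

text \<open>A continuous map from a compact space to a Hausdorff space is closed, so a surjective
  one is a quotient map. It descends to a homeomorphism as soon as its fibres are the classes of the
  generated equivalence.\<close>

lemma quotient_space_homeomorphic:
  assumes X: "compact_space X" and M: "Hausdorff_space M" and f: "continuous_map X M f"
    and surj: "f ` topspace X = topspace M"
    and r: "\<And>p q. r p q \<Longrightarrow> p \<in> topspace X \<and> q \<in> topspace X \<and> f p = f q"
    and eq: "\<And>p q. p \<in> topspace X \<Longrightarrow> q \<in> topspace X \<Longrightarrow> f p = f q \<Longrightarrow> equivclp r p q"
  obtains h where "homeomorphic_map (quotient_space X r) M h"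
    "\<And>p. p \<in> topspace X \<Longrightarrow> h (qclass r p) = f p"
proof -
  have r': "f p = f q" if "equivclp r p q" for p q
    using that by (induction rule: equivclp_induct) (use r in metis)+
  define h where "h c = f (SOME p. p \<in> topspace X \<and> qclass r p = c)" for c
  have hf: "h (qclass r p) = f p" if "p \<in> topspace X" for p
  proof -
    have "\<exists>q. q \<in> topspace X \<and> qclass r q = qclass r p" using that by blast
    then have "qclass r (SOME q. q \<in> topspace X \<and> qclass r q = qclass r p) = qclass r p"
      by (rule someI2_ex) simp
    then show ?thesis unfolding h_def qclass_eq_iff by (rule r')
  qed
  note q = quotient_map_quotient_space[of X r]
  have f': "continuous_map X M (h \<circ> qclass r)"
    using f by (rule continuous_map_eq) (simp add: hf)
  have "continuous_map (quotient_space X r) M h"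
    using continuous_compose_quotient_map_eq[OF q] f' by blast
  moreover have "quotient_map X M (h \<circ> qclass r)"
  proof (rule continuous_closed_imp_quotient_map[OF f'])
    show "closed_map X M (h \<circ> qclass r)" by (rule continuous_imp_closed_map[OF f' X M])
    show "(h \<circ> qclass r) ` topspace X = topspace M" using surj hf by (simp add: image_comp[symmetric])
  qed
  ultimately have "quotient_map (quotient_space X r) M h"
    using quotient_map_from_composition[OF quotient_imp_continuous_map[OF q]] by blast
  moreover have "inj_on h (topspace (quotient_space X r))"
    unfolding topspace_quotient_space
  proof (rule inj_onI, clarify)
    fix p q assume "p \<in> topspace X" "q \<in> topspace X" "h (qclass r p) = h (qclass r q)"
    then show "qclass r p = qclass r q" unfolding qclass_eq_iff using hf eq by simp
  qed
  ultimately show ?thesis using that[of h] hf by (simp add: homeomorphic_map_def)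
qed

text \<open>Both complexes inherit the CW axioms from \<open>M\<close> along the homeomorphisms,
  which also compose to the isomorphism between them.\<close>

lemma cw_isomorphic_via:
  assumes M: "cw_complex M"
    and h: "homeomorphic_map (space_of K) (space_of M) h" "\<And>k. (`) h ` cells_of K k = cells_of M k"
      "\<And>k. \<Union> (cells_of K k) \<subseteq> topspace (space_of K)"
    and g: "homeomorphic_map (space_of L) (space_of M) g" "\<And>k. (`) g ` cells_of L k = cells_of M k"
      "\<And>k. \<Union> (cells_of L k) \<subseteq> topspace (space_of L)"
  shows "cw_isomorphic K L"
proof -
  have inv: "\<exists>h'. homeomorphic_map (space_of M) (space_of N) h' \<and> (\<forall>k. cells_of N k = (`) h' ` cells_of M k)"
    if h: "homeomorphic_map (space_of N) (space_of M) h" "\<And>k. (`) h ` cells_of N k = cells_of M k"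
      "\<And>k. \<Union> (cells_of N k) \<subseteq> topspace (space_of N)" for N :: "'d cell_structure" and h
  proof -
    obtain h' where h': "homeomorphic_maps (space_of N) (space_of M) h h'"
      using h(1) homeomorphic_map_maps by blast
    have "h' ` h ` e = e" if "e \<in> cells_of N k" for e k
    proof -
      have "e \<subseteq> topspace (space_of N)" using that h(3) by blast
      then have "h' (h x) = x" if "x \<in> e" for x using h' that unfolding homeomorphic_maps_def by blast
      then show ?thesis by (simp add: image_image)
    qed
    then have "cells_of N k = (`) h' ` cells_of M k" for k
      unfolding h(2)[symmetric] image_image by simp
    then show ?thesis using h' homeomorphic_maps_map by blast
  qed
  obtain h' where h': "homeomorphic_map (space_of M) (space_of K) h'" "\<And>k. cells_of K k = (`) h' ` cells_of M k"
    using inv[OF h] by blast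
  obtain g' where g': "homeomorphic_map (space_of M) (space_of L) g'" "\<And>k. cells_of L k = (`) g' ` cells_of M k"
    using inv[OF g] by blast
  have "cw_complex K" "cw_complex L" using cw_complex_transfer[OF M] h' g' by blast+
  moreover have "homeomorphic_map (space_of K) (space_of L) (g' \<circ> h)"
    using homeomorphic_map_compose[OF h(1) g'(1)] .
  moreover have "(\<lambda>e. (g' \<circ> h) ` e) ` cells_of K k = cells_of L k" for k
    unfolding g'(2) h(2)[symmetric] image_image by (simp add: image_comp)
  ultimately show ?thesis unfolding cw_isomorphic_def by blast
qed

section \<open>The model complex\<close>

text \<open>All cells are placed in one space of functions on pairs, where the Hausdorff property is
  evident. The open cell of \<open>Z\<close> consists of functions whose first component is nonzero
  exactly on \<open>Z\<close>.\<close>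

definition model_complex :: "nat \<Rightarrow> (nat \<times> nat \<Rightarrow> real \<times> real) cell_structure" where
  "model_complex n =
     \<lparr> space_of = top_of_set (\<Union>Z\<in>{Z. block_order n Z}. psi n Z ` zono n Z),
       cells_of = (\<lambda>k. {psi n Z ` zono_int n Z | Z. block_order n Z \<and> card (cover Z) = k}) \<rparr>"

text \<open>The Minkowski functional of the polytope inside \<open>flat\<close>. Sets of cut zero
  contribute 0 by the convention for division, in accordance with their equations in
  \<open>flat\<close>; among them the empty set makes the maximum nonnegative.\<close>

definition gauge_fn :: "nat \<Rightarrow> (nat \<times> nat) set \<Rightarrow> nat geom \<Rightarrow> real" where
  "gauge_fn n Z x = Max ((\<lambda>A. mass x A / crossings Z A) ` Pow {1..n})"

lemma gauge_fn_ge: "A \<subseteq> {1..n} \<Longrightarrow> mass x A / crossings Z A \<le> gauge_fn n Z x"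
  unfolding gauge_fn_def by (rule Max_ge) auto

lemma gauge_fn_nonneg: "0 \<le> gauge_fn n Z x"
  using gauge_fn_ge[of "{}" n x Z] by (simp add: mass_def)

lemma gauge_fn_scaleR:
  assumes "0 \<le> r" shows "gauge_fn n Z (r *\<^sub>R x) = r * gauge_fn n Z x"
proof -
  have "gauge_fn n Z (r *\<^sub>R x) = Max ((*) r ` (\<lambda>A. mass x A / crossings Z A) ` Pow {1..n})"
    by (simp add: gauge_fn_def mass_scaleR image_image)
  also have "\<dots> = r * gauge_fn n Z x"
    unfolding gauge_fn_def using assms
    by (intro mono_Max_commute[symmetric]) (auto simp: mono_def mult_left_mono)
  finally show ?thesis .
qed

lemma zono_iff_gauge_fn:
  assumes Z: "block_order n Z" and x: "x \<in> flat n Z"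
  shows "x \<in> zono n Z \<longleftrightarrow> gauge_fn n Z x \<le> 1" "x \<in> zono_int n Z \<longleftrightarrow> gauge_fn n Z x < 1"
proof -
  have fin: "finite ((\<lambda>A. mass x A / crossings Z A) ` Pow {1..n})"
    "(\<lambda>A. mass x A / crossings Z A) ` Pow {1..n} \<noteq> {}" by auto
  have "mass x A / crossings Z A \<le> 1 \<longleftrightarrow> (0 < crossings Z A \<longrightarrow> 0 \<le> crossings Z A - mass x A)"
    "mass x A / crossings Z A < 1 \<longleftrightarrow> (0 < crossings Z A \<longrightarrow> 0 < crossings Z A - mass x A)" for A
    using crossings_nonneg[of Z A] by (auto simp: divide_simps)
  then show "x \<in> zono n Z \<longleftrightarrow> gauge_fn n Z x \<le> 1" "x \<in> zono_int n Z \<longleftrightarrow> gauge_fn n Z x < 1"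
    unfolding zono_flat[OF Z] gauge_fn_def Max_le_iff[OF fin] Max_less_iff[OF fin] using x by auto
qed

text \<open>This is boundedness of the polytope: if the gauge vanishes, the singletons show that no
  coordinate is positive, and the coordinates sum to zero.\<close>

lemma gauge_fn_pos:
  assumes Z: "block_order n Z" and x: "x \<in> flat n Z" "x \<noteq> 0"
  shows "0 < gauge_fn n Z x"
proof (rule ccontr)
  assume "\<not> 0 < gauge_fn n Z x"
  then have g: "gauge_fn n Z x = 0" using gauge_fn_nonneg[of n Z x] by simp
  have flat: "Poly_Mapping.keys x \<subseteq> {1..n}" "\<And>A. A \<subseteq> {1..n} \<Longrightarrow> crossings Z A = 0 \<Longrightarrow> mass x A = 0"
    using x(1) by (simp_all add: flat_def)
  have neg: "Poly_Mapping.lookup x i \<le> 0" if i: "i \<in> {1..n}" for i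
  proof (cases "crossings Z {i} = 0")
    case True
    then show ?thesis using flat(2)[of "{i}"] i by (simp add: mass_def)
  next
    case False
    then have "0 < crossings Z {i}" using crossings_nonneg[of Z "{i}"] by simp
    then show ?thesis using gauge_fn_ge[of "{i}" n x Z] g i by (simp add: mass_def divide_le_0_iff)
  qed
  have "crossings Z {1..n} = 0" using block_orderD(1)[OF Z] by (intro crossings_zero) auto
  then have "mass x {1..n} = 0" using flat(2) by simp
  then have "Poly_Mapping.lookup x i = 0" if "i \<in> {1..n}" for i
    using sum_nonneg_eq_0_iff[of "{1..n}" "\<lambda>i. - Poly_Mapping.lookup x i"] neg that
    by (simp add: mass_def sum_negf)
  then have "Poly_Mapping.lookup x i = 0" for i using flat(1) in_keys_iff[of i x] by blast
  then have "x = 0" by (intro poly_mapping_eqI) simp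
  then show False using x(2) by simp
qed

lemma continuous_on_Max_finite:
  fixes f :: "'i \<Rightarrow> 'a::topological_space \<Rightarrow> real"
  assumes "finite I" "I \<noteq> {}" "\<And>i. i \<in> I \<Longrightarrow> continuous_on S (f i)"
  shows "continuous_on S (\<lambda>x. Max ((\<lambda>i. f i x) ` I))"
  using assms
proof (induction I rule: finite_ne_induct)
  case (insert i I)
  have "continuous_on S (\<lambda>x. max (f i x) (Max ((\<lambda>i. f i x) ` I)))"
    using insert by (intro continuous_on_max) auto
  then show ?case using insert.hyps by simp
qed simp

lemma continuous_on_gauge_fn: "continuous_on S (gauge_fn n Z)"
  unfolding gauge_fn_def divide_inverse
  by (intro continuous_on_Max_finite continuous_on_mult continuous_on_mass continuous_on_const) auto

section \<open>Discs and characteristic maps\<close>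

definition disc_set :: "nat \<Rightarrow> (nat \<Rightarrow> real) set" where
  "disc_set k = {y. (\<forall>i\<ge>k. y i = 0) \<and> (\<Sum>i<k. y i ^ 2) \<le> 1}"

definition disc_int :: "nat \<Rightarrow> (nat \<Rightarrow> real) set" where
  "disc_int k = {y. (\<forall>i\<ge>k. y i = 0) \<and> (\<Sum>i<k. y i ^ 2) < 1}"

lemma disc_eq: "closed_disc k = top_of_set (disc_set k)" "open_disc k = top_of_set (disc_int k)"
  unfolding closed_disc_def open_disc_def Euclidean_space_def subtopology_subtopology
    euclidean_product_topology disc_set_def disc_int_def Collect_conj_eq by (rule refl)+

lemma continuous_on_coord [continuous_intros]: "continuous_on S (\<lambda>y :: nat \<Rightarrow> real. y i)"
  by (rule continuous_on_subset[OF continuous_on_product_coordinates subset_UNIV])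

text \<open>The disc is a closed subset of a product of compact intervals, all but finitely many of
  which are points.\<close>

lemma compact_disc_set: "compact (disc_set k)"
proof -
  let ?K = "Pi\<^sub>E UNIV (\<lambda>i. if i < k then {-1..1::real} else {0})"
  have "compactin (product_topology (\<lambda>i. euclidean) UNIV) ?K"
    unfolding compactin_PiE compactin_euclidean_iff by simp
  then have K: "compact ?K" by (simp add: euclidean_product_topology)
  have "closed {y :: nat \<Rightarrow> real. \<forall>i. k \<le> i \<longrightarrow> y i = 0}"
    by (intro closed_Collect_all closed_Collect_imp closed_Collect_eq continuous_intros) simp_all
  moreover have "closed {y :: nat \<Rightarrow> real. (\<Sum>i<k. y i ^ 2) \<le> 1}"
    by (intro closed_Collect_le continuous_intros)
  ultimately have "closed (disc_set k)" unfolding disc_set_def by (rule closed_Collect_conj)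
  moreover have "disc_set k \<subseteq> ?K"
  proof
    fix y assume y: "y \<in> disc_set k"
    have "y i \<in> {-1..1}" if "i < k" for i
    proof -
      have "y i ^ 2 \<le> (\<Sum>i<k. y i ^ 2)" using that by (intro member_le_sum) auto
      then have "y i ^ 2 \<le> 1" using y by (simp add: disc_set_def)
      then show ?thesis by (simp add: abs_square_le_1 abs_le_iff)
    qed
    then show "y \<in> ?K" using y by (auto simp: disc_set_def PiE_iff)
  qed
  ultimately show ?thesis using compact_Int_closed[OF K] by (metis inf.absorb_iff2)
qed

text \<open>A homeomorphism from the disc to the cell: instead of rescaling radially by the quotient of
  the two gauges, which is singular at the origin, divide by \<open>1 + \<mu> - \<nu>\<close>.\<close>

lemma characteristic_map:
  assumes Z: "block_order n Z"
  obtains f where "continuous_on (disc_set (card (cover Z))) f" "f ` disc_set (card (cover Z)) \<subseteq> zono n Z"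
    "f ` disc_int (card (cover Z)) = zono_int n Z" "inj_on f (disc_int (card (cover Z)))"
    "\<And>y. y \<in> disc_set (card (cover Z)) \<Longrightarrow> f y \<in> zono_int n Z \<longleftrightarrow> y \<in> disc_int (card (cover Z))"
proof -
  define k where "k = card (cover Z)"
  have fin: "finite (cover Z)" using finite_subset[OF cover_subset block_orderD(2)[OF Z]] .
  \<comment> \<open>The covering pairs are numbered to serve as coordinates; \<open>L\<close> below
    is then a linear isomorphism from the sequences supported below \<open>k\<close> onto
    \<open>flat\<close>.\<close>
  obtain e where e: "bij_betw e {0..<k} (cover Z)" unfolding k_def using ex_bij_betw_nat_finite[OF fin] by blast
  define E where "E q = inv_into {0..<k} e q" for q
  have E: "E q < k" "e (E q) = q" if "q \<in> cover Z" for q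
    using that e by (auto simp: E_def bij_betw_def inv_into_into f_inv_into_f)
      (metis atLeastLessThan_iff inv_into_into)
  have Ee: "E (e i) = i" "e i \<in> cover Z" if "i < k" for i
    using that e by (auto simp: E_def bij_betw_def)
  define L where "L y = (\<Sum>(a, b)\<in>cover Z. y (E (a, b)) *\<^sub>R dvec a b)" for y :: "nat \<Rightarrow> real"
  define \<nu> where "\<nu> y = sqrt (\<Sum>i<k. y i ^ 2)" for y :: "nat \<Rightarrow> real"
  define \<mu> where "\<mu> = gauge_fn n Z"
  define K where "K = {y :: nat \<Rightarrow> real. \<forall>i\<ge>k. y i = 0}"
  have L_flat: "L y \<in> flat n Z" for y
    unfolding L_def using dvec_flat[OF Z] cover_subset[of Z]
    by (intro subspace_sum[OF subspace_flat]) (auto intro: subspace_scale[OF subspace_flat])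
  have L_scale: "L (\<lambda>i. r * y i) = r *\<^sub>R L y" for r y
    unfolding L_def scaleR_sum_right by (rule sum.cong) auto
  have L_coord: "mass (L y) {c. c = fst (e i) \<or> (c, fst (e i)) \<in> Z} = y i" if "i < k" for y i
    using dvec_cover_coordinates[OF Z, of "fst (e i)" "snd (e i)" "\<lambda>q. y (E q)"] Ee[OF that]
    by (simp add: L_def)
  have L_inj: "y = y'" if "y \<in> K" "y' \<in> K" "L y = L y'" for y y'
  proof
    fix i show "y i = y' i"
      using L_coord[of i y] L_coord[of i y'] that by (cases "i < k") (auto simp: K_def)
  qed
  have L_surj: "\<exists>y\<in>K. L y = x" if "x \<in> flat n Z" for x
  proof -
    have inj: "inj_on (\<lambda>(a, b). dvec a b) (cover Z)"
    proof (rule inj_onI, clarify)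
      fix a b c d assume ab: "(a, b) \<in> cover Z" and cd: "(c, d) \<in> cover Z" and eq: "dvec a b = dvec c d"
      show "a = c \<and> b = d"
        using mass_down_cover[OF Z ab ab] mass_down_cover[OF Z ab cd] unfolding eq
        by (auto split: if_splits)
    qed
    have "x \<in> span ((\<lambda>(a, b). dvec a b) ` cover Z)" using that span_dvec_cover[OF Z] by simp
    then obtain u where u: "x = (\<Sum>v\<in>(\<lambda>(a, b). dvec a b) ` cover Z. u v *\<^sub>R v)"
      using span_finite[OF finite_imageI[OF fin]] by blast
    also have "\<dots> = (\<Sum>q\<in>cover Z. (\<lambda>v. u v *\<^sub>R v) ((\<lambda>(a, b). dvec a b) q))"
      using sum.reindex[OF inj, of "\<lambda>v. u v *\<^sub>R v"] by (simp only: comp_def)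
    also have "\<dots> = (\<Sum>(a, b)\<in>cover Z. u (dvec a b) *\<^sub>R dvec a b)"
      by (rule sum.cong) auto
    also have "\<dots> = L (\<lambda>i. if i < k then u (dvec (fst (e i)) (snd (e i))) else 0)"
      unfolding L_def
    proof (rule sum.cong, simp, clarify)
      fix a b assume "(a, b) \<in> cover Z"
      from E[OF this] show "u (dvec a b) *\<^sub>R dvec a b = (if E (a, b) < k
          then u (dvec (fst (e (E (a, b)))) (snd (e (E (a, b))))) else 0) *\<^sub>R dvec a b" by simp
    qed
    finally show ?thesis by (intro bexI[of _ "\<lambda>i. if i < k then u (dvec (fst (e i)) (snd (e i))) else 0"])
      (auto simp: K_def)
  qed
  have \<nu>_scale: "\<nu> (\<lambda>i. r * y i) = r * \<nu> y" if "0 \<le> r" for r y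
    using that by (simp add: \<nu>_def power_mult_distrib sum_distrib_left[symmetric] real_sqrt_mult)
  have \<nu>_nonneg: "0 \<le> \<nu> y" for y by (simp add: \<nu>_def sum_nonneg)
  have disc: "y \<in> disc_set k \<longleftrightarrow> y \<in> K \<and> \<nu> y \<le> 1" "y \<in> disc_int k \<longleftrightarrow> y \<in> K \<and> \<nu> y < 1" for y
    by (auto simp: disc_set_def disc_int_def K_def \<nu>_def)
  \<comment> \<open>On the sphere \<open>\<nu> y = 1\<close>, so \<open>d y\<close> is the gauge of
    \<open>L y\<close> and the image has gauge 1. At the origin \<open>d y = 1\<close>, so nothing
    degenerates there.\<close>
  define d where "d y = 1 + \<mu> (L y) - \<nu> y" for y
  define f where "f y = inverse (d y) *\<^sub>R L y" for y
  have d_pos: "0 < d y" if "y \<in> disc_set k" for y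
  proof (cases "\<nu> y < 1")
    case True
    then show ?thesis using gauge_fn_nonneg[of n Z "L y"] by (simp add: d_def \<mu>_def)
  next
    case False
    then have "\<nu> y = 1" using that by (simp add: disc)
    then have "y \<noteq> (\<lambda>_. 0)" by (auto simp: \<nu>_def)
    moreover have "L (\<lambda>_. 0) = 0" by (simp add: L_def case_prod_unfold)
    ultimately have "L y \<noteq> 0" using L_inj[of y "\<lambda>_. 0"] that by (auto simp: disc K_def)
    then show ?thesis using gauge_fn_pos[OF Z L_flat] \<open>\<nu> y = 1\<close> by (simp add: d_def \<mu>_def)
  qed
  have f_flat: "f y \<in> flat n Z" for y
    unfolding f_def by (rule subspace_scale[OF subspace_flat L_flat])
  have mu_f: "\<mu> (f y) = \<mu> (L y) / d y" if "y \<in> disc_set k" for y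
    using d_pos[OF that] by (simp add: f_def \<mu>_def gauge_fn_scaleR divide_inverse mult.commute)
  have f_zono: "f y \<in> zono n Z" if "y \<in> disc_set k" for y
    using mu_f[OF that] d_pos[OF that] that zono_iff_gauge_fn(1)[OF Z f_flat]
    by (simp add: \<mu>_def d_def disc)
  have f_int: "f y \<in> zono_int n Z \<longleftrightarrow> y \<in> disc_int k" if "y \<in> disc_set k" for y
    using mu_f[OF that] d_pos[OF that] that zono_iff_gauge_fn(2)[OF Z f_flat]
    by (simp add: \<mu>_def d_def disc)
  have "continuous_on (disc_set k) f"
  proof -
    have cL: "continuous_on S L" for S unfolding L_def case_prod_unfold by (intro continuous_intros)
    have "continuous_on S (\<lambda>y. \<mu> (L y))" for S
      unfolding \<mu>_def by (rule continuous_on_compose2[OF continuous_on_gauge_fn cL]) auto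
    then have "continuous_on S d" for S unfolding d_def \<nu>_def by (intro continuous_intros)
    moreover have "\<forall>y\<in>disc_set k. d y \<noteq> 0"
      by (intro ballI less_imp_neq[THEN not_sym] d_pos)
    ultimately have "continuous_on (disc_set k) (\<lambda>y. inverse (d y))" by (rule continuous_on_inverse)
    then show ?thesis unfolding f_def using cL by (rule continuous_on_scaleR)
  qed
  moreover have "inj_on f (disc_int k)"
  proof (rule inj_onI)
    \<comment> \<open>The way back from \<open>f y\<close>: \<open>z\<close> is recovered from
      \<open>L z = f y\<close>, and then \<open>d y\<close> as the reciprocal of an expression in
      \<open>f y\<close> and \<open>z\<close>.\<close>
    have *: "d y * (1 - \<mu> (f y) + \<nu> z) = 1" "L z = f y" "y = (\<lambda>i. d y * z i)" "z \<in> K"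
      if "y \<in> disc_set k" "z = (\<lambda>i. inverse (d y) * y i)" for y z
    proof -
      have dy: "0 < d y" by (rule d_pos[OF that(1)])
      have "\<nu> z = inverse (d y) * \<nu> y" unfolding that(2) using dy by (intro \<nu>_scale) simp
      then have "d y * \<nu> z = \<nu> y" using dy by simp
      moreover have "d y * \<mu> (f y) = \<mu> (L y)" using mu_f[OF that(1)] dy by simp
      moreover have "d y * (1 - \<mu> (f y) + \<nu> z) = d y - d y * \<mu> (f y) + d y * \<nu> z"
        by (simp add: algebra_simps)
      ultimately show "d y * (1 - \<mu> (f y) + \<nu> z) = 1" by (simp add: d_def)
      show "L z = f y" unfolding that(2) L_scale f_def ..
      show "y = (\<lambda>i. d y * z i)" unfolding that(2) using dy by (simp add: mult.assoc[symmetric])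
      show "z \<in> K" using that by (simp add: disc K_def)
    qed
    fix y y' assume y: "y \<in> disc_int k" and y': "y' \<in> disc_int k" and eq: "f y = f y'"
    have dy: "y \<in> disc_set k" "y' \<in> disc_set k" using y y' by (simp_all add: disc)
    define z where "z = (\<lambda>i. inverse (d y) * y i)"
    define z' where "z' = (\<lambda>i. inverse (d y') * y' i)"
    have "z = z'" using *(2,4)[OF dy(1) z_def] *(2,4)[OF dy(2) z'_def] eq L_inj by simp
    moreover have "d y = d y'"
      using *(1)[OF dy(1) z_def] *(1)[OF dy(2) z'_def] \<open>z = z'\<close> eq
      by (metis mult.commute mult_left_cancel mult_zero_left zero_neq_one)
    ultimately show "y = y'" using *(3)[OF dy(1) z_def] *(3)[OF dy(2) z'_def] by simp
  qed
  moreover have "f ` disc_int k = zono_int n Z"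
  proof
    show "f ` disc_int k \<subseteq> zono_int n Z" using f_int by (auto simp: disc)
    show "zono_int n Z \<subseteq> f ` disc_int k"
    proof
      fix x assume x: "x \<in> zono_int n Z"
      then have xf: "x \<in> flat n Z" using zono_flat(2)[OF Z] by blast
      have mu: "\<mu> x < 1" using x zono_iff_gauge_fn(2)[OF Z xf] by (simp add: \<mu>_def)
      obtain z where z: "z \<in> K" "L z = x" using L_surj[OF xf] by blast
      \<comment> \<open>The value of \<open>d\<close> forced by the identity in the injectivity
        proof.\<close>
      define c where "c = inverse (1 - \<mu> x + \<nu> z)"
      have c: "0 < c" "c * (1 - \<mu> x + \<nu> z) = 1" using mu \<nu>_nonneg[of z] by (simp_all add: c_def)
      define y where "y = (\<lambda>i. c * z i)"
      have Ly: "L y = c *\<^sub>R x" unfolding y_def L_scale z(2) ..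
      have nu_y: "\<nu> y = c * \<nu> z" unfolding y_def using c(1) by (intro \<nu>_scale) simp
      have "\<mu> (L y) = c * \<mu> x" using c(1) by (simp add: Ly \<mu>_def gauge_fn_scaleR)
      then have "d y = c" using c(2) nu_y by (simp add: d_def algebra_simps)
      then have "f y = x" using c(1) by (simp add: f_def Ly)
      moreover have "y \<in> disc_int k"
      proof -
        have "c * \<nu> z < c * (1 - \<mu> x + \<nu> z)" using c(1) mu by simp
        then show ?thesis using z(1) nu_y c(2) by (simp add: disc y_def K_def)
      qed
      ultimately show "x \<in> f ` disc_int k" by blast
    qed
  qed
  ultimately show ?thesis using that[of f] f_zono f_int unfolding k_def by blast
qed

text \<open>Equal comparability together with \<open>Z \<subseteq> T\<close> forces
  \<open>T = Z\<close>, so the translation is by the empty sum.\<close>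

lemma face_step_same: "face_step n Z x Z y \<Longrightarrow> y = x"
proof -
  assume "face_step n Z x Z y"
  then obtain T where T: "block_order n Z" "suborder n Z T" "comparability T = comparability Z"
    "y = x - osum (T - Z)" by (auto simp: face_step_def)
  have "T \<subseteq> Z"
  proof (rule subrelI)
    fix a b assume ab: "(a, b) \<in> T"
    then have "(b, a) \<notin> Z" using block_orderD(6)[OF suborderD(2)[OF T(2)]] suborderD(3)[OF T(2)] by blast
    moreover have "(a, b) \<in> comparability T" using ab by (simp add: comparability_iff)
    then have "(a, b) \<in> comparability Z" using T(3) by simp
    ultimately show "(a, b) \<in> Z" by (simp add: comparability_iff)
  qed
  then show ?thesis using T(4) by (simp add: Diff_eq_empty_iff[THEN iffD2] osum_def)
qed

lemma card_cover_orders: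
  assumes "block_order n Z" "T \<in> orders n Z" shows "card (cover T) = card (cover Z)"
proof -
  obtain u where u: "u \<in> block_perms n (comparability Z)" "map_prod u u ` Z = T"
    using ex_block_perm[OF assms(1)] assms(2) by (auto simp: orders_def)
  have "inj u" using permutes_inj[OF block_perms_permutes[OF u(1)]] .
  then have "cover T = map_prod u u ` cover Z" "inj (map_prod u u)"
    using cover_map_prod u(2) by (auto simp: prod.inj_map)
  then show ?thesis by (simp add: card_image inj_on_subset)
qed

text \<open>Covers of \<open>Y\<close> are covers of the arrangement \<open>T\<close>, which has as
  many covers as \<open>Z\<close>; if none were lost, \<open>Y\<close> would equal \<open>T\<close>
  and then \<open>Z\<close>. Since covers count dimensions, the boundary of a cell lies in cells of
  smaller dimension.\<close>

lemma face_step_card: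
  assumes "face_step n Z x Y y" "Y \<noteq> Z"
  shows "card (cover Y) < card (cover Z)"
proof -
  obtain T where T: "block_order n Z" "suborder n Y T" "comparability T = comparability Z" "Y \<subseteq> Z"
    using assms(1) by (auto simp: face_step_def)
  note o = suborderD(1,2)[OF T(2)]
  have "cover Y \<noteq> cover T"
  proof
    assume "cover Y = cover T"
    then have "Y = T" using block_order_trancl_cover o by metis
    have "Z \<subseteq> Y"
    proof (rule subrelI)
      fix a b assume ab: "(a, b) \<in> Z"
      then have "(a, b) \<in> comparability Z" by (simp add: comparability_iff)
      then have "(a, b) \<in> comparability Y" using T(3) \<open>Y = T\<close> by simp
      then show "(a, b) \<in> Y" using ab T(4) block_orderD(6)[OF T(1)] by (auto simp: comparability_iff)
    qed
    then show False using assms(2) T(4) by blast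
  qed
  then have "cover Y \<subset> cover T" using suborder_cover[OF T(2)] by blast
  then have "card (cover Y) < card (cover T)"
    using finite_subset[OF cover_subset block_orderD(2)[OF o(2)]] by (intro psubset_card_mono)
  then show ?thesis using card_cover_orders[OF T(1), of T] o T(3) by (simp add: orders_def)
qed

lemma psi_cell:
  assumes "block_order n Z" "x \<in> zono n Z"
  obtains Y y where "face_step n Z x Y y" "y \<in> zono_int n Y" "psi n Z x = psi n Y y"
  using ex_face_step_int[OF assms] psi_face_step by metis

text \<open>There are only finitely many cells, which settles the weak topology and the finiteness
  of boundaries. The remaining point is that a characteristic map is a homeomorphism from the open
  disc onto the open cell with its subspace topology.\<close>

lemma cw_complex_model: "cw_complex (model_complex n)"
proof -
  let ?P = "\<Union>Z\<in>{Z. block_order n Z}. psi n Z ` zono n Z"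
  let ?c = "\<lambda>k. {psi n Z ` zono_int n Z | Z. block_order n Z \<and> card (cover Z) = k}"
  have int_sub: "zono_int n Z \<subseteq> zono n Z" for Z by (auto simp: zono_int_def)
  have finB: "finite {Z. block_order n Z}"
    by (rule finite_subset[of _ "Pow ({1..n} \<times> {1..n})"]) (auto simp: block_order_def)
  have 1: "Hausdorff_space (top_of_set ?P)" by (simp add: Hausdorff_space_subtopology)
  let ?E = "(\<lambda>Z. psi n Z ` zono_int n Z) ` {Z. block_order n Z}"
  have E: "\<Union>?E = ?P"
  proof
    show "\<Union>?E \<subseteq> ?P" using int_sub by blast
    show "?P \<subseteq> \<Union>?E"
    proof clarify
      fix Z x assume Z: "block_order n Z" and x: "x \<in> zono n Z"
      obtain Y y where Y: "face_step n Z x Y y" "y \<in> zono_int n Y" "psi n Z x = psi n Y y"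
        using psi_cell[OF Z x] .
      then have "psi n Y ` zono_int n Y \<in> ?E" using face_step_zono(2)[OF Y(1)] by blast
      then show "psi n Z x \<in> \<Union>?E" using Y(2,3) by blast
    qed
  qed
  have "(\<Union>k. \<Union> (?c k)) = \<Union>?E" by blast
  then have un: "(\<Union>k. \<Union> (?c k)) = ?P" using E by (rule trans)
  have disj: "k = l \<and> e = f" if "e \<in> ?c k" "f \<in> ?c l" "e \<inter> f \<noteq> {}" for k l e f
  proof -
    obtain Z Y where Z: "e = psi n Z ` zono_int n Z" "block_order n Z" "card (cover Z) = k"
      and Y: "f = psi n Y ` zono_int n Y" "block_order n Y" "card (cover Y) = l" using \<open>e \<in> _\<close> \<open>f \<in> _\<close> by blast
    obtain x y where "x \<in> zono_int n Z" "y \<in> zono_int n Y" "psi n Z x = psi n Y y"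
      using \<open>e \<inter> f \<noteq> {}\<close> Z(1) Y(1) by blast
    then have "Z = Y" using psi_int_inj(1)[OF Z(2) _ Y(2)] by blast
    then show ?thesis using Z Y by blast
  qed
  have char: "\<exists>\<phi>. continuous_map (closed_disc k) (top_of_set ?P) \<phi> \<and>
      homeomorphic_map (open_disc k) (subtopology (top_of_set ?P) e) \<phi> \<and>
      (\<exists>F. finite F \<and> F \<subseteq> (\<Union>j<k. ?c j) \<and>
        \<phi> ` (topspace (closed_disc k) - topspace (open_disc k)) \<subseteq> \<Union>F)"
    if ec: "e \<in> ?c k" for k e
  proof -
    obtain Z where e: "e = psi n Z ` zono_int n Z" and Z: "block_order n Z" and k: "card (cover Z) = k"
      using ec by blast
    obtain f where f: "continuous_on (disc_set k) f" "f ` disc_set k \<subseteq> zono n Z"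
      "f ` disc_int k = zono_int n Z" "inj_on f (disc_int k)"
      "\<And>y. y \<in> disc_set k \<Longrightarrow> f y \<in> zono_int n Z \<longleftrightarrow> y \<in> disc_int k"
      using characteristic_map[OF Z] unfolding k by blast
    define \<phi> where "\<phi> = psi n Z \<circ> f"
    have sub: "disc_int k \<subseteq> disc_set k" by (auto simp: disc_set_def disc_int_def)
    have "continuous_on S (psi n Z)" for S
      by (intro continuous_on_coordinatewise_then_product continuous_on_psi[OF Z])
    then have "continuous_on (disc_set k) \<phi>" unfolding \<phi>_def using f(1) by (intro continuous_on_compose)
    moreover have "\<phi> ` disc_set k \<subseteq> ?P" using f(2) Z by (auto simp: \<phi>_def)
    ultimately have cont: "continuous_map (closed_disc k) (top_of_set ?P) \<phi>"
      unfolding disc_eq by (auto simp: continuous_map_subtopology_eu)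
    \<comment> \<open>The open disc is the full preimage of the cell, so the closed map restricts to
      a closed map between the two. A point of the sphere cannot land in the cell, because it
      descends to the interior for another block order.\<close>
    have pre: "{y \<in> topspace (closed_disc k). \<phi> y \<in> e} = disc_int k"
    proof
      show "disc_int k \<subseteq> {y \<in> topspace (closed_disc k). \<phi> y \<in> e}"
        using sub f(3) by (auto simp: disc_eq e \<phi>_def)
      show "{y \<in> topspace (closed_disc k). \<phi> y \<in> e} \<subseteq> disc_int k"
      proof
        fix y assume "y \<in> {y \<in> topspace (closed_disc k). \<phi> y \<in> e}"
        then have y: "y \<in> disc_set k" and "\<phi> y \<in> e" by (auto simp: disc_eq)
        then obtain x where x: "x \<in> zono_int n Z" "psi n Z (f y) = psi n Z x" by (auto simp: e \<phi>_def)
        obtain Y w where Y: "face_step n Z (f y) Y w" "w \<in> zono_int n Y" "psi n Z (f y) = psi n Y w"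
          using psi_cell[OF Z] f(2) y by blast
        have "Y = Z"
          using psi_int_inj(1)[OF face_step_zono(2)[OF Y(1)] Y(2) Z x(1)] x(2) Y(3) by simp
        then have "f y \<in> zono_int n Z" using Y(1,2) face_step_same by blast
        then show "y \<in> disc_int k" using f(5)[OF y] by simp
      qed
    qed
    have cpt: "compact_space (closed_disc k)"
      unfolding disc_eq using compact_disc_set by (simp add: compact_space_subtopology)
    have closed: "closed_map (subtopology (closed_disc k) (disc_int k)) (subtopology (top_of_set ?P) e) \<phi>"
      by (rule closed_map_restriction[OF continuous_imp_closed_map[OF cont cpt 1] pre])
    have od: "subtopology (closed_disc k) (disc_int k) = open_disc k"
      unfolding disc_eq using sub by (simp add: subtopology_subtopology Int_absorb1)
    have in_e: "\<phi> y \<in> e" if "y \<in> disc_int k" for y using that unfolding pre[symmetric] by simp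
    have cont': "continuous_map (subtopology (closed_disc k) (disc_int k)) (subtopology (top_of_set ?P) e) \<phi>"
    proof (rule continuous_map_into_subtopology)
      show "continuous_map (subtopology (closed_disc k) (disc_int k)) (top_of_set ?P) \<phi>"
        by (rule continuous_map_from_subtopology[OF cont])
      show "\<phi> \<in> topspace (subtopology (closed_disc k) (disc_int k)) \<rightarrow> e"
        unfolding topspace_subtopology using in_e by blast
    qed
    have "psi n Z ` zono n Z \<subseteq> ?P" using Z by blast
    then have eP: "e \<subseteq> ?P" unfolding e using image_mono[OF int_sub] by (rule subset_trans[rotated])
    have img_e: "\<phi> ` topspace (open_disc k) = topspace (subtopology (top_of_set ?P) e)"
      using f(3) eP unfolding disc_eq \<phi>_def e topspace_subtopology topspace_euclidean image_comp[symmetric]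
      by (simp only: Int_UNIV_left Int_absorb1)
    have inj: "inj_on \<phi> (topspace (open_disc k))"
    proof -
      have "inj_on (psi n Z) (f ` disc_int k)"
        unfolding f(3) using psi_int_inj(2)[OF Z _ Z] by (blast intro: inj_onI)
      then show ?thesis unfolding disc_eq \<phi>_def using f(4) by (simp add: comp_inj_on)
    qed
    have hom: "homeomorphic_map (open_disc k) (subtopology (top_of_set ?P) e) \<phi>"
      by (rule bijective_closed_imp_homeomorphic_map[OF cont'[unfolded od] closed[unfolded od] img_e inj])
    \<comment> \<open>All open cells of smaller dimension; they form a finite family.\<close>
    define F where "F = (\<lambda>Y. psi n Y ` zono_int n Y) ` {Y. block_order n Y \<and> card (cover Y) < k}"
    have F1: "finite F" unfolding F_def using finB by simp
    have F2: "F \<subseteq> (\<Union>j<k. ?c j)" unfolding F_def by blast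
    have F3: "\<phi> ` (topspace (closed_disc k) - topspace (open_disc k)) \<subseteq> \<Union>F"
    proof
      fix p assume "p \<in> \<phi> ` (topspace (closed_disc k) - topspace (open_disc k))"
      then obtain y where y: "y \<in> disc_set k" "y \<notin> disc_int k" "p = psi n Z (f y)"
        by (auto simp: disc_eq \<phi>_def)
      obtain Y w where Y: "face_step n Z (f y) Y w" "w \<in> zono_int n Y" "psi n Z (f y) = psi n Y w"
        using psi_cell[OF Z] f(2) y(1) by blast
      have "Y \<noteq> Z" using Y(1,2) face_step_same f(5)[OF y(1)] y(2) by blast
      then have "card (cover Y) < k" using face_step_card[OF Y(1)] k by simp
      then show "p \<in> \<Union>F" using Y face_step_zono(2)[OF Y(1)] y(3) unfolding F_def by blast
    qed
    show ?thesis by (intro exI[of _ \<phi>] exI[of _ F] conjI cont hom F1 F2 F3)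
  qed
  have weak: "closedin (top_of_set ?P) A" if A: "A \<subseteq> ?P"
    and cl: "\<And>k e. e \<in> ?c k \<Longrightarrow> closedin (top_of_set ?P) (A \<inter> (top_of_set ?P closure_of e))" for A
  proof -
    have fin: "finite ?E" using finB by simp
    have "closedin (top_of_set ?P) (A \<inter> (top_of_set ?P closure_of e))" if "e \<in> ?E" for e
      using that cl by blast
    then have "closedin (top_of_set ?P) (\<Union>e\<in>?E. A \<inter> (top_of_set ?P closure_of e))"
      using fin by (intro closedin_Union) auto
    \<comment> \<open>Every point of \<open>A\<close> lies in a cell and hence in its closure, so
      finitely many closed pieces make up \<open>A\<close>.\<close>
    moreover have "(\<Union>e\<in>?E. A \<inter> (top_of_set ?P closure_of e)) = A"
    proof
      show "A \<subseteq> (\<Union>e\<in>?E. A \<inter> (top_of_set ?P closure_of e))"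
      proof
        fix p assume "p \<in> A"
        then have "p \<in> \<Union>?E" unfolding E using A by (rule subsetD[rotated])
        then obtain e where e: "e \<in> ?E" "p \<in> e" by (rule UnionE)
        have "e \<subseteq> ?P" unfolding E[symmetric] using e(1) by (rule Union_upper)
        then have "e \<subseteq> top_of_set ?P closure_of e"
          by (intro closure_of_subset) (simp only: topspace_euclidean_subtopology)
        then have "p \<in> A \<inter> (top_of_set ?P closure_of e)" using e(2) \<open>p \<in> A\<close> by blast
        then show "p \<in> (\<Union>e\<in>?E. A \<inter> (top_of_set ?P closure_of e))" using e(1) by (rule UN_I[rotated])
      qed
    qed blast
    ultimately show ?thesis by simp
  qed
  show ?thesis
  proof (rule cw_complexI, unfold model_complex_def cell_structure.simps topspace_euclidean_subtopology)
    show "closedin (top_of_set ?P) A" if "A \<subseteq> ?P"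
      "\<forall>k. \<forall>e\<in>?c k. closedin (top_of_set ?P) (A \<inter> (top_of_set ?P closure_of e))" for A
      using that(1) by (rule weak) (use that(2) in blast)
  qed (fact 1 un disj char)+
qed

text \<open>The criterion applied to both complexes. Two things depend on the complex: generators
  identify only points with a common face step, and points with a common face step are linked by
  generators.\<close>

lemma model_quotient:
  fixes X :: "'p topology" and Zf :: "'p \<Rightarrow> (nat \<times> nat) set" and xf :: "'p \<Rightarrow> nat geom"
  assumes X: "compact_space X" and cont: "continuous_map X euclidean (\<lambda>p. psi n (Zf p) (xf p))"
    and pt: "\<And>p. p \<in> topspace X \<Longrightarrow> block_order n (Zf p) \<and> xf p \<in> zono n (Zf p)"
    and onto: "\<And>Z x. block_order n Z \<Longrightarrow> x \<in> zono n Z \<Longrightarrow>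
      \<exists>p\<in>topspace X. psi n (Zf p) (xf p) = psi n Z x"
    and r: "\<And>p q. r p q \<Longrightarrow> p \<in> topspace X \<and> q \<in> topspace X \<and>
      (\<exists>Y y. face_step n (Zf p) (xf p) Y y \<and> face_step n (Zf q) (xf q) Y y)"
    and eq: "\<And>p q Y y. p \<in> topspace X \<Longrightarrow> q \<in> topspace X \<Longrightarrow> face_step n (Zf p) (xf p) Y y \<Longrightarrow>
      face_step n (Zf q) (xf q) Y y \<Longrightarrow> equivclp r p q"
  obtains h where "homeomorphic_map (quotient_space X r) (space_of (model_complex n)) h"
    "\<And>p. p \<in> topspace X \<Longrightarrow> h (qclass r p) = psi n (Zf p) (xf p)"
proof -
  let ?P = "\<Union>Z\<in>{Z. block_order n Z}. psi n Z ` zono n Z"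
  have img: "(\<lambda>p. psi n (Zf p) (xf p)) ` topspace X = ?P"
  proof
    show "(\<lambda>p. psi n (Zf p) (xf p)) ` topspace X \<subseteq> ?P" using pt by blast
    show "?P \<subseteq> (\<lambda>p. psi n (Zf p) (xf p)) ` topspace X"
    proof clarify
      fix Z x assume "block_order n Z" "x \<in> zono n Z"
      then obtain p where "p \<in> topspace X" "psi n (Zf p) (xf p) = psi n Z x" using onto by blast
      then show "psi n Z x \<in> (\<lambda>p. psi n (Zf p) (xf p)) ` topspace X" by (intro image_eqI[OF sym])
    qed
  qed
  have cont': "continuous_map X (top_of_set ?P) (\<lambda>p. psi n (Zf p) (xf p))"
    by (rule continuous_map_into_subtopology[OF cont], unfold img[symmetric]) blast
  have eq': "equivclp r p q" if "p \<in> topspace X" "q \<in> topspace X" "psi n (Zf p) (xf p) = psi n (Zf q) (xf q)" for p q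
  proof -
    have "\<exists>Y y. face_step n (Zf p) (xf p) Y y \<and> face_step n (Zf q) (xf q) Y y \<and> y \<in> zono_int n Y"
      using psi_eq_iff[of n "Zf p" "xf p" "Zf q" "xf q"] pt[OF that(1)] pt[OF that(2)] that(3) by blast
    then show ?thesis using eq[OF that(1,2)] by blast
  qed
  have r': "p \<in> topspace X \<and> q \<in> topspace X \<and> psi n (Zf p) (xf p) = psi n (Zf q) (xf q)" if rpq: "r p q" for p q
  proof -
    obtain Y y where pq: "p \<in> topspace X" "q \<in> topspace X"
      and Y: "face_step n (Zf p) (xf p) Y y" "face_step n (Zf q) (xf q) Y y" using r[OF rpq] by blast
    then show ?thesis using psi_face_step[OF Y(1)] psi_face_step[OF Y(2)] by simp
  qed
  have haus: "Hausdorff_space (top_of_set ?P)" by (simp add: Hausdorff_space_subtopology)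
  have img': "(\<lambda>p. psi n (Zf p) (xf p)) ` topspace X = topspace (top_of_set ?P)" using img by simp
  show ?thesis
  proof (rule quotient_space_homeomorphic[OF X haus cont' img' r' eq'])
    fix h assume h: "homeomorphic_map (quotient_space X r) (top_of_set ?P) h"
      "\<And>p. p \<in> topspace X \<Longrightarrow> h (qclass r p) = psi n (Zf p) (xf p)"
    show ?thesis by (rule that[of h]) (use h in \<open>simp_all add: model_complex_def\<close>)
  qed
qed

section \<open>The Coxeter group of type A\<close>

definition word_perm :: "nat list \<Rightarrow> nat \<Rightarrow> nat" where
  "word_perm w = prod_perms (map (\<lambda>s. Transposition.transpose s (Suc s)) w)"

lemma word_perm_Nil: "word_perm [] = id"
  and word_perm_Cons: "word_perm (s # w) = Transposition.transpose s (Suc s) \<circ> word_perm w"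
  and word_perm_append: "word_perm (u @ v) = word_perm u \<circ> word_perm v"
  by (simp_all only: word_perm_def list.map map_append prod_perms_simps prod_perms_append)

lemma bij_word_perm: "bij (word_perm w)"
proof (induction w)
  case Nil
  show ?case unfolding word_perm_Nil by (rule bij_id)
next
  case (Cons s w)
  then show ?case unfolding word_perm_Cons by (rule bij_comp) simp
qed

lemma word_perm_permutes:
  assumes "set w \<subseteq> {1..<n}" shows "word_perm w permutes {1..n}"
  using assms
proof (induction w)
  case Nil
  show ?case unfolding word_perm_Nil by (rule permutes_id)
next
  case (Cons s w)
  have "Transposition.transpose s (Suc s) permutes {1..n}"
    using Cons.prems by (intro permutes_swap_id) auto
  then show ?case using Cons unfolding word_perm_Cons by (intro permutes_compose) auto
qed

lemma type_A_simps: "nodes (type_A k) = {1..k}"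
  "label (type_A k) i j = (if i = j then 1 else if i = Suc j \<or> j = Suc i then 3 else 2)"
  by (simp_all add: type_A_def)

lemma type_A_label_cases:
  assumes "label (type_A k) s t = enat m"
  obtains "s = t" "m = 1" | "s = Suc t \<or> t = Suc s" "m = 3"
    | "s \<noteq> t" "s \<noteq> Suc t" "t \<noteq> Suc s" "m = 2"
  using assms unfolding type_A_simps one_enat_def numeral_eq_enat
  by (auto split: if_splits)

lemma word_perm_relator:
  assumes "label (type_A k) s t = enat m"
  shows "word_perm (concat (replicate m [s, t])) = id"
  using assms
proof (cases rule: type_A_label_cases)
  case 1
  then show ?thesis
    by (auto simp: word_perm_Cons word_perm_Nil fun_eq_iff)
next
  case 2
  have "concat (replicate 3 [s, t]) = [s, t, s, t, s, t]" by (simp add: numeral_3_eq_3)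
  moreover have "word_perm [s, t, s, t, s, t] x = x" for x
    using 2(1) unfolding word_perm_Cons word_perm_Nil
    by (auto simp: Transposition.transpose_def)
  ultimately show ?thesis using 2(2) by (simp add: fun_eq_iff)
next
  case 3
  have "concat (replicate 2 [s, t]) = [s, t, s, t]" by (simp add: numeral_2_eq_2)
  moreover have "word_perm [s, t, s, t] x = x" for x
    using 3(1-3) unfolding word_perm_Cons word_perm_Nil
    by (auto simp: Transposition.transpose_def)
  ultimately show ?thesis using 3(4) by (simp add: fun_eq_iff)
qed

lemma word_perm_cox_step: "cox_step (type_A k) u v \<Longrightarrow> word_perm u = word_perm v"
proof (induction rule: cox_step.induct)
  case (1 s t m u v)
  show ?case unfolding word_perm_append word_perm_relator[OF 1(3)] by simp
qed

lemma word_perm_equiv: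
  assumes "cox_class (type_A k) u = cox_class (type_A k) v"
  shows "word_perm u = word_perm v"
  using assms unfolding cox_class_eq_iff
  by (induction rule: equivclp_induct) (auto dest: word_perm_cox_step)

section \<open>Consequences of the Coxeter relations\<close>

lemma cox_class_ctx:
  "cox_class \<Gamma> u = cox_class \<Gamma> v \<Longrightarrow> cox_class \<Gamma> (a @ u @ b) = cox_class \<Gamma> (a @ v @ b)"
  unfolding cox_class_eq_iff by (rule cox_equiv_ctx)

lemma cox_class_relator:
  assumes "s \<in> nodes \<Gamma>" "t \<in> nodes \<Gamma>" "label \<Gamma> s t = enat m"
  shows "cox_class \<Gamma> (u @ concat (replicate m [s, t]) @ v) = cox_class \<Gamma> (u @ v)"
  unfolding cox_class_eq_iff by (intro r_into_equivclp cox_step.intros assms)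

lemma cox_square:
  assumes "s \<in> {1..k}"
  shows "cox_class (type_A k) (a @ [s, s] @ b) = cox_class (type_A k) (a @ b)"
  using cox_class_relator[of s "type_A k" s 1 a b] assms by (simp add: type_A_simps one_enat_def)

text \<open>A relator is inserted behind the given letters, after which squares cancel from the
  inside; the braid relation below is obtained in the same way.\<close>

lemma cox_commute:
  assumes s: "s \<in> {1..k}" and t: "t \<in> {1..k}" and "Suc s < t \<or> Suc t < s"
  shows "cox_class (type_A k) (a @ [s, t] @ b) = cox_class (type_A k) (a @ [t, s] @ b)"
proof -
  have "label (type_A k) t s = enat 2" using assms by (auto simp: type_A_simps numeral_eq_enat)
  from cox_class_relator[OF _ _ this, of "a @ [s, t]" b]
  have "cox_class (type_A k) (a @ [s, t] @ b) = cox_class (type_A k) (a @ [s, t, t, s, t, s] @ b)"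
    using s t by (simp add: type_A_simps numeral_2_eq_2)
  also have "\<dots> = cox_class (type_A k) (a @ [s, s, t, s] @ b)"
    using cox_square[OF t, of "a @ [s]" "[s, t, s] @ b"] by simp
  also have "\<dots> = cox_class (type_A k) (a @ [t, s] @ b)"
    using cox_square[OF s, of a "[t, s] @ b"] by simp
  finally show ?thesis .
qed

lemma cox_braid:
  assumes s: "s \<in> {1..k}" and t: "t \<in> {1..k}" and "s = Suc t"
  shows "cox_class (type_A k) (a @ [s, t, s] @ b) = cox_class (type_A k) (a @ [t, s, t] @ b)"
proof -
  have "label (type_A k) s t = enat 3" using assms by (auto simp: type_A_simps numeral_eq_enat)
  from cox_class_relator[OF _ _ this, of "a @ [s, t, s]" b]
  have "cox_class (type_A k) (a @ [s, t, s] @ b) = cox_class (type_A k) (a @ [s, t, s, s, t, s, t, s, t] @ b)"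
    using s t by (simp add: type_A_simps numeral_3_eq_3)
  also have "\<dots> = cox_class (type_A k) (a @ [s, t, t, s, t, s, t] @ b)"
    using cox_square[OF s, of "a @ [s, t]" "[t, s, t, s, t] @ b"] by simp
  also have "\<dots> = cox_class (type_A k) (a @ [s, s, t, s, t] @ b)"
    using cox_square[OF t, of "a @ [s]" "[s, t, s, t] @ b"] by simp
  also have "\<dots> = cox_class (type_A k) (a @ [t, s, t] @ b)"
    using cox_square[OF s, of a "[t, s, t] @ b"] by simp
  finally show ?thesis .
qed

lemma cox_commute_list:
  assumes "s \<in> {1..k}" "\<And>t. t \<in> set l \<Longrightarrow> t \<in> {1..k} \<and> (Suc s < t \<or> Suc t < s)"
  shows "cox_class (type_A k) (a @ l @ [s] @ b) = cox_class (type_A k) (a @ [s] @ l @ b)"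
  using assms(2)
proof (induction l arbitrary: a)
  case (Cons t l)
  have "cox_class (type_A k) (a @ (t # l) @ [s] @ b) = cox_class (type_A k) ((a @ [t]) @ l @ [s] @ b)" by simp
  also have "\<dots> = cox_class (type_A k) ((a @ [t]) @ [s] @ l @ b)" using Cons by (intro Cons.IH) simp
  also have "\<dots> = cox_class (type_A k) (a @ [t, s] @ l @ b)" by simp
  also have "\<dots> = cox_class (type_A k) (a @ [s, t] @ l @ b)"
    using Cons.prems[of t] assms(1) by (intro cox_commute) auto
  finally show ?case by simp
qed simp

text \<open>Normal forms: modulo the words in \<open>s\<^sub>1, \<dots>, s\<^sub>m\<^sub>-\<^sub>1\<close>, a word in \<open>s\<^sub>1, \<dots>, s\<^sub>m\<close> is one of the
  \<open>m + 1\<close> descending words \<open>s\<^sub>m \<dots> s\<^sub>j\<close>.\<close>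

lemma cox_normal_form:
  assumes "m \<le> k" "set w \<subseteq> {1..m}"
  shows "\<exists>w' j. set w' \<subseteq> {1..<m} \<and> j \<in> {1..Suc m} \<and>
    cox_class (type_A k) w = cox_class (type_A k) (w' @ rev [j..<Suc m])"
  using assms(2)
proof (induction w rule: rev_induct)
  case Nil
  show ?case by (intro exI[of _ "[]"] exI[of _ "Suc m"]) simp
next
  case (snoc s w)
  then obtain w' j where w': "set w' \<subseteq> {1..<m}" and j: "j \<in> {1..Suc m}"
    and eq: "cox_class (type_A k) w = cox_class (type_A k) (w' @ rev [j..<Suc m])" by auto
  have s: "s \<in> {1..m}" "s \<in> {1..k}" using snoc.prems assms(1) by auto
  have eq': "cox_class (type_A k) (w @ [s]) = cox_class (type_A k) (w' @ rev [j..<Suc m] @ [s])"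
    using cox_class_ctx[OF eq, of "[]" "[s]"] by simp
  consider "Suc s = j" | "s = j" | "Suc s < j" | "j < s" by linarith
  then show ?case
  proof cases
    case 1
    then have "rev [j..<Suc m] @ [s] = rev [s..<Suc m]"
      using s(1) upt_conv_Cons[of s "Suc m"] by (simp del: upt_Suc)
    then show ?thesis using eq' w' s(1) by (intro exI[of _ w'] exI[of _ s]) auto
  next
    case 2
    then have "w' @ rev [j..<Suc m] @ [s] = (w' @ rev [Suc s..<Suc m]) @ [s, s] @ []"
      using s(1) upt_conv_Cons[of s "Suc m"] by (simp del: upt_Suc)
    then have "cox_class (type_A k) (w @ [s]) = cox_class (type_A k) (w' @ rev [Suc s..<Suc m])"
      using eq' cox_square[OF s(2), of "w' @ rev [Suc s..<Suc m]" "[]"] by (simp del: upt_Suc)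
    then show ?thesis using w' s(1) by (intro exI[of _ w'] exI[of _ "Suc s"]) auto
  next
    case 3
    \<comment> \<open>Here \<open>s\<close> commutes with every letter of the descending word, so it
      passes to the left and is absorbed by \<open>w'\<close>.\<close>
    have "cox_class (type_A k) (w' @ rev [j..<Suc m] @ [s] @ []) =
        cox_class (type_A k) (w' @ [s] @ rev [j..<Suc m] @ [])"
      using 3 j assms(1) s(2) by (intro cox_commute_list) auto
    then have "cox_class (type_A k) (w @ [s]) = cox_class (type_A k) ((w' @ [s]) @ rev [j..<Suc m])"
      using eq' by (simp del: upt_Suc)
    moreover have "set (w' @ [s]) \<subseteq> {1..<m}" using w' 3 j s(1) by auto
    ultimately show ?thesis using j by blast
  next
    case 4
    \<comment> \<open>The descending word contains \<open>s\<close> followed by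
      \<open>r = s - 1\<close>. The appended \<open>s\<close> commutes up to these two letters, the
      braid relation turns \<open>s r s\<close> into \<open>r s r\<close>, and the first
      \<open>r\<close> commutes to the front, where it joins \<open>w'\<close>.\<close>
    define r where "r = s - 1"
    have sr: "s = Suc r" "j \<le> r" "r \<in> {1..<m}" "r \<in> {1..k}" using 4 j s assms(1) by (auto simp: r_def)
    have upt: "rev [j..<Suc m] = rev [Suc s..<Suc m] @ [s, r] @ rev [j..<r]"
    proof -
      have "[j..<Suc m] = [j..<r] @ [r..<Suc m]" using sr s(1) upt_add_eq_append[of j r "Suc m - r"] by (simp del: upt_Suc)
      moreover have "[r..<Suc m] = r # s # [Suc s..<Suc m]" 
        using sr s(1) upt_conv_Cons[of r "Suc m"] upt_conv_Cons[of s "Suc m"] by (simp del: upt_Suc)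
      ultimately show ?thesis by (simp del: upt_Suc)
    qed
    have "cox_class (type_A k) (w' @ rev [j..<Suc m] @ [s]) =
        cox_class (type_A k) ((w' @ rev [Suc s..<Suc m] @ [s, r]) @ rev [j..<r] @ [s] @ [])"
      unfolding upt by (simp del: upt_Suc)
    also have "\<dots> = cox_class (type_A k) ((w' @ rev [Suc s..<Suc m] @ [s, r]) @ [s] @ rev [j..<r] @ [])"
      using sr j s(2) by (intro cox_commute_list) auto
    also have "\<dots> = cox_class (type_A k) ((w' @ rev [Suc s..<Suc m]) @ [s, r, s] @ rev [j..<r])"
      by (simp del: upt_Suc)
    also have "\<dots> = cox_class (type_A k) ((w' @ rev [Suc s..<Suc m]) @ [r, s, r] @ rev [j..<r])"
      using cox_braid[OF s(2) sr(4,1)] .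
    also have "\<dots> = cox_class (type_A k) (w' @ rev [Suc s..<Suc m] @ [r] @ [s, r] @ rev [j..<r])"
      by (simp del: upt_Suc)
    also have "\<dots> = cox_class (type_A k) (w' @ [r] @ rev [Suc s..<Suc m] @ [s, r] @ rev [j..<r])"
      using sr assms(1) by (intro cox_commute_list) auto
    also have "\<dots> = cox_class (type_A k) ((w' @ [r]) @ rev [j..<Suc m])"
      unfolding upt by (simp del: upt_Suc)
    finally have "cox_class (type_A k) (w @ [s]) = cox_class (type_A k) ((w' @ [r]) @ rev [j..<Suc m])"
      using eq' by (simp del: upt_Suc)
    moreover have "set (w' @ [r]) \<subseteq> {1..<m}" using w' sr by auto
    ultimately show ?thesis using j by blast
  qed
qed

lemma word_perm_descending: "j \<le> m \<Longrightarrow> word_perm (rev [j..<m]) j = m"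
proof (induction m)
  case 0
  then show ?case by (simp add: word_perm_Nil)
next
  case (Suc m)
  show ?case
  proof (cases "j \<le> m")
    case True
    then have "rev [j..<Suc m] = m # rev [j..<m]" by simp
    then show ?thesis using Suc.IH[OF True] by (simp add: word_perm_Cons)
  next
    case False
    then show ?thesis using Suc.prems by (simp add: word_perm_Nil)
  qed
qed

text \<open>The descending word of the normal form sends \<open>j\<close> to the top point, which
  the prefix \<open>w'\<close> fixes. If the whole word acts trivially, then \<open>j\<close> is the
  top point itself, the descending word is empty, and the induction hypothesis applies to
  \<open>w'\<close>.\<close>

lemma word_perm_faithful:
  assumes "m \<le> k" "set w \<subseteq> {1..m}" "word_perm w = id"
  shows "cox_class (type_A k) w = cox_class (type_A k) []"
  using assms
proof (induction m arbitrary: w)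
  case 0
  then show ?case by simp
next
  case (Suc m)
  obtain w' j where w': "set w' \<subseteq> {1..<Suc m}" and j: "j \<in> {1..Suc (Suc m)}"
    and eq: "cox_class (type_A k) w = cox_class (type_A k) (w' @ rev [j..<Suc (Suc m)])"
    using cox_normal_form[OF Suc.prems(1,2)] by blast
  have wp: "word_perm w' permutes {1..Suc m}" by (rule word_perm_permutes[OF w'])
  have "id = word_perm w' \<circ> word_perm (rev [j..<Suc (Suc m)])"
    using word_perm_equiv[OF eq] unfolding word_perm_append Suc.prems(3) .
  then have "id j = (word_perm w' \<circ> word_perm (rev [j..<Suc (Suc m)])) j" by (rule fun_cong)
  also have "\<dots> = word_perm w' (word_perm (rev [j..<Suc (Suc m)]) j)" by (rule comp_apply)
  also have "\<dots> = word_perm w' (Suc (Suc m))" 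
    using word_perm_descending[of j "Suc (Suc m)"] j by (simp del: upt_Suc)
  also have "\<dots> = Suc (Suc m)" using permutes_not_in[OF wp] by simp
  finally have "cox_class (type_A k) w = cox_class (type_A k) w'" using eq by simp
  moreover have "word_perm w' = id" using word_perm_equiv[OF calculation] unfolding Suc.prems(3) by (rule sym)
  moreover have "set w' \<subseteq> {1..m}" using w' by auto
  ultimately show ?case using Suc.IH[of w'] Suc.prems(1) by simp
qed

text \<open>The representing word is chosen exactly as in \<open>act\<close>, so that equivariance
  in \<open>cvec_act\<close> can be proved word by word. Independence of the choice is
  \<open>hperm_cox_class\<close>.\<close>

definition hperm :: "nat list set \<Rightarrow> nat \<Rightarrow> nat" where
  "hperm g = word_perm (SOME w. w \<in> g)"

lemma hperm_cox_class: "hperm (cox_class (type_A k) w) = word_perm w"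
proof -
  have "(SOME v. v \<in> cox_class (type_A k) w) \<in> cox_class (type_A k) w"
    using cox_class_self by (rule someI)
  then have "cox_class (type_A k) w = cox_class (type_A k) (SOME v. v \<in> cox_class (type_A k) w)"
    unfolding cox_class_eq_iff by (simp add: cox_class_def qclass_def)
  then show ?thesis unfolding hperm_def using word_perm_equiv by metis
qed

abbreviation cox_A :: "nat \<Rightarrow> nat list set monoid" where
  "cox_A n \<equiv> coxeter_group (type_A (n - 1))"

lemma carrier_cox_A: "carrier (cox_A n) = cox_class (type_A (n - 1)) ` {w. set w \<subseteq> {1..<n}}"
proof -
  have "{1..n - 1} = {1..<n}" by auto
  then show ?thesis by (simp add: coxeter_group_def type_A_simps lists_eq_set)
qed

lemma group_cox_A: "group (cox_A n)"
  by (rule group_coxeter_group[OF coxeter_graph_type_A])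

lemma hperm_permutes: "g \<in> carrier (cox_A n) \<Longrightarrow> hperm g permutes {1..n}"
  by (auto simp: carrier_cox_A hperm_cox_class word_perm_permutes simp del: One_nat_def)

lemma hperm_mult:
  assumes "g \<in> carrier (cox_A n)" "h \<in> carrier (cox_A n)"
  shows "hperm (g \<otimes>\<^bsub>cox_A n\<^esub> h) = hperm g \<circ> hperm h"
proof -
  obtain u v where "g = cox_class (type_A (n - 1)) u" "h = cox_class (type_A (n - 1)) v"
    using assms unfolding carrier_cox_A by blast
  then show ?thesis by (simp only: mult_cox_class hperm_cox_class word_perm_append)
qed

lemma hperm_hom: "hperm \<in> hom (cox_A n) (sym_group n)"
  using hperm_permutes hperm_mult by (intro homI) (simp_all add: sym_group_simps)

lemma group_hom_hperm: "group_hom (cox_A n) (sym_group n) hperm"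
  by (intro group_hom.intro group_hom_axioms.intro group_cox_A sym_group_is_group hperm_hom)

lemma hperm_inv:
  assumes "g \<in> carrier (cox_A n)" shows "hperm (inv\<^bsub>cox_A n\<^esub> g) = inv' (hperm g)"
  using group_hom.hom_inv[OF group_hom_hperm assms] sym_group_inv[OF hperm_permutes[OF assms]] by simp

lemma hperm_inj: "inj_on hperm (carrier (cox_A n))"
proof -
  have "g = \<one>\<^bsub>cox_A n\<^esub>" if g: "g \<in> carrier (cox_A n)" "hperm g = \<one>\<^bsub>sym_group n\<^esub>" for g
  proof -
    obtain w where w: "set w \<subseteq> {1..<n}" "g = cox_class (type_A (n - 1)) w"
      using g(1) unfolding carrier_cox_A by blast
    have "{1..<n} = {1..n - 1}" by auto
    then have "set w \<subseteq> {1..n - 1}" "word_perm w = id"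
      using w g(2) by (simp_all only: hperm_cox_class sym_group_simps)
    then have "cox_class (type_A (n - 1)) w = cox_class (type_A (n - 1)) []"
      by (intro word_perm_faithful[of "n - 1"]) auto
    then show ?thesis using w(2) by (simp add: coxeter_group_def)
  qed
  then show ?thesis using group_hom.inj_on_one_iff[OF group_hom_hperm] by blast
qed

lemma hperm_simple:
  assumes "s \<in> {1..<n}"
  shows "cox_class (type_A (n - 1)) [s] \<in> carrier (cox_A n)"
    "hperm (cox_class (type_A (n - 1)) [s]) = Transposition.transpose s (Suc s)"
proof -
  show "cox_class (type_A (n - 1)) [s] \<in> carrier (cox_A n)"
    unfolding carrier_cox_A using assms by (intro imageI) simp
  show "hperm (cox_class (type_A (n - 1)) [s]) = Transposition.transpose s (Suc s)"
    unfolding hperm_cox_class word_perm_Cons word_perm_Nil by (rule comp_id)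
qed

lemma hperm_surj: "hperm ` carrier (cox_A n) = {p. p permutes {1..n}}"
proof
  show "hperm ` carrier (cox_A n) \<subseteq> {p. p permutes {1..n}}" using hperm_permutes by blast
  show "{p. p permutes {1..n}} \<subseteq> hperm ` carrier (cox_A n)"
  proof
    fix p assume "p \<in> {p. p permutes {1..n}}"
    then have "p \<in> block_perms n (comparability (natural_order n))" by (simp add: block_perms_natural)
    then obtain ts where ts: "set ts \<subseteq> transps (cover (natural_order n))" "prod_perms ts = p"
      using block_perm_word[OF block_order_natural] by metis
    have "transps (cover (natural_order n)) = (\<lambda>s. Transposition.transpose s (Suc s)) ` {1..<n}"
      by (simp add: cover_natural transps_def image_image)
    then have "ts \<in> lists ((\<lambda>s. Transposition.transpose s (Suc s)) ` {1..<n})" using ts(1) by auto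
    then obtain w where w: "w \<in> lists {1..<n}" "ts = map (\<lambda>s. Transposition.transpose s (Suc s)) w"
      unfolding lists_image by blast
    then have "word_perm w = p" using ts(2) by (simp add: word_perm_def)
    then have "p = hperm (cox_class (type_A (n - 1)) w)" by (simp add: hperm_cox_class)
    moreover have "cox_class (type_A (n - 1)) w \<in> carrier (cox_A n)"
      unfolding carrier_cox_A using w(1) by (intro imageI) auto
    ultimately show "p \<in> hperm ` carrier (cox_A n)" by blast
  qed
qed

lemma finite_carrier_cox_A: "finite (carrier (cox_A n))"
  using finite_imageD[OF _ hperm_inj] hperm_surj finite_permutations[of "{1..n}"] by simp

section \<open>Length and coset minimality under injective homomorphisms\<close>

lemma word_length_inj_hom:
  assumes h: "group_hom G H h" and inj: "inj_on h (carrier G)" and R: "R \<subseteq> carrier G" and u: "u \<in> carrier G"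
  shows "word_length H (h ` R) (h u) = word_length G R u"
proof -
  interpret group_hom G H h by (rule h)
  have car: "foldr (mult G) xs \<one>\<^bsub>G\<^esub> \<in> carrier G" if "set xs \<subseteq> R" for xs
    using that R by (induction xs) auto
  have hf: "h (foldr (mult G) xs \<one>\<^bsub>G\<^esub>) = foldr (mult H) (map h xs) \<one>\<^bsub>H\<^esub>" if "set xs \<subseteq> R" for xs
    using that R car by (induction xs) auto
  have "(\<exists>ys. set ys \<subseteq> h ` R \<and> length ys = k \<and> foldr (mult H) ys \<one>\<^bsub>H\<^esub> = h u) \<longleftrightarrow>
      (\<exists>xs. set xs \<subseteq> R \<and> length xs = k \<and> foldr (mult G) xs \<one>\<^bsub>G\<^esub> = u)" for k
  proof
    assume "\<exists>xs. set xs \<subseteq> R \<and> length xs = k \<and> foldr (mult G) xs \<one>\<^bsub>G\<^esub> = u"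
    then obtain xs where xs: "set xs \<subseteq> R" "length xs = k" "foldr (mult G) xs \<one>\<^bsub>G\<^esub> = u" by blast
    then show "\<exists>ys. set ys \<subseteq> h ` R \<and> length ys = k \<and> foldr (mult H) ys \<one>\<^bsub>H\<^esub> = h u"
      using hf[OF xs(1)] by (intro exI[of _ "map h xs"]) auto
  next
    assume "\<exists>ys. set ys \<subseteq> h ` R \<and> length ys = k \<and> foldr (mult H) ys \<one>\<^bsub>H\<^esub> = h u"
    then obtain ys where ys: "ys \<in> lists (h ` R)" "length ys = k" "foldr (mult H) ys \<one>\<^bsub>H\<^esub> = h u" by auto
    then obtain xs where xs: "set xs \<subseteq> R" "ys = map h xs" unfolding lists_image by auto
    then have "h (foldr (mult G) xs \<one>\<^bsub>G\<^esub>) = h u" using ys(3) hf by simp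
    then have "foldr (mult G) xs \<one>\<^bsub>G\<^esub> = u" using inj_onD[OF inj] car[OF xs(1)] u by blast
    then show "\<exists>xs. set xs \<subseteq> R \<and> length xs = k \<and> foldr (mult G) xs \<one>\<^bsub>G\<^esub> = u" using xs ys(2) by auto
  qed
  then show ?thesis unfolding word_length_def by simp
qed

text \<open>Reduces minimality in the abstract Coxeter group to the description by inversions in
  \<open>coset_minimal_transps\<close>.\<close>

lemma coset_minimal_inj_hom:
  assumes h: "group_hom G H h" and inj: "inj_on h (carrier G)" and R: "R \<subseteq> carrier G"
    and T: "T \<subseteq> carrier G" and u: "u \<in> carrier G"
  shows "coset_minimal H (h ` R) (h ` T) (h u) \<longleftrightarrow> coset_minimal G R T u"
proof -
  interpret group_hom G H h by (rule h)
  have gen: "generate H (h ` K) = h ` generate G K" "generate G K \<subseteq> carrier G" if "K \<subseteq> carrier G" for K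
    using generate_img[OF that] G.generate_incl[OF that] by simp_all
  have "h u \<in> generate H (h ` R) \<longleftrightarrow> u \<in> generate G R"
    unfolding gen(1)[OF R] using inj_on_image_mem_iff[OF inj u gen(2)[OF R]] .
  moreover have "word_length H (h ` R) (h u \<otimes>\<^bsub>H\<^esub> h z) = word_length G R (u \<otimes>\<^bsub>G\<^esub> z)" if "z \<in> generate G T" for z
    using word_length_inj_hom[OF h inj R, of "u \<otimes>\<^bsub>G\<^esub> z"] that gen(2)[OF T] u by auto
  ultimately show ?thesis
    unfolding coset_minimal_def gen(1)[OF T] using word_length_inj_hom[OF h inj R u] by auto
qed

section \<open>The geometric representation in coordinates\<close>

lemma lookup_perm_act:
  assumes "inj p" shows "Poly_Mapping.lookup (perm_act p x) (p c) = Poly_Mapping.lookup x c"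
proof -
  have "Poly_Mapping.lookup (perm_act p x) (p c) =
      (\<Sum>i\<in>Poly_Mapping.keys x. if i = c then Poly_Mapping.lookup x i else 0)"
    unfolding perm_act_def lookup_sum
    by (rule sum.cong) (auto simp: lookup_single when_def inj_eq[OF assms])
  then show ?thesis by (simp add: in_keys_iff)
qed

lemma perm_act_eqI:
  assumes "bij p" "\<And>c. Poly_Mapping.lookup y (p c) = Poly_Mapping.lookup x c"
  shows "perm_act p x = y"
proof (rule poly_mapping_eqI)
  fix c
  obtain d where "c = p d" using bij_is_surj[OF assms(1)] by auto
  then show "Poly_Mapping.lookup (perm_act p x) c = Poly_Mapping.lookup y c"
    using lookup_perm_act[OF bij_is_inj[OF assms(1)], of x d] assms(2) by simp
qed

lemma perm_act_diff: "bij p \<Longrightarrow> perm_act p (x - y) = perm_act p x - perm_act p y"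
  by (rule perm_act_eqI) (simp_all add: lookup_minus lookup_perm_act bij_is_inj)

lemma perm_act_scaleR: "bij p \<Longrightarrow> perm_act p (r *\<^sub>R x) = r *\<^sub>R perm_act p x"
  by (rule perm_act_eqI) (simp_all add: lookup_perm_act bij_is_inj)

lemma perm_act_comp: "bij p \<Longrightarrow> bij q \<Longrightarrow> perm_act (p \<circ> q) x = perm_act p (perm_act q x)"
  by (rule perm_act_eqI) (simp_all add: lookup_perm_act bij_is_inj bij_comp)

lemma perm_act_id: "perm_act id x = x"
  by (rule perm_act_eqI) simp_all

lemma perm_act_dvec: "bij p \<Longrightarrow> perm_act p (dvec i j) = dvec (p i) (p j)"
  by (rule perm_act_eqI) (simp_all add: lookup_dvec bij_is_inj inj_eq)

lemma perm_act_osum: "bij p \<Longrightarrow> perm_act p (osum D) = osum (map_prod p p ` D)"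
  by (rule perm_act_eqI) (simp_all add: lookup_osum_map_prod bij_is_inj)

text \<open>The isometry that takes the simple root \<open>\<alpha>\<^sub>i\<close> to \<open>(e\<^sub>i - e\<^sub>i\<^sub>+\<^sub>1) / \<surd>2\<close>, scaled by \<open>\<surd>2\<close>.\<close>

definition cvec :: "nat geom \<Rightarrow> nat geom" where
  "cvec v = (\<Sum>i\<in>Poly_Mapping.keys v. Poly_Mapping.lookup v i *\<^sub>R dvec i (Suc i))"

lemma sum_keys_delta:
  fixes v :: "nat geom"
  shows "(\<Sum>i\<in>Poly_Mapping.keys v. Poly_Mapping.lookup v i * of_bool (i = c)) = Poly_Mapping.lookup v c"
proof -
  have "(\<Sum>i\<in>Poly_Mapping.keys v. Poly_Mapping.lookup v i * of_bool (i = c)) =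
      (\<Sum>i\<in>Poly_Mapping.keys v. if i = c then Poly_Mapping.lookup v i else 0)"
    by (rule sum.cong) auto
  then show ?thesis by (simp add: in_keys_iff)
qed

lemma sum_keys_delta_Suc:
  fixes v :: "nat geom"
  shows "(\<Sum>i\<in>Poly_Mapping.keys v. Poly_Mapping.lookup v i * of_bool (Suc i = c)) =
    (if c = 0 then 0 else Poly_Mapping.lookup v (c - 1))"
proof (cases c)
  case (Suc d)
  then show ?thesis using sum_keys_delta[of v d] by simp
qed simp

lemma lookup_cvec: "Poly_Mapping.lookup (cvec v) c =
    Poly_Mapping.lookup v c - (if c = 0 then 0 else Poly_Mapping.lookup v (c - 1))"
  unfolding cvec_def lookup_sum sum_keys_delta[where v = v and c = c, symmetric]
    sum_keys_delta_Suc[where v = v and c = c, symmetric]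
  by (simp add: lookup_dvec right_diff_distrib sum_subtractf)

lemma linear_cvec: "linear cvec"
  by (rule linearI; rule poly_mapping_eqI) (simp_all add: lookup_cvec lookup_add algebra_simps)

text \<open>The coordinates of \<open>cvec v\<close> are the successive differences of those of
  \<open>v\<close>, starting from zero, so \<open>v\<close> is recovered by summation.\<close>

lemma inj_cvec: "inj cvec"
  unfolding linear_injective_0[OF linear_cvec]
proof (intro allI impI)
  fix v assume "cvec v = 0"
  then have *: "Poly_Mapping.lookup (cvec v) c = 0" for c by simp
  have "Poly_Mapping.lookup v c = 0" for c
    by (induction c) (use *[unfolded lookup_cvec] in \<open>force\<close>)+
  then show "v = 0" by (intro poly_mapping_eqI) simp
qed

lemma cvec_sroot: "cvec (sroot s) = dvec s (Suc s)"
  by (simp add: cvec_def sroot_def)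

text \<open>The labels 1, 3 and 2 give the form the values 1, -1/2 and 0. Doubling the form makes up
  for the scaling of \<open>cvec\<close> by the square root of 2.\<close>

lemma form_sroot: "2 * form (type_A k) (sroot s) v =
    Poly_Mapping.lookup (cvec v) s - Poly_Mapping.lookup (cvec v) (Suc s)"
proof -
  have a: "(case label (type_A k) s t of enat m \<Rightarrow> - cos (pi / real m) | \<infinity> \<Rightarrow> - 1) =
      of_bool (t = s) - (of_bool (t = Suc s) + of_bool (Suc t = s)) / 2" for t
    unfolding type_A_simps one_enat_def numeral_eq_enat by (auto simp: cos_60)
  have "form (type_A k) (sroot s) v = (\<Sum>t\<in>Poly_Mapping.keys v. Poly_Mapping.lookup v t *
      (case label (type_A k) s t of enat m \<Rightarrow> - cos (pi / real m) | \<infinity> \<Rightarrow> - 1))"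
    by (simp add: form_def sroot_def)
  also have "\<dots> = (\<Sum>t\<in>Poly_Mapping.keys v. Poly_Mapping.lookup v t * of_bool (t = s)) -
      ((\<Sum>t\<in>Poly_Mapping.keys v. Poly_Mapping.lookup v t * of_bool (t = Suc s)) +
       (\<Sum>t\<in>Poly_Mapping.keys v. Poly_Mapping.lookup v t * of_bool (Suc t = s))) / 2"
    unfolding a right_diff_distrib sum_subtractf
    by (simp add: distrib_left sum.distrib sum_divide_distrib add_divide_distrib del: sum_mult_of_bool_eq)
  finally show ?thesis
    unfolding sum_keys_delta sum_keys_delta_Suc lookup_cvec by (cases s) (simp_all add: field_simps)
qed

lemma form_cvec: "2 * form (type_A k) v w =
    (\<Sum>a\<in>Poly_Mapping.keys (cvec v). Poly_Mapping.lookup (cvec v) a * Poly_Mapping.lookup (cvec w) a)"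
proof -
  let ?c = "Poly_Mapping.lookup (cvec w)"
  \<comment> \<open>One finite index set that contains every coordinate involved, so that the two
    summations can be interchanged.\<close>
  define A where "A = Poly_Mapping.keys v \<union> Suc ` Poly_Mapping.keys v \<union> Poly_Mapping.keys (cvec v)"
  have A: "finite A" by (simp add: A_def)
  have "2 * form (type_A k) v w =
      (\<Sum>s\<in>Poly_Mapping.keys v. Poly_Mapping.lookup v s * (2 * form (type_A k) (sroot s) w))"
    unfolding form_def sroot_def by (simp add: sum_distrib_left algebra_simps)
  also have "\<dots> = (\<Sum>s\<in>Poly_Mapping.keys v. Poly_Mapping.lookup v s * (?c s - ?c (Suc s)))"
    unfolding form_sroot ..
  also have "\<dots> = (\<Sum>s\<in>Poly_Mapping.keys v. \<Sum>a\<in>A. Poly_Mapping.lookup v s *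
      Poly_Mapping.lookup (dvec s (Suc s)) a * ?c a)"
  proof (rule sum.cong[OF refl])
    fix s assume s: "s \<in> Poly_Mapping.keys v"
    have "(\<Sum>a\<in>A. Poly_Mapping.lookup (dvec s (Suc s)) a * ?c a) =
        (\<Sum>a\<in>{s, Suc s}. Poly_Mapping.lookup (dvec s (Suc s)) a * ?c a)"
      using A s by (intro sum.mono_neutral_right) (auto simp: A_def lookup_dvec)
    then show "Poly_Mapping.lookup v s * (?c s - ?c (Suc s)) = (\<Sum>a\<in>A. Poly_Mapping.lookup v s *
        Poly_Mapping.lookup (dvec s (Suc s)) a * ?c a)"
      by (simp add: lookup_dvec mult.assoc sum_distrib_left[symmetric])
  qed
  also have "\<dots> = (\<Sum>a\<in>A. Poly_Mapping.lookup (cvec v) a * ?c a)"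
    unfolding cvec_def[of v] lookup_sum by (subst sum.swap) (simp add: sum_distrib_right)
  also have "\<dots> = (\<Sum>a\<in>Poly_Mapping.keys (cvec v). Poly_Mapping.lookup (cvec v) a * ?c a)"
    using A by (intro sum.mono_neutral_right) (auto simp: A_def in_keys_iff)
  finally show ?thesis .
qed

lemma form_cvec_dvec:
  assumes "cvec w = dvec i j"
  shows "2 * form (type_A k) v w = Poly_Mapping.lookup (cvec v) i - Poly_Mapping.lookup (cvec v) j"
proof -
  have "2 * form (type_A k) v w =
      (\<Sum>a\<in>Poly_Mapping.keys (cvec v). Poly_Mapping.lookup (cvec v) a * of_bool (a = i)) -
      (\<Sum>a\<in>Poly_Mapping.keys (cvec v). Poly_Mapping.lookup (cvec v) a * of_bool (a = j))"
    unfolding form_cvec assms lookup_dvec right_diff_distrib sum_subtractf by (simp add: eq_commute)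
  then show ?thesis unfolding sum_keys_delta .
qed

lemma cvec_simple_refl:
  "cvec (simple_refl (type_A k) s v) = perm_act (Transposition.transpose s (Suc s)) (cvec v)"
proof (rule perm_act_eqI[symmetric])
  fix c
  have "cvec (simple_refl (type_A k) s v) =
      cvec v - (Poly_Mapping.lookup (cvec v) s - Poly_Mapping.lookup (cvec v) (Suc s)) *\<^sub>R dvec s (Suc s)"
    unfolding simple_refl_def form_sroot linear_diff[OF linear_cvec] linear_scale[OF linear_cvec] cvec_sroot ..
  then show "Poly_Mapping.lookup (cvec (simple_refl (type_A k) s v)) (Transposition.transpose s (Suc s) c) =
      Poly_Mapping.lookup (cvec v) c"
    by (simp add: lookup_minus lookup_dvec Transposition.transpose_def)
qed simp

lemma cvec_act: "cvec (act (type_A k) g v) = perm_act (hperm g) (cvec v)"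
proof -
  have "cvec (foldr (simple_refl (type_A k)) w v) = perm_act (word_perm w) (cvec v)" for w
  proof (induction w)
    case Nil
    show ?case unfolding word_perm_Nil perm_act_id by simp
  next
    case (Cons s w)
    have "bij (Transposition.transpose s (Suc s))" by simp
    then show ?case
      unfolding foldr.simps comp_def word_perm_Cons cvec_simple_refl Cons.IH
      using perm_act_comp[OF _ bij_word_perm, of "Transposition.transpose s (Suc s)"] by (simp add: comp_def)
  qed
  then show ?thesis unfolding act_def hperm_def .
qed

section \<open>Almost parabolic sets of type A\<close>

lemma nodes_type_A: "nodes (type_A (n - 1)) = {1..<n}"
  by (auto simp: type_A_simps)

lemma dvec_inj:
  assumes "i \<noteq> j" "dvec i j = dvec k l" shows "i = k \<and> j = l"
proof -
  have "Poly_Mapping.lookup (dvec k l) i = 1" "Poly_Mapping.lookup (dvec k l) j = - 1"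
    using assms(1) unfolding assms(2)[symmetric] by (simp_all add: lookup_dvec)
  then show ?thesis unfolding lookup_dvec by (cases "k = i"; cases "l = i"; cases "k = j"; cases "l = j") simp_all
qed

lemma cvec_root:
  "cvec (act (type_A k) w (sroot s)) = dvec (hperm w s) (hperm w (Suc s))"
  unfolding cvec_act cvec_sroot by (rule perm_act_dvec) (simp add: hperm_def bij_word_perm)

lemma hperm_bij: "bij (hperm g)"
  by (simp add: hperm_def bij_word_perm)

definition ap_set :: "(nat \<times> nat) set \<Rightarrow> nat geom set" where
  "ap_set Z = {\<gamma>. \<exists>(i, j)\<in>cover Z. cvec \<gamma> = dvec i j}"

lemma ex_hperm: "p permutes {1..n} \<Longrightarrow> \<exists>w\<in>carrier (cox_A n). hperm w = p"
  using equalityD2[OF hperm_surj[of n]] by blast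

text \<open>A linear extension turns the blocks into intervals, so a single \<open>w\<close> takes
  simple roots to all the roots at once, where almost parabolicity speaks of two roots at a
  time.\<close>

lemma cover_simple:
  assumes Z: "block_order n Z"
  obtains w where "w \<in> carrier (cox_A n)"
    "\<And>i j. (i, j) \<in> cover Z \<Longrightarrow> \<exists>s\<in>{1..<n}. i = hperm w s \<and> j = hperm w (Suc s)"
proof -
  obtain p where p: "p permutes {1..n}" "suborder n Z (map_prod p p ` natural_order n)"
    using linear_extension[OF Z] .
  obtain w where w: "w \<in> carrier (cox_A n)" "hperm w = p" using ex_hperm[OF p(1)] by blast
  have "cover Z \<subseteq> map_prod p p ` (\<lambda>i. (i, Suc i)) ` {1..<n}"
    using suborder_cover[OF p(2)] by (simp only: cover_map_prod[OF permutes_inj[OF p(1)]] cover_natural)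
  then have "\<exists>s\<in>{1..<n}. i = hperm w s \<and> j = hperm w (Suc s)" if "(i, j) \<in> cover Z" for i j
    using that w(2) by auto
  then show ?thesis using that w(1) by blast
qed

lemma cvec_ap_set:
  assumes Z: "block_order n Z" shows "cvec ` ap_set Z = (\<lambda>(i, j). dvec i j) ` cover Z"
proof
  show "cvec ` ap_set Z \<subseteq> (\<lambda>(i, j). dvec i j) ` cover Z" by (auto simp: ap_set_def)
  obtain w where w: "\<And>i j. (i, j) \<in> cover Z \<Longrightarrow> \<exists>s\<in>{1..<n}. i = hperm w s \<and> j = hperm w (Suc s)"
    using cover_simple[OF Z] by blast
  have "\<exists>\<gamma>. cvec \<gamma> = dvec i j" if "(i, j) \<in> cover Z" for i j
    using w[OF that] cvec_root[of 0 w] by metis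
  then show "(\<lambda>(i, j). dvec i j) ` cover Z \<subseteq> cvec ` ap_set Z"
    unfolding ap_set_def by force
qed

lemma ex_ap_set_root:
  assumes "block_order n Z" "(i, j) \<in> cover Z"
  obtains \<gamma> where "\<gamma> \<in> ap_set Z" "cvec \<gamma> = dvec i j"
proof -
  have "dvec i j \<in> cvec ` ap_set Z" unfolding cvec_ap_set[OF assms(1)] using assms(2) by force
  then show ?thesis using that by auto
qed

lemma block_order_neq: "block_order n Z \<Longrightarrow> (i, j) \<in> cover Z \<Longrightarrow> i \<noteq> j"
  using block_orderD(3) cover_subset by blast

lemma cover_ap_set:
  assumes Z: "block_order n Z"
  shows "(i, j) \<in> cover Z \<longleftrightarrow> i \<noteq> j \<and> (\<exists>\<gamma>\<in>ap_set Z. cvec \<gamma> = dvec i j)"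
proof
  assume "(i, j) \<in> cover Z"
  then show "i \<noteq> j \<and> (\<exists>\<gamma>\<in>ap_set Z. cvec \<gamma> = dvec i j)"
    using ex_ap_set_root[OF Z] block_order_neq[OF Z] by metis
next
  assume "i \<noteq> j \<and> (\<exists>\<gamma>\<in>ap_set Z. cvec \<gamma> = dvec i j)"
  then obtain k l where "i \<noteq> j" "(k, l) \<in> cover Z" "dvec i j = dvec k l"
    by (auto simp: ap_set_def)
  then show "(i, j) \<in> cover Z" using dvec_inj[of i j k l] by simp
qed

lemma ap_set_inj:
  assumes "block_order n Z" "block_order n Y" "ap_set Z = ap_set Y" shows "Z = Y"
proof -
  have "cover Z = cover Y"
    using cover_ap_set[OF assms(1)] cover_ap_set[OF assms(2)] assms(3) by (intro equalityI subrelI) simp_all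
  then show ?thesis using block_order_trancl_cover assms(1,2) by metis
qed

lemma card_ap_set:
  assumes Z: "block_order n Z" shows "card (ap_set Z) = card (cover Z)"
proof -
  have "inj_on (\<lambda>(i, j). dvec i j) (cover Z)"
  proof (rule inj_onI, clarify)
    fix i j k l assume ij: "(i, j) \<in> cover Z" and "dvec i j = dvec k l"
    then show "i = k \<and> j = l" using dvec_inj[OF block_order_neq[OF Z ij]] by blast
  qed
  then have "card (cover Z) = card (cvec ` ap_set Z)" unfolding cvec_ap_set[OF Z] by (simp add: card_image)
  then show ?thesis using card_image[OF inj_on_subset[OF inj_cvec subset_UNIV], of "ap_set Z"] by simp
qed

lemma finite_ap_set: "block_order n Z \<Longrightarrow> finite (ap_set Z)"
proof (rule finite_imageD)
  assume Z: "block_order n Z"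
  show "finite (cvec ` ap_set Z)"
    unfolding cvec_ap_set[OF Z] by (intro finite_imageI finite_subset[OF cover_subset block_orderD(2)[OF Z]])
  show "inj_on cvec (ap_set Z)" by (rule inj_on_subset[OF inj_cvec subset_UNIV])
qed

text \<open>The partial sums along the chains, as in \<open>mass_down_cover\<close>, form a dual
  system that isolates one coefficient of a linear relation at a time.\<close>

lemma independent_ap_set:
  assumes Z: "block_order n Z" shows "independent (ap_set Z)"
  unfolding dependent_finite[OF finite_ap_set[OF Z]]
proof
  assume "\<exists>u. (\<exists>v\<in>ap_set Z. u v \<noteq> 0) \<and> (\<Sum>v\<in>ap_set Z. u v *\<^sub>R v) = 0"
  then obtain u \<gamma> where u: "(\<Sum>v\<in>ap_set Z. u v *\<^sub>R v) = 0" and \<gamma>: "\<gamma> \<in> ap_set Z" "u \<gamma> \<noteq> 0" by blast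
  obtain a b where ab: "(a, b) \<in> cover Z" "cvec \<gamma> = dvec a b" using \<gamma>(1) by (auto simp: ap_set_def)
  let ?D = "{e. e = a \<or> (e, a) \<in> Z}"
  have "mass (cvec v) ?D = of_bool (v = \<gamma>)" if v: "v \<in> ap_set Z" for v
  proof -
    obtain c d where cd: "(c, d) \<in> cover Z" "cvec v = dvec c d" using v by (auto simp: ap_set_def)
    have "v = \<gamma> \<longleftrightarrow> dvec c d = dvec a b" using inj_cvec cd(2) ab(2) by (metis injD)
    also have "\<dots> \<longleftrightarrow> (c, d) = (a, b)" using dvec_inj[OF block_order_neq[OF Z cd(1)], of a b] by auto
    finally show ?thesis using mass_down_cover[OF Z ab(1) cd(1)] cd(2) by simp
  qed
  then have "(\<Sum>v\<in>ap_set Z. u v * mass (cvec v) ?D) = (\<Sum>v\<in>ap_set Z. if v = \<gamma> then u v else 0)"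
    by (intro sum.cong) auto
  also have "\<dots> = u \<gamma>" using \<gamma>(1) finite_ap_set[OF Z] by simp
  finally have "mass (cvec (\<Sum>v\<in>ap_set Z. u v *\<^sub>R v)) ?D = u \<gamma>"
    by (simp add: linear_sum[OF linear_cvec] linear_scale[OF linear_cvec] mass_sum mass_scaleR)
  then show False using u \<gamma>(2) linear_0[OF linear_cvec] by simp
qed

lemma almost_parabolic_ap_set:
  assumes Z: "block_order n Z" shows "almost_parabolic (type_A (n - 1)) (ap_set Z)"
proof -
  obtain w where w: "w \<in> carrier (cox_A n)"
    "\<And>i j. (i, j) \<in> cover Z \<Longrightarrow> \<exists>s\<in>{1..<n}. i = hperm w s \<and> j = hperm w (Suc s)"
    using cover_simple[OF Z] by blast
  have root: "\<exists>s\<in>nodes (type_A (n - 1)). \<gamma> = act (type_A (n - 1)) w (sroot s)" if \<gamma>: "\<gamma> \<in> ap_set Z" for \<gamma>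
  proof -
    obtain i j where ij: "(i, j) \<in> cover Z" "cvec \<gamma> = dvec i j" using \<gamma> by (auto simp: ap_set_def)
    obtain s where s: "s \<in> {1..<n}" "i = hperm w s" "j = hperm w (Suc s)" using w(2)[OF ij(1)] by blast
    then have "cvec \<gamma> = cvec (act (type_A (n - 1)) w (sroot s))" using ij(2) cvec_root by simp
    then show ?thesis using injD[OF inj_cvec] s(1) nodes_type_A by blast
  qed
  have "ap_set Z \<subseteq> roots (type_A (n - 1))" unfolding roots_def using root w(1) by blast
  then show ?thesis
    unfolding almost_parabolic_def using independent_ap_set[OF Z] root w(1) by blast
qed

text \<open>The roots of \<open>X\<close> are the edges of a directed graph. Since any two edges can
  be moved together to pairs of consecutive positions, edges with the same source or the same target
  coincide; linear independence excludes cycles. So the graph is a disjoint union of chains, and its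
  edges are the covers of its transitive closure.\<close>

lemma almost_parabolic_imp_ap_set:
  assumes X: "almost_parabolic (type_A (n - 1)) X"
  obtains Z where "block_order n Z" "X = ap_set Z"
proof -
  have indep: "independent X" using X by (simp add: almost_parabolic_def)
  define R where "R = {(i, j). i \<noteq> j \<and> (\<exists>\<gamma>\<in>X. cvec \<gamma> = dvec i j)}"
  have pair: "\<exists>p s t. p permutes {1..n} \<and> s \<in> {1..<n} \<and> t \<in> {1..<n} \<and>
      i = p s \<and> j = p (Suc s) \<and> k = p t \<and> l = p (Suc t)" if R: "(i, j) \<in> R" "(k, l) \<in> R" for i j k l
  proof -
    obtain \<beta> \<gamma> where b: "i \<noteq> j" "\<beta> \<in> X" "cvec \<beta> = dvec i j" and g: "k \<noteq> l" "\<gamma> \<in> X" "cvec \<gamma> = dvec k l"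
      using R by (auto simp: R_def)
    obtain w s t where w: "w \<in> carrier (cox_A n)" "s \<in> {1..<n}" "t \<in> {1..<n}"
      "\<beta> = act (type_A (n - 1)) w (sroot s)" "\<gamma> = act (type_A (n - 1)) w (sroot t)"
      using X b(2) g(2) unfolding almost_parabolic_def nodes_type_A by blast
    have "dvec i j = dvec (hperm w s) (hperm w (Suc s))" "dvec k l = dvec (hperm w t) (hperm w (Suc t))"
      using b(3) g(3) w(4,5) cvec_root by simp_all
    then have "i = hperm w s \<and> j = hperm w (Suc s)" "k = hperm w t \<and> l = hperm w (Suc t)"
      using dvec_inj b(1) g(1) by blast+
    then show ?thesis using hperm_permutes[OF w(1)] w(2,3) by blast
  qed
  have RN: "R \<subseteq> {1..n} \<times> {1..n}"
  proof (rule subrelI)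
    fix i j assume ij: "(i, j) \<in> R"
    obtain p s where p: "p permutes {1..n}" "s \<in> {1..<n}" "i = p s" "j = p (Suc s)"
      using pair[OF ij ij] by blast
    then have "s \<in> {1..n}" "Suc s \<in> {1..n}" by auto
    then show "(i, j) \<in> {1..n} \<times> {1..n}" using p permutes_in_image[OF p(1)] by blast
  qed
  have R_sv: "j = l" if R: "(i, j) \<in> R" "(i, l) \<in> R" for i j l
  proof -
    obtain p s t where p: "p permutes {1..n}" "i = p s" "j = p (Suc s)" "i = p t" "l = p (Suc t)"
      using pair[OF R] by blast
    then have "s = t" using injD[OF permutes_inj[OF p(1)], of s t] by simp
    then show ?thesis using p by simp
  qed
  have R_inj: "i = k" if R: "(i, j) \<in> R" "(k, j) \<in> R" for i j k
  proof -
    obtain p s t where p: "p permutes {1..n}" "i = p s" "j = p (Suc s)" "k = p t" "j = p (Suc t)"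
      using pair[OF R] by blast
    then have "s = t" using injD[OF permutes_inj[OF p(1)], of "Suc s" "Suc t"] by simp
    then show ?thesis using p by simp
  qed
  have sv: "single_valued R" "single_valued (R\<inverse>)"
    using R_sv R_inj by (auto simp: single_valued_def)
  have acyc: "(c, c) \<notin> R\<^sup>+" for c
  proof
    assume c: "(c, c) \<in> R\<^sup>+"
    \<comment> \<open>The forward orbit of a point on a cycle. The successor map permutes it, so the
      differences along its edges sum to zero, which is a linear relation between distinct elements
      of \<open>X\<close>.\<close>
    define S where "S = {x. (c, x) \<in> R\<^sup>*}"
    have cyc: "(x, c) \<in> R\<^sup>+" if "(c, x) \<in> R\<^sup>*" for x
      using that
    proof (induction rule: rtrancl_induct)
      case base show ?case by (rule c)
    next
      case (step x y)
      obtain z where "(x, z) \<in> R" "(z, c) \<in> R\<^sup>*" using tranclD[OF step.IH] by blast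
      then have "(y, c) \<in> R\<^sup>*" using R_sv[OF step.hyps(2)] by simp
      then show ?case using c by (rule rtrancl_trancl_trancl)
    qed
    have "\<exists>y. (x, y) \<in> R" if "x \<in> S" for x
      using tranclD[OF cyc[of x]] that by (auto simp: S_def)
    then obtain f where f: "\<And>x. x \<in> S \<Longrightarrow> (x, f x) \<in> R" by metis
    have fS: "f ` S \<subseteq> S" using f by (auto simp: S_def intro: rtrancl_into_rtrancl)
    have "S \<subseteq> {1..n}" using f RN by blast
    then have fin: "finite S" by (rule finite_subset) simp
    have finj: "inj_on f S" using f R_inj by (metis inj_onI)
    have "f ` S = S" using fS finj fin by (simp add: endo_inj_surj)
    have "(\<Sum>x\<in>S. Poly_Mapping.single (f x) (1::real)) = (\<Sum>x\<in>S. Poly_Mapping.single x 1)"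
      using sum.reindex[OF finj, of "\<lambda>x. Poly_Mapping.single x (1::real)"] \<open>f ` S = S\<close> by (simp add: comp_def)
    then have zero: "(\<Sum>x\<in>S. dvec x (f x)) = 0" by (simp add: dvec_def sum_subtractf)
    have "\<exists>\<gamma>. \<gamma> \<in> X \<and> cvec \<gamma> = dvec x (f x) \<and> x \<noteq> f x" if "x \<in> S" for x
      using f[OF that] by (auto simp: R_def)
    then obtain g where g: "\<And>x. x \<in> S \<Longrightarrow> g x \<in> X \<and> cvec (g x) = dvec x (f x) \<and> x \<noteq> f x" by metis
    have ginj: "inj_on g S"
    proof (rule inj_onI)
      fix x y assume xy: "x \<in> S" "y \<in> S" "g x = g y"
      then have "dvec x (f x) = dvec y (f y)" using g by metis
      then show "x = y" using dvec_inj g[OF xy(1)] by blast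
    qed
    have "cvec (\<Sum>x\<in>S. g x) = (\<Sum>x\<in>S. dvec x (f x))"
      unfolding linear_sum[OF linear_cvec] using g by (intro sum.cong) auto
    then have "cvec (\<Sum>x\<in>S. g x) = cvec 0" using zero linear_0[OF linear_cvec] by simp
    then have "(\<Sum>x\<in>S. g x) = 0" by (rule injD[OF inj_cvec])
    then have "(\<Sum>v\<in>g ` S. 1 *\<^sub>R v) = 0" by (simp add: sum.reindex[OF ginj])
    moreover have "finite (g ` S)" "g ` S \<subseteq> X" using fin g by auto
    moreover have "c \<in> S" by (simp add: S_def)
    then have "\<exists>v\<in>g ` S. (\<lambda>_. 1::real) v \<noteq> 0" by auto
    ultimately have "dependent X"
      unfolding dependent_explicit by (intro exI[of _ "g ` S"] exI[of _ "\<lambda>_. 1::real"] conjI)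
    then show False using indep by simp
  qed
  have rt: "a = b \<or> (a, b) \<in> R\<^sup>+" if "(a, b) \<in> R\<^sup>*" for a b using rtranclD[OF that] by blast
  have Z: "block_order n (R\<^sup>+)"
    unfolding block_order_def
  proof (intro conjI allI impI)
    show "R\<^sup>+ \<subseteq> {1..n} \<times> {1..n}" using RN by (rule trancl_subset_Sigma)
    show "irrefl (R\<^sup>+)" using acyc by (simp add: irrefl_def)
    show "trans (R\<^sup>+)" by (rule trans_trancl)
    fix a b c assume "(a, b) \<in> comparability (R\<^sup>+)" "(b, c) \<in> comparability (R\<^sup>+)"
    then consider "(a, b) \<in> R\<^sup>+" "(b, c) \<in> R\<^sup>+" | "(b, a) \<in> R\<^sup>+" "(c, b) \<in> R\<^sup>+"
      | "(b, a) \<in> R\<^sup>+" "(b, c) \<in> R\<^sup>+" | "(a, b) \<in> R\<^sup>+" "(c, b) \<in> R\<^sup>+"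
      by (auto simp: comparability_iff)
    then show "a = c \<or> (a, c) \<in> comparability (R\<^sup>+)"
    proof cases
      case 1
      then show ?thesis using trancl_trans[of a b R c] by (simp add: comparability_iff)
    next
      case 2
      then show ?thesis using trancl_trans[of c b R a] by (simp add: comparability_iff)
    next
      case 3
      \<comment> \<open>Successors are unique, so of two points reached from \<open>b\<close> one is
        reached from the other. The next case is the mirror image, with unique predecessors.\<close>
      then have "(a, c) \<in> R\<^sup>* \<or> (c, a) \<in> R\<^sup>*"
        using single_valued_confluent[OF sv(1)] trancl_into_rtrancl by metis
      then show ?thesis using rt[of a c] rt[of c a] by (auto simp: comparability_iff)
    next
      case 4
      then have "(b, a) \<in> (R\<inverse>)\<^sup>*" "(b, c) \<in> (R\<inverse>)\<^sup>*"
        by (simp_all add: rtrancl_converse trancl_into_rtrancl)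
      then have "(a, c) \<in> (R\<inverse>)\<^sup>* \<or> (c, a) \<in> (R\<inverse>)\<^sup>*" by (rule single_valued_confluent[OF sv(2)])
      then show ?thesis using rt[of a c] rt[of c a] by (auto simp: comparability_iff rtrancl_converse)
    qed
  qed
  have cov: "cover (R\<^sup>+) = R"
  proof (intro equalityI subrelI)
    fix a b assume ab: "(a, b) \<in> cover (R\<^sup>+)"
    then have "(a, b) \<in> R\<^sup>+" using cover_subset by blast
    then show "(a, b) \<in> R"
    proof (cases rule: tranclE)
      case (step c)
      then show ?thesis using ab by (auto simp: cover_def)
    qed
  next
    fix a b assume ab: "(a, b) \<in> R"
    have "False" if ac: "(a, c) \<in> R\<^sup>+" and cb: "(c, b) \<in> R\<^sup>+" for c
    proof -
      obtain d where d: "(a, d) \<in> R" "(d, c) \<in> R\<^sup>*" using tranclD[OF ac] by blast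
      then have "(b, c) \<in> R\<^sup>*" using R_sv[OF ab] by simp
      then have "(b, b) \<in> R\<^sup>+" using cb by (rule rtrancl_trancl_trancl)
      then show False using acyc by blast
    qed
    then show "(a, b) \<in> cover (R\<^sup>+)" using ab by (auto simp: cover_def)
  qed
  have "X = ap_set (R\<^sup>+)"
  proof (intro equalityI subsetI)
    fix \<gamma> assume \<gamma>: "\<gamma> \<in> X"
    then obtain w s where w: "w \<in> carrier (cox_A n)" "s \<in> {1..<n}" "\<gamma> = act (type_A (n - 1)) w (sroot s)"
      using X unfolding almost_parabolic_def roots_def nodes_type_A by blast
    have "hperm w s \<noteq> hperm w (Suc s)" using bij_is_inj[OF hperm_bij[of w]] by (simp add: inj_eq)
    then have "(hperm w s, hperm w (Suc s)) \<in> R" using \<gamma> w(3) cvec_root by (auto simp: R_def)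
    then show "\<gamma> \<in> ap_set (R\<^sup>+)" using w(3) cvec_root by (auto simp: ap_set_def cov)
  next
    fix \<gamma> assume "\<gamma> \<in> ap_set (R\<^sup>+)"
    then obtain i j where "(i, j) \<in> R" "cvec \<gamma> = dvec i j" by (auto simp: ap_set_def cov)
    then obtain \<beta> where "\<beta> \<in> X" "cvec \<beta> = cvec \<gamma>" by (auto simp: R_def)
    then show "\<gamma> \<in> X" using injD[OF inj_cvec] by blast
  qed
  then show ?thesis using that Z by blast
qed

text \<open>The description in \<open>root_refl\<close> singles out one element: every way of
  writing the root as the image of a simple root gives a group element over the same transposition,
  and \<open>hperm\<close> is injective on the group.\<close>

lemma hperm_root_refl:
  assumes ij: "i \<noteq> j" and \<gamma>: "cvec \<gamma> = dvec i j" "\<gamma> \<in> roots (type_A (n - 1))"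
  shows "root_refl (type_A (n - 1)) \<gamma> \<in> carrier (cox_A n)"
    "hperm (root_refl (type_A (n - 1)) \<gamma>) = Transposition.transpose i j"
proof -
  interpret group "cox_A n" by (rule group_cox_A)
  let ?refl = "\<lambda>r. \<exists>w\<in>carrier (cox_A n). \<exists>s\<in>nodes (type_A (n - 1)).
    \<gamma> = act (type_A (n - 1)) w (sroot s) \<and>
    r = w \<otimes>\<^bsub>cox_A n\<^esub> cox_class (type_A (n - 1)) [s] \<otimes>\<^bsub>cox_A n\<^esub> inv\<^bsub>cox_A n\<^esub> w"
  have val: "r \<in> carrier (cox_A n) \<and> hperm r = Transposition.transpose i j" if refl: "?refl r" for r
  proof -
    obtain w s where w: "w \<in> carrier (cox_A n)" "s \<in> {1..<n}" "\<gamma> = act (type_A (n - 1)) w (sroot s)"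
      and r: "r = w \<otimes>\<^bsub>cox_A n\<^esub> cox_class (type_A (n - 1)) [s] \<otimes>\<^bsub>cox_A n\<^esub> inv\<^bsub>cox_A n\<^esub> w"
      using refl unfolding nodes_type_A by blast
    note s = hperm_simple[OF w(2)]
    have "dvec i j = dvec (hperm w s) (hperm w (Suc s))" using \<gamma>(1) w(3) cvec_root by simp
    then have ij': "i = hperm w s" "j = hperm w (Suc s)" using dvec_inj[OF ij] by blast+
    have "hperm r = hperm w \<circ> Transposition.transpose s (Suc s) \<circ> inv' (hperm w)"
      unfolding r using w(1) s by (simp only: hperm_mult hperm_inv m_closed inv_closed)
    also have "\<dots> = Transposition.transpose i j"
    proof
      fix x
      obtain y where y: "x = hperm w y" using bij_is_surj[OF hperm_bij[of w]] by auto
      have inj: "inj (hperm w)" by (rule bij_is_inj[OF hperm_bij])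
      show "(hperm w \<circ> Transposition.transpose s (Suc s) \<circ> inv' (hperm w)) x = Transposition.transpose i j x"
        unfolding ij' y comp_def inv_f_f[OF inj] by (simp add: Transposition.transpose_def inj_eq[OF inj])
    qed
    finally show ?thesis unfolding r by (intro conjI m_closed inv_closed w(1) s(1))
  qed
  obtain w s where w: "w \<in> carrier (cox_A n)" "s \<in> nodes (type_A (n - 1))" "\<gamma> = act (type_A (n - 1)) w (sroot s)"
    using \<gamma>(2) unfolding roots_def by blast
  then have ex: "?refl (w \<otimes>\<^bsub>cox_A n\<^esub> cox_class (type_A (n - 1)) [s] \<otimes>\<^bsub>cox_A n\<^esub> inv\<^bsub>cox_A n\<^esub> w)" by blast
  have the: "?refl (THE r. ?refl r)"
  proof (rule theI[where P = ?refl, OF ex])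
    fix r assume r: "?refl r"
    show "r = w \<otimes>\<^bsub>cox_A n\<^esub> cox_class (type_A (n - 1)) [s] \<otimes>\<^bsub>cox_A n\<^esub> inv\<^bsub>cox_A n\<^esub> w"
    proof (rule inj_onD[OF hperm_inj])
      show "hperm r = hperm (w \<otimes>\<^bsub>cox_A n\<^esub> cox_class (type_A (n - 1)) [s] \<otimes>\<^bsub>cox_A n\<^esub> inv\<^bsub>cox_A n\<^esub> w)"
        unfolding val[OF r, THEN conjunct2] val[OF ex, THEN conjunct2] ..
    qed (rule val[OF r, THEN conjunct1], rule val[OF ex, THEN conjunct1])
  qed
  show "root_refl (type_A (n - 1)) \<gamma> \<in> carrier (cox_A n)"
    unfolding root_refl_def by (rule val[OF the, THEN conjunct1])
  show "hperm (root_refl (type_A (n - 1)) \<gamma>) = Transposition.transpose i j"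
    unfolding root_refl_def by (rule val[OF the, THEN conjunct2])
qed

section \<open>Reflection subgroups of almost parabolic sets\<close>

lemma hperm_ap_refls:
  assumes Z: "block_order n Z"
  shows "ap_refls (type_A (n - 1)) (ap_set Z) \<subseteq> carrier (cox_A n)"
    "hperm ` ap_refls (type_A (n - 1)) (ap_set Z) = transps (cover Z)"
proof -
  have roots: "ap_set Z \<subseteq> roots (type_A (n - 1))"
    using almost_parabolic_ap_set[OF Z] by (simp add: almost_parabolic_def)
  have refl: "root_refl (type_A (n - 1)) \<gamma> \<in> carrier (cox_A n)"
    "hperm (root_refl (type_A (n - 1)) \<gamma>) = Transposition.transpose i j"
    if "\<gamma> \<in> ap_set Z" "(i, j) \<in> cover Z" "cvec \<gamma> = dvec i j" for \<gamma> i j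
    using hperm_root_refl[OF block_order_neq[OF Z that(2)] that(3) subsetD[OF roots that(1)]] .
  show "ap_refls (type_A (n - 1)) (ap_set Z) \<subseteq> carrier (cox_A n)"
  proof
    fix r assume "r \<in> ap_refls (type_A (n - 1)) (ap_set Z)"
    then obtain \<gamma> where \<gamma>: "\<gamma> \<in> ap_set Z" "r = root_refl (type_A (n - 1)) \<gamma>" by (auto simp: ap_refls_def)
    then obtain i j where "(i, j) \<in> cover Z" "cvec \<gamma> = dvec i j" by (auto simp: ap_set_def)
    then show "r \<in> carrier (cox_A n)" using refl(1)[OF \<gamma>(1)] \<gamma>(2) by simp
  qed
  show "hperm ` ap_refls (type_A (n - 1)) (ap_set Z) = transps (cover Z)"
  proof (intro equalityI subsetI)
    fix t assume "t \<in> hperm ` ap_refls (type_A (n - 1)) (ap_set Z)"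
    then obtain \<gamma> where \<gamma>: "\<gamma> \<in> ap_set Z" "t = hperm (root_refl (type_A (n - 1)) \<gamma>)" by (auto simp: ap_refls_def)
    then obtain i j where ij: "(i, j) \<in> cover Z" "cvec \<gamma> = dvec i j" by (auto simp: ap_set_def)
    then have "t = Transposition.transpose i j" using refl(2)[OF \<gamma>(1)] \<gamma>(2) by simp
    then show "t \<in> transps (cover Z)" using ij(1) by (force simp: transps_def)
  next
    fix t assume "t \<in> transps (cover Z)"
    then obtain i j where ij: "(i, j) \<in> cover Z" "t = Transposition.transpose i j" by (auto simp: transps_def)
    obtain \<gamma> where \<gamma>: "\<gamma> \<in> ap_set Z" "cvec \<gamma> = dvec i j" using ex_ap_set_root[OF Z ij(1)] .
    then have "t = hperm (root_refl (type_A (n - 1)) \<gamma>)" using refl(2)[OF \<gamma>(1) ij(1) \<gamma>(2)] ij(2) by simp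
    then show "t \<in> hperm ` ap_refls (type_A (n - 1)) (ap_set Z)" using \<gamma>(1) by (auto simp: ap_refls_def)
  qed
qed

lemma hperm_ap_group:
  assumes Z: "block_order n Z"
  shows "ap_group (type_A (n - 1)) (ap_set Z) \<subseteq> carrier (cox_A n)"
    "hperm ` ap_group (type_A (n - 1)) (ap_set Z) = block_perms n (comparability Z)"
  using group_hom.generate_img[OF group_hom_hperm hperm_ap_refls(1)[OF Z]]
    group.generate_incl[OF group_cox_A hperm_ap_refls(1)[OF Z]]
  by (simp_all only: ap_group_def hperm_ap_refls(2)[OF Z] generate_transps[OF Z])

text \<open>The whole group is finite, so every almost parabolic set is of spherical type.\<close>

lemma spherical_ap_type_A: "spherical_ap (type_A (n - 1)) = ap_set ` {Z. block_order n Z}"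
proof (intro equalityI subsetI)
  fix X assume "X \<in> spherical_ap (type_A (n - 1))"
  then have "almost_parabolic (type_A (n - 1)) X" by (simp add: spherical_ap_def)
  then show "X \<in> ap_set ` {Z. block_order n Z}" using almost_parabolic_imp_ap_set by blast
next
  fix X assume "X \<in> ap_set ` {Z. block_order n Z}"
  then obtain Z where Z: "block_order n Z" "X = ap_set Z" by blast
  have "finite (ap_group (type_A (n - 1)) X)"
    unfolding Z(2) by (rule finite_subset[OF hperm_ap_group(1)[OF Z(1)] finite_carrier_cox_A])
  then show "X \<in> spherical_ap (type_A (n - 1))"
    unfolding Z(2) using almost_parabolic_ap_set[OF Z(1)] by (simp add: spherical_ap_def)
qed

lemma coset_minimal_ap:
  assumes Y: "suborder n Y Z" and u: "u \<in> carrier (cox_A n)"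
  shows "coset_minimal (cox_A n) (ap_refls (type_A (n - 1)) (ap_set Z)) (ap_refls (type_A (n - 1)) (ap_set Y)) u
    \<longleftrightarrow> hperm u \<in> block_perms n (comparability Z) \<and> map_prod (hperm u) (hperm u) ` Y \<subseteq> Z"
  using coset_minimal_inj_hom[OF group_hom_hperm hperm_inj hperm_ap_refls(1)[OF suborderD(2)[OF Y]]
      hperm_ap_refls(1)[OF suborderD(1)[OF Y]] u] coset_minimal_transps[OF Y, of "hperm u"]
  unfolding hperm_ap_refls(2)[OF suborderD(2)[OF Y]] hperm_ap_refls(2)[OF suborderD(1)[OF Y]] by simp

section \<open>Base points and cells\<close>

lemma flat_eq_zero:
  assumes Z: "block_order n Z" and x: "x \<in> flat n Z"
    and const: "\<And>i j. (i, j) \<in> cover Z \<Longrightarrow> Poly_Mapping.lookup x i = Poly_Mapping.lookup x j"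
  shows "x = 0"
proof (rule poly_mapping_eqI, simp)
  fix i
  have const': "Poly_Mapping.lookup x i = Poly_Mapping.lookup x j" if "(i, j) \<in> (cover Z)\<^sup>+" for i j
    using that
  proof (induction rule: trancl_induct)
    case (base y) then show ?case by (rule const)
  next
    case (step y z) then show ?case using const[OF step.hyps(2)] by simp
  qed
  show "Poly_Mapping.lookup x i = 0"
  proof (cases "i \<in> {1..n}")
    case True
    note P = block_of_subset[OF Z True]
    have "0 = mass x (block_of Z i)" using x P crossings_block_of[OF Z] by (simp add: flat_def)
    also have "\<dots> = (\<Sum>a\<in>block_of Z i. Poly_Mapping.lookup x i)"
      unfolding mass_def
    proof (rule sum.cong[OF refl])
      fix a assume "a \<in> block_of Z i"
      then consider "a = i" | "(a, i) \<in> Z" | "(i, a) \<in> Z"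
        by (auto simp: block_of_def comparability_iff)
      then show "Poly_Mapping.lookup x a = Poly_Mapping.lookup x i"
      proof cases
        case 2
        then show ?thesis using const'[of a i] block_order_trancl_cover[OF Z] by simp
      next
        case 3
        then show ?thesis using const'[of i a] block_order_trancl_cover[OF Z] by simp
      qed simp
    qed
    finally have "real (card (block_of Z i)) * Poly_Mapping.lookup x i = 0" by simp
    moreover have "i \<in> block_of Z i" by (simp add: block_of_def)
    then have "card (block_of Z i) \<noteq> 0" using finite_subset[OF P] by auto
    ultimately show ?thesis by simp
  next
    case False
    moreover have "Poly_Mapping.keys x \<subseteq> {1..n}" using x by (simp add: flat_def)
    ultimately have "i \<notin> Poly_Mapping.keys x" by blast
    then show ?thesis by (simp add: in_keys_iff)
  qed
qed

text \<open>The transposition of \<open>i\<close> and \<open>j\<close> permutes the other pairs,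
  which therefore contribute equally to both coordinates; the pair \<open>(i, j)\<close> itself
  contributes 1 and -1. Classically: the Weyl vector pairs to 1 with every simple coroot.\<close>

lemma lookup_osum_cover:
  assumes Z: "block_order n Z" and ij: "(i, j) \<in> cover Z"
  shows "Poly_Mapping.lookup (osum Z) i - Poly_Mapping.lookup (osum Z) j = 2"
proof -
  let ?t = "Transposition.transpose i j" and ?Z = "Z - {(i, j)}"
  have Zij: "(i, j) \<in> Z" "(j, i) \<notin> Z" "i \<noteq> j"
    using ij cover_subset block_orderD(3,6)[OF Z] by blast+
  have mv: "map_prod ?t ?t q \<in> ?Z" if q: "q \<in> ?Z" for q
  proof -
    obtain a b where ab: "q = (a, b)" by fastforce
    have "(?t a, ?t b) \<in> Z" using cover_transpose[OF Z ij, of a b] q ab by auto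
    moreover have "(?t a, ?t b) \<noteq> (i, j)"
    proof
      assume "(?t a, ?t b) = (i, j)"
      then have "a = j" "b = i" by (auto simp: transpose_eq_iff)
      then show False using q ab Zij(2) by simp
    qed
    ultimately show ?thesis using ab by simp
  qed
  have "map_prod ?t ?t ` ?Z = ?Z"
  proof (intro equalityI subsetI)
    fix q assume q: "q \<in> ?Z"
    have "q = map_prod ?t ?t (map_prod ?t ?t q)" by (cases q) simp
    then show "q \<in> map_prod ?t ?t ` ?Z" using mv[OF q] by (rule image_eqI)
  next
    fix q assume "q \<in> map_prod ?t ?t ` ?Z"
    then obtain q' where "q = map_prod ?t ?t q'" "q' \<in> ?Z" by (rule imageE)
    then show "q \<in> ?Z" using mv[of q'] by (simp only:)
  qed
  moreover have inj_t: "inj ?t" by simp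
  from lookup_osum_map_prod[OF inj_t, of ?Z i]
  have "Poly_Mapping.lookup (osum (map_prod ?t ?t ` ?Z)) j = Poly_Mapping.lookup (osum ?Z) i" by simp
  ultimately have "Poly_Mapping.lookup (osum ?Z) j = Poly_Mapping.lookup (osum ?Z) i" by (simp only:)
  moreover have "osum Z = dvec i j + osum ?Z"
    unfolding osum_def using sum.remove[OF block_orderD(2)[OF Z] Zij(1), of "\<lambda>(i, j). dvec i j"] by simp
  ultimately show ?thesis using Zij(3) by (simp add: lookup_add lookup_dvec)
qed

lemma osum_flat: "block_order n Z \<Longrightarrow> osum Z \<in> flat n Z"
  using osum_zono[of n Z Z] zono_flat(1)[of n Z] by (auto simp: orders_def)

lemma span_ap_set:
  assumes Z: "block_order n Z" shows "cvec ` span (ap_set Z) = flat n Z"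
  unfolding linear_span_image[OF linear_cvec, symmetric] cvec_ap_set[OF Z] by (rule span_dvec_cover[OF Z])

lemma span_ap_set_iff:
  assumes Z: "block_order n Z" shows "v \<in> span (ap_set Z) \<longleftrightarrow> cvec v \<in> flat n Z"
  unfolding span_ap_set[OF Z, symmetric] by (rule inj_image_mem_iff[OF inj_cvec, symmetric])

text \<open>Fundamental weights of the blocks, which are ordinary symmetric groups.\<close>

lemma ex_dual:
  assumes Z: "block_order n Z" and ab: "(a, b) \<in> cover Z"
  shows "\<exists>x\<in>flat n Z. \<forall>(i, j)\<in>cover Z.
    Poly_Mapping.lookup x i - Poly_Mapping.lookup x j = 2 * of_bool ((i, j) = (a, b))"
proof -
  let ?D = "{e. e = a \<or> (e, a) \<in> Z}" and ?B = "block_of Z a"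
  have aN: "a \<in> {1..n}" using ab cover_subset block_orderD(1)[OF Z] by blast
  have BN: "?B \<subseteq> {1..n}" by (rule block_of_subset[OF Z aN])
  have DB: "?D \<subseteq> ?B" by (auto simp: block_of_def comparability_iff)
  have finB: "finite ?B" using BN finite_subset by blast
  then have finD: "finite ?D" using DB finite_subset by blast
  have "a \<in> ?B" by (simp add: block_of_def)
  then have m: "card ?B \<noteq> 0" using finB by auto
  \<comment> \<open>Subtracting the mean makes the mass of the block vanish. The factor 2 in
    \<open>w\<close> compensates for the form being half the standard product of the scaled
    vectors.\<close>
  define r where "r = real (card ?D) / real (card ?B)"
  define w where "w e = 2 * (of_bool (e \<in> ?D) - r)" for e
  define x where "x = (\<Sum>e\<in>?B. Poly_Mapping.single e (w e))"
  have "Poly_Mapping.lookup x c = (\<Sum>e\<in>?B. if e = c then w e else 0)" for c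
    unfolding x_def lookup_sum lookup_single when_def ..
  then have lx: "Poly_Mapping.lookup x c = (if c \<in> ?B then w c else 0)" for c
    using sum.delta[OF finB, of c w] by simp
  have keys: "Poly_Mapping.keys x \<subseteq> {1..n}" using lx BN by (auto simp: in_keys_iff split: if_splits)
  have "mass x A = 0" if A: "A \<subseteq> {1..n}" "crossings Z A = 0" for A
  proof -
    have closed: "i \<in> A \<longleftrightarrow> a \<in> A" if "i \<in> ?B" for i
      using that crossings_zeroD[OF block_orderD(2)[OF Z] A(2), of i a]
        crossings_zeroD[OF block_orderD(2)[OF Z] A(2), of a i]
      by (auto simp: block_of_def comparability_iff)
    have "mass x A = (\<Sum>c\<in>A \<inter> ?B. w c)"
      unfolding mass_def lx using finite_subset[OF A(1)] by (simp only: sum.inter_restrict finite_atLeastAtMost)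
    also have "\<dots> = 0"
    proof (cases "a \<in> A")
      case True
      then have "A \<inter> ?B = ?B" using closed by blast
      moreover have "(\<Sum>c\<in>?B. of_bool (c \<in> ?D)) = (\<Sum>c\<in>?D. 1::real)"
        using finB DB by (intro sum.mono_neutral_cong_right) auto
      then have "(\<Sum>c\<in>?B. w c) = 2 * (real (card ?D) - real (card ?B) * r)"
        unfolding w_def sum_distrib_left[symmetric] sum_subtractf by simp
      moreover have "real (card ?B) * r = real (card ?D)" using m by (simp add: r_def)
      ultimately show ?thesis by simp
    next
      case False
      then have "A \<inter> ?B = {}" using closed by blast
      then show ?thesis by simp
    qed
    finally show ?thesis .
  qed
  then have "x \<in> flat n Z" using keys by (simp add: flat_def)
  moreover have "Poly_Mapping.lookup x i - Poly_Mapping.lookup x j = 2 * of_bool ((i, j) = (a, b))"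
    if ij: "(i, j) \<in> cover Z" for i j
  proof -
    have "(i, j) \<in> Z" using ij cover_subset by blast
    then have "i \<in> ?B \<longleftrightarrow> j \<in> ?B" by (rule block_of_closed[OF Z])
    moreover have d: "of_bool (i \<in> ?D) - of_bool (j \<in> ?D) = (of_bool ((i, j) = (a, b)) :: real)"
      using mass_down_cover[OF Z ab ij] unfolding mass_dvec[OF finD] .
    moreover have "i \<in> ?D \<Longrightarrow> i \<in> ?B" "j \<in> ?D \<Longrightarrow> j \<in> ?B" using DB by blast+
    ultimately show ?thesis
    proof (cases "i \<in> ?B")
      case True
      then have "Poly_Mapping.lookup x i - Poly_Mapping.lookup x j =
          2 * (of_bool (i \<in> ?D) - of_bool (j \<in> ?D))"
        using \<open>i \<in> ?B \<longleftrightarrow> j \<in> ?B\<close> by (simp only: lx w_def if_True) argo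
      then show ?thesis by (simp only: d)
    next
      case False
      then have "Poly_Mapping.lookup x i - Poly_Mapping.lookup x j = 0"
        "of_bool (i \<in> ?D) - of_bool (j \<in> ?D) = (0::real)"
        using \<open>i \<in> ?B \<longleftrightarrow> j \<in> ?B\<close> DB unfolding lx by auto
      then show ?thesis unfolding d by simp
    qed
  qed
  ultimately show ?thesis by blast
qed

lemma form_ap_unique:
  assumes Z: "block_order n Z" and v: "v \<in> span (ap_set Z)" "w \<in> span (ap_set Z)"
    and eq: "\<And>\<gamma>. \<gamma> \<in> ap_set Z \<Longrightarrow> form (type_A k) v \<gamma> = form (type_A k) w \<gamma>"
  shows "v = w"
proof -
  have "v - w \<in> span (ap_set Z)" using v by (rule span_diff)
  then have "cvec (v - w) \<in> flat n Z" using span_ap_set_iff[OF Z] by simp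
  moreover have "Poly_Mapping.lookup (cvec (v - w)) i = Poly_Mapping.lookup (cvec (v - w)) j"
    if ij: "(i, j) \<in> cover Z" for i j
  proof -
    obtain \<gamma> where \<gamma>: "\<gamma> \<in> ap_set Z" "cvec \<gamma> = dvec i j" using ex_ap_set_root[OF Z ij] .
    show ?thesis
      using eq[OF \<gamma>(1)] form_cvec_dvec[OF \<gamma>(2), of k v] form_cvec_dvec[OF \<gamma>(2), of k w]
      by (simp add: linear_diff[OF linear_cvec] lookup_minus)
  qed
  ultimately have "cvec (v - w) = 0" by (rule flat_eq_zero[OF Z])
  then show ?thesis by (simp add: linear_diff[OF linear_cvec] inj_eq[OF inj_cvec])
qed

text \<open>Both vectors lie in \<open>flat\<close> and drop by 2 along every covering pair, the one
  by duality with the form doubled, the other by \<open>lookup_osum_cover\<close>. In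
  \<open>flat\<close> these drops determine a vector.\<close>

lemma cvec_base_pt:
  assumes Z: "block_order n Z"
  shows "cvec (base_pt (type_A (n - 1)) (ap_set Z)) = osum Z"
proof -
  let ?\<Gamma> = "type_A (n - 1)"
  have dual: "dual_vec ?\<Gamma> (ap_set Z) \<beta> \<in> span (ap_set Z) \<and>
      (\<forall>\<gamma>\<in>ap_set Z. form ?\<Gamma> (dual_vec ?\<Gamma> (ap_set Z) \<beta>) \<gamma> = (if \<gamma> = \<beta> then 1 else 0))"
    if \<beta>: "\<beta> \<in> ap_set Z" for \<beta>
  proof -
    obtain a b where ab: "(a, b) \<in> cover Z" "cvec \<beta> = dvec a b" using \<beta> by (auto simp: ap_set_def)
    obtain x where x: "x \<in> flat n Z" "\<And>i j. (i, j) \<in> cover Z \<Longrightarrow>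
        Poly_Mapping.lookup x i - Poly_Mapping.lookup x j = 2 * of_bool ((i, j) = (a, b))"
      using ex_dual[OF Z ab(1)] by blast
    obtain v where v: "v \<in> span (ap_set Z)" "cvec v = x" using x(1) span_ap_set[OF Z] by (metis imageE)
    have fv: "form ?\<Gamma> v \<gamma> = (if \<gamma> = \<beta> then 1 else 0)" if \<gamma>: "\<gamma> \<in> ap_set Z" for \<gamma>
    proof -
      obtain c d where cd: "(c, d) \<in> cover Z" "cvec \<gamma> = dvec c d" using \<gamma> by (auto simp: ap_set_def)
      have "\<gamma> = \<beta> \<longleftrightarrow> dvec c d = dvec a b" using inj_cvec cd(2) ab(2) by (metis injD)
      also have "\<dots> \<longleftrightarrow> (c, d) = (a, b)" using dvec_inj[OF block_order_neq[OF Z cd(1)], of a b] by auto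
      finally show ?thesis using form_cvec_dvec[OF cd(2), of "n - 1" v] x(2)[OF cd(1)] v(2) by auto
    qed
    show ?thesis
      unfolding dual_vec_def
    proof (rule theI[where a = v])
      show "v \<in> span (ap_set Z) \<and> (\<forall>\<gamma>\<in>ap_set Z. form ?\<Gamma> v \<gamma> = (if \<gamma> = \<beta> then 1 else 0))"
        using v(1) fv by blast
      show "w = v" if "w \<in> span (ap_set Z) \<and> (\<forall>\<gamma>\<in>ap_set Z. form ?\<Gamma> w \<gamma> = (if \<gamma> = \<beta> then 1 else 0))" for w
        using that v(1) fv by (intro form_ap_unique[OF Z, where k = "n - 1"]) simp_all
    qed
  qed
  let ?o = "base_pt ?\<Gamma> (ap_set Z)"
  have "?o \<in> span (ap_set Z)" unfolding base_pt_def using dual by (intro span_sum) blast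
  then have "cvec ?o - osum Z \<in> flat n Z"
    using span_ap_set_iff[OF Z] osum_flat[OF Z] by (intro subspace_diff[OF subspace_flat]) simp_all
  moreover have "Poly_Mapping.lookup (cvec ?o - osum Z) i = Poly_Mapping.lookup (cvec ?o - osum Z) j"
    if ij: "(i, j) \<in> cover Z" for i j
  proof -
    obtain \<gamma> where \<gamma>: "\<gamma> \<in> ap_set Z" "cvec \<gamma> = dvec i j" using ex_ap_set_root[OF Z ij] .
    have "Poly_Mapping.lookup (cvec ?o) i - Poly_Mapping.lookup (cvec ?o) j =
        (\<Sum>\<beta>\<in>ap_set Z. Poly_Mapping.lookup (cvec (dual_vec ?\<Gamma> (ap_set Z) \<beta>)) i -
          Poly_Mapping.lookup (cvec (dual_vec ?\<Gamma> (ap_set Z) \<beta>)) j)"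
      unfolding base_pt_def linear_sum[OF linear_cvec] lookup_sum sum_subtractf ..
    also have "\<dots> = (\<Sum>\<beta>\<in>ap_set Z. if \<beta> = \<gamma> then 2 else 0)"
    proof (rule sum.cong[OF refl])
      fix \<beta> assume "\<beta> \<in> ap_set Z"
      from dual[OF this] show "Poly_Mapping.lookup (cvec (dual_vec ?\<Gamma> (ap_set Z) \<beta>)) i -
          Poly_Mapping.lookup (cvec (dual_vec ?\<Gamma> (ap_set Z) \<beta>)) j = (if \<beta> = \<gamma> then 2 else 0)"
        unfolding form_cvec_dvec[OF \<gamma>(2), of "n - 1", symmetric] using \<gamma>(1) by simp
    qed
    also have "\<dots> = 2" using \<gamma>(1) finite_ap_set[OF Z] by simp
    finally show ?thesis using lookup_osum_cover[OF Z ij] by (simp add: lookup_minus)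
  qed
  ultimately have "cvec ?o - osum Z = 0" by (rule flat_eq_zero[OF Z])
  then show ?thesis by simp
qed

lemma cvec_coxeter_face:
  assumes Y: "suborder n Y Z" and u: "u \<in> carrier (cox_A n)"
  defines "p \<equiv> hperm u"
  shows "cvec ` coxeter_face (type_A (n - 1)) u (ap_set Y) (ap_set Z) =
    (+) (osum (map_prod p p ` Z - map_prod p p ` Y)) ` zono n (map_prod p p ` Y)"
proof -
  let ?\<Gamma> = "type_A (n - 1)"
  have pt: "cvec (act ?\<Gamma> (u \<otimes>\<^bsub>cox_A n\<^esub> z) (base_pt ?\<Gamma> (ap_set Z))) =
      osum (map_prod (p \<circ> hperm z) (p \<circ> hperm z) ` Z)" if "z \<in> ap_group ?\<Gamma> (ap_set Y)" for z
  proof -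
    have z: "z \<in> carrier (cox_A n)" using that hperm_ap_group(1)[OF suborderD(1)[OF Y]] by blast
    show ?thesis
      unfolding cvec_act cvec_base_pt[OF suborderD(2)[OF Y]] hperm_mult[OF u z] p_def
      by (intro perm_act_osum bij_comp hperm_bij)
  qed
  have "cvec ` coxeter_face ?\<Gamma> u (ap_set Y) (ap_set Z) =
      convex hull (cvec ` (\<lambda>z. act ?\<Gamma> (u \<otimes>\<^bsub>cox_A n\<^esub> z) (base_pt ?\<Gamma> (ap_set Z))) ` ap_group ?\<Gamma> (ap_set Y))"
    unfolding coxeter_face_def by (rule convex_hull_linear_image[OF linear_cvec])
  also have "cvec ` (\<lambda>z. act ?\<Gamma> (u \<otimes>\<^bsub>cox_A n\<^esub> z) (base_pt ?\<Gamma> (ap_set Z))) ` ap_group ?\<Gamma> (ap_set Y) =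
      (\<lambda>q. osum (map_prod (p \<circ> q) (p \<circ> q) ` Z)) ` hperm ` ap_group ?\<Gamma> (ap_set Y)"
    unfolding image_image using pt by (intro image_cong refl)
  also have "hperm ` ap_group ?\<Gamma> (ap_set Y) = block_perms n (comparability Y)"
    by (rule hperm_ap_group(2)[OF suborderD(1)[OF Y]])
  also have "convex hull ((\<lambda>q. osum (map_prod (p \<circ> q) (p \<circ> q) ` Z)) ` block_perms n (comparability Y)) =
      (+) (osum (map_prod p p ` Z - map_prod p p ` Y)) ` zono n (map_prod p p ` Y)"
    using face_hull[OF Y, of p] hperm_permutes[OF u] by (simp add: p_def)
  finally show ?thesis .
qed

lemma coxeter_cell_eq:
  assumes Z: "block_order n Z"
  shows "coxeter_cell (type_A (n - 1)) (ap_set Z) = cvec -` zono n Z"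
    "cvec ` (cvec -` zono n Z) = zono n Z"
proof -
  let ?\<Gamma> = "type_A (n - 1)"
  have "cvec ` coxeter_cell ?\<Gamma> (ap_set Z) =
      convex hull (cvec ` (\<lambda>z. act ?\<Gamma> z (base_pt ?\<Gamma> (ap_set Z))) ` ap_group ?\<Gamma> (ap_set Z))"
    unfolding coxeter_cell_def by (rule convex_hull_linear_image[OF linear_cvec])
  also have "cvec ` (\<lambda>z. act ?\<Gamma> z (base_pt ?\<Gamma> (ap_set Z))) ` ap_group ?\<Gamma> (ap_set Z) =
      (\<lambda>q. osum (map_prod q q ` Z)) ` hperm ` ap_group ?\<Gamma> (ap_set Z)"
    unfolding image_image cvec_act cvec_base_pt[OF Z] using perm_act_osum[OF hperm_bij]
    by (intro image_cong refl)
  also have "hperm ` ap_group ?\<Gamma> (ap_set Z) = block_perms n (comparability Z)"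
    by (rule hperm_ap_group(2)[OF Z])
  also have "convex hull ((\<lambda>q. osum (map_prod q q ` Z)) ` block_perms n (comparability Z)) = zono n Z"
  proof -
    have "map_prod id id ` Z = Z" by (simp only: map_prod.id image_id id_apply)
    then show ?thesis
      using face_hull[OF suborder_refl[OF Z] permutes_id] unfolding id_comp by (simp add: osum_def)
  qed
  finally have img: "cvec ` coxeter_cell ?\<Gamma> (ap_set Z) = zono n Z" .
  then show "coxeter_cell ?\<Gamma> (ap_set Z) = cvec -` zono n Z"
    using inj_vimage_image_eq[OF inj_cvec] by metis
  then show "cvec ` (cvec -` zono n Z) = zono n Z" using img by simp
qed

lemma rel_interior_coxeter_cell:
  assumes Z: "block_order n Z"
  shows "cvec ` rel_interior (coxeter_cell (type_A (n - 1)) (ap_set Z)) = zono_int n Z"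
proof -
  have "rel_interior (cvec -` zono n Z) = cvec -` zono_int n Z"
  proof (rule rel_interior_zono_vimage[OF Z])
    show "continuous_on UNIV (\<lambda>v. Poly_Mapping.lookup (cvec v) c)" for c
      unfolding lookup_cvec by (cases "c = 0") (auto intro!: continuous_intros)
    show "cvec ((1 - t) *\<^sub>R u + t *\<^sub>R v) = (1 - t) *\<^sub>R cvec u + t *\<^sub>R cvec v" for u v t
      by (simp only: linear_add[OF linear_cvec] linear_scale[OF linear_cvec])
    show "cvec 0 = 0" by (rule linear_0[OF linear_cvec])
  qed
  moreover have "zono_int n Z \<subseteq> cvec ` (cvec -` zono n Z)"
    unfolding coxeter_cell_eq(2)[OF Z] by (auto simp: zono_int_def)
  then have "cvec ` (cvec -` zono_int n Z) = zono_int n Z" by auto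
  ultimately show ?thesis unfolding coxeter_cell_eq(1)[OF Z] by simp
qed

section \<open>The generalized BEER complex of type A\<close>

lemma continuous_map_sum_topology:
  assumes "\<And>i. i \<in> I \<Longrightarrow> continuous_map (X i) Y (\<lambda>x. f (i, x))"
  shows "continuous_map (sum_topology X I) Y f"
  unfolding continuous_map_def
proof (intro conjI allI impI)
  show "f \<in> topspace (sum_topology X I) \<rightarrow> topspace Y"
    using assms by (auto simp: continuous_map_def Pi_iff)
  fix U assume U: "openin Y U"
  have "openin (X i) {x. (i, x) \<in> {p \<in> topspace (sum_topology X I). f p \<in> U}}" if i: "i \<in> I" for i
  proof -
    have "openin (X i) {x \<in> topspace (X i). f (i, x) \<in> U}"
      using assms[OF i] U by (rule openin_continuous_map_preimage)
    moreover have "{x. (i, x) \<in> {p \<in> topspace (sum_topology X I). f p \<in> U}} = {x \<in> topspace (X i). f (i, x) \<in> U}"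
      using i by auto
    ultimately show ?thesis by simp
  qed
  then show "openin (sum_topology X I) {p \<in> topspace (sum_topology X I). f p \<in> U}"
    unfolding openin_sum_topology by auto
qed

lemma compact_space_sum_topology:
  assumes "finite I" "\<And>i. i \<in> I \<Longrightarrow> compact_space (X i)"
  shows "compact_space (sum_topology X I)"
proof -
  have "topspace (sum_topology X I) = (\<Union>i\<in>I. (\<lambda>x. (i, x)) ` topspace (X i))" by auto
  moreover have "compactin (sum_topology X I) ((\<lambda>x. (i, x)) ` topspace (X i))" if "i \<in> I" for i
    using assms(2)[OF that] continuous_map_component_injection[OF that, of X]
    unfolding compact_space_def by (rule image_compactin)
  ultimately show ?thesis
    unfolding compact_space_def using assms(1) by (simp only:) (intro compactin_Union, auto)
qed

definition order_of_ap :: "nat \<Rightarrow> nat geom set \<Rightarrow> (nat \<times> nat) set" where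
  "order_of_ap n X = (SOME Z. block_order n Z \<and> X = ap_set Z)"

lemma order_of_ap: "block_order n Z \<Longrightarrow> order_of_ap n (ap_set Z) = Z"
proof -
  assume Z: "block_order n Z"
  then have "block_order n (order_of_ap n (ap_set Z)) \<and> ap_set Z = ap_set (order_of_ap n (ap_set Z))"
    unfolding order_of_ap_def by (intro someI[of "\<lambda>Y. block_order n Y \<and> ap_set Z = ap_set Y" Z]) simp
  then show ?thesis using ap_set_inj[OF _ Z] by metis
qed

lemma act_ap_set:
  assumes V: "block_order n V" and u: "u \<in> carrier (cox_A n)"
  shows "act (type_A (n - 1)) u ` ap_set V = ap_set (map_prod (hperm u) (hperm u) ` V)"
proof -
  have pp: "hperm u permutes {1..n}" by (rule hperm_permutes[OF u])
  have "cvec ` act (type_A (n - 1)) u ` ap_set V = perm_act (hperm u) ` cvec ` ap_set V"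
    unfolding image_image cvec_act ..
  also have "\<dots> = (\<lambda>x. perm_act (hperm u) (case x of (i, j) \<Rightarrow> dvec i j)) ` cover V"
    unfolding cvec_ap_set[OF V] image_image ..
  also have "\<dots> = (\<lambda>(i, j). dvec i j) ` map_prod (hperm u) (hperm u) ` cover V"
    unfolding image_image by (rule image_cong) (auto simp: perm_act_dvec permutes_bij[OF pp])
  also have "\<dots> = cvec ` ap_set (map_prod (hperm u) (hperm u) ` V)"
    unfolding cvec_ap_set[OF block_order_map_prod[OF V pp]] cover_map_prod[OF permutes_inj[OF pp]] ..
  finally show ?thesis by (simp add: inj_image_eq_iff[OF inj_cvec])
qed

text \<open>The arrangement \<open>T\<close> is the image of \<open>Z\<close> under
  \<open>u\<close>, and minimality of \<open>u\<close> says that the image of the smaller order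
  stays inside \<open>Z\<close>. In coordinates the translation vector is minus the sum of the roots
  across the cuts.\<close>

lemma beer_glue_face_step:
  assumes "beer_glue (type_A (n - 1)) (X, x) (X', x')"
  obtains Z Y where "block_order n Z" "X = ap_set Z" "X' = ap_set Y" "face_step n Z (cvec x) Y (cvec x')"
  using assms
proof (cases rule: beer_glue.cases)
  case (1 Y u)
  let ?\<Gamma> = "type_A (n - 1)"
  obtain Z where Z: "block_order n Z" "X = ap_set Z" using 1(3) unfolding spherical_ap_type_A by blast
  have APX: "almost_parabolic ?\<Gamma> X" using 1(3) by (simp add: spherical_ap_def)
  have YX: "Y \<subseteq> X" using 1(4) by blast
  have "independent Y" using APX independent_mono[OF _ YX] by (simp add: almost_parabolic_def)
  then have "almost_parabolic ?\<Gamma> Y"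
    using APX YX unfolding almost_parabolic_def by blast
  then obtain V where V: "block_order n V" "Y = ap_set V" by (rule almost_parabolic_imp_ap_set)
  have "cover V \<subseteq> cover Z"
  proof (rule subrelI)
    fix i j assume "(i, j) \<in> cover V"
    then show "(i, j) \<in> cover Z"
      using YX cover_ap_set[OF V(1), of i j] cover_ap_set[OF Z(1), of i j] unfolding V(2) Z(2) by blast
  qed
  then have VZ: "suborder n V Z" by (rule suborderI_cover[OF V(1) Z(1)])
  have "u \<in> generate (cox_A n) (ap_refls ?\<Gamma> X)" using 1(5) by (simp add: coset_minimal_def)
  then have u: "u \<in> carrier (cox_A n)" using hperm_ap_group(1)[OF Z(1)] by (auto simp: ap_group_def Z(2))
  define p where "p = hperm u"
  have p: "p \<in> block_perms n (comparability Z)" "map_prod p p ` V \<subseteq> Z"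
    using 1(5) coset_minimal_ap[OF VZ u] by (simp_all add: V(2) Z(2) p_def)
  have pp: "p permutes {1..n}" by (rule block_perms_permutes[OF p(1)])
  have S: "suborder n (map_prod p p ` V) (map_prod p p ` Z)" by (rule suborder_map_prod[OF VZ pp])
  have X': "act ?\<Gamma> u ` Y = ap_set (map_prod p p ` V)"
    unfolding V(2) p_def by (rule act_ap_set[OF V(1) u])
  have x': "cvec x' = cvec x - osum (map_prod p p ` Z - map_prod p p ` V)"
  proof -
    have fin: "finite (map_prod p p ` Z)" using block_orderD(2)[OF Z(1)] by simp
    have "cvec x' = cvec x + (osum (map_prod p p ` V) - osum (map_prod p p ` Z))"
      unfolding 1(2) linear_add[OF linear_cvec] cvec_act linear_diff[OF linear_cvec]
        V(2) Z(2) cvec_base_pt[OF V(1)] cvec_base_pt[OF Z(1)] p_def[symmetric]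
        perm_act_diff[OF permutes_bij[OF pp]] perm_act_osum[OF permutes_bij[OF pp]] ..
    moreover have "map_prod p p ` Z = map_prod p p ` V \<union> (map_prod p p ` Z - map_prod p p ` V)"
      using suborderD(3)[OF S] by blast
    then have "osum (map_prod p p ` Z) =
        osum (map_prod p p ` V) + osum (map_prod p p ` Z - map_prod p p ` V)"
      using osum_Un[of "map_prod p p ` V" "map_prod p p ` Z - map_prod p p ` V"] fin
        finite_subset[OF suborderD(3)[OF S] fin] by (metis Diff_disjoint finite_Diff)
    ultimately show ?thesis by simp
  qed
  have "cvec x \<in> cvec ` coxeter_face ?\<Gamma> u Y X" using 1(6) by (rule imageI)
  then have "cvec x' \<in> zono n (map_prod p p ` V)"
    unfolding x' V(2) Z(2) cvec_coxeter_face[OF VZ u] p_def[symmetric] by auto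
  then have "face_step n Z (cvec x) (map_prod p p ` V) (cvec x')"
    unfolding face_step_def using Z(1) S p x' block_perms_map_prod(2)[OF Z(1) p(1)]
    by (intro conjI exI[of _ "map_prod p p ` Z"])
  then show ?thesis using that Z X' 1(1) by blast
qed

text \<open>A permutation carrying \<open>Z\<close> to the arrangement \<open>T\<close> pulls
  \<open>Y\<close> back to a suborder \<open>V\<close> of \<open>Z\<close>. It is minimal with
  respect to \<open>V\<close> precisely because its image \<open>Y\<close> of \<open>V\<close> is
  contained in \<open>Z\<close>.\<close>

lemma face_step_beer_glue:
  assumes fs: "face_step n Z (cvec x) Y (cvec y)"
  shows "equivclp (beer_glue (type_A (n - 1))) (ap_set Z, x) (ap_set Y, y)"
proof -
  let ?\<Gamma> = "type_A (n - 1)"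
  obtain T where Z: "block_order n Z" and T: "suborder n Y T" "comparability T = comparability Z"
    "Y \<subseteq> Z" "cvec y = cvec x - osum (T - Y)" "cvec y \<in> zono n Y"
    using fs by (auto simp: face_step_def)
  obtain p where p: "p \<in> block_perms n (comparability Z)" "map_prod p p ` Z = T"
    using ex_block_perm[OF Z suborderD(2)[OF T(1)] T(2)] .
  have pp: "p permutes {1..n}" by (rule block_perms_permutes[OF p(1)])
  let ?q = "inv' p"
  define V where "V = map_prod ?q ?q ` Y"
  have pq: "p \<circ> ?q = id" "?q \<circ> p = id" using permutes_inv_o[OF pp] by auto
  have qp: "map_prod ?q ?q ` map_prod p p ` W = W" "map_prod p p ` map_prod ?q ?q ` W = W" for W
    unfolding image_comp map_prod.comp pq map_prod.id image_id id_apply by simp_all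
  have pV: "map_prod p p ` V = Y" unfolding V_def by (rule qp)
  have VZ: "suborder n V Z"
    using suborder_map_prod[OF T(1) permutes_inv[OF pp]] p(2) qp(1)[of Z] by (simp add: V_def)
  obtain u where u: "u \<in> carrier (cox_A n)" "hperm u = p" using ex_hperm[OF pp] by blast
  show ?thesis
  proof (cases "V = Z")
    case True
    \<comment> \<open>The gluing relation asks for a proper subset; in the improper case the face
      step is trivial and both points coincide.\<close>
    then have "T = Y" using pV p(2) by simp
    then have "Y = Z"
      using T(2,3) block_orderD(6)[OF Z] by (auto simp: comparability_def)
    moreover have "y = x" using T(4) \<open>T = Y\<close> inj_eq[OF inj_cvec] by (simp add: osum_def)
    ultimately show ?thesis by simp
  next
    case False
    have "ap_set V \<subseteq> ap_set Z" using suborder_cover[OF VZ] by (auto simp: ap_set_def)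
    moreover have "ap_set V \<noteq> ap_set Z" using False ap_set_inj[OF suborderD(1,2)[OF VZ]] by blast
    ultimately have sub: "ap_set V \<subset> ap_set Z" by blast
    have min: "coset_minimal (cox_A n) (ap_refls ?\<Gamma> (ap_set Z)) (ap_refls ?\<Gamma> (ap_set V)) u"
      unfolding coset_minimal_ap[OF VZ u(1)] u(2) pV using p(1) T(3) by simp
    have "cvec x = osum (T - Y) + cvec y" using T(4) by simp
    then have "cvec x \<in> cvec ` coxeter_face ?\<Gamma> u (ap_set V) (ap_set Z)"
      unfolding cvec_coxeter_face[OF VZ u(1)] u(2) pV p(2) using T(5) by (rule image_eqI)
    then have face: "x \<in> coxeter_face ?\<Gamma> u (ap_set V) (ap_set Z)"
      by (simp add: inj_image_mem_iff[OF inj_cvec])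
    have sph: "ap_set Z \<in> spherical_ap ?\<Gamma>" unfolding spherical_ap_type_A using Z by blast
    have glue: "beer_glue ?\<Gamma> (ap_set Z, x) (act ?\<Gamma> u ` ap_set V,
        x + act ?\<Gamma> u (base_pt ?\<Gamma> (ap_set V) - base_pt ?\<Gamma> (ap_set Z)))"
      by (rule beer_glue.intros[OF sph sub min face])
    then obtain Z' Y' where Z': "block_order n Z'" "ap_set Z = ap_set Z'" "act ?\<Gamma> u ` ap_set V = ap_set Y'"
      "face_step n Z' (cvec x) Y' (cvec (x + act ?\<Gamma> u (base_pt ?\<Gamma> (ap_set V) - base_pt ?\<Gamma> (ap_set Z))))"
      by (rule beer_glue_face_step)
    have "act ?\<Gamma> u ` ap_set V = ap_set Y"
      using act_ap_set[OF suborderD(1)[OF VZ] u(1)] unfolding u(2) pV .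
    moreover have "cvec (x + act ?\<Gamma> u (base_pt ?\<Gamma> (ap_set V) - base_pt ?\<Gamma> (ap_set Z))) = cvec y"
    proof -
      have "T = Y \<union> (T - Y)" using suborderD(3)[OF T(1)] by blast
      then have "osum T = osum Y + osum (T - Y)"
        using osum_Un[of Y "T - Y"] block_orderD(2)[OF suborderD(1)[OF T(1)]]
          block_orderD(2)[OF suborderD(2)[OF T(1)]] by (metis Diff_disjoint finite_Diff)
      then show ?thesis
        unfolding linear_add[OF linear_cvec] cvec_act linear_diff[OF linear_cvec] u(2)
          cvec_base_pt[OF suborderD(1)[OF VZ]] cvec_base_pt[OF Z]
          perm_act_diff[OF permutes_bij[OF pp]] perm_act_osum[OF permutes_bij[OF pp]] pV p(2) T(4) by simp
    qed
    then have "x + act ?\<Gamma> u (base_pt ?\<Gamma> (ap_set V) - base_pt ?\<Gamma> (ap_set Z)) = y" by (rule injD[OF inj_cvec])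
    ultimately have "beer_glue ?\<Gamma> (ap_set Z, x) (ap_set Y, y)" using glue by simp
    then show ?thesis by (rule r_into_equivclp)
  qed
qed

lemma compact_coxeter_cell: "block_order n Z \<Longrightarrow> compact (coxeter_cell (type_A (n - 1)) (ap_set Z))"
  unfolding coxeter_cell_def
  by (intro finite_imp_compact_convex_hull finite_imageI
      finite_subset[OF hperm_ap_group(1) finite_carrier_cox_A])

text \<open>In infinite dimension linearity does not give continuity. Here the norm is the sum of
  absolute values and every \<open>dvec\<close> has norm at most 2, which bounds the map.\<close>

lemma continuous_on_cvec: "continuous_on S cvec"
proof -
  have "norm (cvec v) \<le> norm v * 2" for v
  proof -
    have "norm (cvec v) \<le> (\<Sum>i\<in>Poly_Mapping.keys v. norm (Poly_Mapping.lookup v i *\<^sub>R dvec i (Suc i)))"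
      unfolding cvec_def by (rule norm_sum)
    also have "\<dots> \<le> (\<Sum>i\<in>Poly_Mapping.keys v. \<bar>Poly_Mapping.lookup v i\<bar> * 2)"
    proof (rule sum_mono)
      fix i
      have "norm (dvec i (Suc i)) \<le> norm (Poly_Mapping.single i (1::real)) + norm (Poly_Mapping.single (Suc i) (1::real))"
        unfolding dvec_def by (rule norm_triangle_ineq4)
      then have "norm (dvec i (Suc i)) \<le> 2" by (simp add: norm_poly_mapping_def dist_poly_mapping_def)
      then show "norm (Poly_Mapping.lookup v i *\<^sub>R dvec i (Suc i)) \<le> \<bar>Poly_Mapping.lookup v i\<bar> * 2"
        by (simp add: mult_left_mono)
    qed
    also have "\<dots> = norm v * 2"
      by (simp add: norm_poly_mapping_def dist_poly_mapping_def sum_distrib_right)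
    finally show ?thesis .
  qed
  then have "bounded_linear cvec"
    using linear_add[OF linear_cvec] linear_scale[OF linear_cvec] by (intro bounded_linear_intro[of _ 2])
  then show ?thesis by (rule linear_continuous_on)
qed

lemma beer_model:
  obtains h where
    "homeomorphic_map (space_of (beer_complex (type_A (n - 1)))) (space_of (model_complex n)) h"
    "\<And>k. (`) h ` cells_of (beer_complex (type_A (n - 1))) k = cells_of (model_complex n) k"
    "\<And>k. \<Union> (cells_of (beer_complex (type_A (n - 1))) k) \<subseteq> topspace (space_of (beer_complex (type_A (n - 1))))"
proof -
  let ?\<Gamma> = "type_A (n - 1)"
  let ?r = "beer_glue ?\<Gamma>"
  define X where "X = sum_topology (\<lambda>X. top_of_set (coxeter_cell ?\<Gamma> X)) (spherical_ap ?\<Gamma>)"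
  define Zf where "Zf p = order_of_ap n (fst p)" for p :: "nat geom set \<times> nat geom"
  define xf where "xf p = cvec (snd p)" for p :: "nat geom set \<times> nat geom"
  have finB: "finite {Z. block_order n Z}"
    by (rule finite_subset[of _ "Pow ({1..n} \<times> {1..n})"]) (auto simp: block_order_def)
  have top: "topspace X = {(ap_set Z, x) | Z x. block_order n Z \<and> cvec x \<in> zono n Z}"
  proof -
    have "topspace X = (SIGMA C:spherical_ap ?\<Gamma>. coxeter_cell ?\<Gamma> C)"
      by (simp add: X_def comp_def)
    also have "\<dots> = {(ap_set Z, x) | Z x. block_order n Z \<and> cvec x \<in> zono n Z}"
    proof (intro equalityI subsetI)
      fix p assume "p \<in> (SIGMA C:spherical_ap ?\<Gamma>. coxeter_cell ?\<Gamma> C)"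
      then obtain Z x where "block_order n Z" "p = (ap_set Z, x)" "x \<in> coxeter_cell ?\<Gamma> (ap_set Z)"
        unfolding spherical_ap_type_A by blast
      then show "p \<in> {(ap_set Z, x) | Z x. block_order n Z \<and> cvec x \<in> zono n Z}"
        using coxeter_cell_eq(1) by auto
    next
      fix p assume "p \<in> {(ap_set Z, x) | Z x. block_order n Z \<and> cvec x \<in> zono n Z}"
      then obtain Z x where "block_order n Z" "p = (ap_set Z, x)" "cvec x \<in> zono n Z" by blast
      then show "p \<in> (SIGMA C:spherical_ap ?\<Gamma>. coxeter_cell ?\<Gamma> C)"
        unfolding spherical_ap_type_A using coxeter_cell_eq(1)[of n Z] by auto
    qed
    finally show ?thesis .
  qed
  have Zf: "Zf (ap_set Z, x) = Z" if "block_order n Z" for Z x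
    unfolding Zf_def using order_of_ap[OF that] by simp
  have lift: "\<exists>x. cvec x = y" if "block_order n Z" "y \<in> zono n Z" for Z y
    using coxeter_cell_eq(2)[OF that(1)] that(2) by (metis imageE)
  have compact: "compact_space X"
    unfolding X_def
  proof (rule compact_space_sum_topology)
    show "finite (spherical_ap ?\<Gamma>)" unfolding spherical_ap_type_A using finB by simp
    show "compact_space (top_of_set (coxeter_cell ?\<Gamma> C))" if "C \<in> spherical_ap ?\<Gamma>" for C
      using that compact_coxeter_cell unfolding spherical_ap_type_A
      by (auto simp: compact_space_subtopology)
  qed
  have cont: "continuous_map X euclidean (\<lambda>p. psi n (Zf p) (xf p))"
    unfolding X_def
  proof (rule continuous_map_sum_topology)
    fix C assume "C \<in> spherical_ap ?\<Gamma>"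
    then obtain Z where Z: "block_order n Z" "C = ap_set Z" unfolding spherical_ap_type_A by blast
    have "continuous_on UNIV (psi n Z)"
      by (intro continuous_on_coordinatewise_then_product continuous_on_psi[OF Z(1)])
    then have "continuous_on (coxeter_cell ?\<Gamma> C) (\<lambda>x. psi n Z (cvec x))"
      by (rule continuous_on_compose2[OF _ continuous_on_cvec]) simp
    then show "continuous_map (top_of_set (coxeter_cell ?\<Gamma> C)) euclidean (\<lambda>x. psi n (Zf (C, x)) (xf (C, x)))"
      by (simp add: Z(2) Zf[OF Z(1)] xf_def)
  qed
  have pt: "block_order n (Zf p) \<and> xf p \<in> zono n (Zf p)" if "p \<in> topspace X" for p
    using that Zf unfolding top xf_def by auto
  have onto: "\<exists>p\<in>topspace X. psi n (Zf p) (xf p) = psi n Z y" if Z: "block_order n Z" and y: "y \<in> zono n Z" for Z y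
  proof -
    obtain x where x: "cvec x = y" using lift[OF Z y] by blast
    then have "(ap_set Z, x) \<in> topspace X" unfolding top using Z y by blast
    then show ?thesis using Zf[OF Z] x by (intro bexI[of _ "(ap_set Z, x)"]) (simp_all add: xf_def)
  qed
  have r: "p \<in> topspace X \<and> q \<in> topspace X \<and>
      (\<exists>Y y. face_step n (Zf p) (xf p) Y y \<and> face_step n (Zf q) (xf q) Y y)" if rpq: "?r p q" for p q
  proof -
    obtain C x C' x' where pq: "p = (C, x)" "q = (C', x')" by fastforce
    obtain Z Y where Z: "block_order n Z" "C = ap_set Z" "C' = ap_set Y" and fs: "face_step n Z (cvec x) Y (cvec x')"
      using beer_glue_face_step[OF rpq[unfolded pq]] .
    note z = face_step_zono[OF fs]
    have "p \<in> topspace X" "q \<in> topspace X" unfolding top pq Z(2,3) using z by blast+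
    \<comment> \<open>The second point is itself the face point and is reached from itself by a
      trivial step.\<close>
    moreover have "face_step n (Zf p) (xf p) Y (cvec x')" "face_step n (Zf q) (xf q) Y (cvec x')"
      using fs face_step_refl[OF z(2,4)] by (simp_all add: pq Z(2,3) Zf z(1,2) xf_def)
    ultimately show ?thesis by blast
  qed
  have eq: "equivclp ?r p q" if p: "p \<in> topspace X" and q: "q \<in> topspace X"
    and fs: "face_step n (Zf p) (xf p) Y y" "face_step n (Zf q) (xf q) Y y" for p q Y y
  proof -
    obtain Z x Z' x' where pq: "p = (ap_set Z, x)" "block_order n Z" "q = (ap_set Z', x')" "block_order n Z'"
      using p q unfolding top by blast
    obtain v where v: "cvec v = y" using lift face_step_zono[OF fs(1)] by blast
    have "equivclp ?r p (ap_set Y, v)" "equivclp ?r q (ap_set Y, v)"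
      using face_step_beer_glue fs v unfolding pq(1,3) Zf[OF pq(2)] Zf[OF pq(4)] xf_def by auto
    then show ?thesis by (meson equivclp_sym equivclp_trans)
  qed
  have sp: "space_of (beer_complex ?\<Gamma>) = quotient_space X ?r"
    by (simp add: beer_complex_def X_def)
  have ce: "cells_of (beer_complex ?\<Gamma>) k = {qclass ?r ` ({C} \<times> rel_interior (coxeter_cell ?\<Gamma> C)) | C.
      C \<in> spherical_ap ?\<Gamma> \<and> card C = k}" for k
    by (simp add: beer_complex_def)
  have ri: "rel_interior (coxeter_cell ?\<Gamma> (ap_set Z)) \<subseteq> cvec -` zono n Z" if "block_order n Z" for Z
    using rel_interior_subset[of "coxeter_cell ?\<Gamma> (ap_set Z)"] coxeter_cell_eq(1)[OF that] by simp
  show ?thesis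
  proof (rule model_quotient[OF compact cont pt onto r eq])
    fix h assume h: "homeomorphic_map (quotient_space X ?r) (space_of (model_complex n)) h"
      and hq: "\<And>p. p \<in> topspace X \<Longrightarrow> h (qclass ?r p) = psi n (Zf p) (xf p)"
    have cell: "h ` qclass ?r ` ({ap_set Z} \<times> rel_interior (coxeter_cell ?\<Gamma> (ap_set Z))) =
        psi n Z ` zono_int n Z" if Z: "block_order n Z" for Z
    proof -
      have "h (qclass ?r (ap_set Z, x)) = psi n Z (cvec x)"
        if "x \<in> rel_interior (coxeter_cell ?\<Gamma> (ap_set Z))" for x
      proof -
        have "(ap_set Z, x) \<in> topspace X" unfolding top using ri[OF Z] that Z by blast
        from hq[OF this] show ?thesis by (simp add: Zf[OF Z] xf_def)
      qed
      moreover have "{ap_set Z} \<times> rel_interior (coxeter_cell ?\<Gamma> (ap_set Z)) =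
          (\<lambda>x. (ap_set Z, x)) ` rel_interior (coxeter_cell ?\<Gamma> (ap_set Z))" by auto
      ultimately show ?thesis
        unfolding rel_interior_coxeter_cell[OF Z, symmetric] by (simp add: image_image)
    qed
    have cells: "(`) h ` cells_of (beer_complex ?\<Gamma>) k = cells_of (model_complex n) k" for k
    proof -
      have "cells_of (beer_complex ?\<Gamma>) k =
          (\<lambda>Z. qclass ?r ` ({ap_set Z} \<times> rel_interior (coxeter_cell ?\<Gamma> (ap_set Z)))) `
            {Z. block_order n Z \<and> card (cover Z) = k}"
        unfolding ce spherical_ap_type_A using card_ap_set by auto
      also have "(`) h ` \<dots> = (\<lambda>Z. psi n Z ` zono_int n Z) ` {Z. block_order n Z \<and> card (cover Z) = k}"
        unfolding image_image[of "(`) h"] using cell by (intro image_cong refl) simp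
      also have "\<dots> = cells_of (model_complex n) k" by (auto simp: model_complex_def)
      finally show ?thesis .
    qed
    have sub: "\<Union> (cells_of (beer_complex ?\<Gamma>) k) \<subseteq> topspace (quotient_space X ?r)" for k
    proof
      fix a assume "a \<in> \<Union> (cells_of (beer_complex ?\<Gamma>) k)"
      then obtain Z x where Z: "block_order n Z" and x: "x \<in> rel_interior (coxeter_cell ?\<Gamma> (ap_set Z))"
        and a: "a = qclass ?r (ap_set Z, x)"
        unfolding ce spherical_ap_type_A by auto
      have "(ap_set Z, x) \<in> topspace X" unfolding top using ri[OF Z] Z x by blast
      then show "a \<in> topspace (quotient_space X ?r)" unfolding a topspace_quotient_space by (rule imageI)
    qed
    show ?thesis by (rule that[unfolded sp, OF h cells sub])
  qed
qed

section \<open>The complex of Bartholdi, Enriquez, Etingof and Rains\<close>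

definition worder :: "nat \<Rightarrow> (nat \<Rightarrow> nat) \<Rightarrow> (nat \<times> nat) set" where
  "worder n w = {(i, j). i \<in> {1..n} \<and> j \<in> {1..n} \<and> w i < w j}"

text \<open>Pairs of positions for which every simple transposition from index \<open>a\<close> to
  \<open>b - 1\<close> belongs to \<open>X\<close>; these are the positive roots of the standard
  parabolic subgroup.\<close>

definition posrel :: "nat \<Rightarrow> nat set \<Rightarrow> (nat \<times> nat) set" where
  "posrel n X = {(a, b). a \<in> {1..n} \<and> b \<in> {1..n} \<and> a < b \<and> {a..<b} \<subseteq> X}"

text \<open>\<open>worder\<close> compares the values of a permutation, whereas
  \<open>map_prod p p\<close> relabels the compared points; hence the inverse.\<close>

lemma worder_inv:
  assumes p: "p permutes {1..n}" shows "worder n (inv' p) = map_prod p p ` natural_order n"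
proof (intro equalityI subrelI)
  fix i j assume "(i, j) \<in> worder n (inv' p)"
  then have "(inv' p i, inv' p j) \<in> natural_order n"
    using permutes_in_image[OF permutes_inv[OF p], of i] permutes_in_image[OF permutes_inv[OF p], of j]
    unfolding worder_def natural_order_def by blast
  moreover have "(i, j) = map_prod p p (inv' p i, inv' p j)" by (simp add: permutes_inverses[OF p])
  ultimately show "(i, j) \<in> map_prod p p ` natural_order n" by (rule image_eqI[rotated])
next
  fix i j assume "(i, j) \<in> map_prod p p ` natural_order n"
  then obtain a b where "(a, b) \<in> natural_order n" "i = p a" "j = p b" by auto
  then show "(i, j) \<in> worder n (inv' p)"
    using permutes_in_image[OF p, of a] permutes_in_image[OF p, of b] permutes_inverses(2)[OF p]
    unfolding worder_def natural_order_def by simp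
qed

lemma worder_orders:
  assumes w: "w permutes {1..n}" shows "worder n w \<in> orders n (natural_order n)"
proof -
  have "worder n w = map_prod (inv' w) (inv' w) ` natural_order n"
    using worder_inv[OF permutes_inv[OF w]] by (simp add: permutes_inv_inv[OF w])
  then have "block_order n (worder n w)" using block_order_map_prod[OF block_order_natural permutes_inv[OF w]] by simp
  moreover have "comparability (worder n w) = comparability (natural_order n)"
  proof (intro equalityI subrelI)
    fix i j
    show "(i, j) \<in> comparability (natural_order n)" if "(i, j) \<in> comparability (worder n w)"
      using that by (auto simp: comparability_natural comparability_iff worder_def)
    show "(i, j) \<in> comparability (worder n w)" if "(i, j) \<in> comparability (natural_order n)"
      using that inj_eq[OF permutes_inj[OF w], of i j] by (auto simp: comparability_natural comparability_iff worder_def)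
  qed
  ultimately show ?thesis by (simp add: orders_def)
qed

lemma comparability_posrel:
  "(a, b) \<in> comparability (posrel n X) \<longleftrightarrow>
     a \<in> {1..n} \<and> b \<in> {1..n} \<and> a \<noteq> b \<and> {min a b..<max a b} \<subseteq> X"
  unfolding comparability_iff posrel_def by (auto simp: min_def max_def simp del: One_nat_def)

lemma block_order_posrel: "block_order n (posrel n X)"
  unfolding block_order_def
proof (intro conjI allI impI)
  show "posrel n X \<subseteq> {1..n} \<times> {1..n}" by (auto simp: posrel_def)
  show "irrefl (posrel n X)" by (auto simp: posrel_def irrefl_def)
  show "trans (posrel n X)"
  proof (rule transI)
    fix a b c assume ab: "(a, b) \<in> posrel n X" and bc: "(b, c) \<in> posrel n X"
    have "{a..<c} \<subseteq> {a..<b} \<union> {b..<c}" by auto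
    then show "(a, c) \<in> posrel n X" using ab bc unfolding posrel_def by auto
  qed
  fix a b c assume ab: "(a, b) \<in> comparability (posrel n X)" and bc: "(b, c) \<in> comparability (posrel n X)"
  have "{min a c..<max a c} \<subseteq> {min a b..<max a b} \<union> {min b c..<max b c}" by auto
  then show "a = c \<or> (a, c) \<in> comparability (posrel n X)"
    using ab bc unfolding comparability_posrel by blast
qed

lemma posrel_full: "posrel n {1..<n} = natural_order n"
  by (auto simp: posrel_def natural_order_def)

lemma cover_posrel:
  assumes X: "X \<subseteq> {1..<n}" shows "cover (posrel n X) = (\<lambda>i. (i, Suc i)) ` X"
proof (intro equalityI subrelI)
  fix a b assume ab: "(a, b) \<in> cover (posrel n X)"
  then have P: "(a, b) \<in> posrel n X" using cover_subset by blast
  have "\<not> Suc a < b"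
  proof
    assume "Suc a < b"
    then have "(a, Suc a) \<in> posrel n X" "(Suc a, b) \<in> posrel n X" using P by (auto simp: posrel_def)
    then show False using ab unfolding cover_def by blast
  qed
  then have "b = Suc a" using P by (auto simp: posrel_def)
  then show "(a, b) \<in> (\<lambda>i. (i, Suc i)) ` X" using P by (auto simp: posrel_def)
next
  fix a b assume "(a, b) \<in> (\<lambda>i. (i, Suc i)) ` X"
  then have a: "a \<in> X" "b = Suc a" by auto
  then have "(a, b) \<in> posrel n X" using X by (auto simp: posrel_def)
  moreover have "(a, b) \<notin> posrel n X O posrel n X" unfolding a(2) by (auto simp: posrel_def)
  ultimately show "(a, b) \<in> cover (posrel n X)" by (simp add: cover_def)
qed

lemma suborder_posrel:
  assumes X: "X \<subseteq> {1..<n}" shows "suborder n (posrel n X) (natural_order n)"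
  by (rule suborderI_cover[OF block_order_posrel block_order_natural])
    (unfold cover_posrel[OF X] cover_natural, rule image_mono[OF X])

lemma simple_transps_posrel: "X \<subseteq> {1..<n} \<Longrightarrow> simple_transps X = transps (cover (posrel n X))"
  unfolding simple_transps_def transps_def by (simp add: cover_posrel image_image)

lemma perm_minimal_iff:
  assumes X: "X \<subseteq> {1..<n}"
  shows "perm_minimal n X u \<longleftrightarrow> u permutes {1..n} \<and> map_prod u u ` posrel n X \<subseteq> natural_order n"
proof -
  have "simple_transps {1..<n} = transps (cover (natural_order n))"
    using simple_transps_posrel[of "{1..<n}" n] posrel_full[of n] by (simp del: One_nat_def)
  then have "perm_minimal n X u \<longleftrightarrow> u \<in> block_perms n (comparability (natural_order n)) \<and>
      map_prod u u ` posrel n X \<subseteq> natural_order n"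
    unfolding perm_minimal_def using simple_transps_posrel[OF X] coset_minimal_transps[OF suborder_posrel[OF X], of u]
    by (simp only:)
  then show ?thesis by (simp only: block_perms_natural mem_Collect_eq)
qed

lemma young_subgroup_eq:
  "X \<subseteq> {1..<n} \<Longrightarrow> young_subgroup n X = block_perms n (comparability (posrel n X))"
  unfolding young_subgroup_def simple_transps_posrel generate_transps[OF block_order_posrel] ..

lemma scaled_perm_base: "sqrt 2 *\<^sub>R perm_base n = osum (natural_order n)"
proof (rule poly_mapping_eqI)
  fix c
  let ?N = "natural_order n"
  have fin: "finite ?N" by (rule block_orderD(2)[OF block_order_natural])
  have "Poly_Mapping.lookup (sqrt 2 *\<^sub>R perm_base n) c =
      (\<Sum>j=1..n. if j = c then real n + 1 - 2 * real j else 0)"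
    by (simp add: perm_base_def lookup_sum lookup_single when_def sum_distrib_left if_distrib cong: if_cong)
  also have "\<dots> = (if c \<in> {1..n} then real n + 1 - 2 * real c else 0)"
    by (simp add: sum.delta del: One_nat_def)
  \<comment> \<open>The coordinate at \<open>c\<close> is the number of larger indices minus the
    number of smaller ones, \<open>(n - c) - (c - 1)\<close>.\<close>
  also have "\<dots> = real (card {p \<in> ?N. fst p = c}) - real (card {p \<in> ?N. snd p = c})"
  proof (cases "c \<in> {1..n}")
    case True
    have "{p \<in> ?N. fst p = c} = {c} \<times> {c<..n}" "{p \<in> ?N. snd p = c} = {1..<c} \<times> {c}"
      using True by (auto simp: natural_order_def)
    then show ?thesis using True by (simp add: card_cartesian_product of_nat_diff)
  next
    case False
    then have "{p \<in> ?N. fst p = c} = {}" "{p \<in> ?N. snd p = c} = {}"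
      by (auto simp: natural_order_def)
    then show ?thesis using False by (simp only: if_False card.empty)
  qed
  also have "\<dots> = (\<Sum>p\<in>?N. of_bool (fst p = c)) - (\<Sum>p\<in>?N. of_bool (snd p = c))"
    using fin by (simp add: sum_of_bool_eq Int_def conj_commute)
  also have "\<dots> = (\<Sum>p\<in>?N. of_bool (fst p = c) - of_bool (snd p = c))"
    by (rule sum_subtractf[symmetric])
  also have "\<dots> = Poly_Mapping.lookup (osum ?N) c"
    unfolding osum_def lookup_sum by (rule sum.cong) (auto simp: lookup_dvec)
  finally show "Poly_Mapping.lookup (sqrt 2 *\<^sub>R perm_base n) c = Poly_Mapping.lookup (osum ?N) c" .
qed

lemma scaled_perm_act_base:
  "p permutes {1..n} \<Longrightarrow> sqrt 2 *\<^sub>R perm_act p (perm_base n) = osum (map_prod p p ` natural_order n)"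
  using perm_act_osum[of p "natural_order n"] permutes_bij[of p]
  by (simp add: scaled_perm_base[symmetric] perm_act_scaleR)

text \<open>The blocks of \<open>P(u, X)\<close>, each ordered through \<open>u\<close>. After scaling by \<open>\<surd>2\<close>, the face
  \<open>F(u, X, S)\<close> is the translate by \<open>face_shift\<close> of the permutohedron of this block order.\<close>

definition face_order :: "nat \<Rightarrow> (nat \<Rightarrow> nat) \<Rightarrow> nat set \<Rightarrow> (nat \<times> nat) set" where
  "face_order n u X = map_prod u u ` posrel n X"

definition face_shift :: "nat \<Rightarrow> (nat \<Rightarrow> nat) \<Rightarrow> nat set \<Rightarrow> nat geom" where
  "face_shift n u X = osum (map_prod u u ` natural_order n - face_order n u X)"

lemma suborder_face_order:
  "X \<subseteq> {1..<n} \<Longrightarrow> u permutes {1..n} \<Longrightarrow> suborder n (face_order n u X) (map_prod u u ` natural_order n)"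
  unfolding face_order_def by (rule suborder_map_prod[OF suborder_posrel])

lemma osum_Diff: "finite T \<Longrightarrow> Y \<subseteq> T \<Longrightarrow> osum (T - Y) = osum T - osum Y"
  unfolding osum_def by (rule sum_diff)

lemma face_shift_eq:
  assumes "X \<subseteq> {1..<n}" "u permutes {1..n}"
  shows "face_shift n u X = sqrt 2 *\<^sub>R perm_act u (perm_base n) - osum (face_order n u X)"
proof -
  note S = suborder_face_order[OF assms]
  show ?thesis
    unfolding face_shift_def scaled_perm_act_base[OF assms(2)]
    by (rule osum_Diff[OF block_orderD(2)[OF suborderD(2)[OF S]] suborderD(3)[OF S]])
qed

lemma perm_face_eq:
  assumes X: "X \<subseteq> {1..<n}" and u: "u permutes {1..n}"
  shows "perm_face n u X = (\<lambda>x. sqrt 2 *\<^sub>R x - face_shift n u X) -` zono n (face_order n u X)"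
proof -
  have lin: "linear (\<lambda>x. sqrt 2 *\<^sub>R x :: nat geom)" by (rule linear_scale_self)
  have "(\<lambda>x. sqrt 2 *\<^sub>R x) ` perm_face n u X =
      convex hull ((\<lambda>z. osum (map_prod (u \<circ> z) (u \<circ> z) ` natural_order n)) ` block_perms n (comparability (posrel n X)))"
    unfolding perm_face_def convex_hull_linear_image[OF lin] image_image young_subgroup_eq[OF X]
    by (intro arg_cong[of _ _ "(hull) convex"] image_cong refl scaled_perm_act_base
        permutes_compose[OF block_perms_permutes u])
  then have im: "(\<lambda>x. sqrt 2 *\<^sub>R x) ` perm_face n u X = (+) (face_shift n u X) ` zono n (face_order n u X)"
    unfolding face_hull[OF suborder_posrel[OF X] u] face_shift_def face_order_def .
  have inj: "inj (\<lambda>x. sqrt 2 *\<^sub>R x :: nat geom)" by (rule injI) simp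
  show ?thesis
  proof (intro equalityI subsetI)
    fix x assume "x \<in> perm_face n u X"
    then have "sqrt 2 *\<^sub>R x \<in> (+) (face_shift n u X) ` zono n (face_order n u X)" using im by blast
    then show "x \<in> (\<lambda>x. sqrt 2 *\<^sub>R x - face_shift n u X) -` zono n (face_order n u X)" by auto
  next
    fix x assume "x \<in> (\<lambda>x. sqrt 2 *\<^sub>R x - face_shift n u X) -` zono n (face_order n u X)"
    then have "sqrt 2 *\<^sub>R x \<in> (+) (face_shift n u X) ` zono n (face_order n u X)"
      by (intro image_eqI[of _ _ "sqrt 2 *\<^sub>R x - face_shift n u X"]) auto
    then show "x \<in> perm_face n u X" unfolding im[symmetric] inj_image_mem_iff[OF inj] .
  qed
qed

lemma permutohedron_eq: "permutohedron n = (\<lambda>x. sqrt 2 *\<^sub>R x) -` zono n (natural_order n)"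
proof -
  have "permutohedron n = perm_face n id {1..<n}"
    unfolding permutohedron_def perm_face_def young_subgroup_eq[OF order_refl] posrel_full block_perms_natural
    by simp
  then show ?thesis
    unfolding perm_face_eq[OF order_refl permutes_id] face_shift_def face_order_def posrel_full map_prod.id
    by (simp add: osum_def)
qed

lemma zono_orders:
  assumes "T \<in> orders n Z" "block_order n Z" shows "zono n T = zono n Z" "zono_int n T = zono_int n Z"
  using assms crossings_comparability[of n Z T] by (simp_all add: zono_int_def zono_def orders_def)

lemma rel_interior_perm_face:
  assumes X: "X \<subseteq> {1..<n}" and u: "u permutes {1..n}"
  shows "rel_interior (perm_face n u X) =
    (\<lambda>x. sqrt 2 *\<^sub>R x - face_shift n u X) -` zono_int n (face_order n u X)"
  unfolding perm_face_eq[OF assms]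
proof (rule rel_interior_zono_vimage[where p = "(1 / sqrt 2) *\<^sub>R face_shift n u X"])
  show "block_order n (face_order n u X)" by (rule suborderD(1)[OF suborder_face_order[OF assms]])
  show "continuous_on UNIV (\<lambda>v. Poly_Mapping.lookup (sqrt 2 *\<^sub>R v - face_shift n u X) c)" for c
    by (simp add: lookup_minus) (intro continuous_intros continuous_on_lookup)
  show "sqrt 2 *\<^sub>R ((1 - t) *\<^sub>R x + t *\<^sub>R y) - face_shift n u X =
      (1 - t) *\<^sub>R (sqrt 2 *\<^sub>R x - face_shift n u X) + t *\<^sub>R (sqrt 2 *\<^sub>R y - face_shift n u X)" for x y t
    by (simp add: algebra_simps)
qed simp

section \<open>Restricting orders to the blocks of a face\<close>

lemma restrict_order:
  assumes Z: "block_order n Z" and P: "block_order n P" and sub: "comparability P \<subseteq> comparability Z"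
  shows "Z \<inter> comparability P \<in> orders n P"
proof -
  note D = block_orderD[OF Z] and DP = block_orderD[OF P]
  have cmp: "comparability (Z \<inter> comparability P) = comparability P"
  proof (intro equalityI subrelI)
    fix a b
    show "(a, b) \<in> comparability P" if "(a, b) \<in> comparability (Z \<inter> comparability P)"
      using that comparability_sym[of b a P] by (auto simp: comparability_iff[of a b "Z \<inter> comparability P"])
    show "(a, b) \<in> comparability (Z \<inter> comparability P)" if ab: "(a, b) \<in> comparability P"
      using ab comparability_sym[OF ab] subsetD[OF sub ab]
      by (auto simp: comparability_iff[of a b "Z \<inter> comparability P"] comparability_iff[of a b Z])
  qed
  have "trans (Z \<inter> comparability P)"
  proof (rule transI)
    fix a b c assume ab: "(a, b) \<in> Z \<inter> comparability P" and bc: "(b, c) \<in> Z \<inter> comparability P"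
    then have "(a, c) \<in> Z" using D(5)[of a b c] by blast
    then have "a \<noteq> c" using D(3) by blast
    then show "(a, c) \<in> Z \<inter> comparability P" using \<open>(a, c) \<in> Z\<close> DP(7)[of a b c] ab bc by blast
  qed
  then have "block_order n (Z \<inter> comparability P)"
    unfolding block_order_def cmp irrefl_def using D(1,3) DP(7) by (intro conjI allI impI) auto
  then show ?thesis using cmp by (simp add: orders_def)
qed

lemma eq_restrict_order:
  assumes "block_order n Z" "Y \<subseteq> Z" shows "Z \<inter> comparability Y = Y"
proof (intro equalityI subrelI)
  fix a b assume "(a, b) \<in> Z \<inter> comparability Y"
  then show "(a, b) \<in> Y" using block_orderD(6)[OF assms(1), of a b] assms(2) by (auto simp: comparability_iff)
qed (use assms(2) in \<open>auto simp: comparability_iff\<close>)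

section \<open>The ordered partition of a face\<close>

lemma set_zip_consecutive:
  fixes xs :: "'a::linorder list"
  assumes "sorted_wrt (<) xs"
  shows "set (zip xs (tl xs)) =
    {(a, b). a \<in> set xs \<and> b \<in> set xs \<and> a < b \<and> (\<forall>c\<in>set xs. \<not> (a < c \<and> c < b))}"
  using assms
proof (induction xs)
  case (Cons x xs)
  show ?case
  proof (cases xs)
    case (Cons y ys)
    have xy: "x < y" "\<forall>c\<in>set ys. y < c" "\<forall>c\<in>set xs. x < c" using Cons.prems Cons by auto
    have "set (zip (x # xs) (tl (x # xs))) = insert (x, y) (set (zip xs (tl xs)))" by (simp add: Cons)
    also have "\<dots> = insert (x, y)
        {(a, b). a \<in> set xs \<and> b \<in> set xs \<and> a < b \<and> (\<forall>c\<in>set xs. \<not> (a < c \<and> c < b))}"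
      using Cons.IH Cons.prems by simp
    also have "\<dots> = {(a, b). a \<in> set (x # xs) \<and> b \<in> set (x # xs) \<and> a < b \<and> (\<forall>c\<in>set (x # xs). \<not> (a < c \<and> c < b))}"
      using xy unfolding Cons by (auto 0 3 dest: less_asym)
    finally show ?thesis .
  qed auto
qed simp

text \<open>Because the blocks are pairwise different, equality of multisets in
  \<open>faces_equiv\<close> amounts to equality of sets of blocks. For positive \<open>n\<close>
  the list of cut points, from 0 to \<open>n\<close>, is strictly increasing.\<close>

lemma face_partition_blocks:
  assumes n: "1 \<le> n" and X: "X \<subseteq> {1..<n}" and u: "u permutes {1..n}"
  shows "distinct (face_partition n u X)"
    "set (face_partition n u X) = block_of (face_order n u X) ` {1..n}"
proof -
  define xs where "xs = 0 # sorted_list_of_set ({1..<n} - X) @ [n]"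
  \<comment> \<open>The cut points: a cut at \<open>c\<close> lies between the positions
    \<open>c\<close> and \<open>c + 1\<close>.\<close>
  define E where "E = {0..n} - X"
  have set: "set xs = E" using n X by (auto simp: xs_def E_def)
  have sorted: "sorted_wrt (<) xs"
    unfolding xs_def using n by (auto simp: sorted_wrt_append)
  have fp: "face_partition n u X = map (\<lambda>(a, b). u ` {a<..b}) (zip xs (tl xs))"
    by (simp add: face_partition_def xs_def Let_def)
  note cons = set_zip_consecutive[OF sorted, unfolded set]
  have inj: "inj_on (\<lambda>(a, b). u ` {a<..b}) (set (zip xs (tl xs)))"
  proof (rule inj_onI, clarify)
    fix a b c d assume ab: "(a, b) \<in> set (zip xs (tl xs))" and cd: "(c, d) \<in> set (zip xs (tl xs))"
      and eq: "u ` {a<..b} = u ` {c<..d}"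
    have "a < b" "c < d" using ab cd cons by auto
    moreover have "{a<..b} = {c<..d}" using eq by (simp add: inj_image_eq_iff[OF permutes_inj[OF u]])
    ultimately show "a = c \<and> b = d"
      by (metis Ioc_inj leD)
  qed
  have "distinct xs" using sorted by (simp add: strict_sorted_iff)
  then show "distinct (face_partition n u X)"
    unfolding fp distinct_map using inj by (simp add: distinct_zipI1)
  have block: "block_of (face_order n u X) (u i) = u ` block_of (posrel n X) i" for i
  proof (intro equalityI subsetI)
    fix b assume "b \<in> block_of (face_order n u X) (u i)"
    then consider "b = u i" | x y where "b = u x" "u i = u y" "(x, y) \<in> comparability (posrel n X)"
      unfolding block_of_def face_order_def comparability_map_prod by auto
    then show "b \<in> u ` block_of (posrel n X) i"
    proof cases
      case (2 x y)
      then have "(x, i) \<in> comparability (posrel n X)" using injD[OF permutes_inj[OF u], of i y] by simp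
      then show ?thesis unfolding 2(1) block_of_def by blast
    qed (simp add: block_of_def)
  next
    fix b assume "b \<in> u ` block_of (posrel n X) i"
    then show "b \<in> block_of (face_order n u X) (u i)"
      unfolding block_of_def face_order_def comparability_map_prod by force
  qed
  have iv: "{a<..b} = block_of (posrel n X) i"
    if ab: "(a, b) \<in> set (zip xs (tl xs))" and i: "i \<in> {a<..b}" for a b i
  proof -
    have A: "a \<in> E" "b \<in> E" "a < b" "\<And>c. c \<in> E \<Longrightarrow> a < c \<Longrightarrow> c < b \<Longrightarrow> False"
      using ab cons by auto
    have bX: "c \<in> X" if "a < c" "c < b" for c using A(2) A(4)[of c] that by (auto simp: E_def)
    have "j \<in> {a<..b} \<longleftrightarrow> j = i \<or> (j, i) \<in> comparability (posrel n X)" for j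
    proof
      assume j: "j \<in> {a<..b}"
      have "{min j i..<max j i} \<subseteq> X" using bX i j by auto
      moreover have "j \<in> {1..n}" "i \<in> {1..n}" using A(2) i j by (auto simp: E_def)
      ultimately show "j = i \<or> (j, i) \<in> comparability (posrel n X)"
        unfolding comparability_posrel by blast
    next
      assume j: "j = i \<or> (j, i) \<in> comparability (posrel n X)"
      show "j \<in> {a<..b}"
      proof (cases "j = i")
        case False
        then have "{min j i..<max j i} \<subseteq> X" using j comparability_posrel by blast
        then have "a \<notin> {min j i..<max j i}" "b \<notin> {min j i..<max j i}" using A(1,2) by (auto simp: E_def)
        then show ?thesis using i by auto
      qed (use i in simp)
    qed
    then show ?thesis unfolding block_of_def by blast
  qed
  have ex: "\<exists>a b. (a, b) \<in> set (zip xs (tl xs)) \<and> i \<in> {a<..b}" if i: "i \<in> {1..n}" for i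
  proof -
    \<comment> \<open>The last cut strictly before \<open>i\<close> and the first cut at or after
      \<open>i\<close>, in accordance with intervals that are open on the left.\<close>
    define a where "a = Max {c \<in> E. c < i}"
    define b where "b = Min {c \<in> E. i \<le> c}"
    have fin: "finite E" by (simp add: E_def)
    have "0 \<in> {c \<in> E. c < i}" "n \<in> {c \<in> E. i \<le> c}" using i X by (auto simp: E_def)
    then have ne: "{c \<in> E. c < i} \<noteq> {}" "{c \<in> E. i \<le> c} \<noteq> {}" by blast+
    have a: "a \<in> {c \<in> E. c < i}" unfolding a_def by (rule Max_in) (use fin ne in auto)
    have b: "b \<in> {c \<in> E. i \<le> c}" unfolding b_def by (rule Min_in) (use fin ne in auto)
    have "\<not> (a < c \<and> c < b)" if "c \<in> E" for c
      using Max_ge[of "{c \<in> E. c < i}" c] Min_le[of "{c \<in> E. i \<le> c}" c] fin that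
      unfolding a_def[symmetric] b_def[symmetric] by (cases "c < i") auto
    then have "(a, b) \<in> set (zip xs (tl xs))" unfolding cons using a b by auto
    then show ?thesis using a b by auto
  qed
  have "set (face_partition n u X) = (\<lambda>i. u ` block_of (posrel n X) i) ` {1..n}"
  proof (intro equalityI subsetI)
    fix B assume "B \<in> set (face_partition n u X)"
    then obtain a b where ab: "(a, b) \<in> set (zip xs (tl xs))" "B = u ` {a<..b}" unfolding fp by auto
    then have "b \<in> {a<..b}" "b \<in> {1..n}" using cons by (auto simp: E_def)
    then show "B \<in> (\<lambda>i. u ` block_of (posrel n X) i) ` {1..n}" using iv[OF ab(1)] ab(2) by blast
  next
    fix B assume "B \<in> (\<lambda>i. u ` block_of (posrel n X) i) ` {1..n}"
    then obtain i where i: "i \<in> {1..n}" "B = u ` block_of (posrel n X) i" by blast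
    obtain a b where ab: "(a, b) \<in> set (zip xs (tl xs))" "i \<in> {a<..b}" using ex[OF i(1)] by blast
    show "B \<in> set (face_partition n u X)"
      unfolding fp set_map i(2) using iv[OF ab] ab(1) by (intro image_eqI[of _ _ "(a, b)"]) simp_all
  qed
  also have "\<dots> = block_of (face_order n u X) ` u ` {1..n}" unfolding image_image block ..
  finally show "set (face_partition n u X) = block_of (face_order n u X) ` {1..n}"
    unfolding permutes_image[OF u] .
qed

lemma comparability_blocks:
  assumes "block_order n P"
  shows "(a, b) \<in> comparability P \<longleftrightarrow> a \<noteq> b \<and> (\<exists>B\<in>block_of P ` {1..n}. a \<in> B \<and> b \<in> B)"
proof
  note D = block_orderD[OF assms]
  show "a \<noteq> b \<and> (\<exists>B\<in>block_of P ` {1..n}. a \<in> B \<and> b \<in> B)" if ab: "(a, b) \<in> comparability P"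
  proof -
    have "a \<noteq> b" "b \<in> {1..n}" using D(8)[of a] D(10)[OF ab] ab by auto
    moreover have "a \<in> block_of P b" "b \<in> block_of P b" using ab by (auto simp: block_of_def)
    ultimately show ?thesis by blast
  qed
  show "(a, b) \<in> comparability P" if ab: "a \<noteq> b \<and> (\<exists>B\<in>block_of P ` {1..n}. a \<in> B \<and> b \<in> B)"
  proof -
    obtain i where i: "a \<noteq> b" "a = i \<or> (a, i) \<in> comparability P" "b = i \<or> (b, i) \<in> comparability P"
      using ab by (auto simp: block_of_def)
    then show ?thesis using D(7)[of a i b] comparability_sym[of b i P] by blast
  qed
qed

text \<open>The collection of blocks carries the same information as the comparability relation.
  Equivalent faces of two copies are thus those that receive the same block order from the linear
  orders of their copies.\<close>

lemma faces_equiv_iff: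
  assumes n: "1 \<le> n" and X: "X \<subseteq> {1..<n}" "u permutes {1..n}" and Y: "Y \<subseteq> {1..<n}" "v permutes {1..n}"
  shows "faces_equiv n u X w v Y w' \<longleftrightarrow>
    comparability (face_order n u X) = comparability (face_order n v Y) \<and>
    worder n w \<inter> comparability (face_order n u X) = worder n w' \<inter> comparability (face_order n u X)"
proof -
  let ?P = "face_order n u X" and ?Q = "face_order n v Y"
  have P: "block_order n ?P" and Q: "block_order n ?Q"
    using suborderD(1)[OF suborder_face_order] X Y by blast+
  have "mset (face_partition n u X) = mset (face_partition n v Y) \<longleftrightarrow>
      block_of ?P ` {1..n} = block_of ?Q ` {1..n}"
    using set_eq_iff_mset_eq_distinct[OF face_partition_blocks(1)[OF n X] face_partition_blocks(1)[OF n Y]]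
    unfolding face_partition_blocks(2)[OF n X] face_partition_blocks(2)[OF n Y] by (rule sym)
  also have "\<dots> \<longleftrightarrow> comparability ?P = comparability ?Q"
  proof
    assume "block_of ?P ` {1..n} = block_of ?Q ` {1..n}"
    then show "comparability ?P = comparability ?Q"
      using comparability_blocks[OF P] comparability_blocks[OF Q] by (intro equalityI subrelI) simp_all
  qed (simp add: block_of_def)
  finally have 1: "mset (face_partition n u X) = mset (face_partition n v Y) \<longleftrightarrow>
      comparability ?P = comparability ?Q" .
  have "(\<forall>B\<in>set (face_partition n u X). \<forall>i\<in>B. \<forall>j\<in>B. w i < w j \<longleftrightarrow> w' i < w' j) \<longleftrightarrow>
      (\<forall>i j. (i, j) \<in> comparability ?P \<longrightarrow> (w i < w j \<longleftrightarrow> w' i < w' j))"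
    (is "?L \<longleftrightarrow> ?R")
  proof
    assume L: ?L
    show ?R
    proof (intro allI impI)
      fix i j assume "(i, j) \<in> comparability ?P"
      then obtain B where "B \<in> set (face_partition n u X)" "i \<in> B" "j \<in> B"
        unfolding face_partition_blocks(2)[OF n X] comparability_blocks[OF P] by blast
      then show "w i < w j \<longleftrightarrow> w' i < w' j" using L by blast
    qed
  next
    assume R: ?R
    show ?L
    proof (intro ballI)
      fix B i j assume B: "B \<in> set (face_partition n u X)" "i \<in> B" "j \<in> B"
      show "w i < w j \<longleftrightarrow> w' i < w' j"
      proof (cases "i = j")
        case False
        then have "(i, j) \<in> comparability ?P"
          using B unfolding face_partition_blocks(2)[OF n X] comparability_blocks[OF P] by blast
        then show ?thesis using R by blast
      qed simp
    qed
  qed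
  also have "\<dots> \<longleftrightarrow> worder n w \<inter> comparability ?P = worder n w' \<inter> comparability ?P"
  proof
    assume R: "\<forall>i j. (i, j) \<in> comparability ?P \<longrightarrow> (w i < w j \<longleftrightarrow> w' i < w' j)"
    show "worder n w \<inter> comparability ?P = worder n w' \<inter> comparability ?P"
    proof (intro equalityI subrelI)
      fix i j
      show "(i, j) \<in> worder n w' \<inter> comparability ?P" if "(i, j) \<in> worder n w \<inter> comparability ?P"
        using that R unfolding worder_def by blast
      show "(i, j) \<in> worder n w \<inter> comparability ?P" if "(i, j) \<in> worder n w' \<inter> comparability ?P"
        using that R unfolding worder_def by blast
    qed
  next
    assume E: "worder n w \<inter> comparability ?P = worder n w' \<inter> comparability ?P"
    show "\<forall>i j. (i, j) \<in> comparability ?P \<longrightarrow> (w i < w j \<longleftrightarrow> w' i < w' j)"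
    proof (intro allI impI)
      fix i j assume ij: "(i, j) \<in> comparability ?P"
      then have "(i, j) \<in> worder n w \<longleftrightarrow> (i, j) \<in> worder n w'" using E by blast
      then show "w i < w j \<longleftrightarrow> w' i < w' j"
        using block_orderD(9)[OF P ij] block_orderD(10)[OF P ij] unfolding worder_def by blast
    qed
  qed
  finally show ?thesis unfolding faces_equiv_def 1 by simp
qed

lemma face_order_orders:
  assumes X: "X \<subseteq> {1..<n}" and u: "u permutes {1..n}" and w: "w permutes {1..n}"
  shows "worder n w \<inter> comparability (face_order n u X) \<in> orders n (face_order n u X)"
proof -
  note S = suborder_face_order[OF X u]
  have "comparability (face_order n u X) \<subseteq> comparability (natural_order n)"
    using suborderD(5)[OF S] block_perms_map_prod(2)[OF block_order_natural, of u] u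
    by (simp add: block_perms_natural)
  then show ?thesis
    using worder_orders[OF w] by (intro restrict_order[OF _ suborderD(1)[OF S]]) (simp_all add: orders_def)
qed

text \<open>The blocks stay arranged as \<open>u\<close> prescribes, while each of them is reordered
  according to \<open>w\<close>. The polytope depends on the blocks only, so membership in the face
  is not affected.\<close>

lemma omega_face_step:
  assumes X: "X \<subseteq> {1..<n}" and u: "u permutes {1..n}" and w: "w permutes {1..n}"
    and x: "x \<in> perm_face n u X"
  shows "face_step n (worder n w) (sqrt 2 *\<^sub>R x) (worder n w \<inter> comparability (face_order n u X))
    (sqrt 2 *\<^sub>R x - face_shift n u X)"
proof -
  let ?P = "face_order n u X" and ?T = "map_prod u u ` natural_order n"
  define Y where "Y = worder n w \<inter> comparability ?P"
  note S = suborder_face_order[OF X u]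
  have Y: "Y \<in> orders n ?P" unfolding Y_def by (rule face_order_orders[OF X u w])
  note R = suborder_replace[OF S Y]
  have W: "block_order n (worder n w)" "comparability (worder n w) = comparability ?T"
    using worder_orders[OF w] block_perms_map_prod(2)[OF block_order_natural, of u] u
    by (simp_all add: block_perms_natural orders_def)
  have "sqrt 2 *\<^sub>R x - face_shift n u X \<in> zono n Y"
    using x unfolding perm_face_eq[OF X u] zono_orders(1)[OF Y suborderD(1)[OF S]] by simp
  moreover have "(?T - ?P) \<union> Y - Y = ?T - ?P" using R(3) by blast
  moreover have "Y \<subseteq> worder n w" by (simp add: Y_def)
  ultimately show ?thesis
    unfolding face_step_def Y_def[symmetric] face_shift_def using R(1,2) W
    by (intro conjI exI[of _ "(?T - ?P) \<union> Y"]) (simp_all add: orders_def)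
qed

text \<open>Minimality of \<open>u\<close> demands increasing blocks, so the blocks of
  \<open>Y\<close> are reordered by the standard order while their arrangement in \<open>T\<close>
  is kept. The resulting linear order is the image of the standard one under \<open>u\<close>, and
  \<open>X\<close> collects the positions of the covers inside blocks.\<close>

lemma face_step_omega:
  assumes w: "w permutes {1..n}" and fs: "face_step n (worder n w) x Y y"
  obtains u X where "X \<subseteq> {1..<n}" "u permutes {1..n}" "perm_minimal n X u"
    "face_order n u X = natural_order n \<inter> comparability Y" "face_shift n u X = x - y"
    "comparability (face_order n u X) = comparability Y" "worder n w \<inter> comparability Y = Y"
proof -
  let ?N = "natural_order n"
  obtain T where T: "suborder n Y T" "comparability T = comparability (worder n w)"
    "Y \<subseteq> worder n w" "y = x - osum (T - Y)" and W: "block_order n (worder n w)"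
    using fs by (auto simp: face_step_def)
  have TN: "comparability T = comparability ?N" using worder_orders[OF w] T(2) by (simp add: orders_def)
  define P where "P = ?N \<inter> comparability Y"
  have P: "P \<in> orders n Y"
    unfolding P_def using suborderD(5)[OF T(1)] TN
    by (intro restrict_order[OF block_order_natural suborderD(1)[OF T(1)]]) simp
  define U where "U = (T - Y) \<union> P"
  note R = suborder_replace[OF T(1) P, folded U_def]
  have UN: "comparability U = comparability ?N" using R(2) TN by (simp add: orders_def)
  obtain u where u: "u \<in> block_perms n (comparability ?N)" "map_prod u u ` ?N = U"
    using ex_block_perm[OF block_order_natural suborderD(2)[OF R(1)] UN] .
  have uu: "u permutes {1..n}" by (rule block_perms_permutes[OF u(1)])
  let ?v = "inv' u"
  have uv: "u \<circ> ?v = id" "?v \<circ> u = id" using permutes_inv_o[OF uu] by auto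
  have vu: "map_prod ?v ?v ` map_prod u u ` A = A" "map_prod u u ` map_prod ?v ?v ` A = A" for A
    unfolding image_comp map_prod.comp uv map_prod.id image_id id_apply by simp_all
  define Q where "Q = map_prod ?v ?v ` P"
  have Q: "suborder n Q ?N"
    using suborder_map_prod[OF R(1) permutes_inv[OF uu]] vu(1)[of ?N] u(2) by (simp add: Q_def)
  define X where "X = {i. (i, Suc i) \<in> cover Q}"
  have cov: "cover Q \<subseteq> (\<lambda>i. (i, Suc i)) ` {1..<n}" using suborder_cover[OF Q] cover_natural by simp
  then have X: "X \<subseteq> {1..<n}" by (auto simp: X_def)
  have "cover Q = (\<lambda>i. (i, Suc i)) ` X" using cov by (auto simp: X_def)
  then have "cover Q = cover (posrel n X)" using cover_posrel[OF X] by simp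
  then have "(cover Q)\<^sup>+ = (cover (posrel n X))\<^sup>+" by (rule arg_cong)
  then have "Q = posrel n X"
    unfolding block_order_trancl_cover[OF suborderD(1)[OF Q]] block_order_trancl_cover[OF block_order_posrel] .
  then have fo: "face_order n u X = P" unfolding face_order_def using vu(2)[of P] by (simp add: Q_def)
  then have "map_prod u u ` posrel n X \<subseteq> ?N" unfolding face_order_def P_def by blast
  then have min: "perm_minimal n X u" unfolding perm_minimal_iff[OF X] using uu by blast
  have "U - P = T - Y" using R(3) by (auto simp: U_def)
  then have "face_shift n u X = x - y" unfolding face_shift_def fo u(2) T(4) by simp
  moreover have "comparability (face_order n u X) = comparability Y" using P fo by (simp add: orders_def)
  ultimately show ?thesis
    using that[OF X uu min] fo eq_restrict_order[OF W T(3)] by (simp add: P_def)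
qed

lemma continuous_map_prod_discrete:
  assumes "\<And>w. w \<in> W \<Longrightarrow> continuous_map X Y (\<lambda>x. f (x, w))"
  shows "continuous_map (prod_topology X (discrete_topology W)) Y f"
  unfolding continuous_map_def
proof (intro conjI allI impI)
  show "f \<in> topspace (prod_topology X (discrete_topology W)) \<rightarrow> topspace Y"
    using assms by (auto simp: continuous_map_def Pi_iff)
  fix U assume U: "openin Y U"
  have "{p \<in> topspace (prod_topology X (discrete_topology W)). f p \<in> U} =
      (\<Union>w\<in>W. {x \<in> topspace X. f (x, w) \<in> U} \<times> {w})" by auto
  moreover have "openin (prod_topology X (discrete_topology W)) ({x \<in> topspace X. f (x, w) \<in> U} \<times> {w})"
    if w: "w \<in> W" for w
    using openin_continuous_map_preimage[OF assms[OF w] U] w by (simp add: openin_prod_Times_iff)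
  ultimately show "openin (prod_topology X (discrete_topology W))
      {p \<in> topspace (prod_topology X (discrete_topology W)). f p \<in> U}"
    by auto
qed


lemma omega_model:
  assumes n: "1 \<le> n"
  obtains h where
    "homeomorphic_map (space_of (omega_complex n)) (space_of (model_complex n)) h"
    "\<And>k. (`) h ` cells_of (omega_complex n) k = cells_of (model_complex n) k"
    "\<And>k. \<Union> (cells_of (omega_complex n) k) \<subseteq> topspace (space_of (omega_complex n))"
proof -
  let ?r = "omega_glue n" and ?W = "{w. w permutes {1..n}}"
  define X where "X = prod_topology (top_of_set (permutohedron n)) (discrete_topology ?W)"
  define Zf where "Zf p = worder n (snd p)" for p :: "nat geom \<times> (nat \<Rightarrow> nat)"
  define xf where "xf p = sqrt 2 *\<^sub>R fst p" for p :: "nat geom \<times> (nat \<Rightarrow> nat)"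
  have finW: "finite ?W" by (rule finite_permutations) simp
  have worder: "block_order n (worder n w)" "zono n (worder n w) = zono n (natural_order n)"
    if "w permutes {1..n}" for w
    using worder_orders[OF that] zono_orders(1)[OF worder_orders[OF that] block_order_natural]
    by (simp_all add: orders_def)
  have top: "(x, w) \<in> topspace X \<longleftrightarrow> w permutes {1..n} \<and> sqrt 2 *\<^sub>R x \<in> zono n (worder n w)" for x w
    unfolding X_def by (auto simp: permutohedron_eq worder(2))
  have compact: "compact_space X"
  proof -
    have "compact (permutohedron n)"
      unfolding permutohedron_def by (intro finite_imp_compact_convex_hull finite_imageI finW)
    then show ?thesis
      unfolding X_def compact_space_prod_topology using finW
      by (simp add: compact_space_subtopology compact_space_discrete_topology)
  qed
  have cont: "continuous_map X euclidean (\<lambda>p. psi n (Zf p) (xf p))"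
    unfolding X_def
  proof (rule continuous_map_prod_discrete)
    fix w assume "w \<in> ?W"
    then have "continuous_on UNIV (psi n (worder n w))"
      by (intro continuous_on_coordinatewise_then_product continuous_on_psi worder) simp
    then have "continuous_on (permutohedron n) (\<lambda>x. psi n (worder n w) (sqrt 2 *\<^sub>R x))"
      by (rule continuous_on_compose2) (auto intro!: continuous_intros)
    then show "continuous_map (top_of_set (permutohedron n)) euclidean (\<lambda>x. psi n (Zf (x, w)) (xf (x, w)))"
      by (simp add: Zf_def xf_def)
  qed
  have pt: "block_order n (Zf p) \<and> xf p \<in> zono n (Zf p)" if p: "p \<in> topspace X" for p
  proof -
    obtain x w where xw: "p = (x, w)" by fastforce
    show ?thesis using p worder(1) unfolding xw top Zf_def xf_def by simp
  qed
  have lift: "\<exists>x w. w permutes {1..n} \<and> face_step n (worder n w) (sqrt 2 *\<^sub>R x) Z z"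
    if Z: "block_order n Z" and z: "z \<in> zono n Z" for Z z
  proof -
    \<comment> \<open>A linear extension exhibits the cell of \<open>Z\<close> as a face of some
      copy of the full permutohedron.\<close>
    obtain p where p: "p permutes {1..n}" and S: "suborder n Z (map_prod p p ` natural_order n)"
      using linear_extension[OF Z] .
    let ?T = "map_prod p p ` natural_order n"
    have "face_step n ?T (z + osum (?T - Z)) Z z"
      unfolding face_step_def using S suborderD(2,3)[OF S] z by (intro conjI exI[of _ ?T]) simp_all
    then have "face_step n (worder n (inv' p)) (sqrt 2 *\<^sub>R ((1 / sqrt 2) *\<^sub>R (z + osum (?T - Z)))) Z z"
      by (simp add: worder_inv[OF p])
    then show ?thesis using permutes_inv[OF p] by blast
  qed
  have onto: "\<exists>p\<in>topspace X. psi n (Zf p) (xf p) = psi n Z z" if Z: "block_order n Z" and z: "z \<in> zono n Z" for Z z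
  proof -
    obtain x w where xw: "w permutes {1..n}" "face_step n (worder n w) (sqrt 2 *\<^sub>R x) Z z" using lift[OF Z z] by blast
    have "(x, w) \<in> topspace X" unfolding top using xw(1) face_step_zono(3)[OF xw(2)] by simp
    moreover have "psi n (Zf (x, w)) (xf (x, w)) = psi n Z z"
      using psi_face_step[OF xw(2)] by (simp add: Zf_def xf_def)
    ultimately show ?thesis by blast
  qed
  have r: "p \<in> topspace X \<and> q \<in> topspace X \<and>
      (\<exists>Y y. face_step n (Zf p) (xf p) Y y \<and> face_step n (Zf q) (xf q) Y y)" if rpq: "?r p q" for p q
    using rpq
  proof cases
    case (1 A B u v w w' x)
    let ?x' = "x + perm_act v (perm_base n) - perm_act u (perm_base n)"
    have u: "u permutes {1..n}" "map_prod u u ` posrel n A \<subseteq> natural_order n"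
      using 1(5) unfolding perm_minimal_iff[OF 1(3)] by blast+
    have v: "v permutes {1..n}" "map_prod v v ` posrel n B \<subseteq> natural_order n"
      using 1(6) unfolding perm_minimal_iff[OF 1(4)] by blast+
    have cmp: "comparability (face_order n u A) = comparability (face_order n v B)"
      "worder n w \<inter> comparability (face_order n u A) = worder n w' \<inter> comparability (face_order n u A)"
      using 1(9) unfolding faces_equiv_iff[OF n 1(3) u(1) 1(4) v(1)] by blast+
    \<comment> \<open>By minimality both face orders are increasing on their blocks, so equal blocks
      already give equal orders, and the shifts of the two faces differ exactly by the translation
      in the gluing.\<close>
    have "face_order n u A = natural_order n \<inter> comparability (face_order n u A)"
      unfolding face_order_def by (rule eq_restrict_order[OF block_order_natural u(2), symmetric])
    also have "\<dots> = natural_order n \<inter> comparability (face_order n v B)" unfolding cmp(1) ..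
    also have "\<dots> = face_order n v B"
      unfolding face_order_def by (rule eq_restrict_order[OF block_order_natural v(2)])
    finally have P: "face_order n u A = face_order n v B" .
    have sh: "sqrt 2 *\<^sub>R ?x' - face_shift n v B = sqrt 2 *\<^sub>R x - face_shift n u A"
      unfolding face_shift_eq[OF 1(3) u(1)] face_shift_eq[OF 1(4) v(1)] P
      by (simp add: scaleR_add_right scaleR_diff_right)
    have x': "?x' \<in> perm_face n v B"
      using 1(10) unfolding perm_face_eq[OF 1(3) u(1)] perm_face_eq[OF 1(4) v(1)] vimage_eq sh P .
    have s1: "face_step n (worder n w) (sqrt 2 *\<^sub>R x) (worder n w \<inter> comparability (face_order n u A))
        (sqrt 2 *\<^sub>R x - face_shift n u A)"
      by (rule omega_face_step[OF 1(3) u(1) 1(7) 1(10)])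
    have s2: "face_step n (worder n w') (sqrt 2 *\<^sub>R ?x') (worder n w \<inter> comparability (face_order n u A))
        (sqrt 2 *\<^sub>R x - face_shift n u A)"
      using omega_face_step[OF 1(4) v(1) 1(8) x'] unfolding sh P[symmetric] cmp(2) .
    have "p \<in> topspace X" "q \<in> topspace X"
      unfolding 1(1,2) top using 1(7,8) face_step_zono(3)[OF s1] face_step_zono(3)[OF s2] by simp_all
    moreover have "face_step n (Zf p) (xf p) (worder n w \<inter> comparability (face_order n u A))
        (sqrt 2 *\<^sub>R x - face_shift n u A)"
      unfolding Zf_def xf_def 1(1) fst_conv snd_conv by (rule s1)
    moreover have "face_step n (Zf q) (xf q) (worder n w \<inter> comparability (face_order n u A))
        (sqrt 2 *\<^sub>R x - face_shift n u A)"
      unfolding Zf_def xf_def 1(2) fst_conv snd_conv by (rule s2)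
    ultimately show ?thesis by blast
  qed
  have eq: "equivclp ?r p q" if p: "p \<in> topspace X" and q: "q \<in> topspace X"
    and fs: "face_step n (Zf p) (xf p) Y y" "face_step n (Zf q) (xf q) Y y" for p q Y y
  proof -
    obtain x w x' w' where pq: "p = (x, w)" "q = (x', w')" by (metis surj_pair)
    have w: "w permutes {1..n}" "w' permutes {1..n}" using p q unfolding pq top by blast+
    have fs1: "face_step n (worder n w) (sqrt 2 *\<^sub>R x) Y y" and fs2: "face_step n (worder n w') (sqrt 2 *\<^sub>R x') Y y"
      using fs unfolding pq Zf_def xf_def fst_conv snd_conv .
    obtain u A where A: "A \<subseteq> {1..<n}" "u permutes {1..n}" "perm_minimal n A u"
      "face_order n u A = natural_order n \<inter> comparability Y" "face_shift n u A = sqrt 2 *\<^sub>R x - y"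
      "comparability (face_order n u A) = comparability Y" "worder n w \<inter> comparability Y = Y"
      using face_step_omega[OF w(1) fs1] .
    obtain v B where B: "B \<subseteq> {1..<n}" "v permutes {1..n}" "perm_minimal n B v"
      "face_order n v B = natural_order n \<inter> comparability Y" "face_shift n v B = sqrt 2 *\<^sub>R x' - y"
      "comparability (face_order n v B) = comparability Y" "worder n w' \<inter> comparability Y = Y"
      using face_step_omega[OF w(2) fs2] .
    have fe: "faces_equiv n u A w v B w'"
      unfolding faces_equiv_iff[OF n A(1,2) B(1,2)] A(6,7) B(6,7) by simp
    have "face_order n u A \<in> orders n Y"
      using suborderD(1)[OF suborder_face_order[OF A(1,2)]] A(6) by (simp add: orders_def)
    then have "zono n (face_order n u A) = zono n Y"
      by (rule zono_orders(1)) (rule face_step_zono(2)[OF fs1])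
    then have x: "x \<in> perm_face n u A"
      unfolding perm_face_eq[OF A(1,2)] A(5) using face_step_zono(4)[OF fs1] by simp
    \<comment> \<open>Both face orders are the standard order on the blocks of \<open>Y\<close>, so
      their sums cancel and only the images of the base point remain.\<close>
    have "face_shift n u A - face_shift n v B = sqrt 2 *\<^sub>R perm_act u (perm_base n) - sqrt 2 *\<^sub>R perm_act v (perm_base n)"
      unfolding face_shift_eq[OF A(1,2)] face_shift_eq[OF B(1,2)] A(4) B(4) by simp
    then have "sqrt 2 *\<^sub>R x' = sqrt 2 *\<^sub>R (x + perm_act v (perm_base n) - perm_act u (perm_base n))"
      unfolding A(5) B(5) by (simp add: scaleR_add_right scaleR_diff_right algebra_simps)
    then have "x' = x + perm_act v (perm_base n) - perm_act u (perm_base n)" by simp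
    then have "?r p q"
      unfolding pq using omega_glue.intros[OF A(1) B(1) A(3) B(3) w fe x] by simp
    then show ?thesis by (rule r_into_equivclp)
  qed
  have sp: "space_of (omega_complex n) = quotient_space X ?r"
    by (simp add: omega_complex_def X_def)
  have ce: "cells_of (omega_complex n) k = {qclass ?r ` (rel_interior (perm_face n u A) \<times> {w}) | u A w.
      A \<subseteq> {1..<n} \<and> card A = k \<and> perm_minimal n A u \<and> w permutes {1..n}}" for k
    by (simp add: omega_complex_def)
  have ri: "(x, w) \<in> topspace X" "face_step n (Zf (x, w)) (xf (x, w)) (worder n w \<inter> comparability (face_order n u A))
      (sqrt 2 *\<^sub>R x - face_shift n u A)"
    if A: "A \<subseteq> {1..<n}" "u permutes {1..n}" and w: "w permutes {1..n}" and x: "x \<in> rel_interior (perm_face n u A)"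
    for u A w x
  proof -
    have fs: "face_step n (worder n w) (sqrt 2 *\<^sub>R x) (worder n w \<inter> comparability (face_order n u A))
        (sqrt 2 *\<^sub>R x - face_shift n u A)"
      using subsetD[OF rel_interior_subset x] by (rule omega_face_step[OF A w])
    show "(x, w) \<in> topspace X" unfolding top using w face_step_zono(3)[OF fs] by simp
    show "face_step n (Zf (x, w)) (xf (x, w)) (worder n w \<inter> comparability (face_order n u A))
        (sqrt 2 *\<^sub>R x - face_shift n u A)"
      unfolding Zf_def xf_def fst_conv snd_conv by (rule fs)
  qed
  show ?thesis
  proof (rule model_quotient[OF compact cont pt onto r eq])
    fix h assume h: "homeomorphic_map (quotient_space X ?r) (space_of (model_complex n)) h"
      and hq: "\<And>p. p \<in> topspace X \<Longrightarrow> h (qclass ?r p) = psi n (Zf p) (xf p)"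
    have cell: "h ` qclass ?r ` (rel_interior (perm_face n u A) \<times> {w}) = psi n Y ` zono_int n Y"
      "block_order n Y" "card (cover Y) = card A"
      if A: "A \<subseteq> {1..<n}" "u permutes {1..n}" and w: "w permutes {1..n}"
        and Y: "Y = worder n w \<inter> comparability (face_order n u A)" for u A w Y
    proof -
      note oP = suborderD(1)[OF suborder_face_order[OF A]]
      have Y': "Y \<in> orders n (face_order n u A)" unfolding Y by (rule face_order_orders[OF A w])
      show "block_order n Y" using Y' by (simp add: orders_def)
      have "card (cover Y) = card (map_prod u u ` (\<lambda>i. (i, Suc i)) ` A)"
        unfolding card_cover_orders[OF oP Y'] face_order_def cover_map_prod[OF permutes_inj[OF A(2)]]
          cover_posrel[OF A(1)] ..
      also have "\<dots> = card A"
        unfolding image_image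
        by (rule card_image) (auto simp: inj_on_def inj_eq[OF permutes_inj[OF A(2)]])
      finally show "card (cover Y) = card A" .
      let ?F = "\<lambda>x. sqrt 2 *\<^sub>R x - face_shift n u A"
      have "h (qclass ?r (x, w)) = psi n Y (?F x)" if x: "x \<in> rel_interior (perm_face n u A)" for x
        unfolding hq[OF ri(1)[OF A w x]] Y by (rule psi_face_step[OF ri(2)[OF A w x]])
      then have "h ` qclass ?r ` (rel_interior (perm_face n u A) \<times> {w}) =
          psi n Y ` ?F ` rel_interior (perm_face n u A)"
        by (force simp: image_iff)
      also have "?F ` rel_interior (perm_face n u A) = zono_int n (face_order n u A)"
        unfolding rel_interior_perm_face[OF A]
      proof (rule surj_image_vimage_eq, rule surjI)
        show "?F ((1 / sqrt 2) *\<^sub>R (z + face_shift n u A)) = z" for z by simp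
      qed
      also have "\<dots> = zono_int n Y" by (rule zono_orders(2)[OF Y' oP, symmetric])
      finally show "h ` qclass ?r ` (rel_interior (perm_face n u A) \<times> {w}) = psi n Y ` zono_int n Y" .
    qed
    have cells: "(`) h ` cells_of (omega_complex n) k = cells_of (model_complex n) k" for k
    proof (intro equalityI subsetI)
      fix C assume "C \<in> (`) h ` cells_of (omega_complex n) k"
      then obtain u A w where A: "A \<subseteq> {1..<n}" "card A = k" "perm_minimal n A u" "w permutes {1..n}"
        and C: "C = h ` qclass ?r ` (rel_interior (perm_face n u A) \<times> {w})"
        unfolding ce by blast
      have u: "u permutes {1..n}" using A(3) unfolding perm_minimal_iff[OF A(1)] by blast
      show "C \<in> cells_of (model_complex n) k"
        using cell[OF A(1) u A(4) refl] A(2) unfolding C by (auto simp: model_complex_def)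
    next
      fix C assume "C \<in> cells_of (model_complex n) k"
      then obtain Z where Z: "block_order n Z" "card (cover Z) = k" and C: "C = psi n Z ` zono_int n Z"
        by (auto simp: model_complex_def)
      \<comment> \<open>The centre serves as a sample point: lifting it finds a copy and a face that
        represent the cell of \<open>Z\<close>.\<close>
      have "0 \<in> zono n Z" using zero_zono_int[OF Z(1)] by (simp add: zono_int_def)
      then obtain x w where w: "w permutes {1..n}" and fs: "face_step n (worder n w) (sqrt 2 *\<^sub>R x) Z 0"
        using lift[OF Z(1)] by blast
      obtain u A where A: "A \<subseteq> {1..<n}" "u permutes {1..n}" "perm_minimal n A u"
        "face_order n u A = natural_order n \<inter> comparability Z" "face_shift n u A = sqrt 2 *\<^sub>R x - 0"
        "comparability (face_order n u A) = comparability Z" "worder n w \<inter> comparability Z = Z"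
        using face_step_omega[OF w fs] .
      have ZY: "Z = worder n w \<inter> comparability (face_order n u A)" unfolding A(6,7) ..
      have "card A = k" using cell(3)[OF A(1,2) w ZY] Z(2) by simp
      then have "qclass ?r ` (rel_interior (perm_face n u A) \<times> {w}) \<in> cells_of (omega_complex n) k"
        unfolding ce using A(1,3) w by blast
      moreover have "C = h ` qclass ?r ` (rel_interior (perm_face n u A) \<times> {w})"
        unfolding C by (rule cell(1)[OF A(1,2) w ZY, symmetric])
      ultimately show "C \<in> (`) h ` cells_of (omega_complex n) k" by blast
    qed
    have sub: "\<Union> (cells_of (omega_complex n) k) \<subseteq> topspace (quotient_space X ?r)" for k
    proof
      fix a assume "a \<in> \<Union> (cells_of (omega_complex n) k)"
      then obtain u A w x where A: "A \<subseteq> {1..<n}" "perm_minimal n A u" "w permutes {1..n}"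
        and x: "x \<in> rel_interior (perm_face n u A)" and a: "a = qclass ?r (x, w)"
        unfolding ce by blast
      have u: "u permutes {1..n}" using A(2) unfolding perm_minimal_iff[OF A(1)] by blast
      show "a \<in> topspace (quotient_space X ?r)"
        unfolding a topspace_quotient_space by (rule imageI) (rule ri(1)[OF A(1) u A(3) x])
    qed
    show ?thesis by (rule that[unfolded sp, OF h cells sub])
  qed
qed

theorem theorem4p35:
  fixes n :: nat
  assumes "n \<ge> 1"
  shows "cw_isomorphic (beer_complex (type_A (n - 1))) (omega_complex n)"
proof (rule beer_model[of n], rule omega_model[OF assms])
  fix g h
  assume g: "homeomorphic_map (space_of (beer_complex (type_A (n - 1)))) (space_of (model_complex n)) g"
    "\<And>k. (`) g ` cells_of (beer_complex (type_A (n - 1))) k = cells_of (model_complex n) k"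
    "\<And>k. \<Union> (cells_of (beer_complex (type_A (n - 1))) k) \<subseteq> topspace (space_of (beer_complex (type_A (n - 1))))"
    and h: "homeomorphic_map (space_of (omega_complex n)) (space_of (model_complex n)) h"
    "\<And>k. (`) h ` cells_of (omega_complex n) k = cells_of (model_complex n) k"
    "\<And>k. \<Union> (cells_of (omega_complex n) k) \<subseteq> topspace (space_of (omega_complex n))"
  show ?thesis by (rule cw_isomorphic_via[OF cw_complex_model g h])
qed

end
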